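(* There is a biequivalence of 2-categories $$(\mathsf{WGDbl})_{\mathrm{ps}}\simeq(\mathsf{Ta}_2)_{\mathrm{ps}}$$ between the 2-category $(\mathsf{WGDbl})_{\mathrm{ps}}$ of weakly globular double categories, pseudo-functors and vertical transformations, and the 2-category $(\mathsf{Ta}_2)_{\mathrm{ps}}$ of Tamsamani weak 2-categories, pseudo-natural transformations and modifications.
   Context: A double category $\mathbb X$ is an internal category in $\mathsf{Cat}$: categories $\mathbb X_0$ (objects and vertical arrows) and $\mathbb X_1$ (horizontal arrows as objects, double cells as arrows, composed vertically), with functors $d_0,d_1:\mathbb X_1\to\mathbb X_0$ (horizontal domain and codomain), $s:\mathbb X_0\to\mathbb X_1$ (horizontal identities) and $m:\mathbb X_1\times_{\mathbb X_0}\mathbb X_1\to\mathbb X_1$ (horizontal composition). Its horizontal nerve is the functor $N_h\mathbb X:\Delta^{op}\to\mathsf{Cat}$ with $(N_h\mathbb X)_0=\mathbb X_0$, $(N_h\mathbb X)_1=\mathbb X_1$ and $(N_h\mathbb X)_k=\mathbb X_1\times_{\mathbb X_0}\overset{k}{\cdots}\times_{\mathbb X_0}\mathbb X_1$ for $k\ge 2$. A double category $\mathbb X$ is weakly globular if the quotient functor $\gamma:\mathbb X_0\to\mathbb X_0^d$ onto the discrete category $\mathbb X_0^d$ of path components of $\mathbb X_0$ is an equivalence of categories and, for all $n\ge2$, $\gamma$ induces an equivalence of categories $\mathbb X_1\times_{\mathbb X_0}\overset{n}{\cdots}\times_{\mathbb X_0}\mathbb X_1\simeq\mathbb X_1\times_{\mathbb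 X_0^d}\overset{n}{\cdots}\times_{\mathbb X_0^d}\mathbb X_1$. A pseudo-functor $\mathbb X\to\mathbb Y$ of double categories is a pseudo-natural transformation $N_h\mathbb X\Rightarrow N_h\mathbb Y$ of functors $\Delta^{op}\to\mathsf{Cat}$; a vertical transformation between pseudo-functors is a modification between the corresponding pseudo-natural transformations. For $X:\Delta^{op}\to\mathsf{Cat}$ and $k\ge2$, the Segal map $\eta_k:X_k\to X_1\times_{X_0}\overset{k}{\cdots}\times_{X_0}X_1$ is the functor whose $j$-th component $X_k\to X_1$ is induced by $[1]\to[k]$, $0\mapsto j-1$, $1\mapsto j$. A Tamsamani weak 2-category is a functor $X:\Delta^{op}\to\mathsf{Cat}$ with $X_0$ discrete and all Segal maps $\eta_k$ ($k\ge2$) equivalences of categories. *)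

theory Defs
  imports "HOL-Library.FuncSet"
begin

section \<open>Small categories, functors, natural isomorphisms\<close>

text \<open>
  Operations take the value \<^term>\<open>undefined\<close> outside their domain, so that equality of records
  is equality of categories, functors and so on.  \<^term>\<open>cmp C g f\<close> means \<open>g\<close> after \<open>f\<close>.
\<close>

record ('o, 'a) cat =
  obj :: "'o set"
  arr :: "'a set"
  src :: "'a \<Rightarrow> 'o"
  tgt :: "'a \<Rightarrow> 'o"
  ident :: "'o \<Rightarrow> 'a"
  cmp :: "'a \<Rightarrow> 'a \<Rightarrow> 'a"

definition hom :: "('o, 'a) cat \<Rightarrow> 'o \<Rightarrow> 'o \<Rightarrow> 'a set" where
  "hom C x y = {f \<in> arr C. src C f = x \<and> tgt C f = y}"

locale category =
  fixes C :: "('o, 'a) cat"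
  assumes src_closed: "f \<in> arr C \<Longrightarrow> src C f \<in> obj C"
    and tgt_closed: "f \<in> arr C \<Longrightarrow> tgt C f \<in> obj C"
    and ident_closed: "x \<in> obj C \<Longrightarrow> ident C x \<in> hom C x x"
    and cmp_closed: "\<lbrakk>f \<in> hom C x y; g \<in> hom C y z\<rbrakk> \<Longrightarrow> cmp C g f \<in> hom C x z"
    and cmp_ident_left: "f \<in> hom C x y \<Longrightarrow> cmp C (ident C y) f = f"
    and cmp_ident_right: "f \<in> hom C x y \<Longrightarrow> cmp C f (ident C x) = f"
    and cmp_assoc: "\<lbrakk>f \<in> hom C w x; g \<in> hom C x y; h \<in> hom C y z\<rbrakk>
        \<Longrightarrow> cmp C h (cmp C g f) = cmp C (cmp C h g) f"
    and src_ext: "src C \<in> extensional (arr C)"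
    and tgt_ext: "tgt C \<in> extensional (arr C)"
    and ident_ext: "ident C \<in> extensional (obj C)"
    and cmp_ext: "\<not> (f \<in> arr C \<and> g \<in> arr C \<and> src C g = tgt C f) \<Longrightarrow> cmp C g f = undefined"

definition mk_cat ::
  "'o set \<Rightarrow> 'a set \<Rightarrow> ('a \<Rightarrow> 'o) \<Rightarrow> ('a \<Rightarrow> 'o) \<Rightarrow> ('o \<Rightarrow> 'a) \<Rightarrow> ('a \<Rightarrow> 'a \<Rightarrow> 'a) \<Rightarrow> ('o, 'a) cat" where
  "mk_cat Ob Ar s t i c =
    \<lparr>obj = Ob, arr = Ar, src = restrict s Ar, tgt = restrict t Ar, ident = restrict i Ob,
     cmp = (\<lambda>g f. if g \<in> Ar \<and> f \<in> Ar \<and> s g = t f then c g f else undefined)\<rparr>"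

definition iso_arr :: "('o, 'a) cat \<Rightarrow> 'a \<Rightarrow> bool" where
  "iso_arr C f \<longleftrightarrow> f \<in> arr C \<and>
    (\<exists>g \<in> hom C (tgt C f) (src C f).
       cmp C g f = ident C (src C f) \<and> cmp C f g = ident C (tgt C f))"

record ('o, 'a, 'p, 'b) fctr =
  fob :: "'o \<Rightarrow> 'p"
  far :: "'a \<Rightarrow> 'b"

locale is_functor =
  fixes C :: "('o, 'a) cat" and D :: "('p, 'b) cat" and F :: "('o, 'a, 'p, 'b) fctr"
  assumes dom_category: "category C"
    and cod_category: "category D"
    and fob_closed: "x \<in> obj C \<Longrightarrow> fob F x \<in> obj D"
    and far_closed: "f \<in> hom C x y \<Longrightarrow> far F f \<in> hom D (fob F x) (fob F y)"
    and far_ident: "x \<in> obj C \<Longrightarrow> far F (ident C x) = ident D (fob F x)"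
    and far_cmp: "\<lbrakk>f \<in> hom C x y; g \<in> hom C y z\<rbrakk>
        \<Longrightarrow> far F (cmp C g f) = cmp D (far F g) (far F f)"
    and fob_ext: "fob F \<in> extensional (obj C)"
    and far_ext: "far F \<in> extensional (arr C)"

definition functor_on :: "('o, 'a) cat \<Rightarrow> ('o \<Rightarrow> 'p) \<Rightarrow> ('a \<Rightarrow> 'b) \<Rightarrow> ('o, 'a, 'p, 'b) fctr" where
  "functor_on C p q = \<lparr>fob = restrict p (obj C), far = restrict q (arr C)\<rparr>"

definition id_functor :: "('o, 'a) cat \<Rightarrow> ('o, 'a, 'o, 'a) fctr" where
  "id_functor C = functor_on C (\<lambda>x. x) (\<lambda>f. f)"

text \<open>\<^term>\<open>comp_functor C G F\<close> is \<open>G\<close> after \<open>F\<close>, where \<open>C\<close> is the domain of \<open>F\<close>.\<close>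

definition comp_functor ::
  "('o, 'a) cat \<Rightarrow> ('p, 'b, 'q, 'c) fctr \<Rightarrow> ('o, 'a, 'p, 'b) fctr \<Rightarrow> ('o, 'a, 'q, 'c) fctr" where
  "comp_functor C G F = functor_on C (\<lambda>x. fob G (fob F x)) (\<lambda>f. far G (far F f))"

locale nat_trans =
  fixes C :: "('o, 'a) cat" and D :: "('p, 'b) cat"
    and F G :: "('o, 'a, 'p, 'b) fctr" and \<tau> :: "'o \<Rightarrow> 'b"
  assumes dom_functor: "is_functor C D F"
    and cod_functor: "is_functor C D G"
    and component: "x \<in> obj C \<Longrightarrow> \<tau> x \<in> hom D (fob F x) (fob G x)"
    and naturality: "f \<in> hom C x y \<Longrightarrow> cmp D (far G f) (\<tau> x) = cmp D (\<tau> y) (far F f)"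
    and component_ext: "\<tau> \<in> extensional (obj C)"

definition nat_iso ::
  "('o, 'a) cat \<Rightarrow> ('p, 'b) cat \<Rightarrow> ('o, 'a, 'p, 'b) fctr \<Rightarrow> ('o, 'a, 'p, 'b) fctr
    \<Rightarrow> ('o \<Rightarrow> 'b) \<Rightarrow> bool" where
  "nat_iso C D F G \<tau> \<longleftrightarrow> nat_trans C D F G \<tau> \<and> (\<forall>x \<in> obj C. iso_arr D (\<tau> x))"

definition equivalence_functor ::
  "('o, 'a) cat \<Rightarrow> ('p, 'b) cat \<Rightarrow> ('o, 'a, 'p, 'b) fctr \<Rightarrow> bool" where
  "equivalence_functor C D F \<longleftrightarrow> is_functor C D F \<and>
    (\<exists>G \<eta> \<epsilon>. is_functor D C G \<and>
       nat_iso C C (id_functor C) (comp_functor C G F) \<eta> \<and>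
       nat_iso D D (comp_functor D F G) (id_functor D) \<epsilon>)"

definition prod_cat :: "('o, 'a) cat \<Rightarrow> ('p, 'b) cat \<Rightarrow> ('o \<times> 'p, 'a \<times> 'b) cat" where
  "prod_cat C D = mk_cat (obj C \<times> obj D) (arr C \<times> arr D)
     (map_prod (src C) (src D)) (map_prod (tgt C) (tgt D)) (map_prod (ident C) (ident D))
     (\<lambda>g f. (cmp C (fst g) (fst f), cmp D (snd g) (snd f)))"

definition prod_functor ::
  "('o, 'a) cat \<Rightarrow> ('p, 'b) cat \<Rightarrow> ('o, 'a, 'o1, 'a1) fctr \<Rightarrow> ('p, 'b, 'p1, 'b1) fctr
    \<Rightarrow> ('o \<times> 'p, 'a \<times> 'b, 'o1 \<times> 'p1, 'a1 \<times> 'b1) fctr" where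
  "prod_functor C D F G =
     functor_on (prod_cat C D) (map_prod (fob F) (fob G)) (map_prod (far F) (far G))"

definition discrete_cat :: "'o set \<Rightarrow> ('o, 'o) cat" where
  "discrete_cat S = mk_cat S S (\<lambda>x. x) (\<lambda>x. x) (\<lambda>x. x) (\<lambda>g f. f)"

definition is_discrete :: "('o, 'a) cat \<Rightarrow> bool" where
  "is_discrete C \<longleftrightarrow> category C \<and> arr C = ident C ` obj C"

definition path_component :: "('o, 'a) cat \<Rightarrow> 'o \<Rightarrow> 'o set" where
  "path_component C x =
     {y \<in> obj C. (x, y) \<in> ({(src C f, tgt C f) |f. f \<in> arr C} \<union> {(tgt C f, src C f) |f. f \<in> arr C})\<^sup>*}"

definition components_cat :: "('o, 'a) cat \<Rightarrow> ('o set, 'o set) cat" where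
  "components_cat C = discrete_cat (path_component C ` obj C)"

definition quotient_functor :: "('o, 'a) cat \<Rightarrow> ('o, 'a, 'o set, 'o set) fctr" where
  "quotient_functor C = functor_on C (path_component C) (\<lambda>f. path_component C (src C f))"

text \<open>
  For functors \<open>p, q\<close> from \<open>C\<close> to a common category \<open>B\<close>, \<^term>\<open>fibre_power C p q k\<close> is the
  \<open>k\<close>-fold fibre product \<open>C \<times>\<^sub>B \<dots> \<times>\<^sub>B C\<close> (\<open>k \<ge> 1\<close>): lists \<open>[x\<^sub>1, \<dots>, x\<^sub>k]\<close> with \<open>q x\<^sub>i = p x\<^sub>i\<^sub>+\<^sub>1\<close>, and
  likewise for arrows, with the componentwise structure.
\<close>

definition chains :: "'x set \<Rightarrow> ('x \<Rightarrow> 'y) \<Rightarrow> ('x \<Rightarrow> 'y) \<Rightarrow> nat \<Rightarrow> 'x list set" where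
  "chains S p q k =
     {xs. length xs = k \<and> set xs \<subseteq> S \<and> (\<forall>i. Suc i < k \<longrightarrow> q (xs ! i) = p (xs ! Suc i))}"

definition fibre_power ::
  "('o, 'a) cat \<Rightarrow> ('o, 'a, 'p, 'b) fctr \<Rightarrow> ('o, 'a, 'p, 'b) fctr \<Rightarrow> nat
    \<Rightarrow> ('o list, 'a list) cat" where
  "fibre_power C p q k =
     mk_cat (chains (obj C) (fob p) (fob q) k) (chains (arr C) (far p) (far q) k)
       (map (src C)) (map (tgt C)) (map (ident C)) (map2 (cmp C))"


section \<open>Functors from the opposite simplex category to categories\<close>

definition Delta :: "nat \<Rightarrow> nat \<Rightarrow> (nat \<Rightarrow> nat) set" where
  "Delta m n = {\<phi> \<in> {..m} \<rightarrow>\<^sub>E {..n}. mono_on {..m} \<phi>}"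

text \<open>\<^term>\<open>act X m n \<phi>\<close> is the functor \<open>X\<^sub>n \<rightarrow> X\<^sub>m\<close> induced by \<open>\<phi> : [m] \<rightarrow> [n]\<close>.\<close>

record ('o, 'a) scat =
  lev :: "nat \<Rightarrow> ('o, 'a) cat"
  act :: "nat \<Rightarrow> nat \<Rightarrow> (nat \<Rightarrow> nat) \<Rightarrow> ('o, 'a, 'o, 'a) fctr"

locale simplicial_cat =
  fixes X :: "('o, 'a) scat"
  assumes lev_category: "category (lev X n)"
    and act_functor: "\<phi> \<in> Delta m n \<Longrightarrow> is_functor (lev X n) (lev X m) (act X m n \<phi>)"
    and act_id: "act X n n (\<lambda>i\<in>{..n}. i) = id_functor (lev X n)"
    and act_comp: "\<lbrakk>\<psi> \<in> Delta l m; \<phi> \<in> Delta m n\<rbrakk>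
        \<Longrightarrow> act X l n (compose {..l} \<phi> \<psi>) = comp_functor (lev X n) (act X l m \<psi>) (act X m n \<phi>)"
    and act_ext: "\<phi> \<notin> Delta m n \<Longrightarrow> act X m n \<phi> = undefined"

text \<open>
  A pseudo-natural transformation \<open>F : X \<Rightarrow> Y\<close> has functors \<open>F\<^sub>n : X\<^sub>n \<rightarrow> Y\<^sub>n\<close> and, for
  \<open>\<phi> : [m] \<rightarrow> [n]\<close>, natural isomorphisms \<open>F\<^sub>\<phi> : Y(\<phi>) F\<^sub>n \<Rightarrow> F\<^sub>m X(\<phi>)\<close>.
\<close>

record ('o, 'a, 'p, 'b) pnat =
  pfun :: "nat \<Rightarrow> ('o, 'a, 'p, 'b) fctr"
  pcell :: "nat \<Rightarrow> nat \<Rightarrow> (nat \<Rightarrow> nat) \<Rightarrow> 'o \<Rightarrow> 'b"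

locale pseudonatural =
  fixes X :: "('o, 'a) scat" and Y :: "('p, 'b) scat" and F :: "('o, 'a, 'p, 'b) pnat"
  assumes dom_simplicial: "simplicial_cat X"
    and cod_simplicial: "simplicial_cat Y"
    and pfun_functor: "is_functor (lev X n) (lev Y n) (pfun F n)"
    and pcell_iso: "\<phi> \<in> Delta m n \<Longrightarrow>
        nat_iso (lev X n) (lev Y m)
          (comp_functor (lev X n) (act Y m n \<phi>) (pfun F n))
          (comp_functor (lev X n) (pfun F m) (act X m n \<phi>))
          (pcell F m n \<phi>)"
    and pcell_id: "x \<in> obj (lev X n) \<Longrightarrow>
        pcell F n n (\<lambda>i\<in>{..n}. i) x = ident (lev Y n) (fob (pfun F n) x)"
    and pcell_comp: "\<lbrakk>\<psi> \<in> Delta l m; \<phi> \<in> Delta m n; x \<in> obj (lev X n)\<rbrakk> \<Longrightarrow>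
        pcell F l n (compose {..l} \<phi> \<psi>) x =
          cmp (lev Y l) (pcell F l m \<psi> (fob (act X m n \<phi>) x))
            (far (act Y l m \<psi>) (pcell F m n \<phi> x))"
    and pcell_ext: "\<phi> \<notin> Delta m n \<Longrightarrow> pcell F m n \<phi> = undefined"

record ('o, 'a, 'p, 'b) modif =
  msrc :: "('o, 'a, 'p, 'b) pnat"
  mtgt :: "('o, 'a, 'p, 'b) pnat"
  mcomp :: "nat \<Rightarrow> 'o \<Rightarrow> 'b"

locale modification =
  fixes X :: "('o, 'a) scat" and Y :: "('p, 'b) scat" and \<Gamma> :: "('o, 'a, 'p, 'b) modif"
  assumes msrc_pseudonatural: "pseudonatural X Y (msrc \<Gamma>)"
    and mtgt_pseudonatural: "pseudonatural X Y (mtgt \<Gamma>)"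
    and mcomp_trans: "nat_trans (lev X n) (lev Y n) (pfun (msrc \<Gamma>) n) (pfun (mtgt \<Gamma>) n) (mcomp \<Gamma> n)"
    and mcomp_pcell: "\<lbrakk>\<phi> \<in> Delta m n; x \<in> obj (lev X n)\<rbrakk> \<Longrightarrow>
        cmp (lev Y m) (pcell (mtgt \<Gamma>) m n \<phi> x) (far (act Y m n \<phi>) (mcomp \<Gamma> n x)) =
        cmp (lev Y m) (mcomp \<Gamma> m (fob (act X m n \<phi>) x)) (pcell (msrc \<Gamma>) m n \<phi> x)"

definition ps_hom ::
  "('o, 'a) scat \<Rightarrow> ('p, 'b) scat \<Rightarrow> (('o, 'a, 'p, 'b) pnat, ('o, 'a, 'p, 'b) modif) cat" where
  "ps_hom X Y = mk_cat {F. pseudonatural X Y F} {\<Gamma>. modification X Y \<Gamma>} msrc mtgt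
     (\<lambda>F. \<lparr>msrc = F, mtgt = F,
           mcomp = (\<lambda>n. \<lambda>x\<in>obj (lev X n). ident (lev Y n) (fob (pfun F n) x))\<rparr>)
     (\<lambda>\<Delta> \<Gamma>. \<lparr>msrc = msrc \<Gamma>, mtgt = mtgt \<Delta>,
             mcomp = (\<lambda>n. \<lambda>x\<in>obj (lev X n). cmp (lev Y n) (mcomp \<Delta> n x) (mcomp \<Gamma> n x))\<rparr>)"

definition ps_id :: "('o, 'a) scat \<Rightarrow> ('o, 'a, 'o, 'a) pnat" where
  "ps_id X = \<lparr>pfun = (\<lambda>n. id_functor (lev X n)),
     pcell = (\<lambda>m n \<phi>. if \<phi> \<in> Delta m n
       then (\<lambda>x\<in>obj (lev X n). ident (lev X m) (fob (act X m n \<phi>) x)) else undefined)\<rparr>"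

definition ps_comp ::
  "('o, 'a) scat \<Rightarrow> ('q, 'c) scat \<Rightarrow> ('p, 'b, 'q, 'c) pnat \<Rightarrow> ('o, 'a, 'p, 'b) pnat
    \<Rightarrow> ('o, 'a, 'q, 'c) pnat" where
  "ps_comp X Z G F = \<lparr>pfun = (\<lambda>n. comp_functor (lev X n) (pfun G n) (pfun F n)),
     pcell = (\<lambda>m n \<phi>. if \<phi> \<in> Delta m n
       then (\<lambda>x\<in>obj (lev X n). cmp (lev Z m) (far (pfun G m) (pcell F m n \<phi> x))
                                 (pcell G m n \<phi> (fob (pfun F n) x)))
       else undefined)\<rparr>"

definition mod_hcomp ::
  "('o, 'a) scat \<Rightarrow> ('q, 'c) scat \<Rightarrow> ('p, 'b, 'q, 'c) modif \<Rightarrow> ('o, 'a, 'p, 'b) modif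
    \<Rightarrow> ('o, 'a, 'q, 'c) modif" where
  "mod_hcomp X Z \<Delta> \<Gamma> =
     \<lparr>msrc = ps_comp X Z (msrc \<Delta>) (msrc \<Gamma>), mtgt = ps_comp X Z (mtgt \<Delta>) (mtgt \<Gamma>),
      mcomp = (\<lambda>n. \<lambda>x\<in>obj (lev X n).
        cmp (lev Z n) (mcomp \<Delta> n (fob (pfun (mtgt \<Gamma>) n) x))
          (far (pfun (msrc \<Delta>) n) (mcomp \<Gamma> n x)))\<rparr>"


section \<open>2-categories and biequivalences\<close>

text \<open>
  \<^term>\<open>HComp A x y z\<close> is the composition functor \<open>A(y,z) \<times> A(x,y) \<rightarrow> A(x,z)\<close>.
\<close>

record ('x, 'f, 'c) twocat =
  Obj :: "'x set"
  Hom :: "'x \<Rightarrow> 'x \<Rightarrow> ('f, 'c) cat"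
  HComp :: "'x \<Rightarrow> 'x \<Rightarrow> 'x \<Rightarrow> ('f \<times> 'f, 'c \<times> 'c, 'f, 'c) fctr"
  One :: "'x \<Rightarrow> 'f"

abbreviation hc1 :: "('x, 'f, 'c) twocat \<Rightarrow> 'x \<Rightarrow> 'x \<Rightarrow> 'x \<Rightarrow> 'f \<Rightarrow> 'f \<Rightarrow> 'f" where
  "hc1 A x y z g f \<equiv> fob (HComp A x y z) (g, f)"

abbreviation hc2 :: "('x, 'f, 'c) twocat \<Rightarrow> 'x \<Rightarrow> 'x \<Rightarrow> 'x \<Rightarrow> 'c \<Rightarrow> 'c \<Rightarrow> 'c" where
  "hc2 A x y z \<beta> \<alpha> \<equiv> far (HComp A x y z) (\<beta>, \<alpha>)"

abbreviation whisker_left :: "('x, 'f, 'c) twocat \<Rightarrow> 'x \<Rightarrow> 'x \<Rightarrow> 'x \<Rightarrow> 'f \<Rightarrow> 'c \<Rightarrow> 'c" where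
  "whisker_left A x y z g \<alpha> \<equiv> hc2 A x y z (ident (Hom A y z) g) \<alpha>"

abbreviation whisker_right :: "('x, 'f, 'c) twocat \<Rightarrow> 'x \<Rightarrow> 'x \<Rightarrow> 'x \<Rightarrow> 'c \<Rightarrow> 'f \<Rightarrow> 'c" where
  "whisker_right A x y z \<beta> f \<equiv> hc2 A x y z \<beta> (ident (Hom A x y) f)"

locale two_category =
  fixes A :: "('x, 'f, 'c) twocat"
  assumes Hom_category: "\<lbrakk>x \<in> Obj A; y \<in> Obj A\<rbrakk> \<Longrightarrow> category (Hom A x y)"
    and HComp_functor: "\<lbrakk>x \<in> Obj A; y \<in> Obj A; z \<in> Obj A\<rbrakk> \<Longrightarrow>
        is_functor (prod_cat (Hom A y z) (Hom A x y)) (Hom A x z) (HComp A x y z)"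
    and One_closed: "x \<in> Obj A \<Longrightarrow> One A x \<in> obj (Hom A x x)"
    and hc1_assoc: "\<lbrakk>w \<in> Obj A; x \<in> Obj A; y \<in> Obj A; z \<in> Obj A;
          f \<in> obj (Hom A w x); g \<in> obj (Hom A x y); h \<in> obj (Hom A y z)\<rbrakk> \<Longrightarrow>
        hc1 A w y z h (hc1 A w x y g f) = hc1 A w x z (hc1 A x y z h g) f"
    and hc2_assoc: "\<lbrakk>w \<in> Obj A; x \<in> Obj A; y \<in> Obj A; z \<in> Obj A;
          \<alpha> \<in> arr (Hom A w x); \<beta> \<in> arr (Hom A x y); \<gamma> \<in> arr (Hom A y z)\<rbrakk> \<Longrightarrow>
        hc2 A w y z \<gamma> (hc2 A w x y \<beta> \<alpha>) = hc2 A w x z (hc2 A x y z \<gamma> \<beta>) \<alpha>"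
    and hc1_One_left: "\<lbrakk>x \<in> Obj A; y \<in> Obj A; f \<in> obj (Hom A x y)\<rbrakk> \<Longrightarrow>
        hc1 A x y y (One A y) f = f"
    and hc1_One_right: "\<lbrakk>x \<in> Obj A; y \<in> Obj A; f \<in> obj (Hom A x y)\<rbrakk> \<Longrightarrow>
        hc1 A x x y f (One A x) = f"
    and hc2_One_left: "\<lbrakk>x \<in> Obj A; y \<in> Obj A; \<alpha> \<in> arr (Hom A x y)\<rbrakk> \<Longrightarrow>
        whisker_left A x y y (One A y) \<alpha> = \<alpha>"
    and hc2_One_right: "\<lbrakk>x \<in> Obj A; y \<in> Obj A; \<alpha> \<in> arr (Hom A x y)\<rbrakk> \<Longrightarrow>
        whisker_right A x x y \<alpha> (One A x) = \<alpha>"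

definition equivalence_1cell :: "('x, 'f, 'c) twocat \<Rightarrow> 'x \<Rightarrow> 'x \<Rightarrow> 'f \<Rightarrow> bool" where
  "equivalence_1cell A x y f \<longleftrightarrow> f \<in> obj (Hom A x y) \<and>
     (\<exists>g \<in> obj (Hom A y x).
        (\<exists>\<eta> \<in> hom (Hom A x x) (One A x) (hc1 A x y x g f). iso_arr (Hom A x x) \<eta>) \<and>
        (\<exists>\<epsilon> \<in> hom (Hom A y y) (hc1 A y x y f g) (One A y). iso_arr (Hom A y y) \<epsilon>))"

text \<open>
  A pseudo-functor \<open>F\<close> has structure 2-cells \<open>\<mu>\<^sub>g\<^sub>,\<^sub>f : F g \<cdot> F f \<Rightarrow> F (g \<cdot> f)\<close>
  (\<^term>\<open>ps_mult F x y z (g, f)\<close>) and \<open>1 \<Rightarrow> F 1\<close> (\<^term>\<open>ps_unit F x\<close>).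
\<close>

record ('x, 'f, 'c, 'y, 'g, 'd) psfun =
  ps_ob :: "'x \<Rightarrow> 'y"
  ps_map :: "'x \<Rightarrow> 'x \<Rightarrow> ('f, 'c, 'g, 'd) fctr"
  ps_mult :: "'x \<Rightarrow> 'x \<Rightarrow> 'x \<Rightarrow> 'f \<times> 'f \<Rightarrow> 'd"
  ps_unit :: "'x \<Rightarrow> 'd"

locale pseudofunctor =
  fixes A :: "('x, 'f, 'c) twocat" and B :: "('y, 'g, 'd) twocat"
    and F :: "('x, 'f, 'c, 'y, 'g, 'd) psfun"
  assumes dom_two_category: "two_category A"
    and cod_two_category: "two_category B"
    and ps_ob_closed: "x \<in> Obj A \<Longrightarrow> ps_ob F x \<in> Obj B"
    and ps_map_functor: "\<lbrakk>x \<in> Obj A; y \<in> Obj A\<rbrakk> \<Longrightarrow>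
        is_functor (Hom A x y) (Hom B (ps_ob F x) (ps_ob F y)) (ps_map F x y)"
    and ps_mult_iso: "\<lbrakk>x \<in> Obj A; y \<in> Obj A; z \<in> Obj A\<rbrakk> \<Longrightarrow>
        nat_iso (prod_cat (Hom A y z) (Hom A x y)) (Hom B (ps_ob F x) (ps_ob F z))
          (comp_functor (prod_cat (Hom A y z) (Hom A x y))
             (HComp B (ps_ob F x) (ps_ob F y) (ps_ob F z))
             (prod_functor (Hom A y z) (Hom A x y) (ps_map F y z) (ps_map F x y)))
          (comp_functor (prod_cat (Hom A y z) (Hom A x y)) (ps_map F x z) (HComp A x y z))
          (ps_mult F x y z)"
    and ps_unit_closed: "x \<in> Obj A \<Longrightarrow>
        ps_unit F x \<in> hom (Hom B (ps_ob F x) (ps_ob F x))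
          (One B (ps_ob F x)) (fob (ps_map F x x) (One A x))"
    and ps_unit_iso: "x \<in> Obj A \<Longrightarrow> iso_arr (Hom B (ps_ob F x) (ps_ob F x)) (ps_unit F x)"
    and ps_mult_assoc: "\<lbrakk>w \<in> Obj A; x \<in> Obj A; y \<in> Obj A; z \<in> Obj A;
          f \<in> obj (Hom A w x); g \<in> obj (Hom A x y); h \<in> obj (Hom A y z)\<rbrakk> \<Longrightarrow>
        cmp (Hom B (ps_ob F w) (ps_ob F z))
          (ps_mult F w y z (h, hc1 A w x y g f))
          (whisker_left B (ps_ob F w) (ps_ob F y) (ps_ob F z)
             (fob (ps_map F y z) h) (ps_mult F w x y (g, f))) =
        cmp (Hom B (ps_ob F w) (ps_ob F z))
          (ps_mult F w x z (hc1 A x y z h g, f))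
          (whisker_right B (ps_ob F w) (ps_ob F x) (ps_ob F z)
             (ps_mult F x y z (h, g)) (fob (ps_map F w x) f))"
    and ps_mult_unit_right: "\<lbrakk>x \<in> Obj A; y \<in> Obj A; f \<in> obj (Hom A x y)\<rbrakk> \<Longrightarrow>
        cmp (Hom B (ps_ob F x) (ps_ob F y))
          (ps_mult F x x y (f, One A x))
          (whisker_left B (ps_ob F x) (ps_ob F x) (ps_ob F y)
             (fob (ps_map F x y) f) (ps_unit F x)) =
        ident (Hom B (ps_ob F x) (ps_ob F y)) (fob (ps_map F x y) f)"
    and ps_mult_unit_left: "\<lbrakk>x \<in> Obj A; y \<in> Obj A; f \<in> obj (Hom A x y)\<rbrakk> \<Longrightarrow>
        cmp (Hom B (ps_ob F x) (ps_ob F y))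
          (ps_mult F x y y (One A y, f))
          (whisker_right B (ps_ob F x) (ps_ob F y) (ps_ob F y)
             (ps_unit F y) (fob (ps_map F x y) f)) =
        ident (Hom B (ps_ob F x) (ps_ob F y)) (fob (ps_map F x y) f)"

definition id_pseudofunctor :: "('x, 'f, 'c) twocat \<Rightarrow> ('x, 'f, 'c, 'x, 'f, 'c) psfun" where
  "id_pseudofunctor A =
     \<lparr>ps_ob = (\<lambda>x. x),
      ps_map = (\<lambda>x y. id_functor (Hom A x y)),
      ps_mult = (\<lambda>x y z. \<lambda>(g, f)\<in>obj (prod_cat (Hom A y z) (Hom A x y)).
                   ident (Hom A x z) (hc1 A x y z g f)),
      ps_unit = (\<lambda>x. ident (Hom A x x) (One A x))\<rparr>"

definition comp_pseudofunctor ::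
  "('x, 'f, 'c) twocat \<Rightarrow> ('z, 'h, 'e) twocat \<Rightarrow> ('y, 'g, 'd, 'z, 'h, 'e) psfun
    \<Rightarrow> ('x, 'f, 'c, 'y, 'g, 'd) psfun \<Rightarrow> ('x, 'f, 'c, 'z, 'h, 'e) psfun" where
  "comp_pseudofunctor A E G F =
     \<lparr>ps_ob = (\<lambda>x. ps_ob G (ps_ob F x)),
      ps_map = (\<lambda>x y. comp_functor (Hom A x y) (ps_map G (ps_ob F x) (ps_ob F y)) (ps_map F x y)),
      ps_mult = (\<lambda>x y z. \<lambda>(g, f)\<in>obj (prod_cat (Hom A y z) (Hom A x y)).
         cmp (Hom E (ps_ob G (ps_ob F x)) (ps_ob G (ps_ob F z)))
           (far (ps_map G (ps_ob F x) (ps_ob F z)) (ps_mult F x y z (g, f)))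
           (ps_mult G (ps_ob F x) (ps_ob F y) (ps_ob F z)
              (fob (ps_map F y z) g, fob (ps_map F x y) f))),
      ps_unit = (\<lambda>x. cmp (Hom E (ps_ob G (ps_ob F x)) (ps_ob G (ps_ob F x)))
                       (far (ps_map G (ps_ob F x) (ps_ob F x)) (ps_unit F x))
                       (ps_unit G (ps_ob F x)))\<rparr>"

text \<open>
  A pseudo-natural transformation \<open>\<sigma> : F \<Rightarrow> G\<close> has components \<open>\<sigma>\<^sub>x : F x \<rightarrow> G x\<close>
  (\<^term>\<open>pt_ob \<sigma> x\<close>) and invertible 2-cells \<open>\<sigma>\<^sub>f : G f \<cdot> \<sigma>\<^sub>x \<Rightarrow> \<sigma>\<^sub>y \<cdot> F f\<close>
  (\<^term>\<open>pt_cell \<sigma> x y f\<close>), natural in \<open>f : x \<rightarrow> y\<close>.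
\<close>

record ('x, 'f, 'g, 'd) pstrans =
  pt_ob :: "'x \<Rightarrow> 'g"
  pt_cell :: "'x \<Rightarrow> 'x \<Rightarrow> 'f \<Rightarrow> 'd"

locale pseudonat_trans =
  fixes A :: "('x, 'f, 'c) twocat" and B :: "('y, 'g, 'd) twocat"
    and F G :: "('x, 'f, 'c, 'y, 'g, 'd) psfun" and \<sigma> :: "('x, 'f, 'g, 'd) pstrans"
  assumes dom_pseudofunctor: "pseudofunctor A B F"
    and cod_pseudofunctor: "pseudofunctor A B G"
    and pt_ob_closed: "x \<in> Obj A \<Longrightarrow> pt_ob \<sigma> x \<in> obj (Hom B (ps_ob F x) (ps_ob G x))"
    and pt_cell_iso: "\<lbrakk>x \<in> Obj A; y \<in> Obj A\<rbrakk> \<Longrightarrow>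
        nat_iso (Hom A x y) (Hom B (ps_ob F x) (ps_ob G y))
          (functor_on (Hom A x y)
             (\<lambda>f. hc1 B (ps_ob F x) (ps_ob G x) (ps_ob G y) (fob (ps_map G x y) f) (pt_ob \<sigma> x))
             (\<lambda>\<alpha>. whisker_right B (ps_ob F x) (ps_ob G x) (ps_ob G y)
                     (far (ps_map G x y) \<alpha>) (pt_ob \<sigma> x)))
          (functor_on (Hom A x y)
             (\<lambda>f. hc1 B (ps_ob F x) (ps_ob F y) (ps_ob G y) (pt_ob \<sigma> y) (fob (ps_map F x y) f))
             (\<lambda>\<alpha>. whisker_left B (ps_ob F x) (ps_ob F y) (ps_ob G y)
                     (pt_ob \<sigma> y) (far (ps_map F x y) \<alpha>)))
          (pt_cell \<sigma> x y)"
    and pt_cell_unit: "x \<in> Obj A \<Longrightarrow>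
        cmp (Hom B (ps_ob F x) (ps_ob G x))
          (pt_cell \<sigma> x x (One A x))
          (whisker_right B (ps_ob F x) (ps_ob G x) (ps_ob G x) (ps_unit G x) (pt_ob \<sigma> x)) =
        whisker_left B (ps_ob F x) (ps_ob F x) (ps_ob G x) (pt_ob \<sigma> x) (ps_unit F x)"
    and pt_cell_mult: "\<lbrakk>x \<in> Obj A; y \<in> Obj A; z \<in> Obj A;
          f \<in> obj (Hom A x y); g \<in> obj (Hom A y z)\<rbrakk> \<Longrightarrow>
        cmp (Hom B (ps_ob F x) (ps_ob G z))
          (pt_cell \<sigma> x z (hc1 A x y z g f))
          (whisker_right B (ps_ob F x) (ps_ob G x) (ps_ob G z)
             (ps_mult G x y z (g, f)) (pt_ob \<sigma> x)) =
        cmp (Hom B (ps_ob F x) (ps_ob G z))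
          (whisker_left B (ps_ob F x) (ps_ob F z) (ps_ob G z)
             (pt_ob \<sigma> z) (ps_mult F x y z (g, f)))
          (cmp (Hom B (ps_ob F x) (ps_ob G z))
             (whisker_right B (ps_ob F x) (ps_ob F y) (ps_ob G z)
                (pt_cell \<sigma> y z g) (fob (ps_map F x y) f))
             (whisker_left B (ps_ob F x) (ps_ob G y) (ps_ob G z)
                (fob (ps_map G y z) g) (pt_cell \<sigma> x y f)))"

definition pseudonat_equivalence ::
  "('x, 'f, 'c) twocat \<Rightarrow> ('y, 'g, 'd) twocat \<Rightarrow> ('x, 'f, 'c, 'y, 'g, 'd) psfun
    \<Rightarrow> ('x, 'f, 'c, 'y, 'g, 'd) psfun \<Rightarrow> ('x, 'f, 'g, 'd) pstrans \<Rightarrow> bool" where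
  "pseudonat_equivalence A B F G \<sigma> \<longleftrightarrow> pseudonat_trans A B F G \<sigma> \<and>
     (\<forall>x \<in> Obj A. equivalence_1cell B (ps_ob F x) (ps_ob G x) (pt_ob \<sigma> x))"

definition biequivalence ::
  "('x, 'f, 'c) twocat \<Rightarrow> ('y, 'g, 'd) twocat \<Rightarrow> ('x, 'f, 'c, 'y, 'g, 'd) psfun \<Rightarrow> bool" where
  "biequivalence A B F \<longleftrightarrow> pseudofunctor A B F \<and>
     (\<exists>G \<eta> \<epsilon>. pseudofunctor B A G \<and>
        pseudonat_equivalence A A (id_pseudofunctor A) (comp_pseudofunctor A A G F) \<eta> \<and>
        pseudonat_equivalence B B (comp_pseudofunctor B B F G) (id_pseudofunctor B) \<epsilon>)"


section \<open>Weakly globular double categories and Tamsamani weak 2-categories\<close>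

text \<open>\<^term>\<open>fob (hcmp X) [f, g]\<close> is the horizontal composite of \<open>f\<close> followed by \<open>g\<close>.\<close>

record 'u dblcat =
  cat0 :: "('u, 'u) cat"
  cat1 :: "('u, 'u) cat"
  hdom :: "('u, 'u, 'u, 'u) fctr"
  hcod :: "('u, 'u, 'u, 'u) fctr"
  hid :: "('u, 'u, 'u, 'u) fctr"
  hcmp :: "('u list, 'u list, 'u, 'u) fctr"

text \<open>
  The axioms of an internal category in categories are equations between functors, that is,
  equations on objects and on arrows; they say that the object parts and the arrow parts of the
  structure functors each form an ordinary category.
\<close>

definition object_row :: "'u dblcat \<Rightarrow> ('u, 'u) cat" where
  "object_row X = \<lparr>obj = obj (cat0 X), arr = obj (cat1 X), src = fob (hdom X), tgt = fob (hcod X),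
     ident = fob (hid X), cmp = (\<lambda>g f. fob (hcmp X) [f, g])\<rparr>"

definition arrow_row :: "'u dblcat \<Rightarrow> ('u, 'u) cat" where
  "arrow_row X = \<lparr>obj = arr (cat0 X), arr = arr (cat1 X), src = far (hdom X), tgt = far (hcod X),
     ident = far (hid X), cmp = (\<lambda>g f. far (hcmp X) [f, g])\<rparr>"

locale double_category =
  fixes X :: "'u dblcat"
  assumes hdom_functor: "is_functor (cat1 X) (cat0 X) (hdom X)"
    and hcod_functor: "is_functor (cat1 X) (cat0 X) (hcod X)"
    and hid_functor: "is_functor (cat0 X) (cat1 X) (hid X)"
    and hcmp_functor: "is_functor (fibre_power (cat1 X) (hdom X) (hcod X) 2) (cat1 X) (hcmp X)"
    and object_row_category: "category (object_row X)"
    and arrow_row_category: "category (arrow_row X)"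

text \<open>
  \<open>\<gamma> d\<^sub>0\<close> and \<open>\<gamma> d\<^sub>1\<close> cut out the fibre product over the path components, and the functor
  induced by \<open>\<gamma>\<close> is the inclusion of the fibre product over \<open>X\<^sub>0\<close> into it.
\<close>

definition weakly_globular :: "'u dblcat \<Rightarrow> bool" where
  "weakly_globular X \<longleftrightarrow> double_category X \<and>
     equivalence_functor (cat0 X) (components_cat (cat0 X)) (quotient_functor (cat0 X)) \<and>
     (\<forall>n\<ge>2. equivalence_functor
        (fibre_power (cat1 X) (hdom X) (hcod X) n)
        (fibre_power (cat1 X)
           (comp_functor (cat1 X) (quotient_functor (cat0 X)) (hdom X))
           (comp_functor (cat1 X) (quotient_functor (cat0 X)) (hcod X)) n)
        (id_functor (fibre_power (cat1 X) (hdom X) (hcod X) n)))"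

text \<open>
  In the horizontal nerve an element of level \<open>0\<close> or \<open>1\<close> is represented by a list of length \<open>1\<close>,
  so that all levels have the same type.  For \<open>\<phi> : [m] \<rightarrow> [k]\<close> with \<open>m \<ge> 1\<close>, the \<open>j\<close>-th entry of
  the image of \<open>[x\<^sub>1, \<dots>, x\<^sub>k]\<close> is the composite of the segment from vertex \<open>\<phi> (j - 1)\<close> to vertex
  \<open>\<phi> j\<close>, an identity if the segment is empty.
\<close>

definition nerve_vertex :: "('u \<Rightarrow> 'u) \<Rightarrow> ('u \<Rightarrow> 'u) \<Rightarrow> nat \<Rightarrow> 'u list \<Rightarrow> nat \<Rightarrow> 'u" where
  "nerve_vertex d0 d1 k xs i = (if k = 0 then hd xs else if i = 0 then d0 (hd xs) else d1 (xs ! (i - 1)))"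

definition nerve_map ::
  "('u \<Rightarrow> 'u) \<Rightarrow> ('u \<Rightarrow> 'u) \<Rightarrow> ('u \<Rightarrow> 'u) \<Rightarrow> ('u list \<Rightarrow> 'u)
    \<Rightarrow> nat \<Rightarrow> nat \<Rightarrow> (nat \<Rightarrow> nat) \<Rightarrow> 'u list \<Rightarrow> 'u list" where
  "nerve_map d0 d1 i c m k \<phi> xs =
     (if m = 0 then [nerve_vertex d0 d1 k xs (\<phi> 0)]
      else map (\<lambda>j. foldl (\<lambda>y x. c [y, x]) (i (nerve_vertex d0 d1 k xs (\<phi> j)))
                       (map ((!) xs) [\<phi> j..<\<phi> (Suc j)])) [0..<m])"

definition nerve_lev :: "'u dblcat \<Rightarrow> nat \<Rightarrow> ('u list, 'u list) cat" where
  "nerve_lev X k =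
     (if k = 0 then fibre_power (cat0 X) (id_functor (cat0 X)) (id_functor (cat0 X)) 1
      else fibre_power (cat1 X) (hdom X) (hcod X) k)"

definition nerve :: "'u dblcat \<Rightarrow> ('u list, 'u list) scat" where
  "nerve X = \<lparr>lev = nerve_lev X,
     act = (\<lambda>m k \<phi>. if \<phi> \<in> Delta m k
       then functor_on (nerve_lev X k)
         (nerve_map (fob (hdom X)) (fob (hcod X)) (fob (hid X)) (fob (hcmp X)) m k \<phi>)
         (nerve_map (far (hdom X)) (far (hcod X)) (far (hid X)) (far (hcmp X)) m k \<phi>)
       else undefined)\<rparr>"

definition vertex_inclusion :: "nat \<Rightarrow> nat \<Rightarrow> nat" where
  "vertex_inclusion v = (\<lambda>i\<in>{..0}. v)"

definition edge_inclusion :: "nat \<Rightarrow> nat \<Rightarrow> nat" where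
  "edge_inclusion j = (\<lambda>i\<in>{..1}. if i = 0 then j - 1 else j)"

definition segal_target :: "('o, 'a) scat \<Rightarrow> nat \<Rightarrow> ('o list, 'a list) cat" where
  "segal_target X k =
     fibre_power (lev X 1) (act X 0 1 (vertex_inclusion 0)) (act X 0 1 (vertex_inclusion 1)) k"

definition segal_map :: "('o, 'a) scat \<Rightarrow> nat \<Rightarrow> ('o, 'a, 'o list, 'a list) fctr" where
  "segal_map X k = functor_on (lev X k)
     (\<lambda>x. map (\<lambda>j. fob (act X 1 k (edge_inclusion j)) x) [1..<Suc k])
     (\<lambda>f. map (\<lambda>j. far (act X 1 k (edge_inclusion j)) f) [1..<Suc k])"

definition tamsamani :: "('o, 'a) scat \<Rightarrow> bool" where
  "tamsamani X \<longleftrightarrow> simplicial_cat X \<and> is_discrete (lev X 0) \<and>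
     (\<forall>k\<ge>2. equivalence_functor (lev X k) (segal_target X k) (segal_map X k))"

text \<open>
  A family \<open>N\<close> of functors from the opposite simplex category to categories, indexed by a set \<open>S\<close>,
  gives a 2-category with objects \<open>S\<close>, whose 1-cells and 2-cells are the pseudo-natural
  transformations and the modifications between the members of the family.
\<close>

definition ps_twocat ::
  "'x set \<Rightarrow> ('x \<Rightarrow> ('o, 'a) scat)
    \<Rightarrow> ('x, ('o, 'a, 'o, 'a) pnat, ('o, 'a, 'o, 'a) modif) twocat" where
  "ps_twocat S N = \<lparr>Obj = S,
     Hom = (\<lambda>x y. ps_hom (N x) (N y)),
     HComp = (\<lambda>x y z. functor_on (prod_cat (ps_hom (N y) (N z)) (ps_hom (N x) (N y)))
                (\<lambda>(G, F). ps_comp (N x) (N z) G F) (\<lambda>(\<Delta>, \<Gamma>). mod_hcomp (N x) (N z) \<Delta> \<Gamma>)),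
     One = (\<lambda>x. ps_id (N x))\<rparr>"

text \<open>
  The type \<open>'u\<close> plays the role of the universe: small categories are those with objects and
  arrows in \<open>'u\<close>.
\<close>

type_synonym 'u wgdbl_twocat =
  "('u dblcat, ('u list, 'u list, 'u list, 'u list) pnat,
    ('u list, 'u list, 'u list, 'u list) modif) twocat"

type_synonym 'u ta2_twocat =
  "(('u, 'u) scat, ('u, 'u, 'u, 'u) pnat, ('u, 'u, 'u, 'u) modif) twocat"

definition WGDbl_ps :: "'u wgdbl_twocat" where
  "WGDbl_ps = ps_twocat {X. weakly_globular X} nerve"

definition Ta2_ps :: "'u ta2_twocat" where
  "Ta2_ps = ps_twocat {X. tamsamani X} (\<lambda>X. X)"

end

theory Submission
  imports Defs
begin

text \<open>
  Both 2-categories are full in the 2-category of functors from the opposite simplex category to categories,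
  pseudo-natural transformations and modifications.  Replacing every object of one by an object of the
  other along adjoint equivalences \<open>e\<^sub>x : x \<rightarrow> F x\<close>, with \<open>F f = e\<^sub>y f e'\<^sub>x\<close>, makes them biequivalent, and a
  pseudo-natural transformation that is levelwise an equivalence of categories extends to an adjoint
  equivalence.  So for each Tamsamani weak 2-category \<open>Y\<close> one needs a weakly globular double category with
  nerve levelwise equivalent to \<open>Y\<close>, and conversely.

  From \<open>Y\<close>: strictify by taking as objects of level \<open>k\<close> the pairs of a map \<open>\<phi> : [k] \<rightarrow> [m]\<close> and an object of
  \<open>Y\<^sub>m\<close>, and as arrows those of \<open>Y\<^sub>k\<close> between the images under \<open>\<phi>\<close>; by the Segal condition the result is
  already the nerve of a double category.  From the nerve \<open>X\<close> of a weakly globular double category: apply the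
  same strictification, but identify all pairs with constant \<open>\<phi>\<close> that have the same path component in \<open>X\<^sub>0\<close>,
  and represent that component by a chosen object.
\<close>

section \<open>Categories, functors and equivalences\<close>

text \<open>Adjointness is what makes conjugation composable: the composite of two conjugations is
  again a conjugation, by the composite adjoint equivalences. Both round trips of the biequivalence
  are therefore conjugations of one 2-category into itself, and one comparison from the identity and
  one comparison to it serve in all cases. Strictness is the obstacle in the construction of
  objects: replacing each level by an equivalent category and transporting the action gives functors
  that compose only up to isomorphism. For a pair of a map and an object the action merely composes
  maps, which is strictly functorial, and since arrows see only the value of a pair, no level
  changes up to equivalence. Pairs contain natural numbers, finite functions, objects and arrows,
  and must be coded in the same universe \<open>'u\<close>. An infinite type admits injections of
  numbers, pairs and lists into itself; this is the use of the hypothesis of the theorem.\<close>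

lemma in_hom: "f \<in> hom C x y \<longleftrightarrow> f \<in> arr C \<and> src C f = x \<and> tgt C f = y"
  by (simp add: hom_def)

lemma cat_src_obj [simp]: "category C \<Longrightarrow> f \<in> arr C \<Longrightarrow> src C f \<in> obj C"
  by (rule category.src_closed)

lemma cat_tgt_obj [simp]: "category C \<Longrightarrow> f \<in> arr C \<Longrightarrow> tgt C f \<in> obj C"
  by (rule category.tgt_closed)

lemma cat_ident [simp]:
  assumes "category C" "x \<in> obj C"
  shows "ident C x \<in> arr C" "src C (ident C x) = x" "tgt C (ident C x) = x"
  using category.ident_closed[OF assms] by (simp_all add: in_hom)

lemma cat_cmp [simp]:
  assumes "category C" "f \<in> arr C" "g \<in> arr C" "src C g = tgt C f"
  shows "cmp C g f \<in> arr C" "src C (cmp C g f) = src C f" "tgt C (cmp C g f) = tgt C g"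
  using category.cmp_closed[OF assms(1), of f "src C f" "tgt C f" g "tgt C g"] assms
  by (simp_all add: in_hom)

lemma cat_ident_left [simp]:
  "category C \<Longrightarrow> f \<in> arr C \<Longrightarrow> y = tgt C f \<Longrightarrow> cmp C (ident C y) f = f"
  using category.cmp_ident_left[of C f "src C f" y] by (simp add: in_hom)

lemma cat_ident_right [simp]:
  "category C \<Longrightarrow> f \<in> arr C \<Longrightarrow> y = src C f \<Longrightarrow> cmp C f (ident C y) = f"
  using category.cmp_ident_right[of C f y "tgt C f"] by (simp add: in_hom)

lemma cat_assoc [simp]:
  "category C \<Longrightarrow> f \<in> arr C \<Longrightarrow> g \<in> arr C \<Longrightarrow> h \<in> arr C \<Longrightarrow> src C g = tgt C f \<Longrightarrow> src C h = tgt C g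
    \<Longrightarrow> cmp C (cmp C h g) f = cmp C h (cmp C g f)"
  using category.cmp_assoc[of C f "src C f" "tgt C f" g "tgt C g" h "tgt C h"] by (simp add: in_hom)

lemma mk_cat_simps [simp]:
  "obj (mk_cat Ob Ar s t i c) = Ob"
  "arr (mk_cat Ob Ar s t i c) = Ar"
  "f \<in> Ar \<Longrightarrow> src (mk_cat Ob Ar s t i c) f = s f"
  "f \<in> Ar \<Longrightarrow> tgt (mk_cat Ob Ar s t i c) f = t f"
  "x \<in> Ob \<Longrightarrow> ident (mk_cat Ob Ar s t i c) x = i x"
  "f \<in> Ar \<Longrightarrow> g \<in> Ar \<Longrightarrow> s g = t f \<Longrightarrow> cmp (mk_cat Ob Ar s t i c) g f = c g f"
  by (simp_all add: mk_cat_def)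

lemma category_mk_cat:
  assumes "\<And>f. f \<in> Ar \<Longrightarrow> s f \<in> Ob" "\<And>f. f \<in> Ar \<Longrightarrow> t f \<in> Ob"
    and "\<And>x. x \<in> Ob \<Longrightarrow> i x \<in> Ar" "\<And>x. x \<in> Ob \<Longrightarrow> s (i x) = x" "\<And>x. x \<in> Ob \<Longrightarrow> t (i x) = x"
    and "\<And>f g. f \<in> Ar \<Longrightarrow> g \<in> Ar \<Longrightarrow> s g = t f \<Longrightarrow> c g f \<in> Ar \<and> s (c g f) = s f \<and> t (c g f) = t g"
    and "\<And>f. f \<in> Ar \<Longrightarrow> c (i (t f)) f = f" "\<And>f. f \<in> Ar \<Longrightarrow> c f (i (s f)) = f"
    and "\<And>f g h. f \<in> Ar \<Longrightarrow> g \<in> Ar \<Longrightarrow> h \<in> Ar \<Longrightarrow> s g = t f \<Longrightarrow> s h = t g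
      \<Longrightarrow> c h (c g f) = c (c h g) f"
  shows "category (mk_cat Ob Ar s t i c)"
proof -
  have mem: "c g f \<in> Ar" "s (c g f) = s f" "t (c g f) = t g"
    if "f \<in> Ar" "g \<in> Ar" "s g = t f" for f g
    using assms(6)[OF that] by auto
  show ?thesis
    by (rule category.intro) (auto simp: in_hom assms(1-5,7-9) mem, auto simp: mk_cat_def)
qed

section \<open>Inverses of isomorphisms\<close>

definition iinv :: "('o, 'a) cat \<Rightarrow> 'a \<Rightarrow> 'a" where
  "iinv C f = (SOME g. g \<in> hom C (tgt C f) (src C f) \<and>
     cmp C g f = ident C (src C f) \<and> cmp C f g = ident C (tgt C f))"

lemma iso_arr_arr: "iso_arr C f \<Longrightarrow> f \<in> arr C"
  by (simp add: iso_arr_def)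

lemma iso_arrI:
  assumes "f \<in> arr C" "g \<in> arr C" "src C g = tgt C f" "tgt C g = src C f"
    "cmp C g f = ident C (src C f)" "cmp C f g = ident C (tgt C f)"
  shows "iso_arr C f"
  using assms by (auto simp: iso_arr_def hom_def)

lemma iinv_props:
  assumes "iso_arr C f"
  shows "iinv C f \<in> hom C (tgt C f) (src C f) \<and>
     cmp C (iinv C f) f = ident C (src C f) \<and> cmp C f (iinv C f) = ident C (tgt C f)"
  unfolding iinv_def by (rule someI_ex) (use assms in \<open>auto simp: iso_arr_def\<close>)

lemma iinv_simps [simp]:
  assumes "iso_arr C f"
  shows "iinv C f \<in> arr C" "src C (iinv C f) = tgt C f" "tgt C (iinv C f) = src C f"
    "cmp C (iinv C f) f = ident C (src C f)" "cmp C f (iinv C f) = ident C (tgt C f)"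
  using iinv_props[OF assms] by (simp_all add: in_hom)

lemma iso_iinv [simp]: "iso_arr C f \<Longrightarrow> iso_arr C (iinv C f)"
  by (rule iso_arrI[of _ _ f]) (auto simp: iso_arr_arr)

lemma iso_cancel [simp]:
  assumes "category C" "iso_arr C f" "g \<in> arr C"
  shows "tgt C g = src C f \<Longrightarrow> cmp C (iinv C f) (cmp C f g) = g"
    and "tgt C g = tgt C f \<Longrightarrow> cmp C f (cmp C (iinv C f) g) = g"
proof -
  note [simp] = assms(1,3) iinv_simps[OF assms(2)] iso_arr_arr[OF assms(2)]
  show "cmp C (iinv C f) (cmp C f g) = g" if [simp]: "tgt C g = src C f"
    by (subst cat_assoc[symmetric]) simp_all
  show "cmp C f (cmp C (iinv C f) g) = g" if [simp]: "tgt C g = tgt C f"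
    by (subst cat_assoc[symmetric]) simp_all
qed

text \<open>Composing the one given equation with the chosen inverse is enough. Inverses of
  identities, composites and images are then found by checking a single equation.\<close>

lemma iinv_unique:
  assumes "category C" "iso_arr C f" "g \<in> arr C" "src C g = tgt C f" "cmp C g f = ident C (src C f)"
  shows "g = iinv C f"
proof -
  have "g = cmp C g (cmp C f (iinv C f))"
    using assms by simp
  also have "\<dots> = cmp C (cmp C g f) (iinv C f)"
    using assms by (subst cat_assoc) (auto simp: iso_arr_arr)
  finally show ?thesis
    using assms by simp
qed

lemma iso_ident [simp]: "category C \<Longrightarrow> x \<in> obj C \<Longrightarrow> iso_arr C (ident C x)"
  by (rule iso_arrI[of _ _ "ident C x"]) auto

lemma iinv_ident [simp]: "category C \<Longrightarrow> x \<in> obj C \<Longrightarrow> iinv C (ident C x) = ident C x"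
  by (rule iinv_unique[symmetric]) auto

lemma iinv_iinv [simp]: "category C \<Longrightarrow> iso_arr C f \<Longrightarrow> iinv C (iinv C f) = f"
  by (rule iinv_unique[symmetric]) (auto simp: iso_arr_arr)

lemma iso_cmp [simp]:
  assumes "category C" "iso_arr C f" "iso_arr C g" "src C g = tgt C f"
  shows "iso_arr C (cmp C g f)" "iinv C (cmp C g f) = cmp C (iinv C f) (iinv C g)"
proof -
  note [simp] = assms iso_arr_arr[OF assms(2)] iso_arr_arr[OF assms(3)]
  show *: "iso_arr C (cmp C g f)"
    by (rule iso_arrI[of _ _ "cmp C (iinv C f) (iinv C g)"]) auto
  show "iinv C (cmp C g f) = cmp C (iinv C f) (iinv C g)"
    by (rule iinv_unique[symmetric]) (use * in auto)
qed

lemma iso_left_cancel: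
  assumes "category C" "iso_arr C f" "g \<in> arr C" "h \<in> arr C" "tgt C g = src C f" "tgt C h = src C f"
    "cmp C f g = cmp C f h"
  shows "g = h"
  using arg_cong[OF assms(7), of "cmp C (iinv C f)"] assms(1-6) by simp

lemma iso_right_cancel:
  assumes "category C" "iso_arr C f" "g \<in> arr C" "h \<in> arr C" "src C g = tgt C f" "src C h = tgt C f"
    "cmp C g f = cmp C h f"
  shows "g = h"
  using arg_cong[OF assms(7), of "\<lambda>k. cmp C k (iinv C f)"] assms(1-6) by (simp add: iso_arr_arr)

section \<open>Functors and natural transformations on elements\<close>

lemma fun_obj: "is_functor C D F \<Longrightarrow> x \<in> obj C \<Longrightarrow> fob F x \<in> obj D"
  by (rule is_functor.fob_closed)

lemma fun_arr:
  assumes "is_functor C D F" "f \<in> arr C"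
  shows "far F f \<in> arr D" "src D (far F f) = fob F (src C f)" "tgt D (far F f) = fob F (tgt C f)"
  using is_functor.far_closed[OF assms(1), of f "src C f" "tgt C f"] assms(2) by (simp_all add: in_hom)

lemma fun_ident:
  "is_functor C D F \<Longrightarrow> x \<in> obj C \<Longrightarrow> far F (ident C x) = ident D (fob F x)"
  by (rule is_functor.far_ident)

lemma fun_cmp:
  "is_functor C D F \<Longrightarrow> f \<in> arr C \<Longrightarrow> g \<in> arr C \<Longrightarrow> src C g = tgt C f
    \<Longrightarrow> far F (cmp C g f) = cmp D (far F g) (far F f)"
  using is_functor.far_cmp[of C D F f "src C f" "tgt C f" g "tgt C g"] by (simp add: in_hom)

lemma fun_iso:
  assumes "is_functor C D F" "iso_arr C f"
  shows "iso_arr D (far F f)" "far F (iinv C f) = iinv D (far F f)"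
proof -
  have [simp]: "category C" "category D"
    using assms(1) by (simp_all add: is_functor_def)
  have e: "cmp D (far F (iinv C f)) (far F f) = ident D (src D (far F f))"
    "cmp D (far F f) (far F (iinv C f)) = ident D (tgt D (far F f))"
    using assms fun_cmp[OF assms(1), of f "iinv C f"] fun_cmp[OF assms(1), of "iinv C f" f]
    by (simp_all add: iso_arr_arr fun_ident[OF assms(1)] fun_arr[OF assms(1)])
  show *: "iso_arr D (far F f)"
    by (rule iso_arrI[OF _ _ _ _ e]) (use assms in \<open>auto simp: iso_arr_arr fun_arr\<close>)
  show "far F (iinv C f) = iinv D (far F f)"
    by (rule iinv_unique[OF _ * _ _ e(1)]) (use assms in \<open>auto simp: iso_arr_arr fun_arr\<close>)
qed

lemmas functor_rules = fun_obj fun_arr fun_ident fun_cmp fun_iso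

lemma fun_ext: "is_functor C D F \<Longrightarrow> x \<notin> obj C \<Longrightarrow> fob F x = undefined"
  by (meson is_functor.fob_ext extensional_arb)

lemma fun_arr_ext: "is_functor C D F \<Longrightarrow> f \<notin> arr C \<Longrightarrow> far F f = undefined"
  by (meson is_functor.far_ext extensional_arb)

text \<open>Outside the domain both functors take the value \<open>undefined\<close>, so agreement
  on the domain already gives equality of records. Equality of pseudo-natural transformations and of
  modifications will be decided by the same convention.\<close>

lemma fctr_eqI:
  assumes "is_functor C D F" "is_functor C D' G" "\<And>x. x \<in> obj C \<Longrightarrow> fob F x = fob G x"
    "\<And>f. f \<in> arr C \<Longrightarrow> far F f = far G f"
  shows "F = G"
proof -
  have "fob F x = fob G x" for x
    using assms(3) fun_ext[OF assms(1)] fun_ext[OF assms(2)] by (cases "x \<in> obj C") auto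
  moreover have "far F f = far G f" for f
    using assms(4) fun_arr_ext[OF assms(1)] fun_arr_ext[OF assms(2)] by (cases "f \<in> arr C") auto
  ultimately show ?thesis
    by (simp add: fun_eq_iff)
qed

lemma functorI:
  assumes "category C" "category D"
    and "\<And>x. x \<in> obj C \<Longrightarrow> fob F x \<in> obj D"
    and "\<And>f. f \<in> arr C \<Longrightarrow> far F f \<in> arr D \<and> src D (far F f) = fob F (src C f) \<and>
      tgt D (far F f) = fob F (tgt C f)"
    and "\<And>x. x \<in> obj C \<Longrightarrow> far F (ident C x) = ident D (fob F x)"
    and "\<And>f g. f \<in> arr C \<Longrightarrow> g \<in> arr C \<Longrightarrow> src C g = tgt C f
      \<Longrightarrow> far F (cmp C g f) = cmp D (far F g) (far F f)"
    and "\<And>x. x \<notin> obj C \<Longrightarrow> fob F x = undefined" "\<And>f. f \<notin> arr C \<Longrightarrow> far F f = undefined"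
  shows "is_functor C D F"
  by (rule is_functor.intro) (use assms in \<open>auto simp: in_hom extensional_def\<close>)

lemma functor_on_simps [simp]:
  "x \<in> obj C \<Longrightarrow> fob (functor_on C p q) x = p x"
  "f \<in> arr C \<Longrightarrow> far (functor_on C p q) f = q f"
  by (simp_all add: functor_on_def)

lemma functor_functor_on:
  assumes "category C" "category D"
    and "\<And>x. x \<in> obj C \<Longrightarrow> p x \<in> obj D"
    and "\<And>f. f \<in> arr C \<Longrightarrow> q f \<in> arr D \<and> src D (q f) = p (src C f) \<and> tgt D (q f) = p (tgt C f)"
    and "\<And>x. x \<in> obj C \<Longrightarrow> q (ident C x) = ident D (p x)"
    and "\<And>f g. f \<in> arr C \<Longrightarrow> g \<in> arr C \<Longrightarrow> src C g = tgt C f \<Longrightarrow> q (cmp C g f) = cmp D (q g) (q f)"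
  shows "is_functor C D (functor_on C p q)"
  by (rule functorI) (use assms in \<open>auto simp: functor_on_def\<close>)

lemma functor_on_cong:
  "(\<And>x. x \<in> obj C \<Longrightarrow> p x = p' x) \<Longrightarrow> (\<And>f. f \<in> arr C \<Longrightarrow> q f = q' f)
    \<Longrightarrow> functor_on C p q = functor_on C p' q'"
  by (auto simp: functor_on_def)

lemma is_functor_id [simp]: "category C \<Longrightarrow> is_functor C C (id_functor C)"
  unfolding id_functor_def by (rule functor_functor_on) auto

lemma id_functor_simps [simp]:
  "x \<in> obj C \<Longrightarrow> fob (id_functor C) x = x" "f \<in> arr C \<Longrightarrow> far (id_functor C) f = f"
  by (simp_all add: id_functor_def)

lemma comp_functor_simps [simp]:
  "x \<in> obj C \<Longrightarrow> fob (comp_functor C G F) x = fob G (fob F x)"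
  "f \<in> arr C \<Longrightarrow> far (comp_functor C G F) f = far G (far F f)"
  by (simp_all add: comp_functor_def)

lemma is_functor_comp:
  assumes "is_functor C D F" "is_functor D E G"
  shows "is_functor C E (comp_functor C G F)"
proof -
  have "category C" "category D" "category E"
    using assms by (simp_all add: is_functor_def)
  then show ?thesis
    unfolding comp_functor_def
    by (intro functor_functor_on) (simp_all add: functor_rules[OF assms(1)] functor_rules[OF assms(2)])
qed

lemma nat_isoI:
  assumes "is_functor C D F" "is_functor C D G"
    and "\<And>x. x \<in> obj C \<Longrightarrow> iso_arr D (\<tau> x) \<and> src D (\<tau> x) = fob F x \<and> tgt D (\<tau> x) = fob G x"
    and "\<And>f. f \<in> arr C \<Longrightarrow> cmp D (far G f) (\<tau> (src C f)) = cmp D (\<tau> (tgt C f)) (far F f)"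
    and "\<And>x. x \<notin> obj C \<Longrightarrow> \<tau> x = undefined"
  shows "nat_iso C D F G \<tau>"
proof -
  have "nat_trans C D F G \<tau>"
    by (rule nat_trans.intro) (use assms in \<open>auto simp: in_hom extensional_def iso_arr_arr\<close>)
  then show ?thesis
    using assms(3) by (simp add: nat_iso_def)
qed

lemma nat_transI:
  assumes "is_functor C D F" "is_functor C D G"
    and "\<And>x. x \<in> obj C \<Longrightarrow> \<tau> x \<in> arr D \<and> src D (\<tau> x) = fob F x \<and> tgt D (\<tau> x) = fob G x"
    and "\<And>f. f \<in> arr C \<Longrightarrow> cmp D (far G f) (\<tau> (src C f)) = cmp D (\<tau> (tgt C f)) (far F f)"
    and "\<And>x. x \<notin> obj C \<Longrightarrow> \<tau> x = undefined"
  shows "nat_trans C D F G \<tau>"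
  by (rule nat_trans.intro) (use assms in \<open>auto simp: in_hom extensional_def\<close>)

lemma nat_trans_rules:
  assumes "nat_trans C D F G \<tau>"
  shows "x \<in> obj C \<Longrightarrow> \<tau> x \<in> arr D" "x \<in> obj C \<Longrightarrow> src D (\<tau> x) = fob F x"
    "x \<in> obj C \<Longrightarrow> tgt D (\<tau> x) = fob G x"
    "f \<in> arr C \<Longrightarrow> cmp D (far G f) (\<tau> (src C f)) = cmp D (\<tau> (tgt C f)) (far F f)"
    "x \<notin> obj C \<Longrightarrow> \<tau> x = undefined"
  using nat_trans.component[OF assms, of x] nat_trans.naturality[OF assms, of f "src C f" "tgt C f"]
    extensional_arb[OF nat_trans.component_ext[OF assms], of x]
  by (simp_all add: in_hom)

lemma nat_iso_rules:
  assumes "nat_iso C D F G \<tau>"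
  shows "x \<in> obj C \<Longrightarrow> iso_arr D (\<tau> x)" "x \<in> obj C \<Longrightarrow> \<tau> x \<in> arr D" 
    "x \<in> obj C \<Longrightarrow> src D (\<tau> x) = fob F x"
    "x \<in> obj C \<Longrightarrow> tgt D (\<tau> x) = fob G x"
    "f \<in> arr C \<Longrightarrow> cmp D (far G f) (\<tau> (src C f)) = cmp D (\<tau> (tgt C f)) (far F f)"
    "x \<notin> obj C \<Longrightarrow> \<tau> x = undefined"
  using assms nat_trans_rules[of C D F G \<tau>] by (auto simp: nat_iso_def)

section \<open>Equivalences as fully faithful and essentially surjective functors\<close>

definition ff_es :: "('o, 'a) cat \<Rightarrow> ('p, 'b) cat \<Rightarrow> ('o, 'a, 'p, 'b) fctr \<Rightarrow> bool" where
  "ff_es C D F \<longleftrightarrow> is_functor C D F \<and>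
     (\<forall>x \<in> obj C. \<forall>y \<in> obj C. \<forall>g \<in> hom D (fob F x) (fob F y). \<exists>f \<in> hom C x y. far F f = g) \<and>
     (\<forall>f \<in> arr C. \<forall>g \<in> arr C. src C f = src C g \<longrightarrow> tgt C f = tgt C g \<longrightarrow> far F f = far F g \<longrightarrow> f = g) \<and>
     (\<forall>z \<in> obj D. \<exists>x \<in> obj C. \<exists>c. iso_arr D c \<and> src D c = z \<and> tgt D c = fob F x)"

lemma ff_esD:
  assumes "ff_es C D F"
  shows ff_es_functor: "is_functor C D F"
    and ff_es_full: "\<And>x y g. x \<in> obj C \<Longrightarrow> y \<in> obj C \<Longrightarrow> g \<in> arr D \<Longrightarrow> src D g = fob F x \<Longrightarrow> tgt D g = fob F y
      \<Longrightarrow> \<exists>f \<in> arr C. src C f = x \<and> tgt C f = y \<and> far F f = g"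
    and ff_es_faithful: "\<And>f g. f \<in> arr C \<Longrightarrow> g \<in> arr C \<Longrightarrow> src C f = src C g \<Longrightarrow> tgt C f = tgt C g
      \<Longrightarrow> far F f = far F g \<Longrightarrow> f = g"
    and ff_es_es: "\<And>z. z \<in> obj D \<Longrightarrow> \<exists>x \<in> obj C. \<exists>c. iso_arr D c \<and> src D c = z \<and> tgt D c = fob F x"
proof -
  show "\<exists>f \<in> arr C. src C f = x \<and> tgt C f = y \<and> far F f = g"
    if "x \<in> obj C" "y \<in> obj C" "g \<in> arr D" "src D g = fob F x" "tgt D g = fob F y" for x y g
  proof -
    have "\<exists>f \<in> hom C x y. far F f = g"
      using assms that unfolding ff_es_def by (simp add: in_hom)
    then show ?thesis
      by (auto simp: in_hom)
  qed
qed (use assms in \<open>auto simp: ff_es_def\<close>)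

lemma ff_esI:
  assumes "is_functor C D F"
    and "\<And>x y g. x \<in> obj C \<Longrightarrow> y \<in> obj C \<Longrightarrow> g \<in> arr D \<Longrightarrow> src D g = fob F x \<Longrightarrow> tgt D g = fob F y
      \<Longrightarrow> \<exists>f \<in> arr C. src C f = x \<and> tgt C f = y \<and> far F f = g"
    and "\<And>f g. f \<in> arr C \<Longrightarrow> g \<in> arr C \<Longrightarrow> src C f = src C g \<Longrightarrow> tgt C f = tgt C g
      \<Longrightarrow> far F f = far F g \<Longrightarrow> f = g"
    and "\<And>z. z \<in> obj D \<Longrightarrow> \<exists>x \<in> obj C. \<exists>c. iso_arr D c \<and> src D c = z \<and> tgt D c = fob F x"
  shows "ff_es C D F"
proof -
  have "\<exists>f \<in> hom C x y. far F f = g" if "x \<in> obj C" "y \<in> obj C" "g \<in> hom D (fob F x) (fob F y)" for x y g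
    using assms(2)[of x y g] that by (auto simp: in_hom)
  then show ?thesis
    unfolding ff_es_def using assms(1,3,4) by blast
qed

text \<open>Fullness lifts the inverse of the image, and faithfulness turns the two inverse laws of
  the image into inverse laws for the lift.\<close>

lemma ff_es_iso:
  assumes "ff_es C D F" "f \<in> arr C" "iso_arr D (far F f)"
  shows "iso_arr C f"
proof -
  note F = ff_es_functor[OF assms(1)]
  note [simp] = functor_rules[OF F]
  have [simp]: "category C" "category D"
    using F by (simp_all add: is_functor_def)
  obtain g where g: "g \<in> arr C" "src C g = tgt C f" "tgt C g = src C f" "far F g = iinv D (far F f)"
    using ff_es_full[OF assms(1), of "tgt C f" "src C f" "iinv D (far F f)"] assms by auto
  show ?thesis
    by (rule iso_arrI[of _ _ g]; (rule ff_es_faithful[OF assms(1)])?) (use assms g in auto)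
qed

text \<open>The inverse is an adjoint one: \<open>c\<close> and \<open>u\<close> satisfy the first triangle identity by construction,
  and the second follows from faithfulness.\<close>

lemma ff_es_adjoint_inverse:
  assumes F: "ff_es C D F"
  shows "\<exists>G c u. is_functor D C G \<and> nat_iso D D (id_functor D) (comp_functor D F G) c \<and>
    nat_iso C C (comp_functor C G F) (id_functor C) u \<and>
    (\<forall>x \<in> obj C. far F (u x) = iinv D (c (fob F x))) \<and>
    (\<forall>z \<in> obj D. u (fob G z) = iinv C (far G (c z)))"
proof -
  note fF = ff_es_functor[OF F]
  note [simp] = functor_rules[OF fF]
  have [simp]: "category C" "category D"
    using fF by (simp_all add: is_functor_def)
  have "\<forall>z. \<exists>x c. z \<in> obj D \<longrightarrow> x \<in> obj C \<and> iso_arr D c \<and> src D c = z \<and> tgt D c = fob F x"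
    using ff_es_es[OF F] by blast
  then obtain g c where gc: "\<And>z. z \<in> obj D \<Longrightarrow> g z \<in> obj C \<and> iso_arr D (c z) \<and> src D (c z) = z \<and> tgt D (c z) = fob F (g z)"
    by metis
  have [simp]: "g z \<in> obj C" "iso_arr D (c z)" "c z \<in> arr D" "src D (c z) = z" "tgt D (c z) = fob F (g z)"
    if "z \<in> obj D" for z
    using gc[OF that] by (auto simp: iso_arr_arr)
  \<comment> \<open>The value of \<open>F\<close> on the new arrow is forced: it is the only one for
    which \<open>c\<close> becomes natural.\<close>
  have "\<forall>k. \<exists>f. k \<in> arr D \<longrightarrow> f \<in> arr C \<and> src C f = g (src D k) \<and> tgt C f = g (tgt D k) \<and>
      far F f = cmp D (c (tgt D k)) (cmp D k (iinv D (c (src D k))))"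
  proof
    fix k
    show "\<exists>f. k \<in> arr D \<longrightarrow> f \<in> arr C \<and> src C f = g (src D k) \<and> tgt C f = g (tgt D k) \<and>
      far F f = cmp D (c (tgt D k)) (cmp D k (iinv D (c (src D k))))"
      using ff_es_full[OF F, of "g (src D k)" "g (tgt D k)" "cmp D (c (tgt D k)) (cmp D k (iinv D (c (src D k))))"]
      by (cases "k \<in> arr D") auto
  qed
  then obtain h where h: "\<And>k. k \<in> arr D \<Longrightarrow> h k \<in> arr C \<and> src C (h k) = g (src D k) \<and> tgt C (h k) = g (tgt D k) \<and>
      far F (h k) = cmp D (c (tgt D k)) (cmp D k (iinv D (c (src D k))))"
    by metis
  then have [simp]: "h k \<in> arr C" "src C (h k) = g (src D k)" "tgt C (h k) = g (tgt D k)"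
      "far F (h k) = cmp D (c (tgt D k)) (cmp D k (iinv D (c (src D k))))" if "k \<in> arr D" for k
    using that by auto
  define G where "G = functor_on D g h"
  have fG: "is_functor D C G"
    unfolding G_def
    by (rule functor_functor_on; (rule ff_es_faithful[OF F])?) auto
  have [simp]: "fob G z = g z" if "z \<in> obj D" for z
    using that by (simp add: G_def)
  have [simp]: "far G k = h k" if "k \<in> arr D" for k
    using that by (simp add: G_def)
  have "\<forall>x. \<exists>u. x \<in> obj C \<longrightarrow> u \<in> arr C \<and> src C u = g (fob F x) \<and> tgt C u = x \<and> far F u = iinv D (c (fob F x))"
  proof
    fix x
    show "\<exists>u. x \<in> obj C \<longrightarrow> u \<in> arr C \<and> src C u = g (fob F x) \<and> tgt C u = x \<and> far F u = iinv D (c (fob F x))"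
      using ff_es_full[OF F, of "g (fob F x)" x "iinv D (c (fob F x))"]
      by (cases "x \<in> obj C") auto
  qed
  then obtain u where "\<And>x. x \<in> obj C \<Longrightarrow> u x \<in> arr C \<and> src C (u x) = g (fob F x) \<and> tgt C (u x) = x \<and> far F (u x) = iinv D (c (fob F x))"
    by metis
  then have [simp]: "u x \<in> arr C" "src C (u x) = g (fob F x)" "tgt C (u x) = x" "far F (u x) = iinv D (c (fob F x))"
    if "x \<in> obj C" for x
    using that by auto
  have [simp]: "iso_arr C (u x)" if "x \<in> obj C" for x
    by (rule ff_es_iso[OF F]) (use that in auto)
  have [simp]: "iso_arr C (h k)" if "iso_arr D k" for k
    using fun_iso(1)[OF fG that] that by (simp add: iso_arr_arr)
  show ?thesis
  proof (intro exI[of _ G] exI[of _ "restrict c (obj D)"] exI[of _ "restrict u (obj C)"] conjI fG ballI)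
    show "nat_iso D D (id_functor D) (comp_functor D F G) (restrict c (obj D))"
      by (rule nat_isoI) (auto intro: is_functor_comp[OF fG fF])
    show "nat_iso C C (comp_functor C G F) (id_functor C) (restrict u (obj C))"
    proof (rule nat_isoI)
      show "cmp C (far (id_functor C) f) (restrict u (obj C) (src C f)) =
        cmp C (restrict u (obj C) (tgt C f)) (far (comp_functor C G F) f)" if "f \<in> arr C" for f
        by (rule ff_es_faithful[OF F]) (use that in auto)
    qed (auto intro: is_functor_comp[OF fF fG])
    show "far F (restrict u (obj C) x) = iinv D (restrict c (obj D) (fob F x))" if "x \<in> obj C" for x
      using that by simp
    show "restrict u (obj C) (fob G z) = iinv C (far G (restrict c (obj D) z))" if "z \<in> obj D" for z
    proof -
      have "u (g z) = iinv C (h (c z))"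
        by (rule ff_es_faithful[OF F]) (use that in auto)
      then show ?thesis
        using that by simp
    qed
  qed
qed

lemma nat_iso_iinv:
  assumes "nat_iso C D F G \<tau>"
  shows "nat_iso C D G F (\<lambda>x\<in>obj C. iinv D (\<tau> x))"
proof -
  have f: "is_functor C D F" "is_functor C D G"
    using assms by (auto simp: nat_iso_def nat_trans_def)
  have [simp]: "category C" "category D"
    using f by (simp_all add: is_functor_def)
  note [simp] = nat_iso_rules(1-4)[OF assms] functor_rules[OF f(1)] functor_rules[OF f(2)]
  show ?thesis
  proof (rule nat_isoI; (rule f)?)
    fix k
    assume k [simp]: "k \<in> arr C"
    let ?s = "\<tau> (src C k)" and ?t = "\<tau> (tgt C k)"
    have "cmp D (iinv D ?t) (cmp D (far G k) (cmp D ?s (iinv D ?s))) =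
      cmp D (iinv D ?t) (cmp D (cmp D (far G k) ?s) (iinv D ?s))"
      by (subst cat_assoc) auto
    also have "\<dots> = cmp D (far F k) (iinv D ?s)"
      by (subst nat_iso_rules(5)[OF assms k]) simp
    finally show "cmp D (far F k) (restrict (\<lambda>x. iinv D (\<tau> x)) (obj C) (src C k)) =
       cmp D (restrict (\<lambda>x. iinv D (\<tau> x)) (obj C) (tgt C k)) (far G k)"
      by simp
  qed auto
qed

text \<open>The elementary characterisation is the one used from here on. It is extracted from an
  inverse functor by naturality of the two invertible transformations; the converse needs choices,
  which were already made in adjoint form.\<close>

lemma equivalence_functor_iff_ff_es: "equivalence_functor C D F \<longleftrightarrow> ff_es C D F"
proof
  assume F: "ff_es C D F"
  then obtain G c u where G: "is_functor D C G" and c: "nat_iso D D (id_functor D) (comp_functor D F G) c"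
    and u: "nat_iso C C (comp_functor C G F) (id_functor C) u"
    using ff_es_adjoint_inverse[OF F] by blast
  show "equivalence_functor C D F"
    unfolding equivalence_functor_def
    using ff_es_functor[OF F] G nat_iso_iinv[OF c] nat_iso_iinv[OF u] by blast
next
  assume "equivalence_functor C D F"
  then obtain G \<eta> \<epsilon> where F: "is_functor C D F" and G: "is_functor D C G"
    and \<eta>: "nat_iso C C (id_functor C) (comp_functor C G F) \<eta>"
    and \<epsilon>: "nat_iso D D (comp_functor D F G) (id_functor D) \<epsilon>"
    unfolding equivalence_functor_def by blast
  have [simp]: "category C" "category D"
    using F by (simp_all add: is_functor_def)
  note [simp] = functor_rules[OF F] functor_rules[OF G] nat_iso_rules(1-4)[OF \<eta>] nat_iso_rules(1-4)[OF \<epsilon>]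
  have n\<eta>: "cmp C (far G (far F f)) (\<eta> (src C f)) = cmp C (\<eta> (tgt C f)) f" if "f \<in> arr C" for f
    using nat_iso_rules(5)[OF \<eta> that] that by simp
  have n\<epsilon>: "cmp D k (\<epsilon> (src D k)) = cmp D (\<epsilon> (tgt D k)) (far F (far G k))" if "k \<in> arr D" for k
    using nat_iso_rules(5)[OF \<epsilon> that] that by simp
  \<comment> \<open>Faithfulness of \<open>G\<close> follows from naturality of
    \<open>\<epsilon>\<close>. It lets \<open>F f = g\<close> be tested after applying
    \<open>G\<close>, where naturality of \<open>\<eta>\<close> shows that the conjugate of
    \<open>G g\<close> by \<open>\<eta>\<close> is the right \<open>f\<close>.\<close>
  have Gfaith: "k = l" if "k \<in> arr D" "l \<in> arr D" "src D k = src D l" "tgt D k = tgt D l" "far G k = far G l" for k l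
    by (rule iso_right_cancel[of D "\<epsilon> (src D k)"]) (use that n\<epsilon>[of k] n\<epsilon>[of l] in auto)
  show "ff_es C D F"
  proof (rule ff_esI[OF F])
    fix x y g
    assume a [simp]: "x \<in> obj C" "y \<in> obj C" "g \<in> arr D" "src D g = fob F x" "tgt D g = fob F y"
    let ?f = "cmp C (iinv C (\<eta> y)) (cmp C (far G g) (\<eta> x))"
    have "far G (far F ?f) = far G g"
      by (rule iso_right_cancel[of C "\<eta> x"])
        (use n\<eta>[of ?f] in \<open>auto simp del: fun_cmp[OF F] fun_cmp[OF G]\<close>)
    then have "far F ?f = g"
      by (intro Gfaith) (auto simp del: fun_cmp[OF F] fun_cmp[OF G])
    then show "\<exists>f\<in>arr C. src C f = x \<and> tgt C f = y \<and> far F f = g"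
      by (intro bexI[of _ ?f]) auto
  next
    fix f g
    assume a: "f \<in> arr C" "g \<in> arr C" "src C f = src C g" "tgt C f = tgt C g" "far F f = far F g"
    show "f = g"
      by (rule iso_left_cancel[of C "\<eta> (tgt C f)"]) (use a n\<eta>[of f] n\<eta>[of g] in auto)
  next
    fix z
    assume "z \<in> obj D"
    then show "\<exists>x\<in>obj C. \<exists>c. iso_arr D c \<and> src D c = z \<and> tgt D c = fob F x"
      by (intro bexI[of _ "fob G z"] exI[of _ "iinv D (\<epsilon> z)"]) auto
  qed
qed

section \<open>The 2-category of simplicial categories\<close>

text \<open>Composites are kept bracketed to the right, so an equation between two-fold composites
  does not match in front of a further factor \<open>k\<close>. This form applies a commuting square
  at that place; it carries most of the pasting of squares below.\<close>

lemma reassoc: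
  assumes "category C" "cmp C f g = cmp C f' g'" "f \<in> arr C" "g \<in> arr C" "f' \<in> arr C" "g' \<in> arr C" "k \<in> arr C"
    "src C f = tgt C g" "src C f' = tgt C g'" "src C g = tgt C k" "src C g' = tgt C k"
  shows "cmp C f (cmp C g k) = cmp C f' (cmp C g' k)"
proof -
  have "cmp C f (cmp C g k) = cmp C (cmp C f g) k"
    using assms(1,3-) by (subst cat_assoc) simp_all
  also have "\<dots> = cmp C f' (cmp C g' k)"
    unfolding assms(2) using assms(1,3-) by (subst cat_assoc) simp_all
  finally show ?thesis .
qed

lemma lev_cat [simp]: "simplicial_cat X \<Longrightarrow> category (lev X n)"
  by (rule simplicial_cat.lev_category)

lemma act_fun: "simplicial_cat X \<Longrightarrow> \<phi> \<in> Delta m n \<Longrightarrow> is_functor (lev X n) (lev X m) (act X m n \<phi>)"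
  by (rule simplicial_cat.act_functor)

lemma act_rules [simp]:
  assumes "simplicial_cat X" "\<phi> \<in> Delta m n"
  shows "x \<in> obj (lev X n) \<Longrightarrow> fob (act X m n \<phi>) x \<in> obj (lev X m)"
    "f \<in> arr (lev X n) \<Longrightarrow> far (act X m n \<phi>) f \<in> arr (lev X m)"
    "f \<in> arr (lev X n) \<Longrightarrow> src (lev X m) (far (act X m n \<phi>) f) = fob (act X m n \<phi>) (src (lev X n) f)"
    "f \<in> arr (lev X n) \<Longrightarrow> tgt (lev X m) (far (act X m n \<phi>) f) = fob (act X m n \<phi>) (tgt (lev X n) f)"
    "x \<in> obj (lev X n) \<Longrightarrow> far (act X m n \<phi>) (ident (lev X n) x) = ident (lev X m) (fob (act X m n \<phi>) x)"
    "f \<in> arr (lev X n) \<Longrightarrow> g \<in> arr (lev X n) \<Longrightarrow> src (lev X n) g = tgt (lev X n) f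
      \<Longrightarrow> far (act X m n \<phi>) (cmp (lev X n) g f) = cmp (lev X m) (far (act X m n \<phi>) g) (far (act X m n \<phi>) f)"
    "iso_arr (lev X n) f \<Longrightarrow> iso_arr (lev X m) (far (act X m n \<phi>) f)"
    "iso_arr (lev X n) f \<Longrightarrow> far (act X m n \<phi>) (iinv (lev X n) f) = iinv (lev X m) (far (act X m n \<phi>) f)"
  using functor_rules[OF act_fun[OF assms]] by blast+

lemma Delta_id [simp]: "(\<lambda>i\<in>{..n}. i) \<in> Delta n n"
  by (auto simp: Delta_def mono_on_def)

lemma Delta_compose [intro]: "\<psi> \<in> Delta l m \<Longrightarrow> \<phi> \<in> Delta m n \<Longrightarrow> compose {..l} \<phi> \<psi> \<in> Delta l n"
  by (auto simp: Delta_def mono_on_def compose_def PiE_iff Pi_iff)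

lemma act_id_simps [simp]:
  assumes "simplicial_cat X"
  shows "x \<in> obj (lev X n) \<Longrightarrow> fob (act X n n (\<lambda>i\<in>{..n}. i)) x = x"
    "f \<in> arr (lev X n) \<Longrightarrow> far (act X n n (\<lambda>i\<in>{..n}. i)) f = f"
  by (simp_all add: simplicial_cat.act_id[OF assms])

lemma act_compose:
  assumes "simplicial_cat X" "\<psi> \<in> Delta l m" "\<phi> \<in> Delta m n"
  shows "x \<in> obj (lev X n) \<Longrightarrow> fob (act X l n (compose {..l} \<phi> \<psi>)) x = fob (act X l m \<psi>) (fob (act X m n \<phi>) x)"
    "f \<in> arr (lev X n) \<Longrightarrow> far (act X l n (compose {..l} \<phi> \<psi>)) f = far (act X l m \<psi>) (far (act X m n \<phi>) f)"
  by (simp_all add: simplicial_cat.act_comp[OF assms])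

section \<open>Pseudo-natural transformations and modifications\<close>

lemma pn_fun: "pseudonatural X Y F \<Longrightarrow> is_functor (lev X n) (lev Y n) (pfun F n)"
  by (rule pseudonatural.pfun_functor)

lemma pn_rules:
  assumes "pseudonatural X Y F"
  shows "simplicial_cat X" "simplicial_cat Y"
    "x \<in> obj (lev X n) \<Longrightarrow> fob (pfun F n) x \<in> obj (lev Y n)"
    "f \<in> arr (lev X n) \<Longrightarrow> far (pfun F n) f \<in> arr (lev Y n)"
    "f \<in> arr (lev X n) \<Longrightarrow> src (lev Y n) (far (pfun F n) f) = fob (pfun F n) (src (lev X n) f)"
    "f \<in> arr (lev X n) \<Longrightarrow> tgt (lev Y n) (far (pfun F n) f) = fob (pfun F n) (tgt (lev X n) f)"
    "x \<in> obj (lev X n) \<Longrightarrow> far (pfun F n) (ident (lev X n) x) = ident (lev Y n) (fob (pfun F n) x)"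
    "f \<in> arr (lev X n) \<Longrightarrow> g \<in> arr (lev X n) \<Longrightarrow> src (lev X n) g = tgt (lev X n) f
      \<Longrightarrow> far (pfun F n) (cmp (lev X n) g f) = cmp (lev Y n) (far (pfun F n) g) (far (pfun F n) f)"
    "iso_arr (lev X n) f \<Longrightarrow> iso_arr (lev Y n) (far (pfun F n) f)"
    "iso_arr (lev X n) f \<Longrightarrow> far (pfun F n) (iinv (lev X n) f) = iinv (lev Y n) (far (pfun F n) f)"
    "\<phi> \<in> Delta m n \<Longrightarrow> x \<in> obj (lev X n) \<Longrightarrow> iso_arr (lev Y m) (pcell F m n \<phi> x)"
    "\<phi> \<in> Delta m n \<Longrightarrow> x \<in> obj (lev X n) \<Longrightarrow> pcell F m n \<phi> x \<in> arr (lev Y m)"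
    "\<phi> \<in> Delta m n \<Longrightarrow> x \<in> obj (lev X n) \<Longrightarrow>
      src (lev Y m) (pcell F m n \<phi> x) = fob (act Y m n \<phi>) (fob (pfun F n) x)"
    "\<phi> \<in> Delta m n \<Longrightarrow> x \<in> obj (lev X n) \<Longrightarrow>
      tgt (lev Y m) (pcell F m n \<phi> x) = fob (pfun F m) (fob (act X m n \<phi>) x)"
proof -
  show "simplicial_cat X" "simplicial_cat Y"
    using assms by (simp_all add: pseudonatural_def)
  note functor_rules[OF pn_fun[OF assms, of n]]
  then show "x \<in> obj (lev X n) \<Longrightarrow> fob (pfun F n) x \<in> obj (lev Y n)"
    "f \<in> arr (lev X n) \<Longrightarrow> far (pfun F n) f \<in> arr (lev Y n)"
    "f \<in> arr (lev X n) \<Longrightarrow> src (lev Y n) (far (pfun F n) f) = fob (pfun F n) (src (lev X n) f)"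
    "f \<in> arr (lev X n) \<Longrightarrow> tgt (lev Y n) (far (pfun F n) f) = fob (pfun F n) (tgt (lev X n) f)"
    "x \<in> obj (lev X n) \<Longrightarrow> far (pfun F n) (ident (lev X n) x) = ident (lev Y n) (fob (pfun F n) x)"
    "f \<in> arr (lev X n) \<Longrightarrow> g \<in> arr (lev X n) \<Longrightarrow> src (lev X n) g = tgt (lev X n) f
      \<Longrightarrow> far (pfun F n) (cmp (lev X n) g f) = cmp (lev Y n) (far (pfun F n) g) (far (pfun F n) f)"
    "iso_arr (lev X n) f \<Longrightarrow> iso_arr (lev Y n) (far (pfun F n) f)"
    "iso_arr (lev X n) f \<Longrightarrow> far (pfun F n) (iinv (lev X n) f) = iinv (lev Y n) (far (pfun F n) f)"
    by blast+
  show "\<phi> \<in> Delta m n \<Longrightarrow> x \<in> obj (lev X n) \<Longrightarrow> iso_arr (lev Y m) (pcell F m n \<phi> x)"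
    "\<phi> \<in> Delta m n \<Longrightarrow> x \<in> obj (lev X n) \<Longrightarrow> pcell F m n \<phi> x \<in> arr (lev Y m)"
    "\<phi> \<in> Delta m n \<Longrightarrow> x \<in> obj (lev X n) \<Longrightarrow>
      src (lev Y m) (pcell F m n \<phi> x) = fob (act Y m n \<phi>) (fob (pfun F n) x)"
    "\<phi> \<in> Delta m n \<Longrightarrow> x \<in> obj (lev X n) \<Longrightarrow>
      tgt (lev Y m) (pcell F m n \<phi> x) = fob (pfun F m) (fob (act X m n \<phi>) x)"
    using nat_iso_rules(1-4)[OF pseudonatural.pcell_iso[OF assms, of \<phi> m n], of x] by simp_all
qed

lemma pn_nat:
  assumes "pseudonatural X Y F" "\<phi> \<in> Delta m n" "a \<in> arr (lev X n)" "x = src (lev X n) a"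
  shows "cmp (lev Y m) (far (pfun F m) (far (act X m n \<phi>) a)) (pcell F m n \<phi> x) =
    cmp (lev Y m) (pcell F m n \<phi> (tgt (lev X n) a)) (far (act Y m n \<phi>) (far (pfun F n) a))"
  using nat_iso_rules(5)[OF pseudonatural.pcell_iso[OF assms(1,2)] assms(3)] assms(3,4) by simp

lemma pn_nat_assoc:
  assumes F: "pseudonatural X Y F" and [simp]: "\<phi> \<in> Delta m n" "a \<in> arr (lev X n)" "x = src (lev X n) a"
    and [simp]: "k \<in> arr (lev Y m)" "tgt (lev Y m) k = fob (act Y m n \<phi>) (fob (pfun F n) x)"
  shows "cmp (lev Y m) (far (pfun F m) (far (act X m n \<phi>) a)) (cmp (lev Y m) (pcell F m n \<phi> x) k) =
    cmp (lev Y m) (pcell F m n \<phi> (tgt (lev X n) a)) (cmp (lev Y m) (far (act Y m n \<phi>) (far (pfun F n) a)) k)"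
proof -
  note [simp] = pn_rules[OF F]
  have [simp]: "tgt (lev Y m) k = fob (act Y m n \<phi>) (fob (pfun F n) (src (lev X n) a))"
    by simp
  show ?thesis
    by (rule reassoc; (rule pn_nat[OF F])?) simp_all
qed

lemma pnI:
  assumes X: "simplicial_cat X" and Y: "simplicial_cat Y"
    and F: "\<And>n. is_functor (lev X n) (lev Y n) (pfun F n)"
    and cell: "\<And>m n \<phi> x. \<phi> \<in> Delta m n \<Longrightarrow> x \<in> obj (lev X n) \<Longrightarrow>
      iso_arr (lev Y m) (pcell F m n \<phi> x) \<and>
      src (lev Y m) (pcell F m n \<phi> x) = fob (act Y m n \<phi>) (fob (pfun F n) x) \<and>
      tgt (lev Y m) (pcell F m n \<phi> x) = fob (pfun F m) (fob (act X m n \<phi>) x)"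
    and nat: "\<And>m n \<phi> a. \<phi> \<in> Delta m n \<Longrightarrow> a \<in> arr (lev X n) \<Longrightarrow>
      cmp (lev Y m) (far (pfun F m) (far (act X m n \<phi>) a)) (pcell F m n \<phi> (src (lev X n) a)) =
      cmp (lev Y m) (pcell F m n \<phi> (tgt (lev X n) a)) (far (act Y m n \<phi>) (far (pfun F n) a))"
    and cid: "\<And>n x. x \<in> obj (lev X n) \<Longrightarrow>
        pcell F n n (\<lambda>i\<in>{..n}. i) x = ident (lev Y n) (fob (pfun F n) x)"
    and ccomp: "\<And>l m n \<phi> \<psi> x. \<psi> \<in> Delta l m \<Longrightarrow> \<phi> \<in> Delta m n \<Longrightarrow> x \<in> obj (lev X n) \<Longrightarrow>
        pcell F l n (compose {..l} \<phi> \<psi>) x =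
          cmp (lev Y l) (pcell F l m \<psi> (fob (act X m n \<phi>) x)) (far (act Y l m \<psi>) (pcell F m n \<phi> x))"
    and ext: "\<And>m n \<phi>. \<phi> \<notin> Delta m n \<Longrightarrow> pcell F m n \<phi> = undefined"
    and ext2: "\<And>m n \<phi> x. \<phi> \<in> Delta m n \<Longrightarrow> x \<notin> obj (lev X n) \<Longrightarrow> pcell F m n \<phi> x = undefined"
  shows "pseudonatural X Y F"
proof (rule pseudonatural.intro)
  fix m n \<phi>
  assume \<phi> [simp]: "\<phi> \<in> Delta m n"
  show "nat_iso (lev X n) (lev Y m)
          (comp_functor (lev X n) (act Y m n \<phi>) (pfun F n))
          (comp_functor (lev X n) (pfun F m) (act X m n \<phi>))
          (pcell F m n \<phi>)"
    by (rule nat_isoI)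
      (use X Y cell[OF \<phi>] nat[OF \<phi>] ext2[OF \<phi>] in
        \<open>auto intro: is_functor_comp[OF F act_fun] is_functor_comp[OF act_fun F]\<close>)
qed (use assms in auto)

lemma pn_ext: "pseudonatural X Y F \<Longrightarrow> \<phi> \<notin> Delta m n \<Longrightarrow> pcell F m n \<phi> = undefined"
  by (rule pseudonatural.pcell_ext)

lemma pn_ext2: "pseudonatural X Y F \<Longrightarrow> \<phi> \<in> Delta m n \<Longrightarrow> x \<notin> obj (lev X n) \<Longrightarrow> pcell F m n \<phi> x = undefined"
  by (rule nat_iso_rules(6)[OF pseudonatural.pcell_iso])

lemma pnat_eqI:
  assumes "pseudonatural X Y F" "pseudonatural X Y G"
    and "\<And>n x. x \<in> obj (lev X n) \<Longrightarrow> fob (pfun F n) x = fob (pfun G n) x"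
    and "\<And>n f. f \<in> arr (lev X n) \<Longrightarrow> far (pfun F n) f = far (pfun G n) f"
    and "\<And>m n \<phi> x. \<phi> \<in> Delta m n \<Longrightarrow> x \<in> obj (lev X n) \<Longrightarrow> pcell F m n \<phi> x = pcell G m n \<phi> x"
  shows "F = G"
proof (rule pnat.equality)
  show "pfun F = pfun G"
    by (rule ext, rule fctr_eqI[OF pn_fun[OF assms(1)] pn_fun[OF assms(2)]]) (use assms(3,4) in auto)
  have "pcell F m n \<phi> x = pcell G m n \<phi> x" for m n \<phi> x
    using assms(5) pn_ext[OF assms(1)] pn_ext[OF assms(2)] pn_ext2[OF assms(1)] pn_ext2[OF assms(2)]
    by (cases "\<phi> \<in> Delta m n"; cases "x \<in> obj (lev X n)") auto
  then show "pcell F = pcell G"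
    by blast
qed simp

lemma md_rules:
  assumes "modification X Y \<Gamma>"
  shows "x \<in> obj (lev X n) \<Longrightarrow> mcomp \<Gamma> n x \<in> arr (lev Y n)"
    "x \<in> obj (lev X n) \<Longrightarrow> src (lev Y n) (mcomp \<Gamma> n x) = fob (pfun (msrc \<Gamma>) n) x"
    "x \<in> obj (lev X n) \<Longrightarrow> tgt (lev Y n) (mcomp \<Gamma> n x) = fob (pfun (mtgt \<Gamma>) n) x"
  by (rule nat_trans_rules[OF modification.mcomp_trans[OF assms]], assumption)+

lemma md_pn:
  assumes "modification X Y \<Gamma>"
  shows "pseudonatural X Y (msrc \<Gamma>)" "pseudonatural X Y (mtgt \<Gamma>)"
  using assms by (simp_all add: modification_def)

lemma md_nat:
  assumes "modification X Y \<Gamma>" "a \<in> arr (lev X n)" "x = src (lev X n) a"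
  shows "cmp (lev Y n) (far (pfun (mtgt \<Gamma>) n) a) (mcomp \<Gamma> n x) =
    cmp (lev Y n) (mcomp \<Gamma> n (tgt (lev X n) a)) (far (pfun (msrc \<Gamma>) n) a)"
  using nat_trans_rules(4)[OF modification.mcomp_trans[OF assms(1)] assms(2)] assms(3) by simp

lemma md_pcell:
  assumes "modification X Y \<Gamma>" "\<phi> \<in> Delta m n" "x \<in> obj (lev X n)"
  shows "cmp (lev Y m) (pcell (mtgt \<Gamma>) m n \<phi> x) (far (act Y m n \<phi>) (mcomp \<Gamma> n x)) =
        cmp (lev Y m) (mcomp \<Gamma> m (fob (act X m n \<phi>) x)) (pcell (msrc \<Gamma>) m n \<phi> x)"
  using assms by (rule modification.mcomp_pcell)

lemma mdI:
  assumes F: "pseudonatural X Y (msrc \<Gamma>)" and G: "pseudonatural X Y (mtgt \<Gamma>)"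
    and "\<And>n x. x \<in> obj (lev X n) \<Longrightarrow> mcomp \<Gamma> n x \<in> arr (lev Y n) \<and>
      src (lev Y n) (mcomp \<Gamma> n x) = fob (pfun (msrc \<Gamma>) n) x \<and> tgt (lev Y n) (mcomp \<Gamma> n x) = fob (pfun (mtgt \<Gamma>) n) x"
    and "\<And>n a. a \<in> arr (lev X n) \<Longrightarrow> cmp (lev Y n) (far (pfun (mtgt \<Gamma>) n) a) (mcomp \<Gamma> n (src (lev X n) a)) =
    cmp (lev Y n) (mcomp \<Gamma> n (tgt (lev X n) a)) (far (pfun (msrc \<Gamma>) n) a)"
    and "\<And>m n \<phi> x. \<phi> \<in> Delta m n \<Longrightarrow> x \<in> obj (lev X n) \<Longrightarrow>
        cmp (lev Y m) (pcell (mtgt \<Gamma>) m n \<phi> x) (far (act Y m n \<phi>) (mcomp \<Gamma> n x)) =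
        cmp (lev Y m) (mcomp \<Gamma> m (fob (act X m n \<phi>) x)) (pcell (msrc \<Gamma>) m n \<phi> x)"
    and "\<And>n x. x \<notin> obj (lev X n) \<Longrightarrow> mcomp \<Gamma> n x = undefined"
  shows "modification X Y \<Gamma>"
  by (rule modification.intro[OF F G _ assms(5)], rule nat_transI[OF pn_fun[OF F] pn_fun[OF G]])
    (use assms(3-6) in auto)

lemma md_eqI:
  assumes "modification X Y \<Gamma>" "modification X Y \<Delta>" "msrc \<Gamma> = msrc \<Delta>" "mtgt \<Gamma> = mtgt \<Delta>"
    and "\<And>n x. x \<in> obj (lev X n) \<Longrightarrow> mcomp \<Gamma> n x = mcomp \<Delta> n x"
  shows "\<Gamma> = \<Delta>"
proof (rule modif.equality)
  have "mcomp \<Gamma> n x = mcomp \<Delta> n x" for n x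
    using assms(5) nat_trans_rules(5)[OF modification.mcomp_trans[OF assms(1)]]
      nat_trans_rules(5)[OF modification.mcomp_trans[OF assms(2)]] by (cases "x \<in> obj (lev X n)") auto
  then show "mcomp \<Gamma> = mcomp \<Delta>"
    by blast
qed (use assms in auto)

section \<open>The hom-categories\<close>

lemma ps_hom_simps [simp]:
  "F \<in> obj (ps_hom X Y) \<longleftrightarrow> pseudonatural X Y F"
  "\<Gamma> \<in> arr (ps_hom X Y) \<longleftrightarrow> modification X Y \<Gamma>"
  "modification X Y \<Gamma> \<Longrightarrow> src (ps_hom X Y) \<Gamma> = msrc \<Gamma>"
  "modification X Y \<Gamma> \<Longrightarrow> tgt (ps_hom X Y) \<Gamma> = mtgt \<Gamma>"
  by (simp_all add: ps_hom_def)

lemma ps_hom_ident [simp]: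
  assumes "pseudonatural X Y F"
  shows "msrc (ident (ps_hom X Y) F) = F" "mtgt (ident (ps_hom X Y) F) = F"
    "x \<in> obj (lev X n) \<Longrightarrow> mcomp (ident (ps_hom X Y) F) n x = ident (lev Y n) (fob (pfun F n) x)"
  using assms by (simp_all add: ps_hom_def)

lemma ps_hom_cmp [simp]:
  assumes "modification X Y \<Gamma>" "modification X Y \<Delta>" "msrc \<Delta> = mtgt \<Gamma>"
  shows "msrc (cmp (ps_hom X Y) \<Delta> \<Gamma>) = msrc \<Gamma>" "mtgt (cmp (ps_hom X Y) \<Delta> \<Gamma>) = mtgt \<Delta>"
    "x \<in> obj (lev X n) \<Longrightarrow> mcomp (cmp (ps_hom X Y) \<Delta> \<Gamma>) n x = cmp (lev Y n) (mcomp \<Delta> n x) (mcomp \<Gamma> n x)"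
  using assms by (simp_all add: ps_hom_def)

lemma md_ident [simp]:
  assumes F: "pseudonatural X Y F"
  shows "modification X Y (ident (ps_hom X Y) F)"
proof -
  note [simp] = F pn_rules[OF F]
  show ?thesis
    by (rule mdI) (auto, auto simp: ps_hom_def)
qed

lemma md_cmp [simp]:
  assumes \<Gamma>: "modification X Y \<Gamma>" and \<Delta>: "modification X Y \<Delta>" and [simp]: "msrc \<Delta> = mtgt \<Gamma>"
  shows "modification X Y (cmp (ps_hom X Y) \<Delta> \<Gamma>)"
proof -
  note p = md_pn[OF \<Gamma>] md_pn(2)[OF \<Delta>]
  note [simp] = \<Gamma> \<Delta> md_rules[OF \<Gamma>] md_rules[OF \<Delta>] pn_rules[OF p(1)] pn_rules[OF p(2)] pn_rules[OF p(3)] p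
  show ?thesis
  proof (rule mdI)
    fix n a
    assume [simp]: "a \<in> arr (lev X n)"
    have "cmp (lev Y n) (far (pfun (mtgt \<Delta>) n) a) (cmp (lev Y n) (mcomp \<Delta> n (src (lev X n) a)) (mcomp \<Gamma> n (src (lev X n) a))) =
      cmp (lev Y n) (mcomp \<Delta> n (tgt (lev X n) a)) (cmp (lev Y n) (far (pfun (mtgt \<Gamma>) n) a) (mcomp \<Gamma> n (src (lev X n) a)))"
      by (rule reassoc; (subst md_nat[OF \<Delta>])?) simp_all
    then show "cmp (lev Y n) (far (pfun (mtgt (cmp (ps_hom X Y) \<Delta> \<Gamma>)) n) a) (mcomp (cmp (ps_hom X Y) \<Delta> \<Gamma>) n (src (lev X n) a)) =
      cmp (lev Y n) (mcomp (cmp (ps_hom X Y) \<Delta> \<Gamma>) n (tgt (lev X n) a)) (far (pfun (msrc (cmp (ps_hom X Y) \<Delta> \<Gamma>)) n) a)"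
      by (simp add: md_nat[OF \<Gamma>])
  next
    fix m n \<phi> x
    assume [simp]: "\<phi> \<in> Delta m n" "x \<in> obj (lev X n)"
    have "cmp (lev Y m) (pcell (mtgt \<Delta>) m n \<phi> x) (cmp (lev Y m) (far (act Y m n \<phi>) (mcomp \<Delta> n x)) (far (act Y m n \<phi>) (mcomp \<Gamma> n x))) =
       cmp (lev Y m) (mcomp \<Delta> m (fob (act X m n \<phi>) x)) (cmp (lev Y m) (pcell (msrc \<Delta>) m n \<phi> x) (far (act Y m n \<phi>) (mcomp \<Gamma> n x)))"
      by (rule reassoc; (rule md_pcell[OF \<Delta>])?) simp_all
    then show "cmp (lev Y m) (pcell (mtgt (cmp (ps_hom X Y) \<Delta> \<Gamma>)) m n \<phi> x) (far (act Y m n \<phi>) (mcomp (cmp (ps_hom X Y) \<Delta> \<Gamma>) n x)) =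
       cmp (lev Y m) (mcomp (cmp (ps_hom X Y) \<Delta> \<Gamma>) m (fob (act X m n \<phi>) x)) (pcell (msrc (cmp (ps_hom X Y) \<Delta> \<Gamma>)) m n \<phi> x)"
      by (simp add: md_pcell[OF \<Gamma>])
  next
    show "mcomp (cmp (ps_hom X Y) \<Delta> \<Gamma>) n x = undefined" if "x \<notin> obj (lev X n)" for n x
      using that by (simp add: ps_hom_def)
  qed auto
qed

lemma category_ps_hom [simp]: "category (ps_hom X Y)"
proof -
  let ?i = "\<lambda>F. \<lparr>msrc = F, mtgt = F, mcomp = (\<lambda>n. \<lambda>x\<in>obj (lev X n). ident (lev Y n) (fob (pfun F n) x))\<rparr>"
  let ?c = "\<lambda>\<Delta> \<Gamma>. \<lparr>msrc = msrc \<Gamma>, mtgt = mtgt \<Delta>,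
             mcomp = (\<lambda>n. \<lambda>x\<in>obj (lev X n). cmp (lev Y n) (mcomp \<Delta> n x) (mcomp \<Gamma> n x))\<rparr>"
  \<comment> \<open>\<open>md_ident\<close> and \<open>md_cmp\<close> speak of the operations of the
    finished category, which are guarded by their domains, whereas the axioms are to be checked for
    the bare formulas \<open>?i\<close> and \<open>?c\<close>.\<close>
  have i: "modification X Y (?i F)" if "pseudonatural X Y F" for F
    using md_ident[OF that] that by (simp add: ps_hom_def)
  have c: "modification X Y (?c \<Delta> \<Gamma>)" if "modification X Y \<Gamma>" "modification X Y \<Delta>" "msrc \<Delta> = mtgt \<Gamma>" for \<Delta> \<Gamma>
    using md_cmp[OF that] that by (simp add: ps_hom_def)
  show ?thesis
    unfolding ps_hom_def
  proof (rule category_mk_cat; (unfold mem_Collect_eq)?)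
    fix f assume f: "modification X Y f"
    note p = md_pn[OF f]
    note [simp] = md_rules[OF f] pn_rules(1,2)[OF p(1)]
    show "?c (?i (mtgt f)) f = f"
      by (rule md_eqI[OF c[OF f i[OF p(2)]] f]) auto
    show "?c f (?i (msrc f)) = f"
      by (rule md_eqI[OF c[OF i[OF p(1)] f] f]) auto
  next
    fix f g h
    assume f: "modification X Y f" and g: "modification X Y g" and h: "modification X Y h"
      and [simp]: "msrc g = mtgt f" "msrc h = mtgt g"
    note [simp] = md_rules[OF f] md_rules[OF g] md_rules[OF h] pn_rules(1,2)[OF md_pn(1)[OF f]]
    have "modification X Y (?c g f)" "modification X Y (?c h g)"
      by (rule c; simp add: f g h)+
    then have m: "modification X Y (?c h (?c g f))" "modification X Y (?c (?c h g) f)"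
      by (intro c; simp add: f g h)+
    show "?c h (?c g f) = ?c (?c h g) f"
      by (rule md_eqI[OF m]) auto
  qed (use i c in \<open>auto dest: md_pn\<close>)
qed

section \<open>Horizontal composition\<close>

lemma ps_comp_simps [simp]:
  "x \<in> obj (lev X n) \<Longrightarrow> fob (pfun (ps_comp X Z G F) n) x = fob (pfun G n) (fob (pfun F n) x)"
  "f \<in> arr (lev X n) \<Longrightarrow> far (pfun (ps_comp X Z G F) n) f = far (pfun G n) (far (pfun F n) f)"
  "\<phi> \<in> Delta m n \<Longrightarrow> x \<in> obj (lev X n) \<Longrightarrow> pcell (ps_comp X Z G F) m n \<phi> x =
     cmp (lev Z m) (far (pfun G m) (pcell F m n \<phi> x)) (pcell G m n \<phi> (fob (pfun F n) x))"
  by (simp_all add: ps_comp_def)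

lemma ps_id_simps [simp]:
  "x \<in> obj (lev X n) \<Longrightarrow> fob (pfun (ps_id X) n) x = x"
  "f \<in> arr (lev X n) \<Longrightarrow> far (pfun (ps_id X) n) f = f"
  "\<phi> \<in> Delta m n \<Longrightarrow> x \<in> obj (lev X n) \<Longrightarrow> pcell (ps_id X) m n \<phi> x = ident (lev X m) (fob (act X m n \<phi>) x)"
  by (simp_all add: ps_id_def)

lemma ps_id_pn [simp]:
  assumes [simp]: "simplicial_cat X"
  shows "pseudonatural X X (ps_id X)"
proof (rule pnI)
  show "pcell (ps_id X) l n (compose {..l} \<phi> \<psi>) x =
       cmp (lev X l) (pcell (ps_id X) l m \<psi> (fob (act X m n \<phi>) x)) (far (act X l m \<psi>) (pcell (ps_id X) m n \<phi> x))"
    if [simp]: "\<psi> \<in> Delta l m" "\<phi> \<in> Delta m n" "x \<in> obj (lev X n)" for l m n \<phi> \<psi> x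
    by (simp add: Delta_compose[OF that(1,2)] act_compose[OF assms that(1,2)])
qed (auto, auto simp: ps_id_def)

lemma ps_comp_pn:
  assumes F: "pseudonatural X Y F" and G: "pseudonatural Y Z G"
  shows "pseudonatural X Z (ps_comp X Z G F)"
proof -
  note [simp] = pn_rules[OF F] pn_rules[OF G]
  show ?thesis
  proof (rule pnI)
    show "is_functor (lev X n) (lev Z n) (pfun (ps_comp X Z G F) n)" for n
      by (simp add: ps_comp_def is_functor_comp[OF pn_fun[OF F] pn_fun[OF G]])
  next
    fix m n \<phi> a
    assume [simp]: "\<phi> \<in> Delta m n" "a \<in> arr (lev X n)"
    \<comment> \<open>The square for the composite is the image under \<open>G\<close> of the square
      of \<open>F\<close>, pasted to the square of \<open>G\<close> at an arrow in the image of
      \<open>F\<close>.\<close>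
    have "cmp (lev Z m) (far (pfun G m) (far (pfun F m) (far (act X m n \<phi>) a)))
        (cmp (lev Z m) (far (pfun G m) (pcell F m n \<phi> (src (lev X n) a))) (pcell G m n \<phi> (fob (pfun F n) (src (lev X n) a)))) =
       cmp (lev Z m) (far (pfun G m) (pcell F m n \<phi> (tgt (lev X n) a)))
         (cmp (lev Z m) (far (pfun G m) (far (act Y m n \<phi>) (far (pfun F n) a))) (pcell G m n \<phi> (fob (pfun F n) (src (lev X n) a))))"
      using arg_cong[OF pn_nat[OF F, of \<phi> m n a "src (lev X n) a"], of "far (pfun G m)"]
      by (intro reassoc) simp_all
    then show "cmp (lev Z m) (far (pfun (ps_comp X Z G F) m) (far (act X m n \<phi>) a)) (pcell (ps_comp X Z G F) m n \<phi> (src (lev X n) a)) =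
       cmp (lev Z m) (pcell (ps_comp X Z G F) m n \<phi> (tgt (lev X n) a)) (far (act Z m n \<phi>) (far (pfun (ps_comp X Z G F) n) a))"
      by (simp add: pn_nat[OF G])
  next
    fix l m n \<phi> \<psi> x
    assume [simp]: "\<psi> \<in> Delta l m" "\<phi> \<in> Delta m n" "x \<in> obj (lev X n)"
    show "pcell (ps_comp X Z G F) l n (compose {..l} \<phi> \<psi>) x =
       cmp (lev Z l) (pcell (ps_comp X Z G F) l m \<psi> (fob (act X m n \<phi>) x)) (far (act Z l m \<psi>) (pcell (ps_comp X Z G F) m n \<phi> x))"
      by (simp add: Delta_compose[of _ _ m] act_compose[of X _ _ m] pseudonatural.pcell_comp[OF F, of _ _ m]
          pseudonatural.pcell_comp[OF G, of _ _ m] pn_nat_assoc[OF G])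
  qed (auto simp: pseudonatural.pcell_id[OF F] pseudonatural.pcell_id[OF G], auto simp: ps_comp_def)
qed

lemma mod_hcomp_simps [simp]:
  "msrc (mod_hcomp X Z \<Delta> \<Gamma>) = ps_comp X Z (msrc \<Delta>) (msrc \<Gamma>)"
  "mtgt (mod_hcomp X Z \<Delta> \<Gamma>) = ps_comp X Z (mtgt \<Delta>) (mtgt \<Gamma>)"
  "x \<in> obj (lev X n) \<Longrightarrow> mcomp (mod_hcomp X Z \<Delta> \<Gamma>) n x =
     cmp (lev Z n) (mcomp \<Delta> n (fob (pfun (mtgt \<Gamma>) n) x)) (far (pfun (msrc \<Delta>) n) (mcomp \<Gamma> n x))"
  by (simp_all add: mod_hcomp_def)

lemma mod_hcomp_md:
  assumes \<Gamma>: "modification X Y \<Gamma>" and \<Delta>: "modification Y Z \<Delta>"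
  shows "modification X Z (mod_hcomp X Z \<Delta> \<Gamma>)"
proof -
  note p = md_pn[OF \<Gamma>] md_pn[OF \<Delta>]
  note [simp] = md_rules[OF \<Gamma>] md_rules[OF \<Delta>] pn_rules[OF p(1)] pn_rules[OF p(2)] pn_rules[OF p(3)] pn_rules[OF p(4)]
  show ?thesis
  proof (rule mdI)
    fix n a
    assume [simp]: "a \<in> arr (lev X n)"
    let ?s = "src (lev X n) a" and ?t = "tgt (lev X n) a"
    have "cmp (lev Z n) (far (pfun (mtgt \<Delta>) n) (far (pfun (mtgt \<Gamma>) n) a))
       (cmp (lev Z n) (mcomp \<Delta> n (fob (pfun (mtgt \<Gamma>) n) ?s)) (far (pfun (msrc \<Delta>) n) (mcomp \<Gamma> n ?s))) =
      cmp (lev Z n) (mcomp \<Delta> n (fob (pfun (mtgt \<Gamma>) n) ?t))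
       (cmp (lev Z n) (far (pfun (msrc \<Delta>) n) (far (pfun (mtgt \<Gamma>) n) a)) (far (pfun (msrc \<Delta>) n) (mcomp \<Gamma> n ?s)))"
      by (rule reassoc; (subst md_nat[OF \<Delta>])?) simp_all
    also have "cmp (lev Z n) (far (pfun (msrc \<Delta>) n) (far (pfun (mtgt \<Gamma>) n) a)) (far (pfun (msrc \<Delta>) n) (mcomp \<Gamma> n ?s)) =
      cmp (lev Z n) (far (pfun (msrc \<Delta>) n) (mcomp \<Gamma> n ?t)) (far (pfun (msrc \<Delta>) n) (far (pfun (msrc \<Gamma>) n) a))"
      using arg_cong[OF md_nat[OF \<Gamma>, of a n ?s], of "far (pfun (msrc \<Delta>) n)"] by simp
    finally show "cmp (lev Z n) (far (pfun (mtgt (mod_hcomp X Z \<Delta> \<Gamma>)) n) a) (mcomp (mod_hcomp X Z \<Delta> \<Gamma>) n ?s) =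
       cmp (lev Z n) (mcomp (mod_hcomp X Z \<Delta> \<Gamma>) n ?t) (far (pfun (msrc (mod_hcomp X Z \<Delta> \<Gamma>)) n) a)"
      by simp
  next
    fix m n \<phi> x
    assume [simp]: "\<phi> \<in> Delta m n" "x \<in> obj (lev X n)"
    let ?x = "fob (act X m n \<phi>) x" and ?F = "msrc \<Gamma>" and ?F' = "mtgt \<Gamma>" and ?G = "msrc \<Delta>" and ?G' = "mtgt \<Delta>"
    let ?u = "far (act Z m n \<phi>) (far (pfun ?G n) (mcomp \<Gamma> n x))"
    \<comment> \<open>The compatibility square is pasted from four: compatibility of
      \<open>\<Delta>\<close> with the cells of \<open>?G\<close> and \<open>?G'\<close>, naturality
      of \<open>\<Delta>\<close> at a cell of \<open>?F'\<close>, naturality of the cell of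
      \<open>?G\<close> at a component of \<open>\<Gamma>\<close>, and the image under
      \<open>?G\<close> of the compatibility of \<open>\<Gamma>\<close>.\<close>
    have "cmp (lev Z m) (pcell ?G' m n \<phi> (fob (pfun ?F' n) x)) (cmp (lev Z m) (far (act Z m n \<phi>) (mcomp \<Delta> n (fob (pfun ?F' n) x))) ?u) =
      cmp (lev Z m) (mcomp \<Delta> m (fob (act Y m n \<phi>) (fob (pfun ?F' n) x))) (cmp (lev Z m) (pcell ?G m n \<phi> (fob (pfun ?F' n) x)) ?u)"
      by (rule reassoc; (rule md_pcell[OF \<Delta>])?) simp_all
    moreover have "cmp (lev Z m) (far (pfun ?G' m) (pcell ?F' m n \<phi> x))
        (cmp (lev Z m) (mcomp \<Delta> m (fob (act Y m n \<phi>) (fob (pfun ?F' n) x))) (cmp (lev Z m) (pcell ?G m n \<phi> (fob (pfun ?F' n) x)) ?u)) =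
      cmp (lev Z m) (mcomp \<Delta> m (fob (pfun ?F' m) ?x))
        (cmp (lev Z m) (far (pfun ?G m) (pcell ?F' m n \<phi> x)) (cmp (lev Z m) (pcell ?G m n \<phi> (fob (pfun ?F' n) x)) ?u))"
      by (rule reassoc; (subst md_nat[OF \<Delta>])?) simp_all
    moreover have "cmp (lev Z m) (pcell ?G m n \<phi> (fob (pfun ?F' n) x)) ?u =
      cmp (lev Z m) (far (pfun ?G m) (far (act Y m n \<phi>) (mcomp \<Gamma> n x))) (pcell ?G m n \<phi> (fob (pfun ?F n) x))"
      by (subst pn_nat[OF p(3)]) simp_all
    moreover have "cmp (lev Z m) (far (pfun ?G m) (pcell ?F' m n \<phi> x))
        (cmp (lev Z m) (far (pfun ?G m) (far (act Y m n \<phi>) (mcomp \<Gamma> n x))) (pcell ?G m n \<phi> (fob (pfun ?F n) x))) =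
      cmp (lev Z m) (far (pfun ?G m) (mcomp \<Gamma> m ?x)) (cmp (lev Z m) (far (pfun ?G m) (pcell ?F m n \<phi> x)) (pcell ?G m n \<phi> (fob (pfun ?F n) x)))"
      using arg_cong[OF md_pcell[OF \<Gamma>, of \<phi> m n x], of "far (pfun ?G m)"] by (intro reassoc) simp_all
    ultimately show "cmp (lev Z m) (pcell (mtgt (mod_hcomp X Z \<Delta> \<Gamma>)) m n \<phi> x) (far (act Z m n \<phi>) (mcomp (mod_hcomp X Z \<Delta> \<Gamma>) n x)) =
       cmp (lev Z m) (mcomp (mod_hcomp X Z \<Delta> \<Gamma>) m ?x) (pcell (msrc (mod_hcomp X Z \<Delta> \<Gamma>)) m n \<phi> x)"
      by simp
  qed (auto simp: ps_comp_pn[OF p(1) p(3)] ps_comp_pn[OF p(2) p(4)], auto simp: mod_hcomp_def)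
qed

lemma ps_comp_assoc:
  assumes f: "pseudonatural W X f" and g: "pseudonatural X Y g" and h: "pseudonatural Y Z h"
  shows "ps_comp W Z h (ps_comp W Y g f) = ps_comp W Z (ps_comp X Z h g) f"
proof -
  note [simp] = pn_rules[OF f] pn_rules[OF g] pn_rules[OF h]
  note t = ps_comp_pn[OF ps_comp_pn[OF f g] h] ps_comp_pn[OF f ps_comp_pn[OF g h]]
  show ?thesis
    by (rule pnat_eqI[OF t]) auto
qed

lemma mod_hcomp_assoc:
  assumes f: "modification W X f" and g: "modification X Y g" and h: "modification Y Z h"
  shows "mod_hcomp W Z h (mod_hcomp W Y g f) = mod_hcomp W Z (mod_hcomp X Z h g) f"
proof -
  note [simp] = md_rules[OF f] md_rules[OF g] md_rules[OF h]
  note p = md_pn[OF f] md_pn[OF g] md_pn[OF h]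
  note [simp] = p[THEN pn_rules(1)] p[THEN pn_rules(2)] p[THEN pn_rules(3)] p[THEN pn_rules(4)]
    p[THEN pn_rules(5)] p[THEN pn_rules(6)] p[THEN pn_rules(8)]
  note t = mod_hcomp_md[OF mod_hcomp_md[OF f g] h] mod_hcomp_md[OF f mod_hcomp_md[OF g h]]
  show ?thesis
    by (rule md_eqI[OF t]) (simp_all add: ps_comp_assoc[OF p(1,3,5)] ps_comp_assoc[OF p(2,4,6)])
qed

lemma ps_comp_id [simp]:
  assumes f: "pseudonatural X Y f"
  shows "ps_comp X Y (ps_id Y) f = f" "ps_comp X Y f (ps_id X) = f"
proof -
  note [simp] = pn_rules[OF f]
  show "ps_comp X Y (ps_id Y) f = f"
    by (rule pnat_eqI[OF ps_comp_pn[OF f ps_id_pn] f]) auto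
  show "ps_comp X Y f (ps_id X) = f"
    by (rule pnat_eqI[OF ps_comp_pn[OF ps_id_pn f] f]) auto
qed

lemma mod_hcomp_id [simp]:
  assumes f: "modification X Y f"
  shows "mod_hcomp X Y (ident (ps_hom Y Y) (ps_id Y)) f = f" "mod_hcomp X Y f (ident (ps_hom X X) (ps_id X)) = f"
proof -
  note p = md_pn[OF f]
  note [simp] = md_rules[OF f] p[THEN pn_rules(1)] p[THEN pn_rules(2)] p[THEN pn_rules(3)] p[THEN pn_rules(7)] p
  show "mod_hcomp X Y (ident (ps_hom Y Y) (ps_id Y)) f = f"
    by (rule md_eqI[OF mod_hcomp_md[OF f] f]) auto
  show "mod_hcomp X Y f (ident (ps_hom X X) (ps_id X)) = f"
    by (rule md_eqI[OF mod_hcomp_md[OF _ f] f]) auto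
qed

lemma mod_hcomp_ident:
  assumes f: "pseudonatural X Y f" and g: "pseudonatural Y Z g"
  shows "mod_hcomp X Z (ident (ps_hom Y Z) g) (ident (ps_hom X Y) f) = ident (ps_hom X Z) (ps_comp X Z g f)"
proof -
  note [simp] = f g pn_rules[OF f] pn_rules[OF g] ps_comp_pn[OF f g]
  show ?thesis
    by (rule md_eqI[of X Z]) (auto intro: mod_hcomp_md[OF md_ident[OF f] md_ident[OF g]])
qed

text \<open>After expanding both sides only the two middle factors differ, and they are exchanged by
  naturality of \<open>b\<close> at the components of \<open>a'\<close>.\<close>

lemma mod_interchange:
  assumes a: "modification X Y a" and a': "modification X Y a'" and b: "modification Y Z b" and b': "modification Y Z b'"
    and [simp]: "msrc a' = mtgt a" "msrc b' = mtgt b"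
  shows "mod_hcomp X Z (cmp (ps_hom Y Z) b' b) (cmp (ps_hom X Y) a' a) =
    cmp (ps_hom X Z) (mod_hcomp X Z b' a') (mod_hcomp X Z b a)"
proof -
  note p = md_pn[OF a] md_pn(2)[OF a'] md_pn[OF b] md_pn(2)[OF b']
  note [simp] = md_rules[OF a] md_rules[OF b] md_rules[OF a'] md_rules[OF b'] a a' b b' p[THEN pn_rules(1)] p[THEN pn_rules(2)] p[THEN pn_rules(3)]
    p[THEN pn_rules(4)] p[THEN pn_rules(5)] p[THEN pn_rules(6)] p[THEN pn_rules(8)]
  note h = mod_hcomp_md[OF a b] mod_hcomp_md[OF a' b']
  have m: "modification X Z (mod_hcomp X Z (cmp (ps_hom Y Z) b' b) (cmp (ps_hom X Y) a' a))"
    by (rule mod_hcomp_md[of _ Y]) auto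
  have "cmp (lev Z n) (mcomp b n (fob (pfun (mtgt a') n) x))
        (cmp (lev Z n) (far (pfun (msrc b) n) (mcomp a' n x)) (far (pfun (msrc b) n) (mcomp a n x))) =
     cmp (lev Z n) (far (pfun (mtgt b) n) (mcomp a' n x)) 
       (cmp (lev Z n) (mcomp b n (fob (pfun (mtgt a) n) x)) (far (pfun (msrc b) n) (mcomp a n x)))"
    if [simp]: "x \<in> obj (lev X n)" for x n
    by (rule reassoc; (subst md_nat[OF b])?) simp_all
  then show ?thesis
    by (intro md_eqI[OF m]) (simp_all add: h)
qed

section \<open>Products of categories and the 2-category of a family\<close>

lemma prod_cat_simps [simp]:
  "obj (prod_cat C D) = obj C \<times> obj D"
  "arr (prod_cat C D) = arr C \<times> arr D"
  "f \<in> arr C \<Longrightarrow> g \<in> arr D \<Longrightarrow> src (prod_cat C D) (f, g) = (src C f, src D g)"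
  "f \<in> arr C \<Longrightarrow> g \<in> arr D \<Longrightarrow> tgt (prod_cat C D) (f, g) = (tgt C f, tgt D g)"
  "x \<in> obj C \<Longrightarrow> y \<in> obj D \<Longrightarrow> ident (prod_cat C D) (x, y) = (ident C x, ident D y)"
  "f \<in> arr C \<Longrightarrow> g \<in> arr D \<Longrightarrow> f' \<in> arr C \<Longrightarrow> g' \<in> arr D \<Longrightarrow> src C f' = tgt C f \<Longrightarrow> src D g' = tgt D g \<Longrightarrow>
    cmp (prod_cat C D) (f', g') (f, g) = (cmp C f' f, cmp D g' g)"
  by (simp_all add: prod_cat_def)

lemma category_prod_cat [simp]: "category C \<Longrightarrow> category D \<Longrightarrow> category (prod_cat C D)"
  unfolding prod_cat_def by (rule category_mk_cat) auto

lemma ps_twocat_simps [simp]: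
  "Obj (ps_twocat S N) = S"
  "Hom (ps_twocat S N) x y = ps_hom (N x) (N y)"
  "One (ps_twocat S N) x = ps_id (N x)"
  by (simp_all add: ps_twocat_def)

lemma ps_twocat_hc1 [simp]:
  "pseudonatural (N x) (N y) f \<Longrightarrow> pseudonatural (N y) (N z) g \<Longrightarrow>
    hc1 (ps_twocat S N) x y z g f = ps_comp (N x) (N z) g f"
  by (simp add: ps_twocat_def)

lemma ps_twocat_hc2 [simp]:
  "modification (N x) (N y) \<alpha> \<Longrightarrow> modification (N y) (N z) \<beta> \<Longrightarrow>
    hc2 (ps_twocat S N) x y z \<beta> \<alpha> = mod_hcomp (N x) (N z) \<beta> \<alpha>"
  by (simp add: ps_twocat_def)

lemma HComp_ps_twocat_functor:
  "is_functor (prod_cat (ps_hom (N y) (N z)) (ps_hom (N x) (N y))) (ps_hom (N x) (N z)) (HComp (ps_twocat S N) x y z)"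
  unfolding ps_twocat_def
  by simp (rule functor_functor_on; auto simp: ps_comp_pn mod_hcomp_md mod_hcomp_ident mod_interchange dest: md_pn)

lemma two_category_ps_twocat:
  assumes "\<And>x. x \<in> S \<Longrightarrow> simplicial_cat (N x)"
  shows "two_category (ps_twocat S N)"
  by (rule two_category.intro)
    (auto simp: assms HComp_ps_twocat_functor ps_comp_pn mod_hcomp_md ps_comp_assoc mod_hcomp_assoc)

section \<open>Adjoint equivalences and conjugation\<close>

text \<open>Each equation required of the inverse components may be tested after composing on both
  sides with components of \<open>\<Gamma>\<close>, which are invertible; there it becomes the
  corresponding equation for \<open>\<Gamma>\<close>.\<close>

lemma iso_md:
  assumes m: "modification X Y \<Gamma>" and i: "\<And>n x. x \<in> obj (lev X n) \<Longrightarrow> iso_arr (lev Y n) (mcomp \<Gamma> n x)"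
  shows "iso_arr (ps_hom X Y) \<Gamma>"
    and "x \<in> obj (lev X n) \<Longrightarrow> mcomp (iinv (ps_hom X Y) \<Gamma>) n x = iinv (lev Y n) (mcomp \<Gamma> n x)"
proof -
  define \<Delta> where "\<Delta> = \<lparr>msrc = mtgt \<Gamma>, mtgt = msrc \<Gamma>, mcomp = (\<lambda>n. \<lambda>x\<in>obj (lev X n). iinv (lev Y n) (mcomp \<Gamma> n x))\<rparr>"
  note p = md_pn[OF m]
  note [simp] = md_rules[OF m] pn_rules[OF p(1)] pn_rules[OF p(2)] i m p
  have [simp]: "msrc \<Delta> = mtgt \<Gamma>" "mtgt \<Delta> = msrc \<Gamma>"
    "\<And>n x. x \<in> obj (lev X n) \<Longrightarrow> mcomp \<Delta> n x = iinv (lev Y n) (mcomp \<Gamma> n x)"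
    by (simp_all add: \<Delta>_def)
  have d: "modification X Y \<Delta>"
  proof (rule mdI)
    fix n a
    assume [simp]: "a \<in> arr (lev X n)"
    show "cmp (lev Y n) (far (pfun (mtgt \<Delta>) n) a) (mcomp \<Delta> n (src (lev X n) a)) =
           cmp (lev Y n) (mcomp \<Delta> n (tgt (lev X n) a)) (far (pfun (msrc \<Delta>) n) a)"
      by (rule iso_left_cancel[of "lev Y n" "mcomp \<Gamma> n (tgt (lev X n) a)"],
          simp_all, rule iso_right_cancel[of "lev Y n" "mcomp \<Gamma> n (src (lev X n) a)"])
        (simp_all add: md_nat[OF m])
  next
    fix m' n \<phi> x
    assume [simp]: "\<phi> \<in> Delta m' n" "x \<in> obj (lev X n)"
    let ?x = "fob (act X m' n \<phi>) x"
    show "cmp (lev Y m') (pcell (mtgt \<Delta>) m' n \<phi> x) (far (act Y m' n \<phi>) (mcomp \<Delta> n x)) =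
       cmp (lev Y m') (mcomp \<Delta> m' (fob (act X m' n \<phi>) x)) (pcell (msrc \<Delta>) m' n \<phi> x)"
      by (rule iso_left_cancel[of "lev Y m'" "mcomp \<Gamma> m' ?x"], simp_all,
          rule iso_right_cancel[of "lev Y m'" "far (act Y m' n \<phi>) (mcomp \<Gamma> n x)"])
        (simp_all add: md_pcell[OF m])
  qed (auto, auto simp: \<Delta>_def)
  note [simp] = d
  have e: "cmp (ps_hom X Y) \<Delta> \<Gamma> = ident (ps_hom X Y) (msrc \<Gamma>)"
    by (rule md_eqI[of X Y]) simp_all
  show iso: "iso_arr (ps_hom X Y) \<Gamma>"
  proof (rule iso_arrI[of _ _ \<Delta>])
    show "cmp (ps_hom X Y) \<Gamma> \<Delta> = ident (ps_hom X Y) (tgt (ps_hom X Y) \<Gamma>)"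
      by (rule md_eqI[of X Y]) simp_all
  qed (use e in simp_all)
  have "\<Delta> = iinv (ps_hom X Y) \<Gamma>"
    by (rule iinv_unique) (use e iso in simp_all)
  then show "x \<in> obj (lev X n) \<Longrightarrow> mcomp (iinv (ps_hom X Y) \<Gamma>) n x = iinv (lev Y n) (mcomp \<Gamma> n x)"
    by (metis \<open>\<And>n x. x \<in> obj (lev X n) \<Longrightarrow> mcomp \<Delta> n x = iinv (lev Y n) (mcomp \<Gamma> n x)\<close>)
qed

lemma iinv_md:
  assumes "iso_arr (ps_hom X Y) \<Gamma>"
  shows "modification X Y (iinv (ps_hom X Y) \<Gamma>)" "msrc (iinv (ps_hom X Y) \<Gamma>) = mtgt \<Gamma>"
    "mtgt (iinv (ps_hom X Y) \<Gamma>) = msrc \<Gamma>"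
  using iinv_simps(1-3)[OF assms] iso_arr_arr[OF assms] by simp_all

text \<open>Adjoint equivalences, with \<open>u : e' e \<Rightarrow> 1\<close> and \<open>c : 1 \<Rightarrow> e e'\<close>; since all components are
  invertible, the two triangle identities say that \<open>e u\<close> and \<open>u e'\<close> are inverse to \<open>c e\<close> and \<open>e' c\<close>.\<close>

definition adj_equiv ::
  "('o, 'a) scat \<Rightarrow> ('p, 'b) scat \<Rightarrow> ('o, 'a, 'p, 'b) pnat \<Rightarrow> ('p, 'b, 'o, 'a) pnat
    \<Rightarrow> ('o, 'a, 'o, 'a) modif \<Rightarrow> ('p, 'b, 'p, 'b) modif \<Rightarrow> bool" where
  "adj_equiv X Y e e' u c \<longleftrightarrow> pseudonatural X Y e \<and> pseudonatural Y X e' \<and>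
     modification X X u \<and> msrc u = ps_comp X X e' e \<and> mtgt u = ps_id X \<and>
     modification Y Y c \<and> msrc c = ps_id Y \<and> mtgt c = ps_comp Y Y e e' \<and>
     (\<forall>n. \<forall>x \<in> obj (lev X n). iso_arr (lev X n) (mcomp u n x)) \<and>
     (\<forall>n. \<forall>z \<in> obj (lev Y n). iso_arr (lev Y n) (mcomp c n z)) \<and>
     (\<forall>n. \<forall>x \<in> obj (lev X n). far (pfun e n) (mcomp u n x) = iinv (lev Y n) (mcomp c n (fob (pfun e n) x))) \<and>
     (\<forall>n. \<forall>z \<in> obj (lev Y n). mcomp u n (fob (pfun e' n) z) = iinv (lev X n) (far (pfun e' n) (mcomp c n z)))"

lemma adj_equivD:
  assumes "adj_equiv X Y e e' u c"
  shows "pseudonatural X Y e" "pseudonatural Y X e'" "modification X X u" "modification Y Y c"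
    "msrc u = ps_comp X X e' e" "mtgt u = ps_id X" "msrc c = ps_id Y" "mtgt c = ps_comp Y Y e e'"
    "x \<in> obj (lev X n) \<Longrightarrow> iso_arr (lev X n) (mcomp u n x)"
    "z \<in> obj (lev Y n) \<Longrightarrow> iso_arr (lev Y n) (mcomp c n z)"
    "x \<in> obj (lev X n) \<Longrightarrow> far (pfun e n) (mcomp u n x) = iinv (lev Y n) (mcomp c n (fob (pfun e n) x))"
    "z \<in> obj (lev Y n) \<Longrightarrow> mcomp u n (fob (pfun e' n) z) = iinv (lev X n) (far (pfun e' n) (mcomp c n z))"
  using assms by (simp_all add: adj_equiv_def)

lemma adj_equiv_md:
  assumes a: "adj_equiv X Y e e' u c"
  shows "x \<in> obj (lev X n) \<Longrightarrow> mcomp u n x \<in> arr (lev X n)"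
    "x \<in> obj (lev X n) \<Longrightarrow> src (lev X n) (mcomp u n x) = fob (pfun e' n) (fob (pfun e n) x)"
    "x \<in> obj (lev X n) \<Longrightarrow> tgt (lev X n) (mcomp u n x) = x"
    "z \<in> obj (lev Y n) \<Longrightarrow> mcomp c n z \<in> arr (lev Y n)"
    "z \<in> obj (lev Y n) \<Longrightarrow> src (lev Y n) (mcomp c n z) = z"
    "z \<in> obj (lev Y n) \<Longrightarrow> tgt (lev Y n) (mcomp c n z) = fob (pfun e n) (fob (pfun e' n) z)"
  using md_rules[OF adj_equivD(3)[OF a], of x n] md_rules[OF adj_equivD(4)[OF a], of z n]
  by (simp_all add: adj_equivD(5-8)[OF a])

lemma adj_equiv_nat:
  assumes a: "adj_equiv X Y e e' u c"
  shows "f \<in> arr (lev X n) \<Longrightarrow> x = src (lev X n) f \<Longrightarrow> cmp (lev X n) f (mcomp u n x) =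
      cmp (lev X n) (mcomp u n (tgt (lev X n) f)) (far (pfun e' n) (far (pfun e n) f))"
    and "g \<in> arr (lev Y n) \<Longrightarrow> z = src (lev Y n) g \<Longrightarrow> cmp (lev Y n) (far (pfun e n) (far (pfun e' n) g)) (mcomp c n z) =
      cmp (lev Y n) (mcomp c n (tgt (lev Y n) g)) g"
  using md_nat[OF adj_equivD(3)[OF a], of f n x] md_nat[OF adj_equivD(4)[OF a], of g n z]
  by (simp_all add: adj_equivD(5-8)[OF a])

text \<open>Inverting both 2-cells exchanges their roles as unit and counit, and with them the two
  triangle identities.\<close>

lemma adj_equiv_sym:
  assumes a: "adj_equiv X Y e e' u c"
  shows "adj_equiv Y X e' e (iinv (ps_hom Y Y) c) (iinv (ps_hom X X) u)"
proof -
  note d = adj_equivD[OF a]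
  note [simp] = d(1-10) adj_equiv_md[OF a] pn_rules[OF d(1)] pn_rules[OF d(2)]
  have i [simp]: "iso_arr (ps_hom X X) u" "iso_arr (ps_hom Y Y) c"
    by (rule iso_md; simp)+
  show ?thesis
    unfolding adj_equiv_def by (simp add: iinv_md iso_md(2)[of X X] iso_md(2)[of Y Y] d(11,12))
qed

text \<open>The usual unit and counit of a composite adjunction. The component formulas are recorded
  because the structure cells of a composite of two conjugations will be compared by means of the
  one for \<open>w\<close>.\<close>

lemma adj_equiv_comp:
  assumes a: "adj_equiv X Y e e' u c" and b: "adj_equiv Y Z d d' v k"
  defines "w \<equiv> cmp (ps_hom X X) u (mod_hcomp X X (ident (ps_hom Y X) e') (mod_hcomp X Y v (ident (ps_hom X Y) e)))"
    and "j \<equiv> cmp (ps_hom Z Z) (mod_hcomp Z Z (ident (ps_hom Y Z) d) (mod_hcomp Z Y c (ident (ps_hom Z Y) d'))) k"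
  shows "adj_equiv X Z (ps_comp X Z d e) (ps_comp Z X e' d') w j"
    and "x \<in> obj (lev X n) \<Longrightarrow> mcomp w n x = cmp (lev X n) (mcomp u n x) (far (pfun e' n) (mcomp v n (fob (pfun e n) x)))"
    and "z \<in> obj (lev Z n) \<Longrightarrow> mcomp j n z = cmp (lev Z n) (far (pfun d n) (mcomp c n (fob (pfun d' n) z))) (mcomp k n z)"
proof -
  note A = adj_equivD[OF a] and B = adj_equivD[OF b]
  note p = A(1) A(2) B(1) B(2)
  note [simp] = A(1-10) B(1-10) adj_equiv_md[OF a] adj_equiv_md[OF b]
    p[THEN pn_rules(1)] p[THEN pn_rules(2)] p[THEN pn_rules(3)] p[THEN pn_rules(4)] p[THEN pn_rules(5)]
    p[THEN pn_rules(6)] p[THEN pn_rules(7)] p[THEN pn_rules(8)] p[THEN pn_rules(9)] p[THEN pn_rules(10)]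
  have m [simp]: "modification X X (mod_hcomp X X (ident (ps_hom Y X) e') (mod_hcomp X Y v (ident (ps_hom X Y) e)))"
    "modification Z Z (mod_hcomp Z Z (ident (ps_hom Y Z) d) (mod_hcomp Z Y c (ident (ps_hom Z Y) d')))"
    using mod_hcomp_md[OF mod_hcomp_md[OF md_ident[OF A(1)] B(3)] md_ident[OF A(2)]]
      mod_hcomp_md[OF mod_hcomp_md[OF md_ident[OF B(2)] A(4)] md_ident[OF B(1)]] by simp_all
  have s: "ps_comp X X (ps_comp Z X e' d') (ps_comp X Z d e) = ps_comp X X e' (ps_comp X Y (ps_comp Y Y d' d) e)"
    using ps_comp_assoc[OF ps_comp_pn[OF A(1) B(1)] B(2) A(2)] ps_comp_assoc[OF A(1) B(1) B(2)] by simp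
  have t: "ps_comp Z Z (ps_comp X Z d e) (ps_comp Z X e' d') = ps_comp Z Z d (ps_comp Z Y (ps_comp Y Y e e') d')"
    using ps_comp_assoc[OF ps_comp_pn[OF B(2) A(2)] A(1) B(1)] ps_comp_assoc[OF B(2) A(2) A(1)] by simp
  show w: "mcomp w n x = cmp (lev X n) (mcomp u n x) (far (pfun e' n) (mcomp v n (fob (pfun e n) x)))"
    if "x \<in> obj (lev X n)" for n x
    using that by (simp add: w_def)
  show j: "mcomp j n z = cmp (lev Z n) (far (pfun d n) (mcomp c n (fob (pfun d' n) z))) (mcomp k n z)"
    if "z \<in> obj (lev Z n)" for n z
    using that by (simp add: j_def)
  have "modification X X w" "msrc w = ps_comp X X (ps_comp Z X e' d') (ps_comp X Z d e)" "mtgt w = ps_id X"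
    by (simp_all add: w_def s)
  moreover have "modification Z Z j" "msrc j = ps_id Z" "mtgt j = ps_comp Z Z (ps_comp X Z d e) (ps_comp Z X e' d')"
    by (simp_all add: j_def t)
  \<comment> \<open>This is the first triangle identity of the composite with the one for
    \<open>e\<close> already inserted. What remains is the square of \<open>c\<close> at the
    component of \<open>v\<close>, carried along \<open>d\<close>, together with the triangle
    identity for \<open>d\<close>.\<close>
  moreover have "cmp (lev Z n) (iinv (lev Z n) (far (pfun d n) (mcomp c n (fob (pfun e n) x)))) (far (pfun d n) (far (pfun e n) (far (pfun e' n) (mcomp v n (fob (pfun e n) x))))) =
     cmp (lev Z n) (iinv (lev Z n) (mcomp k n (fob (pfun d n) (fob (pfun e n) x)))) (iinv (lev Z n) (far (pfun d n) (mcomp c n (fob (pfun d' n) (fob (pfun d n) (fob (pfun e n) x))))))" 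
    if [simp]: "x \<in> obj (lev X n)" for n x
  proof (rule iso_right_cancel[of "lev Z n" "far (pfun d n) (mcomp c n (fob (pfun d' n) (fob (pfun d n) (fob (pfun e n) x))))"])
    have "cmp (lev Y n) (far (pfun e n) (far (pfun e' n) (mcomp v n (fob (pfun e n) x)))) (mcomp c n (fob (pfun d' n) (fob (pfun d n) (fob (pfun e n) x)))) =
      cmp (lev Y n) (mcomp c n (fob (pfun e n) x)) (mcomp v n (fob (pfun e n) x))"
      by (subst adj_equiv_nat(2)[OF a]) simp_all
    from arg_cong[OF this, of "far (pfun d n)"]
    show "cmp (lev Z n) (cmp (lev Z n) (iinv (lev Z n) (far (pfun d n) (mcomp c n (fob (pfun e n) x))))
         (far (pfun d n) (far (pfun e n) (far (pfun e' n) (mcomp v n (fob (pfun e n) x))))))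
        (far (pfun d n) (mcomp c n (fob (pfun d' n) (fob (pfun d n) (fob (pfun e n) x))))) =
      cmp (lev Z n) (cmp (lev Z n) (iinv (lev Z n) (mcomp k n (fob (pfun d n) (fob (pfun e n) x))))
         (iinv (lev Z n) (far (pfun d n) (mcomp c n (fob (pfun d' n) (fob (pfun d n) (fob (pfun e n) x)))))))
        (far (pfun d n) (mcomp c n (fob (pfun d' n) (fob (pfun d n) (fob (pfun e n) x)))))"
      by (simp add: B(11))
  qed simp_all
  \<comment> \<open>For the second triangle identity the roles change: the square of
    \<open>v\<close> at the component of \<open>c\<close> is carried along
    \<open>e'\<close>.\<close>
  moreover have "cmp (lev X n) (mcomp u n (fob (pfun e' n) (fob (pfun d' n) z))) (far (pfun e' n) (mcomp v n (fob (pfun e n) (fob (pfun e' n) (fob (pfun d' n) z))))) =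
    cmp (lev X n) (iinv (lev X n) (far (pfun e' n) (far (pfun d' n) (mcomp k n z)))) (iinv (lev X n) (far (pfun e' n) (far (pfun d' n) (far (pfun d n) (mcomp c n (fob (pfun d' n) z))))))"
    if [simp]: "z \<in> obj (lev Z n)" for n z
  proof -
    let ?y = "fob (pfun d' n) z"
    have "cmp (lev Y n) (mcomp c n ?y) (mcomp v n ?y) =
      cmp (lev Y n) (mcomp v n (fob (pfun e n) (fob (pfun e' n) ?y))) (far (pfun d' n) (far (pfun d n) (mcomp c n ?y)))"
      by (subst adj_equiv_nat(1)[OF b]) simp_all
    from arg_cong[OF this, of "far (pfun e' n)"]
    have *: "cmp (lev X n) (far (pfun e' n) (mcomp c n ?y)) (far (pfun e' n) (mcomp v n ?y)) =
      cmp (lev X n) (far (pfun e' n) (mcomp v n (fob (pfun e n) (fob (pfun e' n) ?y)))) (far (pfun e' n) (far (pfun d' n) (far (pfun d n) (mcomp c n ?y))))"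
      by simp
    show ?thesis
      by (rule iso_right_cancel[of "lev X n" "far (pfun e' n) (far (pfun d' n) (far (pfun d n) (mcomp c n ?y)))"])
        (simp_all add: *[symmetric] A(12) B(12))
  qed
  ultimately show "adj_equiv X Z (ps_comp X Z d e) (ps_comp Z X e' d') w j"
    unfolding adj_equiv_def by (simp add: ps_comp_pn[OF A(1) B(1)] ps_comp_pn[OF B(2) A(2)] w j A(11))
qed

lemma adj_equiv_equivalence_1cell:
  assumes a: "adj_equiv (N x) (N y) e e' u c"
  shows "equivalence_1cell (ps_twocat S N) x y e" "equivalence_1cell (ps_twocat S N) y x e'"
proof -
  have *: "equivalence_1cell (ps_twocat S N) x y e" if a: "adj_equiv (N x) (N y) e e' u c" for x y e e' u c
  proof -
    note d = adj_equivD[OF a]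
    have i: "iso_arr (ps_hom (N x) (N x)) u" "iso_arr (ps_hom (N y) (N y)) c"
      by (rule iso_md; simp add: d)+
    show ?thesis
      unfolding equivalence_1cell_def
    proof (intro conjI bexI[of _ e'])
      show "\<exists>\<eta>\<in>hom (Hom (ps_twocat S N) x x) (One (ps_twocat S N) x) (hc1 (ps_twocat S N) x y x e' e).
          iso_arr (Hom (ps_twocat S N) x x) \<eta>"
        by (rule bexI[of _ "iinv (ps_hom (N x) (N x)) u"]) (simp_all add: d in_hom iinv_md[OF i(1)] i)
      show "\<exists>\<epsilon>\<in>hom (Hom (ps_twocat S N) y y) (hc1 (ps_twocat S N) y x y e e') (One (ps_twocat S N) y).
          iso_arr (Hom (ps_twocat S N) y y) \<epsilon>"
        by (rule bexI[of _ "iinv (ps_hom (N y) (N y)) c"]) (simp_all add: d in_hom iinv_md[OF i(2)] i)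
    qed (simp_all add: d)
  qed
  show "equivalence_1cell (ps_twocat S N) x y e" "equivalence_1cell (ps_twocat S N) y x e'"
    using *[OF a] *[OF adj_equiv_sym[OF a]] by auto
qed

text \<open>Conjugation \<open>f \<mapsto> e\<^sub>y f e'\<^sub>x\<close> with structure cells \<open>e\<^sub>z g u\<^sub>y f e'\<^sub>x\<close> and \<open>c\<^sub>x\<close>; its unit laws are the triangle
  identities.  The two simplicial families may have different types of objects and arrows.\<close>

locale equiv_family =
  fixes S :: "'x set" and N :: "'x \<Rightarrow> ('o, 'a) scat" and T :: "'y set" and M :: "'y \<Rightarrow> ('p, 'b) scat"
    and P :: "'x \<Rightarrow> 'y" and e e' u c
  assumes cod_simplicial: "y \<in> T \<Longrightarrow> simplicial_cat (M y)"
    and P_closed [simp]: "x \<in> S \<Longrightarrow> P x \<in> T"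
    and adj: "x \<in> S \<Longrightarrow> adj_equiv (N x) (M (P x)) (e x) (e' x) (u x) (c x)"
begin

definition conj1 :: "'x \<Rightarrow> 'x \<Rightarrow> ('o, 'a, 'o, 'a) pnat \<Rightarrow> ('p, 'b, 'p, 'b) pnat" where
  "conj1 x y f = ps_comp (M (P x)) (M (P y)) (e y) (ps_comp (M (P x)) (N y) f (e' x))"

definition conj2 :: "'x \<Rightarrow> 'x \<Rightarrow> ('o, 'a, 'o, 'a) modif \<Rightarrow> ('p, 'b, 'p, 'b) modif" where
  "conj2 x y \<alpha> = mod_hcomp (M (P x)) (M (P y)) (ident (ps_hom (N y) (M (P y))) (e y))
     (mod_hcomp (M (P x)) (N y) \<alpha> (ident (ps_hom (M (P x)) (N x)) (e' x)))"

definition conj_mult :: "'x \<Rightarrow> 'x \<Rightarrow> 'x \<Rightarrow> ('o, 'a, 'o, 'a) pnat \<Rightarrow> ('o, 'a, 'o, 'a) pnat \<Rightarrow> ('p, 'b, 'p, 'b) modif" where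
  "conj_mult x y z g f = mod_hcomp (M (P x)) (M (P z))
     (ident (ps_hom (N y) (M (P z))) (ps_comp (N y) (M (P z)) (e z) g))
     (mod_hcomp (M (P x)) (N y) (u y) (ident (ps_hom (M (P x)) (N y)) (ps_comp (M (P x)) (N y) f (e' x))))"

text \<open>A predicate that constrains the data only on \<open>S\<close>, instead of one fixed
  record: identity pseudo-functors and composites are given by formulas of their own and must
  qualify as well.\<close>

definition is_conj :: "('x, ('o, 'a, 'o, 'a) pnat, ('o, 'a, 'o, 'a) modif, 'y, ('p, 'b, 'p, 'b) pnat, ('p, 'b, 'p, 'b) modif) psfun \<Rightarrow> bool" where
  "is_conj H \<longleftrightarrow> (\<forall>x \<in> S. ps_ob H x = P x) \<and>
     (\<forall>x \<in> S. \<forall>y \<in> S. ps_map H x y = functor_on (ps_hom (N x) (N y)) (conj1 x y) (conj2 x y)) \<and>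
     (\<forall>x \<in> S. \<forall>y \<in> S. \<forall>z \<in> S. ps_mult H x y z =
        (\<lambda>(g, f)\<in>obj (prod_cat (ps_hom (N y) (N z)) (ps_hom (N x) (N y))). conj_mult x y z g f)) \<and>
     (\<forall>x \<in> S. ps_unit H x = c x)"

lemma adj_rules [simp]:
  assumes "x \<in> S"
  shows "pseudonatural (N x) (M (P x)) (e x)" "pseudonatural (M (P x)) (N x) (e' x)"
    "modification (N x) (N x) (u x)" "modification (M (P x)) (M (P x)) (c x)"
    "msrc (u x) = ps_comp (N x) (N x) (e' x) (e x)" "mtgt (u x) = ps_id (N x)"
    "msrc (c x) = ps_id (M (P x))" "mtgt (c x) = ps_comp (M (P x)) (M (P x)) (e x) (e' x)"
    "a \<in> obj (lev (N x) n) \<Longrightarrow> iso_arr (lev (N x) n) (mcomp (u x) n a)"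
    "b \<in> obj (lev (M (P x)) n) \<Longrightarrow> iso_arr (lev (M (P x)) n) (mcomp (c x) n b)"
    "a \<in> obj (lev (N x) n) \<Longrightarrow> far (pfun (e x) n) (mcomp (u x) n a) =
      iinv (lev (M (P x)) n) (mcomp (c x) n (fob (pfun (e x) n) a))"
    "b \<in> obj (lev (M (P x)) n) \<Longrightarrow> mcomp (u x) n (fob (pfun (e' x) n) b) =
      iinv (lev (N x) n) (far (pfun (e' x) n) (mcomp (c x) n b))"
  by (rule adj_equivD[OF adj[OF assms]]; assumption?)+

lemmas e_rules [simp] = pn_rules[OF adj_rules(1)] and e'_rules [simp] = pn_rules[OF adj_rules(2)]
  and u_rules [simp] = adj_equiv_md[OF adj]

lemma conj1_pn [simp]:
  assumes [simp]: "x \<in> S" "y \<in> S" and f: "pseudonatural (N x) (N y) f"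
  shows "pseudonatural (M (P x)) (M (P y)) (conj1 x y f)"
  unfolding conj1_def by (rule ps_comp_pn[OF ps_comp_pn[OF _ f]]; simp)

lemma conj1_simps [simp]:
  "a \<in> obj (lev (M (P x)) n) \<Longrightarrow> x \<in> S \<Longrightarrow> fob (pfun (conj1 x y f) n) a = fob (pfun (e y) n) (fob (pfun f n) (fob (pfun (e' x) n) a))"
  "k \<in> arr (lev (M (P x)) n) \<Longrightarrow> x \<in> S \<Longrightarrow> far (pfun (conj1 x y f) n) k = far (pfun (e y) n) (far (pfun f n) (far (pfun (e' x) n) k))"
  by (simp_all add: conj1_def)

lemma conj2_md [simp]:
  assumes [simp]: "x \<in> S" "y \<in> S" and \<alpha>: "modification (N x) (N y) \<alpha>"
  shows "modification (M (P x)) (M (P y)) (conj2 x y \<alpha>)"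
    "msrc (conj2 x y \<alpha>) = conj1 x y (msrc \<alpha>)" "mtgt (conj2 x y \<alpha>) = conj1 x y (mtgt \<alpha>)"
  unfolding conj2_def by (rule mod_hcomp_md[OF mod_hcomp_md[OF _ \<alpha>]]; simp) (simp_all add: conj1_def)

lemma conj2_comp [simp]:
  assumes [simp]: "x \<in> S" "y \<in> S" and \<alpha>: "modification (N x) (N y) \<alpha>" and [simp]: "a \<in> obj (lev (M (P x)) n)"
  shows "mcomp (conj2 x y \<alpha>) n a = far (pfun (e y) n) (mcomp \<alpha> n (fob (pfun (e' x) n) a))"
proof -
  note [simp] = md_rules[OF \<alpha>] pn_rules[OF md_pn(1)[OF \<alpha>]] pn_rules[OF md_pn(2)[OF \<alpha>]]
  show ?thesis
    by (simp add: conj2_def)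
qed

text \<open>The bracketing in \<open>conj_mult\<close> is not that of \<open>conj1\<close>, so
  source and target are identified value by value.\<close>

lemma conj_mult_md [simp]:
  assumes [simp]: "x \<in> S" "y \<in> S" "z \<in> S" and f: "pseudonatural (N x) (N y) f" and g: "pseudonatural (N y) (N z) g"
  shows "modification (M (P x)) (M (P z)) (conj_mult x y z g f)" (is ?A)
    "msrc (conj_mult x y z g f) = ps_comp (M (P x)) (M (P z)) (conj1 y z g) (conj1 x y f)" (is ?B)
    "mtgt (conj_mult x y z g f) = conj1 x z (ps_comp (N x) (N z) g f)" (is ?C)
    "a \<in> obj (lev (M (P x)) n) \<Longrightarrow> mcomp (conj_mult x y z g f) n a =
       far (pfun (e z) n) (far (pfun g n) (mcomp (u y) n (fob (pfun f n) (fob (pfun (e' x) n) a))))"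
proof -
  note [simp] = f g pn_rules[OF f] pn_rules[OF g]
  note p = ps_comp_pn[OF adj_rules(2) f] ps_comp_pn[OF g adj_rules(1)]
  have [simp]: "pseudonatural (M (P x)) (N y) (ps_comp (M (P x)) (N y) f (e' x))"
    "pseudonatural (N y) (M (P z)) (ps_comp (N y) (M (P z)) (e z) g)"
    by (rule p; simp)+
  show ?A
    unfolding conj_mult_def by (rule mod_hcomp_md[OF mod_hcomp_md[of _ "N y"]]) simp_all
  from md_pn[OF this] have q: "pseudonatural (M (P x)) (M (P z)) (msrc (conj_mult x y z g f))"
    "pseudonatural (M (P x)) (M (P z)) (mtgt (conj_mult x y z g f))" .
  show ?B
    by (rule pnat_eqI[OF q(1) ps_comp_pn[of _ "M (P y)"]]) (simp_all add: conj_mult_def, simp add: conj1_def)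
  show ?C
    by (rule pnat_eqI[OF q(2) conj1_pn]) (simp_all add: conj_mult_def ps_comp_pn[OF f g], simp add: conj1_def)
  show "a \<in> obj (lev (M (P x)) n) \<Longrightarrow> mcomp (conj_mult x y z g f) n a =
       far (pfun (e z) n) (far (pfun g n) (mcomp (u y) n (fob (pfun f n) (fob (pfun (e' x) n) a))))"
    by (simp add: conj_mult_def)
qed

lemma conj_functor:
  assumes [simp]: "x \<in> S" "y \<in> S"
  shows "is_functor (ps_hom (N x) (N y)) (ps_hom (M (P x)) (M (P y))) (functor_on (ps_hom (N x) (N y)) (conj1 x y) (conj2 x y))"
proof (rule functor_functor_on)
  fix f assume f: "f \<in> obj (ps_hom (N x) (N y))"
  then show "conj1 x y f \<in> obj (ps_hom (M (P x)) (M (P y)))"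
    by simp
  show "conj2 x y (ident (ps_hom (N x) (N y)) f) = ident (ps_hom (M (P x)) (M (P y))) (conj1 x y f)"
    by (rule md_eqI[of "M (P x)" "M (P y)"]) (use f pn_rules[of "N x" "N y" f] in simp_all)
next
  fix f g
  assume a: "f \<in> arr (ps_hom (N x) (N y))" "g \<in> arr (ps_hom (N x) (N y))" "src (ps_hom (N x) (N y)) g = tgt (ps_hom (N x) (N y)) f"
  then have f: "modification (N x) (N y) f" and g: "modification (N x) (N y) g" and [simp]: "msrc g = mtgt f"
    by simp_all
  note [simp] = f g md_rules[OF f] md_rules[OF g]
  show "conj2 x y (cmp (ps_hom (N x) (N y)) g f) = cmp (ps_hom (M (P x)) (M (P y))) (conj2 x y g) (conj2 x y f)"
    by (rule md_eqI[of "M (P x)" "M (P y)"]) simp_all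
qed (auto dest: md_pn)

end

lemma is_functor_prod:
  assumes F: "is_functor C C' F" and G: "is_functor D D' G"
  shows "is_functor (prod_cat C D) (prod_cat C' D') (prod_functor C D F G)"
proof -
  have [simp]: "category C" "category D" "category C'" "category D'"
    using F G by (simp_all add: is_functor_def)
  show ?thesis
    unfolding prod_functor_def
    by (rule functor_functor_on) (auto simp: functor_rules[OF F] functor_rules[OF G])
qed

lemma prod_functor_simps [simp]:
  "x \<in> obj C \<Longrightarrow> y \<in> obj D \<Longrightarrow> fob (prod_functor C D F G) (x, y) = (fob F x, fob G y)"
  "f \<in> arr C \<Longrightarrow> g \<in> arr D \<Longrightarrow> far (prod_functor C D F G) (f, g) = (far F f, far G g)"
  by (simp_all add: prod_functor_def)

context equiv_family
begin

lemma u_nat: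
  "x \<in> S \<Longrightarrow> k \<in> arr (lev (N x) n) \<Longrightarrow> a = src (lev (N x) n) k \<Longrightarrow> cmp (lev (N x) n) k (mcomp (u x) n a) =
      cmp (lev (N x) n) (mcomp (u x) n (tgt (lev (N x) n) k)) (far (pfun (e' x) n) (far (pfun (e x) n) k))"
  by (rule adj_equiv_nat(1)[OF adj])

text \<open>Two squares are pasted: \<open>u y\<close> is natural at the components of
  \<open>\<alpha>\<close>, and \<open>\<beta>\<close> is natural at the components of
  \<open>u y\<close>. Everything is then carried along \<open>e z\<close>.\<close>

lemma conj_mult_nat:
  assumes [simp]: "x \<in> S" "y \<in> S" "z \<in> S" and \<alpha>: "modification (N x) (N y) \<alpha>" and \<beta>: "modification (N y) (N z) \<beta>"
  shows "cmp (ps_hom (M (P x)) (M (P z))) (conj2 x z (mod_hcomp (N x) (N z) \<beta> \<alpha>)) (conj_mult x y z (msrc \<beta>) (msrc \<alpha>)) =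
    cmp (ps_hom (M (P x)) (M (P z))) (conj_mult x y z (mtgt \<beta>) (mtgt \<alpha>)) (mod_hcomp (M (P x)) (M (P z)) (conj2 y z \<beta>) (conj2 x y \<alpha>))"
proof -
  note p = md_pn[OF \<alpha>] md_pn[OF \<beta>]
  note h = mod_hcomp_md[OF \<alpha> \<beta>]
  note h2 = mod_hcomp_md[OF conj2_md(1)[OF _ _ \<alpha>] conj2_md(1)[OF _ _ \<beta>]]
  note [simp] = \<alpha> \<beta> p md_rules[OF \<alpha>] md_rules[OF \<beta>] pn_rules[OF p(1)] pn_rules[OF p(2)] pn_rules[OF p(3)] pn_rules[OF p(4)] h h2
  have *: "cmp (lev (N z) n) (far (pfun (msrc \<beta>) n) (mcomp \<alpha> n b)) (far (pfun (msrc \<beta>) n) (mcomp (u y) n (fob (pfun (msrc \<alpha>) n) b))) =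
    cmp (lev (N z) n) (far (pfun (msrc \<beta>) n) (mcomp (u y) n (fob (pfun (mtgt \<alpha>) n) b)))
      (far (pfun (msrc \<beta>) n) (far (pfun (e' y) n) (far (pfun (e y) n) (mcomp \<alpha> n b))))"
    if "b \<in> obj (lev (N x) n)" for n b
    using arg_cong[OF u_nat[of y "mcomp \<alpha> n b" n "fob (pfun (msrc \<alpha>) n) b"], of "far (pfun (msrc \<beta>) n)"] that by simp
  have **: "cmp (lev (N z) n) (mcomp \<beta> n (fob (pfun (mtgt \<alpha>) n) b)) (far (pfun (msrc \<beta>) n) (mcomp (u y) n (fob (pfun (mtgt \<alpha>) n) b))) =
    cmp (lev (N z) n) (far (pfun (mtgt \<beta>) n) (mcomp (u y) n (fob (pfun (mtgt \<alpha>) n) b))) (mcomp \<beta> n (fob (pfun (e' y) n) (fob (pfun (e y) n) (fob (pfun (mtgt \<alpha>) n) b))))"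
    if "b \<in> obj (lev (N x) n)" for n b
    by (subst md_nat[OF \<beta>]) (use that in simp_all)
  have ***: "cmp (lev (N z) n) (mcomp \<beta> n (fob (pfun (mtgt \<alpha>) n) b))
       (cmp (lev (N z) n) (far (pfun (msrc \<beta>) n) (mcomp \<alpha> n b)) (far (pfun (msrc \<beta>) n) (mcomp (u y) n (fob (pfun (msrc \<alpha>) n) b)))) =
    cmp (lev (N z) n) (far (pfun (mtgt \<beta>) n) (mcomp (u y) n (fob (pfun (mtgt \<alpha>) n) b)))
       (cmp (lev (N z) n) (mcomp \<beta> n (fob (pfun (e' y) n) (fob (pfun (e y) n) (fob (pfun (mtgt \<alpha>) n) b))))
         (far (pfun (msrc \<beta>) n) (far (pfun (e' y) n) (far (pfun (e y) n) (mcomp \<alpha> n b)))))"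
    if [simp]: "b \<in> obj (lev (N x) n)" for n b
    unfolding *[OF that] by (rule reassoc; (rule **)?) simp_all
  show ?thesis
  proof (rule md_eqI[of "M (P x)" "M (P z)"])
    fix n a
    assume [simp]: "a \<in> obj (lev (M (P x)) n)"
    show "mcomp (cmp (ps_hom (M (P x)) (M (P z))) (conj2 x z (mod_hcomp (N x) (N z) \<beta> \<alpha>)) (conj_mult x y z (msrc \<beta>) (msrc \<alpha>))) n a =
      mcomp (cmp (ps_hom (M (P x)) (M (P z))) (conj_mult x y z (mtgt \<beta>) (mtgt \<alpha>)) (mod_hcomp (M (P x)) (M (P z)) (conj2 y z \<beta>) (conj2 x y \<alpha>))) n a"
      using arg_cong[OF ***[of "fob (pfun (e' x) n) a" n], of "far (pfun (e z) n)"]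
      by (simp del: adj_rules(11,12))
  qed simp_all
qed

text \<open>Both sides cancel one pair \<open>e' e\<close> at \<open>x\<close> by \<open>u x\<close>
  and one at \<open>y\<close> by \<open>u y\<close>, in opposite orders. The orders agree because
  \<open>u y\<close> is natural at the image of \<open>u x\<close> under \<open>g\<close>.\<close>

lemma conj_mult_assoc:
  assumes [simp]: "w \<in> S" "x \<in> S" "y \<in> S" "z \<in> S"
    and f: "pseudonatural (N w) (N x) f" and g: "pseudonatural (N x) (N y) g" and h: "pseudonatural (N y) (N z) h"
  shows "cmp (ps_hom (M (P w)) (M (P z))) (conj_mult w y z h (ps_comp (N w) (N y) g f))
      (mod_hcomp (M (P w)) (M (P z)) (ident (ps_hom (M (P y)) (M (P z))) (conj1 y z h)) (conj_mult w x y g f)) =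
    cmp (ps_hom (M (P w)) (M (P z))) (conj_mult w x z (ps_comp (N x) (N z) h g) f)
      (mod_hcomp (M (P w)) (M (P z)) (conj_mult x y z h g) (ident (ps_hom (M (P w)) (M (P x))) (conj1 w x f)))"
proof -
  note c = ps_comp_pn[OF f g] ps_comp_pn[OF g h]
  note [simp] = f g h c pn_rules[OF f] pn_rules[OF g] pn_rules[OF h] ps_comp_assoc[OF f g h]
  have [simp]: "modification (M (P w)) (M (P z)) (mod_hcomp (M (P w)) (M (P z)) (ident (ps_hom (M (P y)) (M (P z))) (conj1 y z h)) (conj_mult w x y g f))"
    by (rule mod_hcomp_md[of _ "M (P y)"]) simp_all
  have [simp]: "modification (M (P w)) (M (P z)) (mod_hcomp (M (P w)) (M (P z)) (conj_mult x y z h g) (ident (ps_hom (M (P w)) (M (P x))) (conj1 w x f)))"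
    by (rule mod_hcomp_md[of _ "M (P x)"]) simp_all
  note q = conj1_pn[of w x f] conj1_pn[of x y g] conj1_pn[of y z h]
  have [simp]: "ps_comp (M (P w)) (M (P z)) (conj1 y z h) (ps_comp (M (P w)) (M (P y)) (conj1 x y g) (conj1 w x f)) =
     ps_comp (M (P w)) (M (P z)) (ps_comp (M (P x)) (M (P z)) (conj1 y z h) (conj1 x y g)) (conj1 w x f)"
    by (rule ps_comp_assoc[OF q]) simp_all
  show ?thesis
  proof (rule md_eqI[of "M (P w)" "M (P z)"])
    fix n a
    assume [simp]: "a \<in> obj (lev (M (P w)) n)"
    define b where "b = fob (pfun f n) (fob (pfun (e' w) n) a)"
    have [simp]: "b \<in> obj (lev (N x) n)"
      by (simp add: b_def)
    let ?k = "far (pfun g n) (mcomp (u x) n b)"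
    have "cmp (lev (N y) n) ?k (mcomp (u y) n (fob (pfun g n) (fob (pfun (e' x) n) (fob (pfun (e x) n) b)))) =
      cmp (lev (N y) n) (mcomp (u y) n (fob (pfun g n) b)) (far (pfun (e' y) n) (far (pfun (e y) n) ?k))"
      by (subst u_nat) simp_all
    from arg_cong[OF this, of "\<lambda>k. far (pfun (e z) n) (far (pfun h n) k)"]
    show "mcomp (cmp (ps_hom (M (P w)) (M (P z))) (conj_mult w y z h (ps_comp (N w) (N y) g f))
      (mod_hcomp (M (P w)) (M (P z)) (ident (ps_hom (M (P y)) (M (P z))) (conj1 y z h)) (conj_mult w x y g f))) n a =
      mcomp (cmp (ps_hom (M (P w)) (M (P z))) (conj_mult w x z (ps_comp (N x) (N z) h g) f)
      (mod_hcomp (M (P w)) (M (P z)) (conj_mult x y z h g) (ident (ps_hom (M (P w)) (M (P x))) (conj1 w x f)))) n a"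
      by (simp add: b_def del: adj_rules(11,12))
  qed simp_all
qed

text \<open>Here \<open>u x\<close> is evaluated at values of \<open>e' x\<close>, where the second
  triangle identity makes it inverse to the image of \<open>c x\<close> under
  \<open>e' x\<close>.\<close>

lemma conj_mult_unit_right:
  assumes [simp]: "x \<in> S" "y \<in> S" and f: "pseudonatural (N x) (N y) f"
  shows "cmp (ps_hom (M (P x)) (M (P y))) (conj_mult x x y f (ps_id (N x)))
      (mod_hcomp (M (P x)) (M (P y)) (ident (ps_hom (M (P x)) (M (P y))) (conj1 x y f)) (c x)) =
    ident (ps_hom (M (P x)) (M (P y))) (conj1 x y f)"
proof -
  note [simp] = f pn_rules[OF f]
  have [simp]: "conj1 x x (ps_id (N x)) = ps_comp (M (P x)) (M (P x)) (e x) (e' x)"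
    by (simp add: conj1_def)
  have [simp]: "modification (M (P x)) (M (P y)) (mod_hcomp (M (P x)) (M (P y)) (ident (ps_hom (M (P x)) (M (P y))) (conj1 x y f)) (c x))"
    by (rule mod_hcomp_md[of _ "M (P x)"]) simp_all
  show ?thesis
    by (rule md_eqI[of "M (P x)" "M (P y)"]) simp_all
qed

text \<open>Here the component is an image of \<open>u y\<close> under \<open>e y\<close>, which the
  first triangle identity makes inverse to \<open>c y\<close>.\<close>

lemma conj_mult_unit_left:
  assumes [simp]: "x \<in> S" "y \<in> S" and f: "pseudonatural (N x) (N y) f"
  shows "cmp (ps_hom (M (P x)) (M (P y))) (conj_mult x y y (ps_id (N y)) f)
      (mod_hcomp (M (P x)) (M (P y)) (c y) (ident (ps_hom (M (P x)) (M (P y))) (conj1 x y f))) =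
    ident (ps_hom (M (P x)) (M (P y))) (conj1 x y f)"
proof -
  note [simp] = f pn_rules[OF f]
  have [simp]: "conj1 y y (ps_id (N y)) = ps_comp (M (P y)) (M (P y)) (e y) (e' y)"
    by (simp add: conj1_def)
  have [simp]: "modification (M (P x)) (M (P y)) (mod_hcomp (M (P x)) (M (P y)) (c y) (ident (ps_hom (M (P x)) (M (P y))) (conj1 x y f)))"
    by (rule mod_hcomp_md[of _ "M (P y)"]) simp_all
  show ?thesis
    by (rule md_eqI[of "M (P x)" "M (P y)"]) simp_all
qed

lemma is_conjD:
  assumes "is_conj H" "x \<in> S"
  shows "ps_ob H x = P x" "ps_unit H x = c x"
    "y \<in> S \<Longrightarrow> ps_map H x y = functor_on (ps_hom (N x) (N y)) (conj1 x y) (conj2 x y)"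
    "y \<in> S \<Longrightarrow> z \<in> S \<Longrightarrow> ps_mult H x y z =
        (\<lambda>(g, f)\<in>obj (prod_cat (ps_hom (N y) (N z)) (ps_hom (N x) (N y))). conj_mult x y z g f)"
  using assms by (simp_all add: is_conj_def)

text \<open>Invertibility of the structure cells is inherited componentwise from \<open>u\<close>
  and \<open>c\<close>; their coherence laws are the preceding four lemmas.\<close>

lemma conj_pseudofunctor:
  assumes H: "is_conj H"
  shows "pseudofunctor (ps_twocat S N) (ps_twocat T M) H"
proof (rule pseudofunctor.intro; (unfold ps_twocat_simps)?)
  note [simp] = is_conjD[OF H]
  show "two_category (ps_twocat S N)" "two_category (ps_twocat T M)"
    using adj[THEN adj_equivD(1), THEN pn_rules(1)] cod_simplicial by (auto intro!: two_category_ps_twocat)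
  fix x assume [simp]: "x \<in> S"
  show "ps_ob H x \<in> T"
    by simp
  show "ps_unit H x \<in> hom (ps_hom (M (ps_ob H x)) (M (ps_ob H x))) (ps_id (M (ps_ob H x))) (fob (ps_map H x x) (ps_id (N x)))"
    by (simp add: in_hom conj1_def)
  show "iso_arr (ps_hom (M (ps_ob H x)) (M (ps_ob H x))) (ps_unit H x)"
    by (simp add: iso_md)
  fix y assume [simp]: "y \<in> S"
  show "is_functor (ps_hom (N x) (N y)) (ps_hom (M (ps_ob H x)) (M (ps_ob H y))) (ps_map H x y)"
    by (simp add: conj_functor)
  {
    fix f assume "f \<in> obj (ps_hom (N x) (N y))"
    then have [simp]: "pseudonatural (N x) (N y) f"
      by simp
    show "cmp (ps_hom (M (ps_ob H x)) (M (ps_ob H y))) (ps_mult H x x y (f, ps_id (N x)))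
            (hc2 (ps_twocat T M) (ps_ob H x) (ps_ob H x) (ps_ob H y) (ident (ps_hom (M (ps_ob H x)) (M (ps_ob H y))) (fob (ps_map H x y) f)) (ps_unit H x)) =
           ident (ps_hom (M (ps_ob H x)) (M (ps_ob H y))) (fob (ps_map H x y) f)"
      by (simp add: conj_mult_unit_right)
    show "cmp (ps_hom (M (ps_ob H x)) (M (ps_ob H y))) (ps_mult H x y y (ps_id (N y), f))
            (hc2 (ps_twocat T M) (ps_ob H x) (ps_ob H y) (ps_ob H y) (ps_unit H y) (ident (ps_hom (M (ps_ob H x)) (M (ps_ob H y))) (fob (ps_map H x y) f))) =
           ident (ps_hom (M (ps_ob H x)) (M (ps_ob H y))) (fob (ps_map H x y) f)"
      by (simp add: conj_mult_unit_left)
  }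
  fix z assume [simp]: "z \<in> S"
  show "nat_iso (prod_cat (ps_hom (N y) (N z)) (ps_hom (N x) (N y))) (ps_hom (M (ps_ob H x)) (M (ps_ob H z)))
        (comp_functor (prod_cat (ps_hom (N y) (N z)) (ps_hom (N x) (N y)))
          (HComp (ps_twocat T M) (ps_ob H x) (ps_ob H y) (ps_ob H z))
          (prod_functor (ps_hom (N y) (N z)) (ps_hom (N x) (N y)) (ps_map H y z) (ps_map H x y)))
        (comp_functor (prod_cat (ps_hom (N y) (N z)) (ps_hom (N x) (N y))) (ps_map H x z) (HComp (ps_twocat S N) x y z))
        (ps_mult H x y z)"
  proof (rule nat_isoI)
    show "is_functor (prod_cat (ps_hom (N y) (N z)) (ps_hom (N x) (N y))) (ps_hom (M (ps_ob H x)) (M (ps_ob H z)))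
     (comp_functor (prod_cat (ps_hom (N y) (N z)) (ps_hom (N x) (N y)))
       (HComp (ps_twocat T M) (ps_ob H x) (ps_ob H y) (ps_ob H z))
       (prod_functor (ps_hom (N y) (N z)) (ps_hom (N x) (N y)) (ps_map H y z) (ps_map H x y)))"
      by (rule is_functor_comp[OF is_functor_prod HComp_ps_twocat_functor]) (simp_all add: conj_functor)
    show "is_functor (prod_cat (ps_hom (N y) (N z)) (ps_hom (N x) (N y))) (ps_hom (M (ps_ob H x)) (M (ps_ob H z)))
     (comp_functor (prod_cat (ps_hom (N y) (N z)) (ps_hom (N x) (N y))) (ps_map H x z) (HComp (ps_twocat S N) x y z))"
      by (rule is_functor_comp[OF HComp_ps_twocat_functor]) (simp add: conj_functor)
  next
    fix gf assume "gf \<in> obj (prod_cat (ps_hom (N y) (N z)) (ps_hom (N x) (N y)))"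
    then obtain g f where [simp]: "gf = (g, f)" and f: "pseudonatural (N x) (N y) f" and g: "pseudonatural (N y) (N z) g"
      by auto
    note [simp] = f g pn_rules[OF f] pn_rules[OF g] ps_comp_pn[OF f g] ps_comp_pn[OF conj1_pn[of x y f] conj1_pn[of y z g]]
    show "iso_arr (ps_hom (M (ps_ob H x)) (M (ps_ob H z))) (ps_mult H x y z gf) \<and>
       src (ps_hom (M (ps_ob H x)) (M (ps_ob H z))) (ps_mult H x y z gf) =
        fob (comp_functor (prod_cat (ps_hom (N y) (N z)) (ps_hom (N x) (N y)))
           (HComp (ps_twocat T M) (ps_ob H x) (ps_ob H y) (ps_ob H z))
           (prod_functor (ps_hom (N y) (N z)) (ps_hom (N x) (N y)) (ps_map H y z) (ps_map H x y))) gf \<and>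
       tgt (ps_hom (M (ps_ob H x)) (M (ps_ob H z))) (ps_mult H x y z gf) =
        fob (comp_functor (prod_cat (ps_hom (N y) (N z)) (ps_hom (N x) (N y))) (ps_map H x z) (HComp (ps_twocat S N) x y z)) gf"
      by (auto intro: iso_md)
  next
    fix ba assume "ba \<in> arr (prod_cat (ps_hom (N y) (N z)) (ps_hom (N x) (N y)))"
    then obtain \<beta> \<alpha> where [simp]: "ba = (\<beta>, \<alpha>)" and \<alpha>: "modification (N x) (N y) \<alpha>" and \<beta>: "modification (N y) (N z) \<beta>"
      by auto
    note [simp] = \<alpha> \<beta> md_pn[OF \<alpha>] md_pn[OF \<beta>] mod_hcomp_md[OF \<alpha> \<beta>]
    show "cmp (ps_hom (M (ps_ob H x)) (M (ps_ob H z)))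
        (far (comp_functor (prod_cat (ps_hom (N y) (N z)) (ps_hom (N x) (N y))) (ps_map H x z) (HComp (ps_twocat S N) x y z)) ba)
        (ps_mult H x y z (src (prod_cat (ps_hom (N y) (N z)) (ps_hom (N x) (N y))) ba)) =
       cmp (ps_hom (M (ps_ob H x)) (M (ps_ob H z)))
        (ps_mult H x y z (tgt (prod_cat (ps_hom (N y) (N z)) (ps_hom (N x) (N y))) ba))
        (far (comp_functor (prod_cat (ps_hom (N y) (N z)) (ps_hom (N x) (N y)))
           (HComp (ps_twocat T M) (ps_ob H x) (ps_ob H y) (ps_ob H z))
           (prod_functor (ps_hom (N y) (N z)) (ps_hom (N x) (N y)) (ps_map H y z) (ps_map H x y))) ba)"
      by (simp add: conj_mult_nat)
  next
    fix gf assume "gf \<notin> obj (prod_cat (ps_hom (N y) (N z)) (ps_hom (N x) (N y)))"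
    then show "ps_mult H x y z gf = undefined"
      by (simp add: restrict_def)
  qed
  fix w f g h
  assume [simp]: "w \<in> S"
  assume "f \<in> obj (ps_hom (N x) (N y))" "g \<in> obj (ps_hom (N y) (N z))" "h \<in> obj (ps_hom (N z) (N w))"
  then have f: "pseudonatural (N x) (N y) f" and g: "pseudonatural (N y) (N z) g" and h: "pseudonatural (N z) (N w) h"
    by simp_all
  note [simp] = f g h ps_comp_pn[OF f g] ps_comp_pn[OF g h]
  show "cmp (ps_hom (M (ps_ob H x)) (M (ps_ob H w))) (ps_mult H x z w (h, hc1 (ps_twocat S N) x y z g f))
       (hc2 (ps_twocat T M) (ps_ob H x) (ps_ob H z) (ps_ob H w) (ident (ps_hom (M (ps_ob H z)) (M (ps_ob H w))) (fob (ps_map H z w) h)) (ps_mult H x y z (g, f))) =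
      cmp (ps_hom (M (ps_ob H x)) (M (ps_ob H w))) (ps_mult H x y w (hc1 (ps_twocat S N) y z w h g, f))
       (hc2 (ps_twocat T M) (ps_ob H x) (ps_ob H y) (ps_ob H w) (ps_mult H y z w (h, g)) (ident (ps_hom (M (ps_ob H x)) (M (ps_ob H y))) (fob (ps_map H x y) f)))"
    by (simp add: conj_mult_assoc)
qed

end

section \<open>Comparison of a conjugation with the identity\<close>

lemma mod_whisker_cmp:
  assumes "modification Y Z b" "modification Y Z b'" "msrc b' = mtgt b" and f: "pseudonatural X Y f"
  shows "mod_hcomp X Z (cmp (ps_hom Y Z) b' b) (ident (ps_hom X Y) f) =
    cmp (ps_hom X Z) (mod_hcomp X Z b' (ident (ps_hom X Y) f)) (mod_hcomp X Z b (ident (ps_hom X Y) f))"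
  using mod_interchange[of X Y "ident (ps_hom X Y) f" "ident (ps_hom X Y) f" Z b b'] assms by simp

lemma mod_cmp_whisker:
  assumes "modification X Y a" "modification X Y a'" "msrc a' = mtgt a" and g: "pseudonatural Y Z g"
  shows "mod_hcomp X Z (ident (ps_hom Y Z) g) (cmp (ps_hom X Y) a' a) =
    cmp (ps_hom X Z) (mod_hcomp X Z (ident (ps_hom Y Z) g) a') (mod_hcomp X Z (ident (ps_hom Y Z) g) a)"
  using mod_interchange[of X Y a a' Z "ident (ps_hom Y Z) g" "ident (ps_hom Y Z) g"] assms by simp

context equiv_family
begin

lemma e_comp_pn [simp]:
  assumes [simp]: "x \<in> S" "y \<in> S" and f: "pseudonatural (N x) (N y) f"
  shows "pseudonatural (N x) (M (P y)) (ps_comp (N x) (M (P y)) (e y) f)"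
    "pseudonatural (N x) (M (P y)) (ps_comp (N x) (M (P y)) (conj1 x y f) (e x))"
    "pseudonatural (M (P x)) (N y) (ps_comp (M (P x)) (N y) f (e' x))"
    "pseudonatural (M (P x)) (N y) (ps_comp (M (P x)) (N y) (e' y) (conj1 x y f))"
  using ps_comp_pn[OF f, of "M (P y)" "e y"] ps_comp_pn[of "N x" "M (P x)" "e x" "M (P y)" "conj1 x y f"]
    ps_comp_pn[OF _ f, of "M (P x)" "e' x"] ps_comp_pn[of "M (P x)" "M (P y)" "conj1 x y f" "N y" "e' y"] f
  by simp_all

lemma e_comp_md [simp]:
  assumes [simp]: "x \<in> S" "y \<in> S" and f: "modification (N x) (N y) \<alpha>"
  shows "modification (N x) (M (P y)) (mod_hcomp (N x) (M (P y)) (ident (ps_hom (N y) (M (P y))) (e y)) \<alpha>)"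
    "modification (N x) (M (P y)) (mod_hcomp (N x) (M (P y)) (conj2 x y \<alpha>) (ident (ps_hom (N x) (M (P x))) (e x)))"
    "modification (M (P x)) (N y) (mod_hcomp (M (P x)) (N y) \<alpha> (ident (ps_hom (M (P x)) (N x)) (e' x)))"
    "modification (M (P x)) (N y) (mod_hcomp (M (P x)) (N y) (ident (ps_hom (M (P y)) (N y)) (e' y)) (conj2 x y \<alpha>))"
  using mod_hcomp_md[OF f, of "M (P y)" "ident (ps_hom (N y) (M (P y))) (e y)"]
    mod_hcomp_md[of "N x" "M (P x)" "ident (ps_hom (N x) (M (P x))) (e x)" "M (P y)" "conj2 x y \<alpha>"]
    mod_hcomp_md[OF _ f, of "M (P x)" "ident (ps_hom (M (P x)) (N x)) (e' x)"]
    mod_hcomp_md[of "M (P x)" "M (P y)" "conj2 x y \<alpha>" "N y" "ident (ps_hom (M (P y)) (N y)) (e' y)"] f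
  by simp_all

lemma conj2_cmp [simp]:
  assumes "x \<in> S" "y \<in> S" "modification (N x) (N y) f" "modification (N x) (N y) g" "msrc g = mtgt f"
  shows "conj2 x y (cmp (ps_hom (N x) (N y)) g f) = cmp (ps_hom (M (P x)) (M (P y))) (conj2 x y g) (conj2 x y f)"
  using fun_cmp[OF conj_functor[OF assms(1,2)], of f g] assms(3-5) by simp

lemma conj2_ident [simp]:
  assumes "x \<in> S" "y \<in> S" "pseudonatural (N x) (N y) f"
  shows "conj2 x y (ident (ps_hom (N x) (N y)) f) = ident (ps_hom (M (P x)) (M (P y))) (conj1 x y f)"
  using fun_ident[OF conj_functor[OF assms(1,2)], of f] assms(3) by simp

text \<open>Structure cell at \<open>f\<close> of the transformation with components
  \<open>e\<close> from the identity to a conjugation: in \<open>e_y f e'_x e_x\<close> the last two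
  factors are cancelled by \<open>u x\<close>.\<close>

definition cellA :: "'x \<Rightarrow> 'x \<Rightarrow> ('o, 'a, 'o, 'a) pnat \<Rightarrow> ('o, 'a, 'p, 'b) modif" where
  "cellA x y f = mod_hcomp (N x) (M (P y)) (ident (ps_hom (N x) (M (P y))) (ps_comp (N x) (M (P y)) (e y) f)) (u x)"

text \<open>Structure cell at \<open>f\<close> of the transformation with components
  \<open>e'\<close> in the other direction. It has to run from \<open>f e'_x\<close> to
  \<open>e'_y e_y f e'_x\<close>, against the direction of \<open>u y\<close>, whence the
  inverse.\<close>

definition cellB :: "'x \<Rightarrow> 'x \<Rightarrow> ('o, 'a, 'o, 'a) pnat \<Rightarrow> ('p, 'b, 'o, 'a) modif" where
  "cellB x y f = iinv (ps_hom (M (P x)) (N y))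
     (mod_hcomp (M (P x)) (N y) (u y) (ident (ps_hom (M (P x)) (N y)) (ps_comp (M (P x)) (N y) f (e' x))))"

lemma cellA_md [simp]:
  assumes [simp]: "x \<in> S" "y \<in> S" and f: "pseudonatural (N x) (N y) f"
  shows "modification (N x) (M (P y)) (cellA x y f)" (is ?A)
    "msrc (cellA x y f) = ps_comp (N x) (M (P y)) (conj1 x y f) (e x)" (is ?B)
    "mtgt (cellA x y f) = ps_comp (N x) (M (P y)) (e y) f" (is ?C)
    "a \<in> obj (lev (N x) n) \<Longrightarrow> mcomp (cellA x y f) n a = far (pfun (e y) n) (far (pfun f n) (mcomp (u x) n a))"
proof -
  note [simp] = f pn_rules[OF f]
  show ?A
    unfolding cellA_def by (rule mod_hcomp_md[of _ "N x"]) simp_all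
  from md_pn(1)[OF this] show ?B
    by (rule pnat_eqI) (simp_all, simp_all add: cellA_def conj1_def)
  show ?C
    by (simp add: cellA_def)
  show "a \<in> obj (lev (N x) n) \<Longrightarrow> mcomp (cellA x y f) n a = far (pfun (e y) n) (far (pfun f n) (mcomp (u x) n a))"
    by (simp add: cellA_def)
qed

lemma cellA_iso [simp]:
  assumes [simp]: "x \<in> S" "y \<in> S" and f: "pseudonatural (N x) (N y) f"
  shows "iso_arr (ps_hom (N x) (M (P y))) (cellA x y f)"
  by (rule iso_md) (simp_all add: f pn_rules[OF f])

lemma cellB_md [simp]:
  assumes [simp]: "x \<in> S" "y \<in> S" and f: "pseudonatural (N x) (N y) f"
  shows "modification (M (P x)) (N y) (cellB x y f)"
    "msrc (cellB x y f) = ps_comp (M (P x)) (N y) f (e' x)"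
    "mtgt (cellB x y f) = ps_comp (M (P x)) (N y) (e' y) (conj1 x y f)"
    "b \<in> obj (lev (M (P x)) n) \<Longrightarrow> mcomp (cellB x y f) n b = iinv (lev (N y) n) (mcomp (u y) n (fob (pfun f n) (fob (pfun (e' x) n) b)))"
    "iso_arr (ps_hom (M (P x)) (N y)) (cellB x y f)"
proof -
  note [simp] = f pn_rules[OF f]
  let ?D = "mod_hcomp (M (P x)) (N y) (u y) (ident (ps_hom (M (P x)) (N y)) (ps_comp (M (P x)) (N y) f (e' x)))"
  have m [simp]: "modification (M (P x)) (N y) ?D"
    by (rule mod_hcomp_md[of _ "N y"]) simp_all
  have i [simp]: "iso_arr (ps_hom (M (P x)) (N y)) ?D"
    by (rule iso_md) simp_all
  show "modification (M (P x)) (N y) (cellB x y f)" "iso_arr (ps_hom (M (P x)) (N y)) (cellB x y f)"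
    "msrc (cellB x y f) = ps_comp (M (P x)) (N y) f (e' x)"
    by (simp_all add: cellB_def iinv_md[OF i])
  have "msrc ?D = ps_comp (M (P x)) (N y) (e' y) (conj1 x y f)"
    using md_pn(1)[OF m] by (rule pnat_eqI) (simp_all, simp_all add: conj1_def)
  then show "mtgt (cellB x y f) = ps_comp (M (P x)) (N y) (e' y) (conj1 x y f)"
    by (simp add: cellB_def iinv_md[OF i])
  show "b \<in> obj (lev (M (P x)) n) \<Longrightarrow> mcomp (cellB x y f) n b = iinv (lev (N y) n) (mcomp (u y) n (fob (pfun f n) (fob (pfun (e' x) n) b)))"
    by (simp add: cellB_def iso_md(2)[OF m])
qed

end

lemma adj_equiv_id:
  assumes [simp]: "simplicial_cat X"
  shows "adj_equiv X X (ps_id X) (ps_id X) (ident (ps_hom X X) (ps_id X)) (ident (ps_hom X X) (ps_id X))"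
  unfolding adj_equiv_def by simp

text \<open>The identity is the conjugation by identity equivalences, so its axioms are an instance
  of those already proved.\<close>

lemma id_pseudofunctor_pseudofunctor:
  assumes N [simp]: "\<And>x. x \<in> S \<Longrightarrow> simplicial_cat (N x)"
  shows "pseudofunctor (ps_twocat S N) (ps_twocat S N) (id_pseudofunctor (ps_twocat S N))"
proof -
  interpret equiv_family S N S N "\<lambda>x. x" "\<lambda>x. ps_id (N x)" "\<lambda>x. ps_id (N x)"
    "\<lambda>x. ident (ps_hom (N x) (N x)) (ps_id (N x))" "\<lambda>x. ident (ps_hom (N x) (N x)) (ps_id (N x))"
    by (rule equiv_family.intro) (auto intro: adj_equiv_id)
  show ?thesis
  proof (rule conj_pseudofunctor)
    show "is_conj (id_pseudofunctor (ps_twocat S N))"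
      unfolding is_conj_def
      by (auto simp: id_pseudofunctor_def id_functor_def conj1_def conj2_def conj_mult_def mod_hcomp_ident ps_comp_pn
          intro!: functor_on_cong restrict_ext)
  qed
qed

text \<open>Only when both families coincide do the conjugation and the identity have the same
  source and target and admit a comparison.\<close>

locale endo_family = equiv_family S N S N P e e' u c for S N P e e' u c
begin

text \<open>The components are the \<open>e x\<close>. Naturality of the cells comes from naturality
  of the modification \<open>\<alpha>\<close> at \<open>u x\<close>, the unit law from a triangle
  identity, and compatibility with composition from naturality of \<open>u y\<close> at the image of
  \<open>u x\<close> under \<open>f\<close>.\<close>

lemma unit_pseudonat_equivalence:
  assumes H: "is_conj H"
  shows "\<exists>\<sigma>. pseudonat_equivalence (ps_twocat S N) (ps_twocat S N) (id_pseudofunctor (ps_twocat S N)) H \<sigma>"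
proof -
  define \<sigma> where "\<sigma> = \<lparr>pt_ob = e, pt_cell = (\<lambda>x y. \<lambda>f\<in>obj (ps_hom (N x) (N y)). cellA x y f)\<rparr>"
  note [simp] = is_conjD[OF H] cod_simplicial
  have [simp]: "pt_ob \<sigma> = e" "\<And>x y f. pseudonatural (N x) (N y) f \<Longrightarrow> pt_cell \<sigma> x y f = cellA x y f"
    by (simp_all add: \<sigma>_def)
  have "pseudonat_trans (ps_twocat S N) (ps_twocat S N) (id_pseudofunctor (ps_twocat S N)) H \<sigma>"
  proof (rule pseudonat_trans.intro, goal_cases)
    case 1
    show ?case by (rule id_pseudofunctor_pseudofunctor) simp
  next
    case 2
    show ?case by (rule conj_pseudofunctor[OF H])
  next
    case (3 x)
    then show ?case by (simp add: id_pseudofunctor_def)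
  next
    case (4 x y)
    then have [simp]: "x \<in> S" "y \<in> S" by simp_all
    show ?case
    proof (rule nat_isoI, goal_cases)
      case 1
      show ?case
        by (rule functor_functor_on) (auto simp: id_pseudofunctor_def md_pn mod_hcomp_ident mod_whisker_cmp)
    next
      case 2
      show ?case
        by (rule functor_functor_on) (auto simp: id_pseudofunctor_def md_pn mod_hcomp_ident mod_cmp_whisker)
    next
      case (3 f)
      then show ?case by (simp add: id_pseudofunctor_def)
    next
      case (4 \<alpha>)
      then have \<alpha>: "modification (N x) (N y) \<alpha>" by simp
      note [simp] = \<alpha> md_pn[OF \<alpha>] md_rules[OF \<alpha>] pn_rules[OF md_pn(1)[OF \<alpha>]] pn_rules[OF md_pn(2)[OF \<alpha>]]
      have "cmp (ps_hom (N x) (N (P y))) (mod_hcomp (N x) (N (P y)) (ident (ps_hom (N y) (N (P y))) (e y)) \<alpha>) (cellA x y (msrc \<alpha>)) =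
        cmp (ps_hom (N x) (N (P y))) (cellA x y (mtgt \<alpha>)) (mod_hcomp (N x) (N (P y)) (conj2 x y \<alpha>) (ident (ps_hom (N x) (N (P x))) (e x)))"
      proof (rule md_eqI[of "N x" "N (P y)"])
        fix n a
        assume [simp]: "a \<in> obj (lev (N x) n)"
        have "cmp (lev (N y) n) (mcomp \<alpha> n a) (far (pfun (msrc \<alpha>) n) (mcomp (u x) n a)) =
          cmp (lev (N y) n) (far (pfun (mtgt \<alpha>) n) (mcomp (u x) n a)) (mcomp \<alpha> n (fob (pfun (e' x) n) (fob (pfun (e x) n) a)))"
          by (subst md_nat[OF \<alpha>]) simp_all
        from arg_cong[OF this, of "far (pfun (e y) n)"]
        show "mcomp (cmp (ps_hom (N x) (N (P y))) (mod_hcomp (N x) (N (P y)) (ident (ps_hom (N y) (N (P y))) (e y)) \<alpha>) (cellA x y (msrc \<alpha>))) n a =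
          mcomp (cmp (ps_hom (N x) (N (P y))) (cellA x y (mtgt \<alpha>)) (mod_hcomp (N x) (N (P y)) (conj2 x y \<alpha>) (ident (ps_hom (N x) (N (P x))) (e x)))) n a"
          by simp
      qed simp_all
      then show ?case
        by (simp add: id_pseudofunctor_def)
    next
      case (5 f)
      then show ?case by (simp add: \<sigma>_def restrict_def)
    qed
  next
    case (5 x)
    then have [simp]: "x \<in> S" by simp
    have [simp]: "conj1 x x (ps_id (N x)) = ps_comp (N (P x)) (N (P x)) (e x) (e' x)"
      by (simp add: conj1_def)
    have [simp]: "modification (N x) (N (P x)) (mod_hcomp (N x) (N (P x)) (c x) (ident (ps_hom (N x) (N (P x))) (e x)))"
      by (rule mod_hcomp_md[of _ "N (P x)"]) simp_all
    have "cmp (ps_hom (N x) (N (P x))) (cellA x x (ps_id (N x))) (mod_hcomp (N x) (N (P x)) (c x) (ident (ps_hom (N x) (N (P x))) (e x))) =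
      ident (ps_hom (N x) (N (P x))) (e x)"
      by (rule md_eqI[of "N x" "N (P x)"]) simp_all
    then show ?case
      by (simp add: id_pseudofunctor_def mod_hcomp_ident)
  next
    case (6 x y z f g)
    then have [simp]: "x \<in> S" "y \<in> S" "z \<in> S" and f: "pseudonatural (N x) (N y) f" and g: "pseudonatural (N y) (N z) g"
      by simp_all
    note [simp] = f g pn_rules[OF f] pn_rules[OF g] ps_comp_pn[OF f g]
    let ?X = "N x" and ?Z = "N (P z)"
    have [simp]: "modification ?X ?Z (mod_hcomp ?X ?Z (conj_mult x y z g f) (ident (ps_hom (N x) (N (P x))) (e x)))"
      by (rule mod_hcomp_md[of _ "N (P x)"]) simp_all
    have [simp]: "modification ?X ?Z (mod_hcomp ?X ?Z (cellA y z g) (ident (ps_hom (N x) (N y)) f))"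
      by (rule mod_hcomp_md[of _ "N y"]) simp_all
    have [simp]: "modification ?X ?Z (mod_hcomp ?X ?Z (ident (ps_hom (N (P y)) (N (P z))) (conj1 y z g)) (cellA x y f))"
      by (rule mod_hcomp_md[of _ "N (P y)"]) simp_all
    have [simp]: "pseudonatural ?X ?Z (ps_comp ?X ?Z (e z) (ps_comp (N x) (N z) g f))"
      by simp
    have a1: "ps_comp ?X ?Z (conj1 y z g) (ps_comp ?X (N (P y)) (e y) f) = ps_comp ?X ?Z (ps_comp (N y) ?Z (conj1 y z g) (e y)) f"
      by (rule ps_comp_assoc) simp_all
    have a2: "ps_comp ?X ?Z (e z) (ps_comp ?X (N z) g f) = ps_comp ?X ?Z (ps_comp (N y) ?Z (e z) g) f"
      by (rule ps_comp_assoc) simp_all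
    have a3: "ps_comp ?X ?Z (ps_comp (N (P x)) ?Z (conj1 y z g) (conj1 x y f)) (e x) =
       ps_comp ?X ?Z (conj1 y z g) (ps_comp ?X (N (P y)) (conj1 x y f) (e x))"
      by (rule ps_comp_assoc[symmetric]) simp_all
    have "cmp (ps_hom ?X ?Z) (cellA x z (ps_comp (N x) (N z) g f))
        (mod_hcomp ?X ?Z (conj_mult x y z g f) (ident (ps_hom (N x) (N (P x))) (e x))) =
      cmp (ps_hom ?X ?Z) (ident (ps_hom ?X ?Z) (ps_comp ?X ?Z (e z) (ps_comp (N x) (N z) g f)))
        (cmp (ps_hom ?X ?Z) (mod_hcomp ?X ?Z (cellA y z g) (ident (ps_hom (N x) (N y)) f))
          (mod_hcomp ?X ?Z (ident (ps_hom (N (P y)) (N (P z))) (conj1 y z g)) (cellA x y f)))"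
    proof (rule md_eqI[of ?X ?Z], goal_cases)
      case (5 n a)
      then have [simp]: "a \<in> obj (lev (N x) n)" .
      let ?k = "far (pfun f n) (mcomp (u x) n a)"
      have "cmp (lev (N y) n) ?k (mcomp (u y) n (fob (pfun f n) (fob (pfun (e' x) n) (fob (pfun (e x) n) a)))) =
        cmp (lev (N y) n) (mcomp (u y) n (fob (pfun f n) a)) (far (pfun (e' y) n) (far (pfun (e y) n) ?k))"
        by (subst u_nat) simp_all
      from arg_cong[OF this, of "\<lambda>k. far (pfun (e z) n) (far (pfun g n) k)"]
      show ?case
        by (simp add: a1 a2 a3 del: adj_rules(11,12))
    qed (simp_all add: a1 a2 a3)
    then show ?case
      by (simp add: id_pseudofunctor_def mod_hcomp_ident)
  qed
  moreover have "equivalence_1cell (ps_twocat S N) (ps_ob (id_pseudofunctor (ps_twocat S N)) x) (ps_ob H x) (pt_ob \<sigma> x)" if "x \<in> S" for x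
    using adj_equiv_equivalence_1cell(1)[where N = N and x = x and y = "P x", OF adj[OF that]] that by (simp add: id_pseudofunctor_def)
  ultimately show ?thesis
    unfolding pseudonat_equivalence_def by auto
qed

text \<open>The mirror image, with components \<open>e'\<close>. The cells contain inverses of
  components of \<open>u\<close>, so each equation is first cleared of them by cancellation and then
  reduced to naturality of \<open>u\<close>.\<close>

lemma counit_pseudonat_equivalence:
  assumes H: "is_conj H"
  shows "\<exists>\<sigma>. pseudonat_equivalence (ps_twocat S N) (ps_twocat S N) H (id_pseudofunctor (ps_twocat S N)) \<sigma>"
proof -
  define \<sigma> where "\<sigma> = \<lparr>pt_ob = e', pt_cell = (\<lambda>x y. \<lambda>f\<in>obj (ps_hom (N x) (N y)). cellB x y f)\<rparr>"
  note [simp] = is_conjD[OF H] cod_simplicial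
  have [simp]: "pt_ob \<sigma> = e'" "\<And>x y f. pseudonatural (N x) (N y) f \<Longrightarrow> pt_cell \<sigma> x y f = cellB x y f"
    by (simp_all add: \<sigma>_def)
  have "pseudonat_trans (ps_twocat S N) (ps_twocat S N) H (id_pseudofunctor (ps_twocat S N)) \<sigma>"
  proof (rule pseudonat_trans.intro, goal_cases)
    case 1
    show ?case by (rule conj_pseudofunctor[OF H])
  next
    case 2
    show ?case by (rule id_pseudofunctor_pseudofunctor) simp
  next
    case (3 x)
    then show ?case by (simp add: id_pseudofunctor_def)
  next
    case (4 x y)
    then have [simp]: "x \<in> S" "y \<in> S" by simp_all
    show ?case
    proof (rule nat_isoI, goal_cases)
      case 1
      show ?case
        by (rule functor_functor_on) (auto simp: id_pseudofunctor_def md_pn mod_hcomp_ident mod_whisker_cmp)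
    next
      case 2
      show ?case
        by (rule functor_functor_on) (auto simp: id_pseudofunctor_def md_pn mod_hcomp_ident mod_cmp_whisker)
    next
      case (3 f)
      then show ?case by (simp add: id_pseudofunctor_def)
    next
      case (4 \<alpha>)
      then have \<alpha>: "modification (N x) (N y) \<alpha>" by simp
      note [simp] = \<alpha> md_pn[OF \<alpha>] md_rules[OF \<alpha>] pn_rules[OF md_pn(1)[OF \<alpha>]] pn_rules[OF md_pn(2)[OF \<alpha>]]
      have "cmp (ps_hom (N (P x)) (N y)) (mod_hcomp (N (P x)) (N y) (ident (ps_hom (N (P y)) (N y)) (e' y)) (conj2 x y \<alpha>)) (cellB x y (msrc \<alpha>)) =
        cmp (ps_hom (N (P x)) (N y)) (cellB x y (mtgt \<alpha>)) (mod_hcomp (N (P x)) (N y) \<alpha> (ident (ps_hom (N (P x)) (N x)) (e' x)))"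
      proof (rule md_eqI[of "N (P x)" "N y"], goal_cases)
        case (5 n b)
        then have [simp]: "b \<in> obj (lev (N (P x)) n)" .
        let ?k = "mcomp \<alpha> n (fob (pfun (e' x) n) b)"
        let ?s = "mcomp (u y) n (fob (pfun (msrc \<alpha>) n) (fob (pfun (e' x) n) b))"
        let ?t = "mcomp (u y) n (fob (pfun (mtgt \<alpha>) n) (fob (pfun (e' x) n) b))"
        have "cmp (lev (N y) n) (far (pfun (e' y) n) (far (pfun (e y) n) ?k)) (iinv (lev (N y) n) ?s) = cmp (lev (N y) n) (iinv (lev (N y) n) ?t) ?k"
          by (rule iso_left_cancel[of "lev (N y) n" ?t], simp_all, rule iso_right_cancel[of "lev (N y) n" ?s])
            (simp_all add: u_nat)
        then show ?case
          by simp
      qed simp_all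
      then show ?case
        by (simp add: id_pseudofunctor_def)
    next
      case (5 f)
      then show ?case by (simp add: \<sigma>_def restrict_def)
    qed
  next
    case (5 x)
    then have [simp]: "x \<in> S" by simp
    have [simp]: "conj1 x x (ps_id (N x)) = ps_comp (N (P x)) (N (P x)) (e x) (e' x)"
      by (simp add: conj1_def)
    have [simp]: "modification (N (P x)) (N x) (mod_hcomp (N (P x)) (N x) (ident (ps_hom (N (P x)) (N x)) (e' x)) (c x))"
      by (rule mod_hcomp_md[of _ "N (P x)"]) simp_all
    have "cmp (ps_hom (N (P x)) (N x)) (cellB x x (ps_id (N x))) (ident (ps_hom (N (P x)) (N x)) (e' x)) =
      mod_hcomp (N (P x)) (N x) (ident (ps_hom (N (P x)) (N x)) (e' x)) (c x)"
      by (rule md_eqI[of "N (P x)" "N x"]) simp_all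
    then show ?case
      by (simp add: id_pseudofunctor_def mod_hcomp_ident)
  next
    case (6 x y z f g)
    then have [simp]: "x \<in> S" "y \<in> S" "z \<in> S" and f: "pseudonatural (N x) (N y) f" and g: "pseudonatural (N y) (N z) g"
      by simp_all
    note [simp] = f g pn_rules[OF f] pn_rules[OF g] ps_comp_pn[OF f g]
    let ?X = "N (P x)" and ?Z = "N z"
    have [simp]: "modification ?X ?Z (mod_hcomp ?X ?Z (ident (ps_hom (N (P z)) (N z)) (e' z)) (conj_mult x y z g f))"
      by (rule mod_hcomp_md[of _ "N (P z)"]) simp_all
    have [simp]: "modification ?X ?Z (mod_hcomp ?X ?Z (cellB y z g) (ident (ps_hom (N (P x)) (N (P y))) (conj1 x y f)))"
      by (rule mod_hcomp_md[of _ "N (P y)"]) simp_all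
    have [simp]: "modification ?X ?Z (mod_hcomp ?X ?Z (ident (ps_hom (N y) (N z)) g) (cellB x y f))"
      by (rule mod_hcomp_md[of _ "N y"]) simp_all
    have a1: "ps_comp ?X ?Z (ps_comp (N x) ?Z g f) (e' x) = ps_comp ?X ?Z g (ps_comp ?X (N y) f (e' x))"
      by (rule ps_comp_assoc[symmetric]) simp_all
    have a2: "ps_comp ?X ?Z (ps_comp (N (P y)) ?Z (e' z) (conj1 y z g)) (conj1 x y f) = ps_comp ?X ?Z (e' z) (ps_comp ?X (N (P z)) (conj1 y z g) (conj1 x y f))"
      by (rule ps_comp_assoc[symmetric]) simp_all
    have a3: "ps_comp ?X ?Z (ps_comp (N (P y)) ?Z g (e' y)) (conj1 x y f) = ps_comp ?X ?Z g (ps_comp ?X (N y) (e' y) (conj1 x y f))"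
      by (rule ps_comp_assoc[symmetric]) simp_all
    have [simp]: "pseudonatural ?X ?Z (ps_comp ?X ?Z g (ps_comp ?X (N y) f (e' x)))"
      unfolding a1[symmetric] by simp
    have "cmp (ps_hom ?X ?Z) (cellB x z (ps_comp (N x) (N z) g f)) (ident (ps_hom ?X ?Z) (ps_comp ?X ?Z (ps_comp (N x) ?Z g f) (e' x))) =
      cmp (ps_hom ?X ?Z) (mod_hcomp ?X ?Z (ident (ps_hom (N (P z)) (N z)) (e' z)) (conj_mult x y z g f))
        (cmp (ps_hom ?X ?Z) (mod_hcomp ?X ?Z (cellB y z g) (ident (ps_hom (N (P x)) (N (P y))) (conj1 x y f)))
          (mod_hcomp ?X ?Z (ident (ps_hom (N y) (N z)) g) (cellB x y f)))"
    proof (rule md_eqI[of ?X ?Z], goal_cases)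
      case (5 n b)
      then have [simp]: "b \<in> obj (lev (N (P x)) n)" .
      define a where "a = fob (pfun f n) (fob (pfun (e' x) n) b)"
      have [simp]: "a \<in> obj (lev (N y) n)"
        by (simp add: a_def)
      let ?k = "far (pfun g n) (mcomp (u y) n a)"
      let ?s = "mcomp (u z) n (fob (pfun g n) (fob (pfun (e' y) n) (fob (pfun (e y) n) a)))"
      let ?t = "mcomp (u z) n (fob (pfun g n) a)"
      \<comment> \<open>The naturality square of \<open>u z\<close> at \<open>?k\<close>, read with
        its vertical sides inverted.\<close>
      have *: "cmp (lev (N z) n) (iinv (lev (N z) n) ?t) ?k = cmp (lev (N z) n) (far (pfun (e' z) n) (far (pfun (e z) n) ?k)) (iinv (lev (N z) n) ?s)"
        by (rule iso_left_cancel[of "lev (N z) n" ?t], simp_all del: adj_rules(11,12), rule iso_right_cancel[of "lev (N z) n" ?s])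
            (simp_all add: u_nat del: adj_rules(11,12))
      have "iinv (lev (N z) n) ?t = cmp (lev (N z) n) (far (pfun (e' z) n) (far (pfun (e z) n) ?k)) (cmp (lev (N z) n) (iinv (lev (N z) n) ?s) (iinv (lev (N z) n) ?k))"
        by (rule iso_right_cancel[of "lev (N z) n" ?k]) (simp_all add: * del: adj_rules(11,12))
      then show ?case
        by (simp add: a_def a1 a2 a3 del: adj_rules(11,12))
    qed (simp_all add: a1 a2 a3)
    from this[symmetric] show ?case
      by (simp add: id_pseudofunctor_def mod_hcomp_ident)
  qed
  moreover have "equivalence_1cell (ps_twocat S N) (ps_ob H x) (ps_ob (id_pseudofunctor (ps_twocat S N)) x) (pt_ob \<sigma> x)" if "x \<in> S" for x
    using adj_equiv_equivalence_1cell(2)[where N = N and x = x and y = "P x", OF adj[OF that]] that by (simp add: id_pseudofunctor_def)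
  ultimately show ?thesis
    unfolding pseudonat_equivalence_def by auto
qed

end

text \<open>Composition of pseudo-natural transformations is strictly associative, so conjugating
  twice is conjugation by the composite equivalences on the nose, not merely up to isomorphism. This
  reduces both round trips of the biequivalence to the case of one family.\<close>

lemma comp_conj:
  assumes F: "equiv_family S N T M P e e' u c" and G: "equiv_family T M R L Q d d' v k"
  shows "\<exists>s s' w j. equiv_family S N R L (\<lambda>x. Q (P x)) s s' w j \<and>
    (\<forall>H K. equiv_family.is_conj S N M P e e' u c H \<longrightarrow> equiv_family.is_conj T M L Q d d' v k K \<longrightarrow>
      equiv_family.is_conj S N L (\<lambda>x. Q (P x)) s s' w j (comp_pseudofunctor (ps_twocat S N) (ps_twocat R L) K H))"
proof -
  interpret F: equiv_family S N T M P e e' u c by (rule F)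
  interpret G: equiv_family T M R L Q d d' v k by (rule G)
  define s where "s = (\<lambda>x. ps_comp (N x) (L (Q (P x))) (d (P x)) (e x))"
  define s' where "s' = (\<lambda>x. ps_comp (L (Q (P x))) (N x) (e' x) (d' (P x)))"
  define w where "w = (\<lambda>x. cmp (ps_hom (N x) (N x)) (u x) (mod_hcomp (N x) (N x) (ident (ps_hom (M (P x)) (N x)) (e' x))
    (mod_hcomp (N x) (M (P x)) (v (P x)) (ident (ps_hom (N x) (M (P x))) (e x)))))"
  define j where "j = (\<lambda>x. cmp (ps_hom (L (Q (P x))) (L (Q (P x)))) (mod_hcomp (L (Q (P x))) (L (Q (P x))) (ident (ps_hom (M (P x)) (L (Q (P x)))) (d (P x)))
    (mod_hcomp (L (Q (P x))) (M (P x)) (c x) (ident (ps_hom (L (Q (P x))) (M (P x))) (d' (P x))))) (k (P x)))"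
  note A = adj_equiv_comp[OF F.adj G.adj, OF _ F.P_closed]
  interpret C: equiv_family S N R L "\<lambda>x. Q (P x)" s s' w j
    by (rule equiv_family.intro) (auto simp: s_def s'_def w_def j_def intro: A(1) G.cod_simplicial)
  have w: "mcomp (w x) n a = cmp (lev (N x) n) (mcomp (u x) n a) (far (pfun (e' x) n) (mcomp (v (P x)) n (fob (pfun (e x) n) a)))"
    if "x \<in> S" "a \<in> obj (lev (N x) n)" for x n a
    unfolding w_def by (rule A(2)) (use that in auto)
  have c1: "G.conj1 (P x) (P y) (F.conj1 x y f) = C.conj1 x y f"
    if [simp]: "x \<in> S" "y \<in> S" and f: "pseudonatural (N x) (N y) f" for x y f
  proof -
    note [simp] = f pn_rules[OF f]
    show ?thesis
      by (rule pnat_eqI[OF G.conj1_pn C.conj1_pn]) (simp_all, simp_all add: s_def s'_def, simp add: G.conj1_def F.conj1_def C.conj1_def[unfolded s_def s'_def])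
  qed
  have c2: "G.conj2 (P x) (P y) (F.conj2 x y \<alpha>) = C.conj2 x y \<alpha>"
    if [simp]: "x \<in> S" "y \<in> S" and f: "modification (N x) (N y) \<alpha>" for x y \<alpha>
  proof -
    note [simp] = f md_rules[OF f] md_pn[OF f]
    show ?thesis
      by (rule md_eqI[OF G.conj2_md(1) C.conj2_md(1)]) (simp_all add: c1, simp_all add: s_def s'_def)
  qed
  \<comment> \<open>Two nested cancellations, an inner one by \<open>v\<close> and an outer one by
    \<open>u\<close>, amount to a single one by \<open>w\<close>; this is the component formula for
    \<open>w\<close>.\<close>
  have cm: "cmp (ps_hom (L (Q (P x))) (L (Q (P z)))) (G.conj2 (P x) (P z) (F.conj_mult x y z g f)) (G.conj_mult (P x) (P y) (P z) (F.conj1 y z g) (F.conj1 x y f)) =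
     C.conj_mult x y z g f"
    if [simp]: "x \<in> S" "y \<in> S" "z \<in> S" and f: "pseudonatural (N x) (N y) f" and g: "pseudonatural (N y) (N z) g" for x y z g f
  proof -
    note [simp] = f g pn_rules[OF f] pn_rules[OF g] ps_comp_pn[OF f g]
    show ?thesis
      by (rule md_eqI[OF md_cmp C.conj_mult_md(1)]) (simp_all add: c1, simp_all add: s_def s'_def w)
  qed
  have "C.is_conj (comp_pseudofunctor (ps_twocat S N) (ps_twocat R L) K H)" if H: "F.is_conj H" and K: "G.is_conj K" for H K
  proof -
    note [simp] = F.is_conjD[OF H] G.is_conjD[OF K]
    show ?thesis
      unfolding C.is_conj_def
    proof (intro conjI ballI)
      fix x assume [simp]: "x \<in> S"
      show "ps_ob (comp_pseudofunctor (ps_twocat S N) (ps_twocat R L) K H) x = Q (P x)"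
        by (simp add: comp_pseudofunctor_def)
      show "ps_unit (comp_pseudofunctor (ps_twocat S N) (ps_twocat R L) K H) x = j x"
        by (simp add: comp_pseudofunctor_def j_def G.conj2_def)
      fix y assume [simp]: "y \<in> S"
      show "ps_map (comp_pseudofunctor (ps_twocat S N) (ps_twocat R L) K H) x y = functor_on (ps_hom (N x) (N y)) (C.conj1 x y) (C.conj2 x y)"
        by (auto simp: comp_pseudofunctor_def comp_functor_def c1 c2 intro!: functor_on_cong)
      fix z assume [simp]: "z \<in> S"
      show "ps_mult (comp_pseudofunctor (ps_twocat S N) (ps_twocat R L) K H) x y z =
        (\<lambda>(g, f)\<in>obj (prod_cat (ps_hom (N y) (N z)) (ps_hom (N x) (N y))). C.conj_mult x y z g f)"
        by (auto simp: comp_pseudofunctor_def cm ps_comp_pn intro!: restrict_ext)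
    qed
  qed
  then show ?thesis
    using C.equiv_family_axioms by blast
qed

lemma ex_is_conj:
  assumes "equiv_family S N T M P e e' u c"
  shows "\<exists>H. equiv_family.is_conj S N M P e e' u c H"
proof -
  interpret equiv_family S N T M P e e' u c by (rule assms)
  show ?thesis
    unfolding is_conj_def
    by (rule exI[of _ "\<lparr>ps_ob = P, ps_map = (\<lambda>x y. functor_on (ps_hom (N x) (N y)) (conj1 x y) (conj2 x y)),
      ps_mult = (\<lambda>x y z. \<lambda>(g, f)\<in>obj (prod_cat (ps_hom (N y) (N z)) (ps_hom (N x) (N y))). conj_mult x y z g f), ps_unit = c\<rparr>"]) simp
qed

lemma biequivalence_of_equiv_families:
  assumes F: "equiv_family S N T M P e e' u c" and G: "equiv_family T M S N Q d d' v k"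
  shows "\<exists>F. biequivalence (ps_twocat S N) (ps_twocat T M) F"
proof -
  obtain H where H: "equiv_family.is_conj S N M P e e' u c H"
    using ex_is_conj[OF F] by blast
  obtain K where K: "equiv_family.is_conj T M N Q d d' v k K"
    using ex_is_conj[OF G] by blast
  obtain s s' w j where 1: "equiv_family S N S N (\<lambda>x. Q (P x)) s s' w j"
    and "equiv_family.is_conj S N N (\<lambda>x. Q (P x)) s s' w j (comp_pseudofunctor (ps_twocat S N) (ps_twocat S N) K H)"
    using comp_conj[OF F G] H K by blast
  then obtain \<eta> where \<eta>: "pseudonat_equivalence (ps_twocat S N) (ps_twocat S N) (id_pseudofunctor (ps_twocat S N))
      (comp_pseudofunctor (ps_twocat S N) (ps_twocat S N) K H) \<eta>"
    using endo_family.unit_pseudonat_equivalence[OF endo_family.intro[OF 1]] by blast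
  obtain s s' w j where 2: "equiv_family T M T M (\<lambda>x. P (Q x)) s s' w j"
    and "equiv_family.is_conj T M M (\<lambda>x. P (Q x)) s s' w j (comp_pseudofunctor (ps_twocat T M) (ps_twocat T M) H K)"
    using comp_conj[OF G F] H K by blast
  then obtain \<epsilon> where \<epsilon>: "pseudonat_equivalence (ps_twocat T M) (ps_twocat T M)
      (comp_pseudofunctor (ps_twocat T M) (ps_twocat T M) H K) (id_pseudofunctor (ps_twocat T M)) \<epsilon>"
    using endo_family.counit_pseudonat_equivalence[OF endo_family.intro[OF 2]] by blast
  show ?thesis
    unfolding biequivalence_def
    using equiv_family.conj_pseudofunctor[OF F H] equiv_family.conj_pseudofunctor[OF G K] \<eta> \<epsilon> by blast
qed

text \<open>A partner and an adjoint equivalence are chosen separately for every object. The two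
  choices \<open>P\<close> and \<open>Q\<close> need not be related: the round trip from
  \<open>x\<close> to \<open>Q (P x)\<close> is controlled by the composite equivalence, whatever
  object it leads to.\<close>

lemma biequivalence_of_equivalent_objects:
  assumes "\<And>x. x \<in> S \<Longrightarrow> simplicial_cat (N x)" "\<And>y. y \<in> T \<Longrightarrow> simplicial_cat (M y)"
    and F: "\<And>x. x \<in> S \<Longrightarrow> \<exists>y \<in> T. \<exists>e e' u c. adj_equiv (N x) (M y) e e' u c"
    and G: "\<And>y. y \<in> T \<Longrightarrow> \<exists>x \<in> S. \<exists>d d' v k. adj_equiv (M y) (N x) d d' v k"
  shows "\<exists>F. biequivalence (ps_twocat S N) (ps_twocat T M) F"
proof -
  obtain P e e' u c where "\<And>x. x \<in> S \<Longrightarrow> P x \<in> T \<and> adj_equiv (N x) (M (P x)) (e x) (e' x) (u x) (c x)"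
    using F by metis
  then have 1: "equiv_family S N T M P e e' u c"
    using assms(2) by (auto intro: equiv_family.intro)
  obtain Q d d' v k where "\<And>y. y \<in> T \<Longrightarrow> Q y \<in> S \<and> adj_equiv (M y) (N (Q y)) (d y) (d' y) (v y) (k y)"
    using G by metis
  then have 2: "equiv_family T M S N Q d d' v k"
    using assms(1) by (auto intro: equiv_family.intro)
  show ?thesis
    by (rule biequivalence_of_equiv_families[OF 1 2])
qed

text \<open>Each level has an adjoint inverse \<open>G n\<close>, and the task is to make these
  inverses pseudo-natural. Equations in \<open>X\<close> are verified after applying the faithful
  functor \<open>F\<close> of the level, where they reduce to the axioms for the cells of
  \<open>F\<close>.\<close>

lemma ex_adj_equiv_of_ff_es:
  assumes F: "pseudonatural X Y F" and ff: "\<And>n. ff_es (lev X n) (lev Y n) (pfun F n)"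
  shows "\<exists>e' u c. adj_equiv X Y F e' u c"
proof -
  note [simp] = pn_rules[OF F]
  have "\<forall>n. \<exists>G c u. is_functor (lev Y n) (lev X n) G \<and>
    nat_iso (lev Y n) (lev Y n) (id_functor (lev Y n)) (comp_functor (lev Y n) (pfun F n) G) c \<and>
    nat_iso (lev X n) (lev X n) (comp_functor (lev X n) G (pfun F n)) (id_functor (lev X n)) u \<and>
    (\<forall>x \<in> obj (lev X n). far (pfun F n) (u x) = iinv (lev Y n) (c (fob (pfun F n) x))) \<and>
    (\<forall>z \<in> obj (lev Y n). u (fob G z) = iinv (lev X n) (far G (c z)))"
    using ff_es_adjoint_inverse[OF ff] by blast
  then obtain G c u where G: "\<And>n. is_functor (lev Y n) (lev X n) (G n)"
    and c: "\<And>n. nat_iso (lev Y n) (lev Y n) (id_functor (lev Y n)) (comp_functor (lev Y n) (pfun F n) (G n)) (c n)"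
    and u: "\<And>n. nat_iso (lev X n) (lev X n) (comp_functor (lev X n) (G n) (pfun F n)) (id_functor (lev X n)) (u n)"
    and Fu: "\<And>n x. x \<in> obj (lev X n) \<Longrightarrow> far (pfun F n) (u n x) = iinv (lev Y n) (c n (fob (pfun F n) x))"
    and uG: "\<And>n z. z \<in> obj (lev Y n) \<Longrightarrow> u n (fob (G n) z) = iinv (lev X n) (far (G n) (c n z))"
    by metis
  note [simp] = functor_rules[OF G] nat_iso_rules(1-4)[OF c] nat_iso_rules(1-4)[OF u] Fu
  \<comment> \<open>Naturality of \<open>c\<close> computes \<open>F G\<close> on arrows as
    conjugation by \<open>c\<close>, so that \<open>G\<close> can be eliminated from images under
    \<open>F\<close>.\<close>
  have FG: "far (pfun F n) (far (G n) k) = cmp (lev Y n) (c n (tgt (lev Y n) k)) (cmp (lev Y n) k (iinv (lev Y n) (c n (src (lev Y n) k))))"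
    if [simp]: "k \<in> arr (lev Y n)" for n k
    by (rule iso_right_cancel[of "lev Y n" "c n (src (lev Y n) k)"])
      (use nat_iso_rules(5)[OF c, of k n] in simp_all)
  note faithful = ff_es_faithful[OF ff]
  \<comment> \<open>The mate of the inverse cell of \<open>F\<close>: from
    \<open>X(\<phi>) G z\<close> to \<open>G F X(\<phi>) G z\<close> by the inverse of
    \<open>u\<close>, to \<open>G Y(\<phi>) F G z\<close> by the inverse of the cell of
    \<open>F\<close>, and to \<open>G Y(\<phi>) z\<close> by the inverse of
    \<open>c\<close>.\<close>
  define cell where "cell = (\<lambda>m n \<phi> z. cmp (lev X m) (far (G m) (far (act Y m n \<phi>) (iinv (lev Y n) (c n z))))
    (cmp (lev X m) (far (G m) (iinv (lev Y m) (pcell F m n \<phi> (fob (G n) z)))) (iinv (lev X m) (u m (fob (act X m n \<phi>) (fob (G n) z))))))"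
  define e' where "e' = \<lparr>pfun = G, pcell = (\<lambda>m n \<phi>. if \<phi> \<in> Delta m n then \<lambda>z\<in>obj (lev Y n). cell m n \<phi> z else undefined)\<rparr>"
  have e'1 [simp]: "pfun e' = G"
    by (simp add: e'_def)
  have e'2 [simp]: "pcell e' m n \<phi> z = cell m n \<phi> z" if "\<phi> \<in> Delta m n" "z \<in> obj (lev Y n)" for m n \<phi> z
    using that by (simp add: e'_def)
  have [simp]: "iso_arr (lev X m) (cell m n \<phi> z)" "cell m n \<phi> z \<in> arr (lev X m)"
    "src (lev X m) (cell m n \<phi> z) = fob (act X m n \<phi>) (fob (G n) z)"
    "tgt (lev X m) (cell m n \<phi> z) = fob (G m) (fob (act Y m n \<phi>) z)" if [simp]: "\<phi> \<in> Delta m n" "z \<in> obj (lev Y n)" for m n \<phi> z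
    by (simp_all add: cell_def)
  \<comment> \<open>By the triangle identity the factor coming from \<open>u\<close> becomes a
    component of \<open>c\<close>; what is left consists only of components of \<open>c\<close> and
    a cell of \<open>F\<close>.\<close>
  have Fcell: "far (pfun F m) (cell m n \<phi> z) = cmp (lev Y m) (c m (fob (act Y m n \<phi>) z))
      (cmp (lev Y m) (iinv (lev Y m) (far (act Y m n \<phi>) (c n z))) (iinv (lev Y m) (pcell F m n \<phi> (fob (G n) z))))"
    if [simp]: "\<phi> \<in> Delta m n" "z \<in> obj (lev Y n)" for m n \<phi> z
    by (simp add: cell_def FG)
  have e': "pseudonatural Y X e'"
  proof (rule pnI)
    fix m n \<phi> a
    assume [simp]: "\<phi> \<in> Delta m n" "a \<in> arr (lev Y n)"
    let ?p = "pcell F m n \<phi> (fob (G n) (src (lev Y n) a))"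
    have "cmp (lev X m) (far (G m) (far (act Y m n \<phi>) a)) (cell m n \<phi> (src (lev Y n) a)) =
        cmp (lev X m) (cell m n \<phi> (tgt (lev Y n) a)) (far (act X m n \<phi>) (far (G n) a))"
    proof (rule faithful)
      show "far (pfun F m) (cmp (lev X m) (far (G m) (far (act Y m n \<phi>) a)) (cell m n \<phi> (src (lev Y n) a))) =
        far (pfun F m) (cmp (lev X m) (cell m n \<phi> (tgt (lev Y n) a)) (far (act X m n \<phi>) (far (G n) a)))"
        by (rule iso_right_cancel[of "lev Y m" ?p]) (simp_all add: Fcell FG pn_nat[OF F])
    qed simp_all
    then show "cmp (lev X m) (far (pfun e' m) (far (act Y m n \<phi>) a)) (pcell e' m n \<phi> (src (lev Y n) a)) =
        cmp (lev X m) (pcell e' m n \<phi> (tgt (lev Y n) a)) (far (act X m n \<phi>) (far (pfun e' n) a))"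
      by simp
  next
    fix n z
    assume [simp]: "z \<in> obj (lev Y n)"
    show "pcell e' n n (\<lambda>i\<in>{..n}. i) z = ident (lev X n) (fob (pfun e' n) z)"
      by (rule ff_es_faithful[OF ff[of n]]) (simp_all add: Fcell pseudonatural.pcell_id[OF F])
  next
    fix l m n \<phi> \<psi> z
    assume a: "\<psi> \<in> Delta l m" "\<phi> \<in> Delta m n" and [simp]: "z \<in> obj (lev Y n)"
    note [simp] = a Delta_compose[OF a] pseudonatural.pcell_comp[OF F a] act_compose[OF pn_rules(1)[OF F] a] act_compose[OF pn_rules(2)[OF F] a]
    let ?p = "pcell F l m \<psi> (fob (act X m n \<phi>) (fob (G n) z))"
    have "cell l n (compose {..l} \<phi> \<psi>) z = cmp (lev X l) (cell l m \<psi> (fob (act Y m n \<phi>) z)) (far (act X l m \<psi>) (cell m n \<phi> z))"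
    proof (rule faithful)
      show "far (pfun F l) (cell l n (compose {..l} \<phi> \<psi>) z) =
        far (pfun F l) (cmp (lev X l) (cell l m \<psi> (fob (act Y m n \<phi>) z)) (far (act X l m \<psi>) (cell m n \<phi> z)))"
        by (rule iso_right_cancel[of "lev Y l" ?p]) (simp_all add: Fcell pn_nat[OF F])
    qed simp_all
    then show "pcell e' l n (compose {..l} \<phi> \<psi>) z =
       cmp (lev X l) (pcell e' l m \<psi> (fob (act Y m n \<phi>) z)) (far (act X l m \<psi>) (pcell e' m n \<phi> z))"
      by simp
  qed (auto simp: G, auto simp: e'_def)
  define U where "U = \<lparr>msrc = ps_comp X X e' F, mtgt = ps_id X, mcomp = u\<rparr>"
  define V where "V = \<lparr>msrc = ps_id Y, mtgt = ps_comp Y Y F e', mcomp = c\<rparr>"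
  have U: "modification X X U"
  proof (rule mdI)
    fix n a
    assume [simp]: "a \<in> arr (lev X n)"
    show "cmp (lev X n) (far (pfun (mtgt U) n) a) (mcomp U n (src (lev X n) a)) =
      cmp (lev X n) (mcomp U n (tgt (lev X n) a)) (far (pfun (msrc U) n) a)"
      using nat_iso_rules(5)[OF u, of a n] by (simp add: U_def)
  next
    fix m n \<phi> x
    assume [simp]: "\<phi> \<in> Delta m n" "x \<in> obj (lev X n)"
    let ?p = "pcell F m n \<phi> (fob (G n) (fob (pfun F n) x))"
    have "far (act X m n \<phi>) (u n x) = cmp (lev X m) (u m (fob (act X m n \<phi>) x))
      (cmp (lev X m) (far (G m) (pcell F m n \<phi> x)) (cell m n \<phi> (fob (pfun F n) x)))"
    proof (rule faithful)
      show "far (pfun F m) (far (act X m n \<phi>) (u n x)) = far (pfun F m) (cmp (lev X m) (u m (fob (act X m n \<phi>) x))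
        (cmp (lev X m) (far (G m) (pcell F m n \<phi> x)) (cell m n \<phi> (fob (pfun F n) x))))"
        by (rule iso_right_cancel[of "lev Y m" ?p]) (simp_all add: Fcell FG pn_nat[OF F])
    qed simp_all
    then show "cmp (lev X m) (pcell (mtgt U) m n \<phi> x) (far (act X m n \<phi>) (mcomp U n x)) =
        cmp (lev X m) (mcomp U m (fob (act X m n \<phi>) x)) (pcell (msrc U) m n \<phi> x)"
      by (simp add: U_def)
  qed (auto simp: U_def ps_comp_pn[OF F e'] nat_iso_rules(6)[OF u])
  have V: "modification Y Y V"
  proof (rule mdI)
    fix n a
    assume [simp]: "a \<in> arr (lev Y n)"
    show "cmp (lev Y n) (far (pfun (mtgt V) n) a) (mcomp V n (src (lev Y n) a)) =
      cmp (lev Y n) (mcomp V n (tgt (lev Y n) a)) (far (pfun (msrc V) n) a)"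
      using nat_iso_rules(5)[OF c, of a n] by (simp add: V_def)
  next
    fix m n \<phi> x
    assume [simp]: "\<phi> \<in> Delta m n" "x \<in> obj (lev Y n)"
    show "cmp (lev Y m) (pcell (mtgt V) m n \<phi> x) (far (act Y m n \<phi>) (mcomp V n x)) =
        cmp (lev Y m) (mcomp V m (fob (act Y m n \<phi>) x)) (pcell (msrc V) m n \<phi> x)"
      by (simp add: V_def Fcell)
  qed (auto simp: V_def ps_comp_pn[OF e' F] nat_iso_rules(6)[OF c])
  have "adj_equiv X Y F e' U V"
    unfolding adj_equiv_def using F e' U V by (simp add: U_def V_def uG)
  then show ?thesis
    by blast
qed

section \<open>Horizontal nerves\<close>

lemma chainsD:
  assumes "xs \<in> chains S p q k"
  shows "length xs = k" "i < k \<Longrightarrow> xs ! i \<in> S" "Suc i < k \<Longrightarrow> q (xs ! i) = p (xs ! Suc i)"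
  using assms by (auto simp: chains_def)

lemma chainsI:
  assumes "length xs = k" "\<And>i. i < k \<Longrightarrow> xs ! i \<in> S" "\<And>i. Suc i < k \<Longrightarrow> q (xs ! i) = p (xs ! Suc i)"
  shows "xs \<in> chains S p q k"
  using assms by (auto simp: chains_def in_set_conv_nth)

lemma fibre_power_simps [simp]:
  "obj (fibre_power C p q k) = chains (obj C) (fob p) (fob q) k"
  "arr (fibre_power C p q k) = chains (arr C) (far p) (far q) k"
  "fs \<in> chains (arr C) (far p) (far q) k \<Longrightarrow> src (fibre_power C p q k) fs = map (src C) fs"
  "fs \<in> chains (arr C) (far p) (far q) k \<Longrightarrow> tgt (fibre_power C p q k) fs = map (tgt C) fs"
  "xs \<in> chains (obj C) (fob p) (fob q) k \<Longrightarrow> ident (fibre_power C p q k) xs = map (ident C) xs"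
  "fs \<in> chains (arr C) (far p) (far q) k \<Longrightarrow> gs \<in> chains (arr C) (far p) (far q) k \<Longrightarrow>
    map (src C) gs = map (tgt C) fs \<Longrightarrow> cmp (fibre_power C p q k) gs fs = map2 (cmp C) gs fs"
  by (simp_all add: fibre_power_def)

lemma map_eq_nthD: "map f xs = map g ys \<Longrightarrow> i < length xs \<Longrightarrow> f (xs ! i) = g (ys ! i)"
  by (metis length_map nth_map)

lemma fibre_power_closed:
  assumes p: "is_functor C B p" and q: "is_functor C B q"
  shows "fs \<in> chains (arr C) (far p) (far q) k \<Longrightarrow> map (src C) fs \<in> chains (obj C) (fob p) (fob q) k"
    "fs \<in> chains (arr C) (far p) (far q) k \<Longrightarrow> map (tgt C) fs \<in> chains (obj C) (fob p) (fob q) k"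
    "xs \<in> chains (obj C) (fob p) (fob q) k \<Longrightarrow> map (ident C) xs \<in> chains (arr C) (far p) (far q) k"
    "fs \<in> chains (arr C) (far p) (far q) k \<Longrightarrow> gs \<in> chains (arr C) (far p) (far q) k \<Longrightarrow>
      map (src C) gs = map (tgt C) fs \<Longrightarrow> map2 (cmp C) gs fs \<in> chains (arr C) (far p) (far q) k"
proof -
  have [simp]: "category C" "category B"
    using p by (simp_all add: is_functor_def)
  note [simp] = functor_rules[OF p] functor_rules[OF q]
  show "map (src C) fs \<in> chains (obj C) (fob p) (fob q) k" if fs: "fs \<in> chains (arr C) (far p) (far q) k"
  proof (rule chainsI)
    show "fob q (map (src C) fs ! i) = fob p (map (src C) fs ! Suc i)" if "Suc i < k" for i
      using arg_cong[OF chainsD(3)[OF fs that], of "src B"] chainsD(1,2)[OF fs] that by simp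
  qed (use chainsD[OF fs] in auto)
  show "map (tgt C) fs \<in> chains (obj C) (fob p) (fob q) k" if fs: "fs \<in> chains (arr C) (far p) (far q) k"
  proof (rule chainsI)
    show "fob q (map (tgt C) fs ! i) = fob p (map (tgt C) fs ! Suc i)" if "Suc i < k" for i
      using arg_cong[OF chainsD(3)[OF fs that], of "tgt B"] chainsD(1,2)[OF fs] that by simp
  qed (use chainsD[OF fs] in auto)
  show "map (ident C) xs \<in> chains (arr C) (far p) (far q) k" if xs: "xs \<in> chains (obj C) (fob p) (fob q) k"
    by (rule chainsI) (use chainsD[OF xs] in auto)
  show "map2 (cmp C) gs fs \<in> chains (arr C) (far p) (far q) k"
    if fs: "fs \<in> chains (arr C) (far p) (far q) k" and gs: "gs \<in> chains (arr C) (far p) (far q) k"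
      and e: "map (src C) gs = map (tgt C) fs"
    by (rule chainsI) (use chainsD[OF fs] chainsD[OF gs] map_eq_nthD[OF e] in auto)
qed

lemma category_fibre_power:
  assumes p: "is_functor C B p" and q: "is_functor C B q"
  shows "category (fibre_power C p q k)"
proof -
  have [simp]: "category C" "category B"
    using p by (simp_all add: is_functor_def)
  note cl = fibre_power_closed[OF p q]
  show ?thesis
    unfolding fibre_power_def
  proof (rule category_mk_cat, goal_cases)
    case (1 f) then show ?case by (rule cl)
  next
    case (2 f) then show ?case by (rule cl)
  next
    case (3 x) then show ?case by (rule cl)
  next
    case (4 x) then show ?case by (auto intro!: nth_equalityI simp: chainsD(1,2))
  next
    case (5 x) then show ?case by (auto intro!: nth_equalityI simp: chainsD(1,2))
  next
    case (6 f g)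
    then show ?case
      using map_eq_nthD[OF 6(3)] by (auto intro!: nth_equalityI cl(4) simp: chainsD(1,2))
  next
    case (7 f) then show ?case by (auto intro!: nth_equalityI simp: chainsD(1,2))
  next
    case (8 f) then show ?case by (auto intro!: nth_equalityI simp: chainsD(1,2))
  next
    case (9 f g h)
    then show ?case
      using map_eq_nthD[OF 9(4)] map_eq_nthD[OF 9(5)] by (auto intro!: nth_equalityI simp: chainsD(1,2))
  qed
qed

section \<open>The nerve of a single row\<close>

definition nvalid :: "('o, 'o) cat \<Rightarrow> nat \<Rightarrow> 'o list \<Rightarrow> bool" where
  "nvalid C k xs \<longleftrightarrow> (if k = 0 then \<exists>v \<in> obj C. xs = [v] else xs \<in> chains (arr C) (src C) (tgt C) k)"

abbreviation nvtx :: "('o, 'o) cat \<Rightarrow> nat \<Rightarrow> 'o list \<Rightarrow> nat \<Rightarrow> 'o" where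
  "nvtx C \<equiv> nerve_vertex (src C) (tgt C)"

definition npath :: "('o, 'o) cat \<Rightarrow> nat \<Rightarrow> 'o list \<Rightarrow> nat \<Rightarrow> nat \<Rightarrow> 'o" where
  "npath C k xs a b = foldl (\<lambda>y x. cmp C x y) (ident C (nvtx C k xs a)) (map ((!) xs) [a..<b])"

text \<open>The formula of \<open>nerve_map\<close> read in an arbitrary category. The object part
  and the arrow part of the action on a horizontal nerve are its instances at the two rows, so their
  functoriality is proved once.\<close>

definition nmap :: "('o, 'o) cat \<Rightarrow> nat \<Rightarrow> nat \<Rightarrow> (nat \<Rightarrow> nat) \<Rightarrow> 'o list \<Rightarrow> 'o list" where
  "nmap C m k \<phi> xs = (if m = 0 then [nvtx C k xs (\<phi> 0)] else map (\<lambda>j. npath C k xs (\<phi> j) (\<phi> (Suc j))) [0..<m])"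

lemma nvalid_length: "nvalid C k xs \<Longrightarrow> length xs = (if k = 0 then 1 else k)"
  by (auto simp: nvalid_def chainsD(1) split: if_splits)

lemma nvalid_ne: "nvalid C k xs \<Longrightarrow> xs \<noteq> []"
  using nvalid_length by (cases k) fastforce+

lemma nvalid_nth:
  assumes "nvalid C k xs" "i < k"
  shows "xs ! i \<in> arr C" "src C (xs ! i) = nvtx C k xs i" "tgt C (xs ! i) = nvtx C k xs (Suc i)"
proof -
  have c: "xs \<in> chains (arr C) (src C) (tgt C) k"
    using assms by (auto simp: nvalid_def)
  show "xs ! i \<in> arr C" "tgt C (xs ! i) = nvtx C k xs (Suc i)"
    using chainsD[OF c] assms by (auto simp: nerve_vertex_def)
  show "src C (xs ! i) = nvtx C k xs i"
  proof (cases i)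
    case 0
    then show ?thesis
      using chainsD(1)[OF c] assms by (auto simp: nerve_vertex_def hd_conv_nth)
  next
    case (Suc j)
    then show ?thesis
      using chainsD(3)[OF c, of j] assms by (auto simp: nerve_vertex_def)
  qed
qed

lemma nvtx_obj:
  assumes "category C" "nvalid C k xs" "i \<le> k"
  shows "nvtx C k xs i \<in> obj C"
proof (cases "k = 0")
  case True
  then show ?thesis
    using assms by (auto simp: nvalid_def nerve_vertex_def)
next
  case False
  show ?thesis
  proof (cases i)
    case 0
    then show ?thesis
      using nvalid_nth[OF assms(2), of 0] False assms(1) cat_src_obj[of C "xs ! 0"] by simp
  next
    case (Suc j)
    then show ?thesis
      using nvalid_nth[OF assms(2), of j] assms cat_tgt_obj[of C "xs ! j"] by simp
  qed
qed

lemma npath_refl: "npath C k xs a a = ident C (nvtx C k xs a)"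
  by (simp add: npath_def)

lemma npath_Suc: "a \<le> b \<Longrightarrow> npath C k xs a (Suc b) = cmp C (xs ! b) (npath C k xs a b)"
  by (simp add: npath_def)

lemma npath_arr:
  assumes "category C" "nvalid C k xs" "a \<le> b" "b \<le> k"
  shows "npath C k xs a b \<in> arr C \<and> src C (npath C k xs a b) = nvtx C k xs a \<and> tgt C (npath C k xs a b) = nvtx C k xs b"
  using assms(3,4)
proof (induction b rule: dec_induct)
  case base
  then show ?case
    using assms by (simp add: npath_refl nvtx_obj)
next
  case (step b)
  then show ?case
    using assms nvalid_nth[OF assms(2), of b] by (simp add: npath_Suc)
qed

lemma npath_rules:
  assumes "category C" "nvalid C k xs" "a \<le> b" "b \<le> k"
  shows "npath C k xs a b \<in> arr C" "src C (npath C k xs a b) = nvtx C k xs a" "tgt C (npath C k xs a b) = nvtx C k xs b"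
  using npath_arr[OF assms] by auto

lemma npath_single:
  assumes "category C" "nvalid C k xs" "i < k"
  shows "npath C k xs i (Suc i) = xs ! i"
  using assms nvalid_nth[OF assms(2,3)] by (simp add: npath_Suc npath_refl)

lemma npath_trans:
  assumes "category C" "nvalid C k xs" "a \<le> b" "b \<le> c" "c \<le> k"
  shows "npath C k xs a c = cmp C (npath C k xs b c) (npath C k xs a b)"
  using assms(4,5)
proof (induction c rule: dec_induct)
  case base
  then show ?case
    using assms npath_rules[OF assms(1-3)] by (simp add: npath_refl)
next
  case (step c)
  then show ?case
    using assms(1,3) npath_rules[OF assms(1-3)] npath_rules[OF assms(1,2), of b c] nvalid_nth[OF assms(2), of c]
    by (simp add: npath_Suc)
qed

lemma Delta_mono: "\<phi> \<in> Delta m n \<Longrightarrow> i \<le> j \<Longrightarrow> j \<le> m \<Longrightarrow> \<phi> i \<le> \<phi> j"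
  by (auto simp: Delta_def mono_on_def)

lemma Delta_le: "\<phi> \<in> Delta m n \<Longrightarrow> i \<le> m \<Longrightarrow> \<phi> i \<le> n"
  by (auto simp: Delta_def)

lemma nmap_valid:
  assumes "category C" "nvalid C k xs" "\<phi> \<in> Delta m k"
  shows "nvalid C m (nmap C m k \<phi> xs)"
proof (cases "m = 0")
  case True
  then show ?thesis
    using assms nvtx_obj[OF assms(1,2), of "\<phi> 0"] Delta_le[OF assms(3), of 0] by (simp add: nmap_def nvalid_def)
next
  case False
  have "npath C k xs (\<phi> j) (\<phi> (Suc j)) \<in> arr C" "src C (npath C k xs (\<phi> j) (\<phi> (Suc j))) = nvtx C k xs (\<phi> j)"
    "tgt C (npath C k xs (\<phi> j) (\<phi> (Suc j))) = nvtx C k xs (\<phi> (Suc j))" if "j < m" for j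
    using npath_rules[OF assms(1,2), of "\<phi> j" "\<phi> (Suc j)"] Delta_mono[OF assms(3), of j "Suc j"] Delta_le[OF assms(3), of "Suc j"] that
    by simp_all
  then show ?thesis
    using False by (auto simp: nmap_def nvalid_def intro!: chainsI)
qed

lemma nmap_nth: "j < m \<Longrightarrow> nmap C m k \<phi> xs ! j = npath C k xs (\<phi> j) (\<phi> (Suc j))"
  by (simp add: nmap_def)

lemma nmap_vtx:
  assumes "category C" "nvalid C k xs" "\<phi> \<in> Delta m k" "i \<le> m"
  shows "nvtx C m (nmap C m k \<phi> xs) i = nvtx C k xs (\<phi> i)"
proof (cases "m = 0")
  case True
  then show ?thesis
    using assms(4) by (simp add: nmap_def nerve_vertex_def)
next
  case False
  note v = nmap_valid[OF assms(1-3)]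
  show ?thesis
  proof (cases i)
    case 0
    then show ?thesis
      using nvalid_nth(2)[OF v, of 0] False npath_rules[OF assms(1,2), of "\<phi> 0" "\<phi> (Suc 0)"]
        Delta_mono[OF assms(3), of 0 "Suc 0"] Delta_le[OF assms(3), of "Suc 0"] by (simp add: nmap_nth)
  next
    case (Suc j)
    then show ?thesis
      using nvalid_nth(3)[OF v, of j] assms(4) npath_rules[OF assms(1,2), of "\<phi> j" "\<phi> (Suc j)"]
        Delta_mono[OF assms(3), of j "Suc j"] Delta_le[OF assms(3), of "Suc j"] by (simp add: nmap_nth)
  qed
qed

text \<open>Entries of the image list are composites over adjacent segments, and composites over
  adjacent segments concatenate. Functoriality in \<open>\<phi>\<close> follows at once.\<close>

lemma nmap_path:
  assumes "category C" "nvalid C k xs" "\<phi> \<in> Delta m k" "a \<le> b" "b \<le> m"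
  shows "npath C m (nmap C m k \<phi> xs) a b = npath C k xs (\<phi> a) (\<phi> b)"
  using assms(4,5)
proof (induction b rule: dec_induct)
  case base
  then show ?case
    by (simp add: npath_refl nmap_vtx[OF assms(1-3)])
next
  case (step b)
  then show ?case
    using npath_trans[OF assms(1,2), of "\<phi> a" "\<phi> b" "\<phi> (Suc b)"] Delta_mono[OF assms(3), of a b]
      Delta_mono[OF assms(3), of b "Suc b"] Delta_le[OF assms(3), of "Suc b"]
    by (simp add: npath_Suc nmap_nth)
qed

lemma nmap_nmap:
  assumes "category C" "nvalid C n xs" "\<phi> \<in> Delta m n" "\<psi> \<in> Delta l m"
  shows "nmap C l m \<psi> (nmap C m n \<phi> xs) = nmap C l n (compose {..l} \<phi> \<psi>) xs"
proof -
  have "nvtx C m (nmap C m n \<phi> xs) (\<psi> 0) = nvtx C n xs (\<phi> (\<psi> 0))"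
    using nmap_vtx[OF assms(1-3), of "\<psi> 0"] Delta_le[OF assms(4), of 0] by simp
  moreover have "npath C m (nmap C m n \<phi> xs) (\<psi> j) (\<psi> (Suc j)) = npath C n xs (\<phi> (\<psi> j)) (\<phi> (\<psi> (Suc j)))" if "j < l" for j
    using nmap_path[OF assms(1-3), of "\<psi> j" "\<psi> (Suc j)"] Delta_mono[OF assms(4), of j "Suc j"] Delta_le[OF assms(4), of "Suc j"] that by simp
  ultimately show ?thesis
    by (auto simp: nmap_def[of C l] compose_def)
qed

lemma nmap_id:
  assumes "category C" "nvalid C n xs"
  shows "nmap C n n (\<lambda>i\<in>{..n}. i) xs = xs"
proof (cases "n = 0")
  case True
  then show ?thesis
    using assms by (auto simp: nmap_def nvalid_def nerve_vertex_def)
next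
  case False
  then show ?thesis
    using nvalid_length[OF assms(2)] npath_single[OF assms] by (auto simp: nmap_def intro!: nth_equalityI)
qed

text \<open>The part of functoriality needed to commute with \<open>nmap\<close>. The vertical
  source, target and identity operations are of this kind, as maps between the two rows; lists of
  level 0 contain objects of the row, so they are mapped by \<open>h0\<close> instead of
  \<open>h1\<close>.\<close>

locale row_hom =
  fixes C :: "('o, 'o) cat" and D :: "('p, 'p) cat" and h0 h1 :: "'o \<Rightarrow> 'p"
  assumes dom_cat: "category C"
    and h_src: "f \<in> arr C \<Longrightarrow> src D (h1 f) = h0 (src C f)"
    and h_tgt: "f \<in> arr C \<Longrightarrow> tgt D (h1 f) = h0 (tgt C f)"
    and h_ident: "x \<in> obj C \<Longrightarrow> h1 (ident C x) = ident D (h0 x)"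
    and h_cmp: "f \<in> arr C \<Longrightarrow> g \<in> arr C \<Longrightarrow> src C g = tgt C f \<Longrightarrow> h1 (cmp C g f) = cmp D (h1 g) (h1 f)"
begin

lemma hom_vtx:
  assumes "nvalid C k xs" "i \<le> k"
  shows "nvtx D k (map (if k = 0 then h0 else h1) xs) i = h0 (nvtx C k xs i)"
proof -
  have "hd xs \<in> arr C" if "k \<noteq> 0"
    using nvalid_nth(1)[OF assms(1), of 0] nvalid_length[OF assms(1)] that by (cases xs) auto
  moreover have "xs ! (i - 1) \<in> arr C" if "i \<noteq> 0"
    using nvalid_nth(1)[OF assms(1), of "i - 1"] that assms by auto
  ultimately show ?thesis
    using nvalid_length[OF assms(1)] assms(2) by (auto simp: nerve_vertex_def h_src h_tgt hd_map[OF nvalid_ne[OF assms(1)]])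
qed

lemma hom_path:
  assumes "nvalid C k xs" "a \<le> b" "b \<le> k"
  shows "npath D k (map (if k = 0 then h0 else h1) xs) a b = h1 (npath C k xs a b)"
  using assms(2,3)
proof (induction b rule: dec_induct)
  case base
  then show ?case
    using hom_vtx[OF assms(1)] nvtx_obj[OF dom_cat assms(1)] by (simp only: npath_refl h_ident)
next
  case (step b)
  then show ?case
    using nvalid_nth[OF assms(1), of b] npath_rules[OF dom_cat assms(1), of a b] nvalid_length[OF assms(1)]
    by (simp add: npath_Suc h_cmp)
qed

lemma hom_nmap:
  assumes "nvalid C k xs" "\<phi> \<in> Delta m k"
  shows "nmap D m k \<phi> (map (if k = 0 then h0 else h1) xs) = map (if m = 0 then h0 else h1) (nmap C m k \<phi> xs)"
proof (cases "m = 0")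
  case True
  then show ?thesis
    using hom_vtx[OF assms(1) Delta_le[OF assms(2), of 0]] by (simp add: nmap_def)
next
  case False
  have "npath D k (map (if k = 0 then h0 else h1) xs) (\<phi> j) (\<phi> (Suc j)) = h1 (npath C k xs (\<phi> j) (\<phi> (Suc j)))" if "j < m" for j
    using hom_path[OF assms(1), of "\<phi> j" "\<phi> (Suc j)"] Delta_mono[OF assms(2), of j "Suc j"] Delta_le[OF assms(2), of "Suc j"] that by simp
  then show ?thesis
    using False by (simp add: nmap_def)
qed

end

section \<open>Assembling the two rows\<close>

lemma object_row_simps [simp]:
  "obj (object_row X) = obj (cat0 X)" "arr (object_row X) = obj (cat1 X)"
  "src (object_row X) = fob (hdom X)" "tgt (object_row X) = fob (hcod X)"
  "ident (object_row X) = fob (hid X)" "cmp (object_row X) g f = fob (hcmp X) [f, g]"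
  by (simp_all add: object_row_def)

lemma arrow_row_simps [simp]:
  "obj (arrow_row X) = arr (cat0 X)" "arr (arrow_row X) = arr (cat1 X)"
  "src (arrow_row X) = far (hdom X)" "tgt (arrow_row X) = far (hcod X)"
  "ident (arrow_row X) = far (hid X)" "cmp (arrow_row X) g f = far (hcmp X) [f, g]"
  by (simp_all add: arrow_row_def)

lemma nerve_map_rows:
  "nerve_map (fob (hdom X)) (fob (hcod X)) (fob (hid X)) (fob (hcmp X)) = nmap (object_row X)"
  "nerve_map (far (hdom X)) (far (hcod X)) (far (hid X)) (far (hcmp X)) = nmap (arrow_row X)"
  by (simp_all add: fun_eq_iff nerve_map_def nmap_def npath_def)

lemma nerve_simps:
  "lev (nerve X) = nerve_lev X"
  "act (nerve X) m k \<phi> = (if \<phi> \<in> Delta m k then functor_on (nerve_lev X k) (nmap (object_row X) m k \<phi>) (nmap (arrow_row X) m k \<phi>) else undefined)"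
  by (simp_all add: nerve_def nerve_map_rows)

lemma chains2 [simp]: "[f, g] \<in> chains S p q 2 \<longleftrightarrow> f \<in> S \<and> g \<in> S \<and> q f = p g"
  by (auto simp: chains_def less_Suc_eq_0_disj)

lemma chains_1: "xs \<in> chains S p q (Suc 0) \<longleftrightarrow> (\<exists>v \<in> S. xs = [v])"
  by (auto simp: chains_def length_Suc_conv)

context double_category
begin

lemma cats [simp]: "category (cat0 X)" "category (cat1 X)" "category (object_row X)" "category (arrow_row X)"
  using hdom_functor object_row_category arrow_row_category by (auto simp: is_functor_def)

lemmas hrules [simp] = functor_rules[OF hdom_functor] functor_rules[OF hcod_functor] functor_rules[OF hid_functor]

lemma hcmp_rules:
  assumes "f \<in> arr (cat1 X)" "g \<in> arr (cat1 X)" "far (hcod X) f = far (hdom X) g"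
  shows "far (hcmp X) [f, g] \<in> arr (cat1 X)"
    "src (cat1 X) (far (hcmp X) [f, g]) = fob (hcmp X) [src (cat1 X) f, src (cat1 X) g]"
    "tgt (cat1 X) (far (hcmp X) [f, g]) = fob (hcmp X) [tgt (cat1 X) f, tgt (cat1 X) g]"
  using fun_arr[OF hcmp_functor, of "[f, g]"] assms by simp_all

lemma hcmp_ident:
  assumes "x \<in> obj (cat1 X)" "y \<in> obj (cat1 X)" "fob (hcod X) x = fob (hdom X) y"
  shows "far (hcmp X) [ident (cat1 X) x, ident (cat1 X) y] = ident (cat1 X) (fob (hcmp X) [x, y])"
  using fun_ident[OF hcmp_functor, of "[x, y]"] assms by simp

lemma hcmp_interchange:
  assumes "f \<in> arr (cat1 X)" "g \<in> arr (cat1 X)" "far (hcod X) f = far (hdom X) g"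
    "f' \<in> arr (cat1 X)" "g' \<in> arr (cat1 X)" "far (hcod X) f' = far (hdom X) g'"
    "src (cat1 X) f' = tgt (cat1 X) f" "src (cat1 X) g' = tgt (cat1 X) g"
  shows "far (hcmp X) [cmp (cat1 X) f' f, cmp (cat1 X) g' g] = cmp (cat1 X) (far (hcmp X) [f', g']) (far (hcmp X) [f, g])"
  using fun_cmp[OF hcmp_functor, of "[f, g]" "[f', g']"] assms by simp

text \<open>The axioms say that the horizontal structure functors respect vertical sources, targets
  and identities. Read the other way, each of these vertical operations respects the horizontal
  structure.\<close>

lemma row_homs:
  "row_hom (arrow_row X) (object_row X) (src (cat0 X)) (src (cat1 X))"
  "row_hom (arrow_row X) (object_row X) (tgt (cat0 X)) (tgt (cat1 X))"
  "row_hom (object_row X) (arrow_row X) (ident (cat0 X)) (ident (cat1 X))"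
  by (rule row_hom.intro; simp add: hcmp_rules hcmp_ident)+

abbreviation "c0 k \<equiv> if k = 0 then cat0 X else cat1 X"

lemma nerve_lev_obj: "xs \<in> obj (nerve_lev X k) \<longleftrightarrow> nvalid (object_row X) k xs"
  by (auto simp: nerve_lev_def nvalid_def chains_1)

lemma nerve_lev_arr: "xs \<in> arr (nerve_lev X k) \<longleftrightarrow> nvalid (arrow_row X) k xs"
  by (auto simp: nerve_lev_def nvalid_def chains_1)

lemma nerve_lev_simps:
  "nvalid (arrow_row X) k f \<Longrightarrow> src (nerve_lev X k) f = map (if k = 0 then src (cat0 X) else src (cat1 X)) f"
  "nvalid (arrow_row X) k f \<Longrightarrow> tgt (nerve_lev X k) f = map (if k = 0 then tgt (cat0 X) else tgt (cat1 X)) f"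
  "nvalid (object_row X) k x \<Longrightarrow> ident (nerve_lev X k) x = map (if k = 0 then ident (cat0 X) else ident (cat1 X)) x"
  "nvalid (arrow_row X) k f \<Longrightarrow> nvalid (arrow_row X) k g \<Longrightarrow>
     map (if k = 0 then src (cat0 X) else src (cat1 X)) g = map (if k = 0 then tgt (cat0 X) else tgt (cat1 X)) f \<Longrightarrow>
     cmp (nerve_lev X k) g f = map2 (cmp (c0 k)) g f"
  by (auto simp: nerve_lev_arr[symmetric] nerve_lev_obj[symmetric] nerve_lev_def)

lemma nerve_lev_category: "category (nerve_lev X k)"
  unfolding nerve_lev_def by (auto intro!: category_fibre_power hdom_functor hcod_functor is_functor_id)

text \<open>Vertical composition is defined on composable pairs only and is therefore not a
  \<open>row_hom\<close>. The same induction along the path is carried out directly, with the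
  interchange law as its inductive step.\<close>

lemma nmap_cmp:
  assumes f: "nvalid (arrow_row X) k f" and g: "nvalid (arrow_row X) k g"
    and e: "map (if k = 0 then src (cat0 X) else src (cat1 X)) g = map (if k = 0 then tgt (cat0 X) else tgt (cat1 X)) f"
    and \<phi>: "\<phi> \<in> Delta m k"
  shows "nmap (arrow_row X) m k \<phi> (map2 (cmp (c0 k)) g f) = map2 (cmp (c0 m)) (nmap (arrow_row X) m k \<phi> g) (nmap (arrow_row X) m k \<phi> f)"
proof -
  let ?A = "arrow_row X"
  note e1 = map_eq_nthD[OF e]
  note [simp] = nvalid_length[OF f] nvalid_length[OF g]
  interpret s: row_hom "arrow_row X" "object_row X" "src (cat0 X)" "src (cat1 X)" by (rule row_homs)
  interpret t: row_hom "arrow_row X" "object_row X" "tgt (cat0 X)" "tgt (cat1 X)" by (rule row_homs)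
  \<comment> \<open>Composability has to be known for all vertices and all partial composites before
    interchange can be applied to them.\<close>
  have vcomp: "src (cat0 X) (nvtx ?A k g i) = tgt (cat0 X) (nvtx ?A k f i)" if "i \<le> k" for i
    using s.hom_vtx[OF g that] t.hom_vtx[OF f that] by (simp only: e)
  have pcomp: "src (cat1 X) (npath ?A k g a b) = tgt (cat1 X) (npath ?A k f a b)" if "a \<le> b" "b \<le> k" for a b
    using s.hom_path[OF g that] t.hom_path[OF f that] by (simp only: e)
  have v: "nvtx ?A k (map2 (cmp (c0 k)) g f) i = cmp (cat0 X) (nvtx ?A k g i) (nvtx ?A k f i)" if "i \<le> k" for i
  proof (cases "k = 0")
    case True
    then show ?thesis
      using nvalid_ne[OF f] nvalid_ne[OF g] by (simp add: nerve_vertex_def hd_zip hd_map)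
  next
    case False
    have *: "f ! j \<in> arr (cat1 X)" "g ! j \<in> arr (cat1 X)" "src (cat1 X) (g ! j) = tgt (cat1 X) (f ! j)" if "j < k" for j
      using nvalid_nth(1)[OF f that] nvalid_nth(1)[OF g that] e1[of j] False that by simp_all
    have "f \<noteq> []" "g \<noteq> []"
      by (rule nvalid_ne[OF f] nvalid_ne[OF g])+
    then show ?thesis
      using False *[of 0] *[of "i - 1"] that by (auto simp: nerve_vertex_def hd_conv_nth)
  qed
  have p: "npath ?A k (map2 (cmp (c0 k)) g f) a b = cmp (cat1 X) (npath ?A k g a b) (npath ?A k f a b)" if "a \<le> b" "b \<le> k" for a b
    using that
  proof (induction b rule: dec_induct)
    case base
    then show ?case
      unfolding npath_refl v[OF base]
      using vcomp[of a] nvtx_obj[OF cats(4) f, of a] nvtx_obj[OF cats(4) g, of a] by simp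
  next
    case (step b)
    have "map2 (cmp (c0 k)) g f ! b = cmp (cat1 X) (g ! b) (f ! b)"
      using step by simp
    moreover have "src (cat1 X) (g ! b) = tgt (cat1 X) (f ! b)"
      using e1[of b] step by simp
    moreover have "src (cat1 X) (npath ?A k g a b) = tgt (cat1 X) (npath ?A k f a b)"
      using pcomp step by simp
    moreover note nvalid_nth[OF f, of b] nvalid_nth[OF g, of b] npath_rules[OF cats(4) f, of a b] npath_rules[OF cats(4) g, of a b]
    ultimately show ?case
      using step(1) step.IH step.prems step.hyps by (simp add: npath_Suc hcmp_interchange)
  qed
  show ?thesis
  proof (cases "m = 0")
    case True
    then show ?thesis
      using v[OF Delta_le[OF \<phi>, of 0]] by (simp add: nmap_def)
  next
    case False
    show ?thesis
    proof (rule nth_equalityI)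
      fix j assume "j < length (nmap ?A m k \<phi> (map2 (cmp (c0 k)) g f))"
      then have j: "j < m"
        using False by (simp add: nmap_def)
      have l: "length (nmap ?A m k \<phi> xs) = m" for xs
        using False by (simp add: nmap_def)
      show "nmap ?A m k \<phi> (map2 (cmp (c0 k)) g f) ! j = map2 (cmp (c0 m)) (nmap ?A m k \<phi> g) (nmap ?A m k \<phi> f) ! j"
        using j p[of "\<phi> j" "\<phi> (Suc j)"] Delta_mono[OF \<phi>, of j "Suc j"] Delta_le[OF \<phi>, of "Suc j"] False
        by (simp add: nmap_nth l)
    qed (use False in \<open>simp add: nmap_def\<close>)
  qed
qed

lemma nerve_act_functor:
  assumes \<phi>: "\<phi> \<in> Delta m n"
  shows "is_functor (nerve_lev X n) (nerve_lev X m) (functor_on (nerve_lev X n) (nmap (object_row X) m n \<phi>) (nmap (arrow_row X) m n \<phi>))"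
proof (rule functor_functor_on, goal_cases)
  case 1 show ?case by (rule nerve_lev_category)
next
  case 2 show ?case by (rule nerve_lev_category)
next
  case (3 x)
  then show ?case by (simp add: nerve_lev_obj nmap_valid \<phi>)
next
  case (4 f)
  then have f: "nvalid (arrow_row X) n f" by (simp add: nerve_lev_arr)
  have f': "nvalid (arrow_row X) m (nmap (arrow_row X) m n \<phi> f)" by (rule nmap_valid) (simp_all add: f \<phi>)
  show ?case
    using row_hom.hom_nmap[OF row_homs(1) f \<phi>] row_hom.hom_nmap[OF row_homs(2) f \<phi>] f'
    by (simp only: nerve_lev_simps(1,2)[OF f] nerve_lev_simps(1,2)[OF f'] nerve_lev_arr simp_thms)
next
  case (5 x)
  then have x: "nvalid (object_row X) n x" by (simp add: nerve_lev_obj)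
  have x': "nvalid (object_row X) m (nmap (object_row X) m n \<phi> x)" by (rule nmap_valid) (simp_all add: x \<phi>)
  show ?case
    using row_hom.hom_nmap[OF row_homs(3) x \<phi>] by (simp only: nerve_lev_simps(3)[OF x] nerve_lev_simps(3)[OF x'])
next
  case (6 f g)
  then have f: "nvalid (arrow_row X) n f" and g: "nvalid (arrow_row X) n g" by (simp_all add: nerve_lev_arr)
  have e: "map (if n = 0 then src (cat0 X) else src (cat1 X)) g = map (if n = 0 then tgt (cat0 X) else tgt (cat1 X)) f"
    using 6(3) by (simp only: nerve_lev_simps(1,2)[OF f] nerve_lev_simps(1,2)[OF g])
  have f': "nvalid (arrow_row X) m (nmap (arrow_row X) m n \<phi> f)" and g': "nvalid (arrow_row X) m (nmap (arrow_row X) m n \<phi> g)"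
    by (rule nmap_valid; simp add: f g \<phi>)+
  have e': "map (if m = 0 then src (cat0 X) else src (cat1 X)) (nmap (arrow_row X) m n \<phi> g) =
    map (if m = 0 then tgt (cat0 X) else tgt (cat1 X)) (nmap (arrow_row X) m n \<phi> f)"
    using row_hom.hom_nmap[OF row_homs(1) g \<phi>] row_hom.hom_nmap[OF row_homs(2) f \<phi>] e by metis
  show ?case
    unfolding nerve_lev_simps(4)[OF f g e] nerve_lev_simps(4)[OF f' g' e'] by (rule nmap_cmp[OF f g e \<phi>])
qed

lemma simplicial_nerve: "simplicial_cat (nerve X)"
proof (rule simplicial_cat.intro, goal_cases)
  case (1 n)
  show ?case by (simp add: nerve_simps nerve_lev_category)
next
  case (2 \<phi> m n)
  then show ?case by (simp add: nerve_simps nerve_act_functor)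
next
  case (3 n)
  show ?case
    by (auto simp: nerve_simps id_functor_def nerve_lev_obj nerve_lev_arr nmap_id intro!: functor_on_cong)
next
  case (4 \<psi> l m \<phi> n)
  then show ?case
    by (auto simp: nerve_simps comp_functor_def nerve_lev_obj nerve_lev_arr nmap_nmap nmap_valid Delta_compose
        intro!: functor_on_cong)
next
  case (5 \<phi> m n)
  then show ?case by (simp add: nerve_simps)
qed

end

section \<open>From Tamsamani weak 2-categories to weakly globular double categories\<close>

definition seg :: "nat \<Rightarrow> nat \<Rightarrow> nat \<Rightarrow> nat" where
  "seg a b = (\<lambda>i\<in>{..1}. if i = 0 then a else b)"

definition tri :: "nat \<Rightarrow> nat \<Rightarrow> nat \<Rightarrow> nat \<Rightarrow> nat" where
  "tri a b c = (\<lambda>i\<in>{..2}. if i = 0 then a else if i = 1 then b else c)"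

lemma edge_inclusion_seg: "edge_inclusion (Suc j) = seg j (Suc j)"
  by (auto simp: fun_eq_iff edge_inclusion_def seg_def restrict_def)

lemma seg_Delta [simp]: "a \<le> b \<Longrightarrow> b \<le> k \<Longrightarrow> seg a b \<in> Delta (Suc 0) k"
  by (auto simp: seg_def Delta_def mono_on_def)

lemma tri_Delta [simp]: "a \<le> b \<Longrightarrow> b \<le> c \<Longrightarrow> c \<le> k \<Longrightarrow> tri a b c \<in> Delta 2 k"
  by (auto simp: tri_def Delta_def mono_on_def)

lemma vertex_Delta [simp]: "a \<le> k \<Longrightarrow> vertex_inclusion a \<in> Delta 0 k"
  by (auto simp: vertex_inclusion_def Delta_def mono_on_def)

lemma compose_seg: "\<phi> \<in> Delta k m \<Longrightarrow> a \<le> b \<Longrightarrow> b \<le> k \<Longrightarrow> compose {..Suc 0} \<phi> (seg a b) = seg (\<phi> a) (\<phi> b)"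
  by (auto simp: compose_def seg_def fun_eq_iff)

lemma compose_vertex: "compose {0} \<phi> (vertex_inclusion a) = vertex_inclusion (\<phi> a)"
  by (auto simp: compose_def vertex_inclusion_def fun_eq_iff)

lemma seg_simps [simp]: "seg a b 0 = a" "seg a b (Suc 0) = b"
  by (simp_all add: seg_def)

lemma tri_simps [simp]: "tri a b c 0 = a" "tri a b c (Suc 0) = b" "tri a b c 2 = c"
  by (simp_all add: tri_def)

text \<open>A degenerate edge factors through \<open>[0]\<close>. Whatever is restricted along it
  passes through level 0, where a Tamsamani weak 2-category is discrete.\<close>

lemma seg_vertex: "seg a a = compose {..Suc 0} (vertex_inclusion a) (\<lambda>i\<in>{..Suc 0}. 0)"
  by (auto simp: compose_def seg_def vertex_inclusion_def fun_eq_iff)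

lemma const_Delta [simp]: "(\<lambda>i\<in>{..k}. 0) \<in> Delta k n"
  by (auto simp: Delta_def mono_on_def)

lemma Delta_arb: "\<phi> \<in> Delta k m \<Longrightarrow> i > k \<Longrightarrow> \<phi> i = undefined"
  by (auto simp: Delta_def PiE_def extensional_def)

lemma Delta_eqI: "\<phi> \<in> Delta k m \<Longrightarrow> \<psi> \<in> Delta k n \<Longrightarrow> (\<And>i. i \<le> k \<Longrightarrow> \<phi> i = \<psi> i) \<Longrightarrow> \<phi> = \<psi>"
  using Delta_arb[of \<phi> k m] Delta_arb[of \<psi> k n] by (metis ext not_le_imp_less)

lemma iso_fibre_power:
  assumes p: "is_functor C B p" and q: "is_functor C B q"
    and fs: "fs \<in> chains (arr C) (far p) (far q) k" and iso: "\<And>i. i < k \<Longrightarrow> iso_arr C (fs ! i)"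
  shows "iso_arr (fibre_power C p q k) fs"
proof -
  have [simp]: "category C" "category B"
    using p by (simp_all add: is_functor_def)
  note l = chainsD(1)[OF fs]
  have gs: "map (iinv C) fs \<in> chains (arr C) (far p) (far q) k"
  proof (rule chainsI)
    show "far q (map (iinv C) fs ! i) = far p (map (iinv C) fs ! Suc i)" if "Suc i < k" for i
      using chainsD(3)[OF fs that] iso[of i] iso[of "Suc i"] that by (simp add: l fun_iso[OF p] fun_iso[OF q])
  qed (simp_all add: l iso)
  have iso' [simp]: "iso_arr C f" if "f \<in> set fs" for f
    using iso that l by (auto simp: in_set_conv_nth)
  have e: "map (src C) (map (iinv C) fs) = map (tgt C) fs" "map (tgt C) (map (iinv C) fs) = map (src C) fs"
    by simp_all
  show ?thesis
  proof (rule iso_arrI[of _ _ "map (iinv C) fs"])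
    show "cmp (fibre_power C p q k) (map (iinv C) fs) fs = ident (fibre_power C p q k) (src (fibre_power C p q k) fs)"
      using fs gs fibre_power_closed(1)[OF p q fs] by (subst fibre_power_simps) (auto intro!: nth_equalityI)
    show "cmp (fibre_power C p q k) fs (map (iinv C) fs) = ident (fibre_power C p q k) (tgt (fibre_power C p q k) fs)"
      using fs gs fibre_power_closed(2)[OF p q fs] by (subst fibre_power_simps) (auto intro!: nth_equalityI)
  qed (use fs gs e in \<open>simp_all del: map_map\<close>)
qed

section \<open>Path components\<close>

lemma path_component_arr:
  assumes C: "category C" and f: "f \<in> arr C"
  shows "path_component C (src C f) = path_component C (tgt C f)"
proof -
  define R where "R = {(src C f, tgt C f) |f. f \<in> arr C} \<union> {(tgt C f, src C f) |f. f \<in> arr C}"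
  have "(src C f, tgt C f) \<in> R\<^sup>*" "(tgt C f, src C f) \<in> R\<^sup>*"
    using f by (auto simp: R_def)
  then show ?thesis
    unfolding path_component_def R_def[symmetric] by (blast intro: rtrancl_trans)
qed

lemma components_cat_simps [simp]:
  "obj (components_cat C) = path_component C ` obj C" "arr (components_cat C) = path_component C ` obj C"
  "c \<in> path_component C ` obj C \<Longrightarrow> src (components_cat C) c = c"
  "c \<in> path_component C ` obj C \<Longrightarrow> tgt (components_cat C) c = c"
  "c \<in> path_component C ` obj C \<Longrightarrow> ident (components_cat C) c = c"
  "c \<in> path_component C ` obj C \<Longrightarrow> cmp (components_cat C) c c = c"
  by (simp_all add: components_cat_def discrete_cat_def)

lemma category_components_cat [simp]: "category (components_cat C)"
  unfolding components_cat_def discrete_cat_def by (rule category_mk_cat) auto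

lemma quotient_functor_simps [simp]:
  "x \<in> obj C \<Longrightarrow> fob (quotient_functor C) x = path_component C x"
  "f \<in> arr C \<Longrightarrow> far (quotient_functor C) f = path_component C (src C f)"
  by (simp_all add: quotient_functor_def)

lemma is_functor_quotient: "category C \<Longrightarrow> is_functor C (components_cat C) (quotient_functor C)"
  unfolding quotient_functor_def by (rule functor_functor_on) (auto simp: path_component_arr)

lemma path_component_self: "x \<in> obj C \<Longrightarrow> x \<in> path_component C x"
  by (simp add: path_component_def)

section \<open>Segal maps and formal restrictions of objects\<close>

context simplicial_cat
begin

abbreviation "L n \<equiv> lev X n"
abbreviation "fo m n \<phi> \<equiv> fob (act X m n \<phi>)"
abbreviation "fa m n \<phi> \<equiv> far (act X m n \<phi>)"

lemma self_simplicial [simp]: "simplicial_cat X"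
  by (rule simplicial_cat_axioms)

lemma compose_fo:
  "\<psi> \<in> Delta l m \<Longrightarrow> \<phi> \<in> Delta m n \<Longrightarrow> x \<in> obj (L n) \<Longrightarrow> fo l m \<psi> (fo m n \<phi> x) = fo l n (compose {..l} \<phi> \<psi>) x"
  "\<psi> \<in> Delta l m \<Longrightarrow> \<phi> \<in> Delta m n \<Longrightarrow> f \<in> arr (L n) \<Longrightarrow> fa l m \<psi> (fa m n \<phi> f) = fa l n (compose {..l} \<phi> \<psi>) f"
  by (simp_all add: act_compose)

lemma fo_seg_vertex:
  assumes "a \<le> b" "b \<le> k" "x \<in> obj (L k)"
  shows "fo 0 (Suc 0) (vertex_inclusion 0) (fo (Suc 0) k (seg a b) x) = fo 0 k (vertex_inclusion a) x"
    "fo 0 (Suc 0) (vertex_inclusion (Suc 0)) (fo (Suc 0) k (seg a b) x) = fo 0 k (vertex_inclusion b) x"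
  using assms by (simp_all add: compose_fo compose_vertex)

lemma segal_map_simps:
  "x \<in> obj (L k) \<Longrightarrow> fob (segal_map X k) x = map (\<lambda>j. fo (Suc 0) k (seg j (Suc j)) x) [0..<k]"
  "f \<in> arr (L k) \<Longrightarrow> far (segal_map X k) f = map (\<lambda>j. fa (Suc 0) k (seg j (Suc j)) f) [0..<k]"
  by (auto simp: segal_map_def edge_inclusion_seg[symmetric] simp del: upt_Suc intro!: nth_equalityI)

lemma id_seg: "(\<lambda>i\<in>{..Suc 0}. i) = seg 0 (Suc 0)"
  by (auto simp: seg_def fun_eq_iff)

lemma is_functor_vertex: "a \<le> Suc 0 \<Longrightarrow> is_functor (L (Suc 0)) (L 0) (act X 0 (Suc 0) (vertex_inclusion a))"
  by (rule act_fun) simp_all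

lemma segal_target_eq:
  "segal_target X k = fibre_power (L (Suc 0)) (act X 0 (Suc 0) (vertex_inclusion 0)) (act X 0 (Suc 0) (vertex_inclusion (Suc 0))) k"
  by (simp add: segal_target_def)

text \<open>A triple \<open>(m, \<phi>, x)\<close> in \<open>T k\<close> stands for the object \<open>X(\<phi>)(x)\<close> of \<open>X\<^sub>k\<close>.\<close>

definition T where "T k = {s. fst (snd s) \<in> Delta k (fst s) \<and> snd (snd s) \<in> obj (L (fst s))}"
definition ev where "ev k s = fo k (fst s) (fst (snd s)) (snd (snd s))"
definition res :: "nat \<Rightarrow> (nat \<Rightarrow> nat) \<Rightarrow> nat \<times> (nat \<Rightarrow> nat) \<times> 'o \<Rightarrow> nat \<times> (nat \<Rightarrow> nat) \<times> 'o" where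
  "res l \<theta> s = (fst s, compose {..l} (fst (snd s)) \<theta>, snd (snd s))"

lemma ev_obj [simp]: "s \<in> T k \<Longrightarrow> ev k s \<in> obj (L k)"
  by (auto simp: T_def ev_def)

lemma res_T [simp]: "s \<in> T n \<Longrightarrow> \<theta> \<in> Delta l n \<Longrightarrow> res l \<theta> s \<in> T l"
  by (auto simp: T_def res_def)

lemma res_ev [simp]: "s \<in> T n \<Longrightarrow> \<theta> \<in> Delta l n \<Longrightarrow> ev l (res l \<theta> s) = fo l n \<theta> (ev n s)"
  by (auto simp: T_def res_def ev_def compose_fo)

end

locale discrete_objects = simplicial_cat Y for Y :: "('o, 'a) scat" +
  assumes discrete: "is_discrete (lev Y 0)"
begin

lemma Y0_arr:
  assumes "f \<in> arr (L 0)"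
  shows "tgt (L 0) f = src (L 0) f" "f = ident (L 0) (src (L 0) f)"
proof -
  obtain x where "x \<in> obj (L 0)" "f = ident (L 0) x"
    using assms discrete by (auto simp: is_discrete_def)
  then show "tgt (L 0) f = src (L 0) f" "f = ident (L 0) (src (L 0) f)"
    by simp_all
qed

text \<open>The images of an arrow of level 1 at its two vertices are identities, hence determined
  by the source of the arrow. A list of arrows is thus a chain as soon as the sources are.\<close>

lemma segal_chain:
  assumes "length fs = k" "\<And>j. j < k \<Longrightarrow> fs ! j \<in> arr (L (Suc 0))"
    "\<And>j. Suc j < k \<Longrightarrow> fo 0 (Suc 0) (vertex_inclusion (Suc 0)) (src (L (Suc 0)) (fs ! j)) = fo 0 (Suc 0) (vertex_inclusion 0) (src (L (Suc 0)) (fs ! Suc j))"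
  shows "fs \<in> chains (arr (L (Suc 0))) (fa 0 (Suc 0) (vertex_inclusion 0)) (fa 0 (Suc 0) (vertex_inclusion (Suc 0))) k"
proof (rule chainsI)
  fix j assume j: "Suc j < k"
  show "fa 0 (Suc 0) (vertex_inclusion (Suc 0)) (fs ! j) = fa 0 (Suc 0) (vertex_inclusion 0) (fs ! Suc j)"
    using Y0_arr(2)[of "fa 0 (Suc 0) (vertex_inclusion (Suc 0)) (fs ! j)"] Y0_arr(2)[of "fa 0 (Suc 0) (vertex_inclusion 0) (fs ! Suc j)"]
      assms(2)[of j] assms(2)[of "Suc j"] assms(3)[OF j] j by simp
qed (use assms in auto)

end

text \<open>
  The double category built from \<open>Y\<close> has as objects the vertices \<open>(m, i, y)\<close> of the objects \<open>y\<close> of the \<open>Y\<^sub>m\<close> and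
  as horizontal arrows their edges \<open>(m, i \<le> j, y)\<close>, so that composable strings lie on one \<open>y\<close> and
  composition is strict.  Vertical arrows and cells are those of \<open>Y\<^sub>0\<close> and \<open>Y\<^sub>1\<close> between the underlying
  objects; cells compose horizontally because the Segal map \<open>\<eta>\<^sub>2\<close> is fully faithful.  The injections
  \<open>k0\<close>, \<open>k0a\<close>, \<open>k1\<close>, \<open>k1a\<close> encode all this in the universe.
\<close>

locale tam_code = discrete_objects Y for Y :: "('o, 'a) scat" +
  fixes k0 :: "nat \<times> nat \<times> 'o \<Rightarrow> 'u" and k0a :: "(nat \<times> nat \<times> 'o) \<times> (nat \<times> nat \<times> 'o) \<Rightarrow> 'u"
    and k1 :: "nat \<times> nat \<times> nat \<times> 'o \<Rightarrow> 'u" and k1a :: "(nat \<times> nat \<times> nat \<times> 'o) \<times> 'a \<times> (nat \<times> nat \<times> nat \<times> 'o) \<Rightarrow> 'u"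
  assumes segal: "2 \<le> k \<Longrightarrow> equivalence_functor (lev Y k) (segal_target Y k) (segal_map Y k)"
    and inj: "inj k0" "inj k0a" "inj k1" "inj k1a"
begin

lemma k_eq [simp]: "k0 a = k0 b \<longleftrightarrow> a = b" "k0a c = k0a d \<longleftrightarrow> c = d" "k1 e = k1 f \<longleftrightarrow> e = f" "k1a g = k1a h \<longleftrightarrow> g = h"
  using inj by (auto simp: inj_eq)

lemma k_inv [simp]: "inv k0 (k0 a) = a" "inv k0a (k0a c) = c" "inv k1 (k1 e) = e" "inv k1a (k1a g) = g"
  using inj by simp_all

lemma segal_ff_es: "2 \<le> k \<Longrightarrow> ff_es (L k) (segal_target Y k) (segal_map Y k)"
  using segal by (simp add: equivalence_functor_iff_ff_es)

text \<open>From level 2 on this is faithfulness of the Segal map. On level 0 an arrow is an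
  identity and determined by its ends; on level 1 the only edge is the identity of
  \<open>[1]\<close>.\<close>

lemma spine_unique:
  assumes F: "F \<in> arr (L k)" "G \<in> arr (L k)" "src (L k) F = src (L k) G" "tgt (L k) F = tgt (L k) G"
    and e: "\<And>j. j < k \<Longrightarrow> fa (Suc 0) k (seg j (Suc j)) F = fa (Suc 0) k (seg j (Suc j)) G"
  shows "F = G"
proof -
  consider "k = 0" | "k = 1" | "2 \<le> k" by linarith
  then show ?thesis
  proof cases
    case 1
    then show ?thesis
      using Y0_arr(2)[of F] Y0_arr(2)[of G] F by auto
  next
    case 2
    then show ?thesis
      using e[of 0] F by (simp add: id_seg[symmetric])
  next
    case 3
    show ?thesis
      by (rule ff_es_faithful[OF segal_ff_es[OF 3] F]) (simp add: segal_map_simps F e)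
  qed
qed

text \<open>Fullness of the Segal map. The prescribed arrows form a chain automatically, because
  their sources are the edges of \<open>x\<close> and level 0 is discrete.\<close>

lemma spine_lift:
  assumes k: "k > 0" and x: "x \<in> obj (L k)" and y: "y \<in> obj (L k)"
    and f: "\<And>j. j < k \<Longrightarrow> f j \<in> arr (L (Suc 0)) \<and> src (L (Suc 0)) (f j) = fo (Suc 0) k (seg j (Suc j)) x \<and> tgt (L (Suc 0)) (f j) = fo (Suc 0) k (seg j (Suc j)) y"
  shows "\<exists>F \<in> arr (L k). src (L k) F = x \<and> tgt (L k) F = y \<and> (\<forall>j<k. fa (Suc 0) k (seg j (Suc j)) F = f j)"
proof (cases "k = 1")
  case True
  then show ?thesis
    using f[of 0] x y by (intro bexI[of _ "f 0"]) (simp_all add: id_seg[symmetric])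
next
  case False
  then have k2: "2 \<le> k"
    using k by simp
  let ?fs = "map f [0..<k]"
  have c: "?fs \<in> chains (arr (L (Suc 0))) (fa 0 (Suc 0) (vertex_inclusion 0)) (fa 0 (Suc 0) (vertex_inclusion (Suc 0))) k"
    by (rule segal_chain) (use f x in \<open>auto simp: fo_seg_vertex\<close>)
  have "\<exists>F \<in> arr (L k). src (L k) F = x \<and> tgt (L k) F = y \<and> far (segal_map Y k) F = ?fs"
    by (rule ff_es_full[OF segal_ff_es[OF k2] x y])
      (use c f in \<open>auto simp: segal_target_eq segal_map_simps x y intro!: nth_equalityI\<close>)
  then obtain F where F: "F \<in> arr (L k)" "src (L k) F = x" "tgt (L k) F = y" "far (segal_map Y k) F = ?fs"
    by blast
  then show ?thesis
    by (intro bexI[of _ F]) (auto simp: segal_map_simps map_eq_conv)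
qed

definition V :: "(nat \<times> nat \<times> 'o) set" where
  "V = {(m, i, y). i \<le> m \<and> y \<in> obj (L m)}"

definition vt :: "nat \<times> nat \<times> 'o \<Rightarrow> 'o" where
  "vt = (\<lambda>(m, i, y). fo 0 m (vertex_inclusion i) y)"

definition E :: "(nat \<times> nat \<times> nat \<times> 'o) set" where
  "E = {(m, i, j, y). i \<le> j \<and> j \<le> m \<and> y \<in> obj (L m)}"

definition ed :: "nat \<times> nat \<times> nat \<times> 'o \<Rightarrow> 'o" where
  "ed = (\<lambda>(m, i, j, y). fo (Suc 0) m (seg i j) y)"

definition d0 :: "nat \<times> nat \<times> nat \<times> 'o \<Rightarrow> nat \<times> nat \<times> 'o" where "d0 = (\<lambda>(m, i, j, y). (m, i, y))"
definition d1 :: "nat \<times> nat \<times> nat \<times> 'o \<Rightarrow> nat \<times> nat \<times> 'o" where "d1 = (\<lambda>(m, i, j, y). (m, j, y))"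
definition sd :: "nat \<times> nat \<times> 'o \<Rightarrow> nat \<times> nat \<times> nat \<times> 'o" where "sd = (\<lambda>(m, i, y). (m, i, i, y))"

text \<open>An arrow of the discrete category \<open>Y_0\<close> amounts to an equality of values,
  so a pair of ends codes it completely. A cell needs its arrow as well, and also its ends, since
  different edges may have the same value.\<close>

definition VA where "VA = {(a, b). a \<in> V \<and> b \<in> V \<and> vt a = vt b}"
definition EA where "EA = {(p, f, q). p \<in> E \<and> q \<in> E \<and> f \<in> arr (L (Suc 0)) \<and> src (L (Suc 0)) f = ed p \<and> tgt (L (Suc 0)) f = ed q}"

lemma V_rules [simp]: "p \<in> E \<Longrightarrow> d0 p \<in> V" "p \<in> E \<Longrightarrow> d1 p \<in> V" "a \<in> V \<Longrightarrow> sd a \<in> E"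
  "d0 (sd a) = a" "d1 (sd a) = a"
  by (auto simp: E_def V_def d0_def d1_def sd_def split: prod.splits)

lemma vt_obj [simp]: "a \<in> V \<Longrightarrow> vt a \<in> obj (L 0)"
  by (auto simp: V_def vt_def)

lemma ed_obj [simp]: "p \<in> E \<Longrightarrow> ed p \<in> obj (L (Suc 0))"
  by (auto simp: E_def ed_def)

lemma vt_d: "p \<in> E \<Longrightarrow> vt (d0 p) = fo 0 (Suc 0) (vertex_inclusion 0) (ed p)"
  "p \<in> E \<Longrightarrow> vt (d1 p) = fo 0 (Suc 0) (vertex_inclusion (Suc 0)) (ed p)"
  by (auto simp: E_def vt_def ed_def d0_def d1_def fo_seg_vertex)

lemma ed_sd: "a \<in> V \<Longrightarrow> ed (sd a) = fo (Suc 0) 0 (\<lambda>i\<in>{..Suc 0}. 0) (vt a)"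
  by (auto simp: V_def vt_def ed_def sd_def seg_vertex compose_fo)

lemma EA_vt:
  assumes "(p, f, q) \<in> EA"
  shows "vt (d0 p) = vt (d0 q)" "vt (d1 p) = vt (d1 q)"
  using assms Y0_arr(1)[of "fa 0 (Suc 0) (vertex_inclusion 0) f"] Y0_arr(1)[of "fa 0 (Suc 0) (vertex_inclusion (Suc 0)) f"]
  by (auto simp: EA_def vt_d)

definition C0 :: "('u, 'u) cat" where
  "C0 = mk_cat (k0 ` V) (k0a ` VA) (\<lambda>f. k0 (fst (inv k0a f))) (\<lambda>f. k0 (snd (inv k0a f)))
     (\<lambda>x. k0a (inv k0 x, inv k0 x)) (\<lambda>g f. k0a (fst (inv k0a f), snd (inv k0a g)))"

definition C1 :: "('u, 'u) cat" where
  "C1 = mk_cat (k1 ` E) (k1a ` EA) (\<lambda>f. k1 (fst (inv k1a f))) (\<lambda>f. k1 (snd (snd (inv k1a f))))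
     (\<lambda>x. k1a (inv k1 x, ident (L (Suc 0)) (ed (inv k1 x)), inv k1 x))
     (\<lambda>g f. k1a (fst (inv k1a f), cmp (L (Suc 0)) (fst (snd (inv k1a g))) (fst (snd (inv k1a f))), snd (snd (inv k1a g))))"

lemma cat_C0 [simp]: "category C0"
  unfolding C0_def by (rule category_mk_cat) (auto simp: VA_def)

lemma cat_C1 [simp]: "category C1"
  unfolding C1_def by (rule category_mk_cat) (auto simp: EA_def)

lemma C0_simps [simp]:
  "obj C0 = k0 ` V" "arr C0 = k0a ` VA"
  "(a, b) \<in> VA \<Longrightarrow> src C0 (k0a (a, b)) = k0 a" "(a, b) \<in> VA \<Longrightarrow> tgt C0 (k0a (a, b)) = k0 b"
  "a \<in> V \<Longrightarrow> ident C0 (k0 a) = k0a (a, a)"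
  "(a, b) \<in> VA \<Longrightarrow> (b, c) \<in> VA \<Longrightarrow> cmp C0 (k0a (b, c)) (k0a (a, b)) = k0a (a, c)"
  by (simp_all add: C0_def)

lemma C1_simps [simp]:
  "obj C1 = k1 ` E" "arr C1 = k1a ` EA"
  "(p, f, q) \<in> EA \<Longrightarrow> src C1 (k1a (p, f, q)) = k1 p" "(p, f, q) \<in> EA \<Longrightarrow> tgt C1 (k1a (p, f, q)) = k1 q"
  "p \<in> E \<Longrightarrow> ident C1 (k1 p) = k1a (p, ident (L (Suc 0)) (ed p), p)"
  "(p, f, q) \<in> EA \<Longrightarrow> (q, g, r) \<in> EA \<Longrightarrow> cmp C1 (k1a (q, g, r)) (k1a (p, f, q)) = k1a (p, cmp (L (Suc 0)) g f, r)"
  by (simp_all add: C1_def)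

lemma VA_iff: "(a, b) \<in> VA \<longleftrightarrow> a \<in> V \<and> b \<in> V \<and> vt a = vt b"
  by (simp add: VA_def)

lemma EA_d [simp]: "(p, f, q) \<in> EA \<Longrightarrow> (d0 p, d0 q) \<in> VA" "(p, f, q) \<in> EA \<Longrightarrow> (d1 p, d1 q) \<in> VA"
  using EA_vt[of p f q] by (auto simp: VA_def EA_def)

lemma VA_refl [simp]: "a \<in> V \<Longrightarrow> (a, a) \<in> VA"
  by (simp add: VA_def)

definition H0 :: "('u, 'u, 'u, 'u) fctr" where
  "H0 = functor_on C1 (\<lambda>x. k0 (d0 (inv k1 x))) (\<lambda>f. k0a (d0 (fst (inv k1a f)), d0 (snd (snd (inv k1a f)))))"
definition H1 :: "('u, 'u, 'u, 'u) fctr" where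
  "H1 = functor_on C1 (\<lambda>x. k0 (d1 (inv k1 x))) (\<lambda>f. k0a (d1 (fst (inv k1a f)), d1 (snd (snd (inv k1a f)))))"
text \<open>The value of \<open>sd a\<close> depends only on \<open>vt a\<close>. The degenerate
  edges at the two ends of a vertical arrow thus have the same value, and its identity is a cell
  between them.\<close>

definition HI :: "('u, 'u, 'u, 'u) fctr" where
  "HI = functor_on C0 (\<lambda>x. k1 (sd (inv k0 x)))
     (\<lambda>f. k1a (sd (fst (inv k0a f)), ident (L (Suc 0)) (ed (sd (fst (inv k0a f)))), sd (snd (inv k0a f))))"

lemma H_simps [simp]:
  "p \<in> E \<Longrightarrow> fob H0 (k1 p) = k0 (d0 p)" "p \<in> E \<Longrightarrow> fob H1 (k1 p) = k0 (d1 p)" "a \<in> V \<Longrightarrow> fob HI (k0 a) = k1 (sd a)"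
  "(p, f, q) \<in> EA \<Longrightarrow> far H0 (k1a (p, f, q)) = k0a (d0 p, d0 q)"
  "(p, f, q) \<in> EA \<Longrightarrow> far H1 (k1a (p, f, q)) = k0a (d1 p, d1 q)"
  "(a, b) \<in> VA \<Longrightarrow> far HI (k0a (a, b)) = k1a (sd a, ident (L (Suc 0)) (ed (sd a)), sd b)"
  by (simp_all add: H0_def H1_def HI_def)

lemma EA_E: "(p, f, q) \<in> EA \<Longrightarrow> p \<in> E \<and> q \<in> E"
  by (simp add: EA_def)

lemma H0_functor: "is_functor C1 C0 H0"
  unfolding H0_def by (rule functor_functor_on) (auto dest: EA_E)

lemma H1_functor: "is_functor C1 C0 H1"
  unfolding H1_def by (rule functor_functor_on) (auto dest: EA_E)

lemma HI_functor: "is_functor C0 C1 HI"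
  unfolding HI_def by (rule functor_functor_on) (auto simp: VA_iff ed_sd EA_def)

end

text \<open>If the composable strings of arrows of \<open>R\<close> are the spines of abstract simplices whose edges compose,
  then \<open>R\<close> is a category.  Both rows of the double category built from \<open>Y\<close> are of this form.\<close>

locale spined =
  fixes R :: "('o, 'o) cat" and \<Sigma> :: "nat \<Rightarrow> 's set" and vtx :: "nat \<Rightarrow> 's \<Rightarrow> nat \<Rightarrow> 'o" and pth :: "nat \<Rightarrow> 's \<Rightarrow> nat \<Rightarrow> nat \<Rightarrow> 'o"
  assumes sp_obj: "x \<in> obj R \<Longrightarrow> \<exists>\<sigma> \<in> \<Sigma> 0. x = vtx 0 \<sigma> 0"
    and sp_ex: "xs \<in> chains (arr R) (src R) (tgt R) k \<Longrightarrow> k > 0 \<Longrightarrow> \<exists>\<sigma> \<in> \<Sigma> k. xs = map (\<lambda>j. pth k \<sigma> j (Suc j)) [0..<k]"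
    and sp_vtx: "\<sigma> \<in> \<Sigma> k \<Longrightarrow> a \<le> k \<Longrightarrow> vtx k \<sigma> a \<in> obj R"
    and sp_pth: "\<sigma> \<in> \<Sigma> k \<Longrightarrow> a \<le> b \<Longrightarrow> b \<le> k \<Longrightarrow> pth k \<sigma> a b \<in> arr R"
    and sp_src: "\<sigma> \<in> \<Sigma> k \<Longrightarrow> a \<le> b \<Longrightarrow> b \<le> k \<Longrightarrow> src R (pth k \<sigma> a b) = vtx k \<sigma> a"
    and sp_tgt: "\<sigma> \<in> \<Sigma> k \<Longrightarrow> a \<le> b \<Longrightarrow> b \<le> k \<Longrightarrow> tgt R (pth k \<sigma> a b) = vtx k \<sigma> b"
    and sp_ident: "\<sigma> \<in> \<Sigma> k \<Longrightarrow> a \<le> k \<Longrightarrow> ident R (vtx k \<sigma> a) = pth k \<sigma> a a"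
    and sp_cmp: "\<sigma> \<in> \<Sigma> k \<Longrightarrow> a \<le> b \<Longrightarrow> b \<le> c \<Longrightarrow> c \<le> k \<Longrightarrow> cmp R (pth k \<sigma> b c) (pth k \<sigma> a b) = pth k \<sigma> a c"
    and sp_ext: "src R \<in> extensional (arr R)" "tgt R \<in> extensional (arr R)" "ident R \<in> extensional (obj R)"
      "\<not> (f \<in> arr R \<and> g \<in> arr R \<and> src R g = tgt R f) \<Longrightarrow> cmp R g f = undefined"
begin

lemmas sp_rules = sp_vtx sp_pth sp_src sp_tgt sp_ident sp_cmp

lemma sp1:
  assumes "f \<in> arr R"
  shows "\<exists>\<sigma> \<in> \<Sigma> 1. f = pth 1 \<sigma> 0 1"
  using sp_ex[of "[f]" 1] assms by (auto simp: chains_1)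

lemma sp2:
  assumes "f \<in> arr R" "g \<in> arr R" "src R g = tgt R f"
  shows "\<exists>\<sigma> \<in> \<Sigma> 2. f = pth 2 \<sigma> 0 1 \<and> g = pth 2 \<sigma> 1 2"
proof -
  obtain \<sigma> where "\<sigma> \<in> \<Sigma> 2" "[f, g] = map (\<lambda>j. pth 2 \<sigma> j (Suc j)) [0..<2]"
    using sp_ex[of "[f, g]" 2] assms by auto
  then show ?thesis
    by (intro bexI[of _ \<sigma>]) (auto simp: numeral_2_eq_2)
qed

lemma sp3:
  assumes "f \<in> arr R" "g \<in> arr R" "h \<in> arr R" "src R g = tgt R f" "src R h = tgt R g"
  shows "\<exists>\<sigma> \<in> \<Sigma> 3. f = pth 3 \<sigma> 0 1 \<and> g = pth 3 \<sigma> 1 2 \<and> h = pth 3 \<sigma> 2 3"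
proof -
  have "[f, g, h] \<in> chains (arr R) (src R) (tgt R) 3"
    using assms by (auto simp: chains_def less_Suc_eq_0_disj numeral_3_eq_3)
  then obtain \<sigma> where "\<sigma> \<in> \<Sigma> 3" "[f, g, h] = map (\<lambda>j. pth 3 \<sigma> j (Suc j)) [0..<3]"
    using sp_ex[of "[f, g, h]" 3] by auto
  then show ?thesis
    by (intro bexI[of _ \<sigma>]) (auto simp: numeral_3_eq_3 numeral_2_eq_2)
qed

text \<open>Every axiom involves at most three composable arrows. They are edges of one abstract
  simplex, where composition is concatenation of intervals.\<close>

lemma category_spined: "category R"
proof (rule category.intro, goal_cases)
  case (1 f)
  then show ?case using sp1[of f] by (auto simp: sp_rules)
next
  case (2 f)
  then show ?case using sp1[of f] by (auto simp: sp_rules)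
next
  case (3 x)
  then show ?case using sp_obj[of x] by (auto simp: sp_rules in_hom)
next
  case (4 f x y g z)
  then show ?case using sp2[of f g] by (auto simp: sp_rules in_hom)
next
  case (5 f x y)
  then obtain \<sigma> where "\<sigma> \<in> \<Sigma> 1" "f = pth 1 \<sigma> 0 1" using sp1[of f] by (auto simp: in_hom)
  then show ?case using 5 by (auto simp: sp_rules in_hom)
next
  case (6 f x y)
  then obtain \<sigma> where "\<sigma> \<in> \<Sigma> 1" "f = pth 1 \<sigma> 0 1" using sp1[of f] by (auto simp: in_hom)
  then show ?case using 6 by (auto simp: sp_rules in_hom)
next
  case (7 f w x g y h z)
  then show ?case using sp3[of f g h] by (auto simp: sp_rules in_hom)
qed (use sp_ext in auto)

definition spine where
  "spine k \<sigma> = (if k = 0 then [vtx 0 \<sigma> 0] else map (\<lambda>j. pth k \<sigma> j (Suc j)) [0..<k])"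

lemma spine_valid: "\<sigma> \<in> \<Sigma> k \<Longrightarrow> nvalid R k (spine k \<sigma>)"
  by (auto simp: nvalid_def spine_def sp_rules intro!: chainsI)

lemma valid_spine: "nvalid R k xs \<Longrightarrow> \<exists>\<sigma> \<in> \<Sigma> k. xs = spine k \<sigma>"
  unfolding nvalid_def spine_def using sp_ex[of xs k] sp_obj by (cases "k = 0") fastforce+

lemma spine_vtx:
  assumes "\<sigma> \<in> \<Sigma> k" "a \<le> k"
  shows "nvtx R k (spine k \<sigma>) a = vtx k \<sigma> a"
  using assms by (auto simp: nerve_vertex_def spine_def sp_rules hd_conv_nth)

lemma spine_path:
  assumes "\<sigma> \<in> \<Sigma> k" "a \<le> b" "b \<le> k"
  shows "npath R k (spine k \<sigma>) a b = pth k \<sigma> a b"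
  using assms(2,3)
proof (induction b rule: dec_induct)
  case base
  then show ?case
    using assms by (simp add: npath_refl spine_vtx sp_ident)
next
  case (step b)
  then have "spine k \<sigma> ! b = pth k \<sigma> b (Suc b)"
    by (simp add: spine_def)
  then show ?case
    using assms step by (simp add: npath_Suc sp_cmp)
qed

text \<open>On spines the action only reindexes vertices and edges. This is what later identifies
  the nerve with formal restrictions of simplices.\<close>

lemma spine_nmap:
  assumes "\<sigma> \<in> \<Sigma> k" "\<phi> \<in> Delta m k"
  shows "nmap R m k \<phi> (spine k \<sigma>) = (if m = 0 then [vtx k \<sigma> (\<phi> 0)] else map (\<lambda>j. pth k \<sigma> (\<phi> j) (\<phi> (Suc j))) [0..<m])"
  using assms Delta_le[OF assms(2)] Delta_mono[OF assms(2)] by (simp add: nmap_def spine_vtx spine_path)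

end

section \<open>Simplices of the two rows\<close>

context tam_code
begin

definition vx :: "nat \<times> (nat \<Rightarrow> nat) \<times> 'o \<Rightarrow> nat \<Rightarrow> nat \<times> nat \<times> 'o" where
  "vx s a = (fst s, fst (snd s) a, snd (snd s))"
definition edg :: "nat \<times> (nat \<Rightarrow> nat) \<times> 'o \<Rightarrow> nat \<Rightarrow> nat \<Rightarrow> nat \<times> nat \<times> nat \<times> 'o" where
  "edg s a b = (fst s, fst (snd s) a, fst (snd s) b, snd (snd s))"
lemma vx_rules [simp]: "s \<in> T k \<Longrightarrow> a \<le> k \<Longrightarrow> vx s a \<in> V"
  "s \<in> T k \<Longrightarrow> a \<le> k \<Longrightarrow> vt (vx s a) = fo 0 k (vertex_inclusion a) (ev k s)"
  by (auto simp: T_def vx_def V_def vt_def ev_def compose_fo compose_vertex Delta_le)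

lemma edg_rules [simp]: "s \<in> T k \<Longrightarrow> a \<le> b \<Longrightarrow> b \<le> k \<Longrightarrow> edg s a b \<in> E"
  "s \<in> T k \<Longrightarrow> a \<le> b \<Longrightarrow> b \<le> k \<Longrightarrow> ed (edg s a b) = fo (Suc 0) k (seg a b) (ev k s)"
  "d0 (edg s a b) = vx s a" "d1 (edg s a b) = vx s b" "sd (vx s a) = edg s a a"
  by (auto simp: T_def vx_def edg_def E_def ed_def ev_def compose_fo compose_seg Delta_le Delta_mono d0_def d1_def sd_def)

lemma res_rules [simp]:
  "a \<le> l \<Longrightarrow> b \<le> l \<Longrightarrow> edg (res l \<theta> s) a b = edg s (\<theta> a) (\<theta> b)"
  "a \<le> l \<Longrightarrow> vx (res l \<theta> s) a = vx s (\<theta> a)"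
  by (simp_all add: res_def edg_def vx_def compose_def)

text \<open>Arrows of the strictified level \<open>k\<close>. The two triples are part of the arrow
  because \<open>ev k\<close> forgets how a value was presented.\<close>

definition A where "A k = {(s, F, t). s \<in> T k \<and> t \<in> T k \<and> F \<in> arr (L k) \<and> src (L k) F = ev k s \<and> tgt (L k) F = ev k t}"

lemma AD:
  assumes "(s, F, t) \<in> A k"
  shows "s \<in> T k" "t \<in> T k" "F \<in> arr (L k)" "src (L k) F = ev k s" "tgt (L k) F = ev k t"
  using assms by (simp_all add: A_def)

definition pa where "pa k \<sigma> a b = (case \<sigma> of (s, F, t) \<Rightarrow> k1a (edg s a b, fa (Suc 0) k (seg a b) F, edg t a b))"
definition va :: "nat \<Rightarrow> (nat \<times> (nat \<Rightarrow> nat) \<times> 'o) \<times> 'a \<times> (nat \<times> (nat \<Rightarrow> nat) \<times> 'o) \<Rightarrow> nat \<Rightarrow> 'u" where "va k \<sigma> a = (case \<sigma> of (s, F, t) \<Rightarrow> k0a (vx s a, vx t a))"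
definition rA where "rA l k \<theta> \<sigma> = (case \<sigma> of (s, F, t) \<Rightarrow> (res l \<theta> s, fa l k \<theta> F, res l \<theta> t))"

lemma rA_A:
  assumes "\<sigma> \<in> A k" "\<theta> \<in> Delta l k"
  shows "rA l k \<theta> \<sigma> \<in> A l"
proof -
  obtain s F t where st: "\<sigma> = (s, F, t)"
    by (rule prod_cases3)
  show ?thesis
    using AD[OF assms(1)[unfolded st]] assms(2) by (simp add: st rA_def A_def)
qed

lemma rA_pa: "\<sigma> \<in> A k \<Longrightarrow> \<theta> \<in> Delta l k \<Longrightarrow> a \<le> b \<Longrightarrow> b \<le> l \<Longrightarrow> pa l (rA l k \<theta> \<sigma>) a b = pa k \<sigma> (\<theta> a) (\<theta> b)"
  by (rule prod_cases3[of \<sigma>]) (simp add: pa_def rA_def compose_fo compose_seg A_def)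

lemma rA_va: "a \<le> l \<Longrightarrow> va l (rA l k \<theta> \<sigma>) a = va k \<sigma> (\<theta> a)"
  by (auto simp: va_def rA_def split: prod.splits)

lemma pa_EA: "(s, F, t) \<in> A k \<Longrightarrow> a \<le> b \<Longrightarrow> b \<le> k \<Longrightarrow> (edg s a b, fa (Suc 0) k (seg a b) F, edg t a b) \<in> EA"
  using edg_rules(1,2)[of s k a b] edg_rules(1,2)[of t k a b] AD[of s F t k] by (simp add: EA_def)

lemma va_VA: "(s, F, t) \<in> A k \<Longrightarrow> a \<le> k \<Longrightarrow> (vx s a, vx t a) \<in> VA"
  using Y0_arr(1)[of "fa 0 k (vertex_inclusion a) F"] vx_rules(1,2)[of s k a] vx_rules(1,2)[of t k a] AD[of s F t k] by (simp add: VA_def)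

lemma pa_rules:
  assumes "(s, F, t) \<in> A k" "a \<le> b" "b \<le> k"
  shows "pa k (s, F, t) a b \<in> arr C1" "src C1 (pa k (s, F, t) a b) = k1 (edg s a b)" "tgt C1 (pa k (s, F, t) a b) = k1 (edg t a b)"
    "far H0 (pa k (s, F, t) a b) = va k (s, F, t) a" "far H1 (pa k (s, F, t) a b) = va k (s, F, t) b"
  using pa_EA[OF assms] by (simp_all add: pa_def va_def)

lemma va_rules:
  assumes "(s, F, t) \<in> A k" "a \<le> k"
  shows "va k (s, F, t) a \<in> arr C0" "src C0 (va k (s, F, t) a) = k0 (vx s a)" "tgt C0 (va k (s, F, t) a) = k0 (vx t a)"
    "far HI (va k (s, F, t) a) = pa k (s, F, t) a a"
proof -
  note v = va_VA[OF assms]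
  show "va k (s, F, t) a \<in> arr C0" "src C0 (va k (s, F, t) a) = k0 (vx s a)" "tgt C0 (va k (s, F, t) a) = k0 (vx t a)"
    using v by (simp_all add: va_def)
  \<comment> \<open>A degenerate edge passes through level 0, where the image of \<open>F\<close> is
    an identity.\<close>
  have "fa (Suc 0) k (seg a a) F = fa (Suc 0) 0 (\<lambda>i\<in>{..Suc 0}. 0) (fa 0 k (vertex_inclusion a) F)"
    using assms by (simp add: seg_vertex compose_fo AD)
  also have "\<dots> = fa (Suc 0) 0 (\<lambda>i\<in>{..Suc 0}. 0) (ident (L 0) (fo 0 k (vertex_inclusion a) (ev k s)))"
    using Y0_arr(2)[of "fa 0 k (vertex_inclusion a) F"] AD[OF assms(1)] assms(2) by simp
  also have "\<dots> = ident (L (Suc 0)) (fo (Suc 0) k (seg a a) (ev k s))"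
    using AD[OF assms(1)] assms(2) by (simp add: seg_vertex compose_fo)
  finally show "far HI (va k (s, F, t) a) = pa k (s, F, t) a a"
    using v AD[OF assms(1)] assms(2) by (simp add: va_def pa_def)
qed

text \<open>\<open>SO k\<close> and \<open>SA k\<close> turn out to be bijections from
  \<open>T k\<close> and \<open>A k\<close> onto the objects and arrows of level \<open>k\<close> of
  the nerve; lists of edges and cells are always handled through the triples they come from.\<close>

definition SO where "SO k s = (if k = 0 then [k0 (vx s 0)] else map (\<lambda>j. k1 (edg s j (Suc j))) [0..<k])"
definition SA where "SA k \<sigma> = (if k = 0 then [va 0 \<sigma> 0] else map (\<lambda>j. pa k \<sigma> j (Suc j)) [0..<k])"

lemma T_eqI:
  assumes "s \<in> T k" "s' \<in> T k" "\<And>i. i \<le> k \<Longrightarrow> vx s i = vx s' i"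
  shows "s = s'"
proof -
  have "fst (snd s) = fst (snd s')"
    by (rule Delta_eqI[of _ k "fst s" _ "fst s'"]) (use assms in \<open>auto simp: T_def vx_def\<close>)
  then show ?thesis
    using assms(3)[of 0] by (auto simp: vx_def prod_eq_iff)
qed

lemma SO_inj:
  assumes "s \<in> T k" "s' \<in> T k" "SO k s = SO k s'"
  shows "s = s'"
proof (rule T_eqI[OF assms(1,2)])
  fix i assume i: "i \<le> k"
  have *: "edg s j (Suc j) = edg s' j (Suc j)" if "j < k" for j
    using arg_cong[OF assms(3), of "\<lambda>xs. xs ! j"] that by (simp add: SO_def)
  show "vx s i = vx s' i"
  proof (cases "k = 0")
    case True
    then show ?thesis using assms(3) i by (simp add: SO_def)
  next
    case False
    show ?thesis
    proof (cases i)
      case 0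
      then show ?thesis using *[of 0] False by (simp add: edg_def vx_def)
    next
      case (Suc j)
      then show ?thesis using *[of j] i by (simp add: edg_def vx_def)
    qed
  qed
qed

lemma inv_SO [simp]: "s \<in> T k \<Longrightarrow> inv_into (T k) (SO k) (SO k s) = s"
  by (rule inv_into_f_f) (auto intro: inj_onI SO_inj)

text \<open>Consecutive edges share their vertex literally, hence also its components
  \<open>m\<close> and \<open>y\<close>. All edges of a chain therefore lie on one object
  \<open>y\<close>, and their vertices form a monotone map. Horizontal composition is strict for
  this reason.\<close>

lemma SO_surj:
  assumes zs: "zs \<in> chains (k1 ` E) (fob H0) (fob H1) k" and k: "k > 0"
  shows "\<exists>s \<in> T k. zs = SO k s"
proof -
  note z = chainsD[OF zs]
  have "\<forall>j. \<exists>p. j < k \<longrightarrow> p \<in> E \<and> zs ! j = k1 p"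
    using z(2) by blast
  then obtain p where p: "\<And>j. j < k \<Longrightarrow> p j \<in> E \<and> zs ! j = k1 (p j)"
    by metis
  have d: "d1 (p j) = d0 (p (Suc j))" if "Suc j < k" for j
    using z(3)[OF that] p[of j] p[of "Suc j"] that by simp
  define m where "m = fst (p 0)"
  define y where "y = snd (snd (snd (p 0)))"
  \<comment> \<open>From vertex 1 on, the ends of the edges are used; the last vertex
    \<open>k\<close> is the start of no edge.\<close>
  define \<phi> where "\<phi> = (\<lambda>i\<in>{..k}. if i = 0 then fst (snd (p 0)) else fst (snd (snd (p (i - 1)))))"
  have P: "p j = (m, \<phi> j, \<phi> (Suc j), y)" if "j < k" for j
    using that
  proof (induction j)
    case 0
    then show ?case by (simp add: m_def y_def \<phi>_def prod_eq_iff)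
  next
    case (Suc j)
    then show ?case using d[of j] by (auto simp: d0_def d1_def \<phi>_def prod_eq_iff split: prod.splits)
  qed
  have e: "\<phi> j \<le> \<phi> (Suc j)" "\<phi> (Suc j) \<le> m" "y \<in> obj (L m)" if "j < k" for j
    using P[OF that] p[OF that] by (auto simp: E_def)
  have mono: "\<phi> i \<le> \<phi> j" if "i \<le> j" "j \<le> k" for i j
    using that by (induction j rule: dec_induct) (auto intro: order_trans[OF _ e(1)])
  have "\<phi> i \<le> m" if "i \<le> k" for i
  proof (cases "i = k")
    case True
    then show ?thesis using e(2)[of "k - 1"] k by simp
  next
    case False
    then show ?thesis using e(1,2)[of i] that by simp
  qed
  then have "(m, \<phi>, y) \<in> T k"
    using e(3)[OF k] mono by (auto simp: T_def Delta_def mono_on_def \<phi>_def)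
  moreover have "zs = SO k (m, \<phi>, y)"
    using k p P z(1) by (auto simp: SO_def edg_def intro!: nth_equalityI)
  ultimately show ?thesis by blast
qed

lemma SA_src: "(s, F, t) \<in> A k \<Longrightarrow> map (if k = 0 then src C0 else src C1) (SA k (s, F, t)) = SO k s"
  "(s, F, t) \<in> A k \<Longrightarrow> map (if k = 0 then tgt C0 else tgt C1) (SA k (s, F, t)) = SO k t"
  by (auto simp: SA_def SO_def pa_rules va_rules)

lemma SA_inj:
  assumes "\<sigma> \<in> A k" "\<tau> \<in> A k" "SA k \<sigma> = SA k \<tau>"
  shows "\<sigma> = \<tau>"
proof -
  obtain s F t s' F' t' where st: "\<sigma> = (s, F, t)" "\<tau> = (s', F', t')"
    by (metis prod_cases3)
  note a = assms(1)[unfolded st] assms(2)[unfolded st]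
  have s: "s = s'" "t = t'"
    using SO_inj[of s k s'] SO_inj[of t k t'] SA_src[OF a(1)] SA_src[OF a(2)] assms(3) AD[OF a(1)] AD[OF a(2)] by (auto simp: st)
  have "F = F'"
  proof (rule spine_unique)
    show "fa (Suc 0) k (seg j (Suc j)) F = fa (Suc 0) k (seg j (Suc j)) F'" if "j < k" for j
      using arg_cong[OF assms(3), of "\<lambda>xs. xs ! j"] that by (simp add: SA_def pa_def st)
  qed (use AD[OF a(1)] AD[OF a(2)] s in simp_all)
  then show ?thesis using s st by simp
qed

lemma inv_SA [simp]: "\<sigma> \<in> A k \<Longrightarrow> inv_into (A k) (SA k) (SA k \<sigma>) = \<sigma>"
  by (rule inv_into_f_f) (auto intro: inj_onI SA_inj)

text \<open>Sources and targets of the cells form chains of edges and so come from triples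
  \<open>s\<close> and \<open>t\<close>. Fullness of the Segal map then glues the cells to one arrow
  between the values of these triples.\<close>

lemma SA_surj:
  assumes fs: "fs \<in> chains (k1a ` EA) (far H0) (far H1) k" and k: "k > 0"
  shows "\<exists>\<sigma> \<in> A k. fs = SA k \<sigma>"
proof -
  have "map (src C1) fs \<in> chains (k1 ` E) (fob H0) (fob H1) k" "map (tgt C1) fs \<in> chains (k1 ` E) (fob H0) (fob H1) k"
    using fibre_power_closed(1,2)[OF H0_functor H1_functor, of fs k] fs by simp_all
  then obtain s t where s: "s \<in> T k" "map (src C1) fs = SO k s" and t: "t \<in> T k" "map (tgt C1) fs = SO k t"
    using SO_surj k by metis
  note f = chainsD[OF fs]
  have "\<forall>j. \<exists>g. j < k \<longrightarrow> (edg s j (Suc j), g, edg t j (Suc j)) \<in> EA \<and> fs ! j = k1a (edg s j (Suc j), g, edg t j (Suc j))"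
  proof
    fix j
    show "\<exists>g. j < k \<longrightarrow> (edg s j (Suc j), g, edg t j (Suc j)) \<in> EA \<and> fs ! j = k1a (edg s j (Suc j), g, edg t j (Suc j))"
    proof (cases "j < k")
      case True
      then obtain p g q where pq: "(p, g, q) \<in> EA" "fs ! j = k1a (p, g, q)"
        using f(2)[of j] by (metis imageE prod_cases3)
      have "k1 p = k1 (edg s j (Suc j))" "k1 q = k1 (edg t j (Suc j))"
        using arg_cong[OF s(2), of "\<lambda>xs. xs ! j"] arg_cong[OF t(2), of "\<lambda>xs. xs ! j"] True pq f(1) k by (simp_all add: SO_def)
      then show ?thesis using pq by auto
    qed simp
  qed
  then obtain g where g: "\<And>j. j < k \<Longrightarrow> (edg s j (Suc j), g j, edg t j (Suc j)) \<in> EA \<and> fs ! j = k1a (edg s j (Suc j), g j, edg t j (Suc j))"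
    by metis
  have "\<exists>F \<in> arr (L k). src (L k) F = ev k s \<and> tgt (L k) F = ev k t \<and> (\<forall>j<k. fa (Suc 0) k (seg j (Suc j)) F = g j)"
    by (rule spine_lift[OF k]) (use g s t in \<open>auto simp: EA_def\<close>)
  then obtain F where F: "F \<in> arr (L k)" "src (L k) F = ev k s" "tgt (L k) F = ev k t" "\<And>j. j < k \<Longrightarrow> fa (Suc 0) k (seg j (Suc j)) F = g j"
    by blast
  have "(s, F, t) \<in> A k"
    using F s t by (simp add: A_def)
  moreover have "fs = SA k (s, F, t)"
    using k f(1) g F(4) by (auto simp: SA_def pa_def intro!: nth_equalityI)
  ultimately show ?thesis by blast
qed

text \<open>The usual composition of a Segal object: a composable pair is read as the spine of a
  unique 2-simplex, and the long edge of this simplex is taken.\<close>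

definition HC where
  "HC = functor_on (fibre_power C1 H0 H1 2) (\<lambda>xs. k1 (edg (inv_into (T 2) (SO 2) xs) 0 2)) (\<lambda>xs. pa 2 (inv_into (A 2) (SA 2) xs) 0 2)"

lemma SO_chains: "s \<in> T k \<Longrightarrow> k > 0 \<Longrightarrow> SO k s \<in> chains (k1 ` E) (fob H0) (fob H1) k"
  by (rule chainsI) (auto simp: SO_def)

lemma SA_chains: "\<sigma> \<in> A k \<Longrightarrow> k > 0 \<Longrightarrow> SA k \<sigma> \<in> chains (k1a ` EA) (far H0) (far H1) k"
  by (rule chainsI; cases \<sigma>) (auto simp: SA_def pa_rules pa_rules(1)[simplified])

lemma HC_simps: "s \<in> T 2 \<Longrightarrow> fob HC (SO 2 s) = k1 (edg s 0 2)" "\<sigma> \<in> A 2 \<Longrightarrow> far HC (SA 2 \<sigma>) = pa 2 \<sigma> 0 2"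
  by (simp_all add: HC_def SO_chains SA_chains)

text \<open>Two adjacent edges of a \<open>k\<close>-simplex are the spine of its restriction along
  \<open>tri a b c\<close>, whose long edge is the edge from \<open>a\<close> to
  \<open>c\<close>.\<close>

lemma HC_edg:
  assumes "s \<in> T k" "a \<le> b" "b \<le> c" "c \<le> k"
  shows "fob HC [k1 (edg s a b), k1 (edg s b c)] = k1 (edg s a c)"
  using HC_simps(1)[of "res 2 (tri a b c) s"] assms by (simp add: SO_def numeral_2_eq_2[symmetric] upt_rec)

lemma HC_pa:
  assumes "\<sigma> \<in> A k" "a \<le> b" "b \<le> c" "c \<le> k"
  shows "far HC [pa k \<sigma> a b, pa k \<sigma> b c] = pa k \<sigma> a c"
  using HC_simps(2)[of "rA 2 k (tri a b c) \<sigma>"] rA_A[OF assms(1), of "tri a b c" 2] rA_pa[OF assms(1), of "tri a b c" 2] assms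
  by (simp add: SA_def numeral_2_eq_2[symmetric] upt_rec)

lemma SA_ident: "s \<in> T k \<Longrightarrow> (s, ident (L k) (ev k s), s) \<in> A k"
  "s \<in> T k \<Longrightarrow> SA k (s, ident (L k) (ev k s), s) = map (if k = 0 then ident C0 else ident C1) (SO k s)"
  by (auto simp: A_def SA_def SO_def pa_def va_def)

lemma pa_cmp:
  assumes "(s, F, t) \<in> A k" "(t, G, r) \<in> A k" "a \<le> b" "b \<le> k"
  shows "pa k (s, cmp (L k) G F, r) a b = cmp C1 (pa k (t, G, r) a b) (pa k (s, F, t) a b)"
  using pa_EA[OF assms(1,3,4)] pa_EA[OF assms(2,3,4)] AD[OF assms(1)] AD[OF assms(2)] assms(3,4) by (simp add: pa_def)

lemma SA_cmp:
  assumes "(s, F, t) \<in> A k" "(t, G, r) \<in> A k"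
  shows "(s, cmp (L k) G F, r) \<in> A k"
    "SA k (s, cmp (L k) G F, r) = map2 (if k = 0 then cmp C0 else cmp C1) (SA k (t, G, r)) (SA k (s, F, t))"
proof -
  show "(s, cmp (L k) G F, r) \<in> A k"
    using AD[OF assms(1)] AD[OF assms(2)] by (simp add: A_def)
  have "pa k (s, cmp (L k) G F, r) j (Suc j) = cmp C1 (pa k (t, G, r) j (Suc j)) (pa k (s, F, t) j (Suc j))" if "j < k" for j
    by (rule pa_cmp[OF assms]) (use that in simp_all)
  moreover have "va k (s, cmp (L k) G F, r) 0 = cmp C0 (va k (t, G, r) 0) (va k (s, F, t) 0)"
    using va_VA[OF assms(1), of 0] va_VA[OF assms(2), of 0] by (simp add: va_def)
  ultimately show "SA k (s, cmp (L k) G F, r) = map2 (if k = 0 then cmp C0 else cmp C1) (SA k (t, G, r)) (SA k (s, F, t))"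
    by (auto simp: SA_def intro!: nth_equalityI)
qed

definition DC :: "'u dblcat" where
  "DC = \<lparr>cat0 = C0, cat1 = C1, hdom = H0, hcod = H1, hid = HI, hcmp = HC\<rparr>"

lemma DC_simps [simp]: "cat0 DC = C0" "cat1 DC = C1" "hdom DC = H0" "hcod DC = H1" "hid DC = HI" "hcmp DC = HC"
  by (simp_all add: DC_def)

lemma HC_functor: "is_functor (fibre_power C1 H0 H1 2) C1 HC"
proof (rule functorI, goal_cases)
  case 1 show ?case by (rule category_fibre_power[OF H0_functor H1_functor])
next
  case 2 show ?case by simp
next
  case (3 x)
  then obtain s where "s \<in> T 2" "x = SO 2 s" using SO_surj[of x 2] by auto
  then show ?case by (simp add: HC_simps)
next
  case (4 f)
  then obtain s F t where f: "(s, F, t) \<in> A 2" "f = SA 2 (s, F, t)" using SA_surj[of f 2] by auto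
  have e: "src (fibre_power C1 H0 H1 2) f = SO 2 s" "tgt (fibre_power C1 H0 H1 2) f = SO 2 t"
    using 4 SA_src[OF f(1)] f(2) by simp_all
  have h: "far HC f = pa 2 (s, F, t) 0 2"
    unfolding f(2) by (rule HC_simps(2)[OF f(1)])
  show ?case
    unfolding e h HC_simps(1)[OF AD(1)[OF f(1)]] HC_simps(1)[OF AD(2)[OF f(1)]] using pa_rules(1-3)[OF f(1), of 0 2] by simp
next
  case (5 x)
  then obtain s where s: "s \<in> T 2" "x = SO 2 s" using SO_surj[of x 2] by auto
  then have "ident (fibre_power C1 H0 H1 2) x = SA 2 (s, ident (L 2) (ev 2 s), s)"
    using 5 by (simp add: SA_ident)
  then show ?case
    using s by (simp add: HC_simps SA_ident(1), simp add: pa_def)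
next
  case (6 f g)
  then have fc: "f \<in> chains (arr C1) (far H0) (far H1) 2" and gc: "g \<in> chains (arr C1) (far H0) (far H1) 2"
    by (simp_all only: fibre_power_simps(2))
  obtain \<sigma> \<tau> where "\<sigma> \<in> A 2" "f = SA 2 \<sigma>" "\<tau> \<in> A 2" "g = SA 2 \<tau>"
    using SA_surj[OF fc[unfolded C1_simps] zero_less_numeral] SA_surj[OF gc[unfolded C1_simps] zero_less_numeral] by blast
  moreover obtain s F t where "\<sigma> = (s, F, t)"
    by (rule prod_cases3)
  moreover obtain t' G r where "\<tau> = (t', G, r)"
    by (rule prod_cases3)
  ultimately have f: "(s, F, t) \<in> A 2" "f = SA 2 (s, F, t)" and g: "(t', G, r) \<in> A 2" "g = SA 2 (t', G, r)"
    by (simp_all only:)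
  have e: "map (src C1) g = map (tgt C1) f"
    using 6(3) by (simp only: fibre_power_simps(3)[OF gc] fibre_power_simps(4)[OF fc])
  have "SO 2 t' = SO 2 t"
    using SA_src(2)[OF f(1)] SA_src(1)[OF g(1)] e by (simp add: f(2)[symmetric] g(2)[symmetric])
  \<comment> \<open>Composable pairs of cells have the same middle chain of edges, and a chain
    determines its triple.\<close>
  then have t': "t' = t"
    by (rule SO_inj[OF AD(1)[OF g(1)] AD(2)[OF f(1)]])
  note g1 = g(1)[unfolded t']
  have c: "cmp (fibre_power C1 H0 H1 2) g f = map2 (cmp C1) g f"
    by (rule fibre_power_simps(6)[OF fc gc e])
  have "cmp (fibre_power C1 H0 H1 2) g f = SA 2 (s, cmp (L 2) G F, r)"
    by (simp only: c SA_cmp(2)[OF f(1) g1] f(2)[symmetric] g(2)[unfolded t', symmetric]) simp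
  then have "far HC (cmp (fibre_power C1 H0 H1 2) g f) = pa 2 (s, cmp (L 2) G F, r) 0 2"
    using HC_simps(2)[OF SA_cmp(1)[OF f(1) g1]] by (simp only:)
  also have "\<dots> = cmp C1 (pa 2 (t, G, r) 0 2) (pa 2 (s, F, t) 0 2)"
    by (rule pa_cmp[OF f(1) g1]) simp_all
  also have "\<dots> = cmp C1 (far HC g) (far HC f)"
    unfolding f(2) g(2) t' HC_simps(2)[OF f(1)] HC_simps(2)[OF g1] ..
  finally show ?case .
qed (auto simp: HC_def functor_on_def)

lemma vertex_at: "vertex_inclusion i 0 = i"
  by (simp add: vertex_inclusion_def)

lemma object_spined: "spined (object_row DC) T (\<lambda>k s a. k0 (vx s a)) (\<lambda>k s a b. k1 (edg s a b))"
proof (rule spined.intro, goal_cases)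
  case (1 x)
  then obtain m i y where "x = k0 (m, i, y)" "(m, i, y) \<in> V" by auto
  then show ?case
    by (intro bexI[of _ "(m, vertex_inclusion i, y)"]) (auto simp: vx_def V_def T_def vertex_at)
next
  case (2 xs k)
  then show ?case using SO_surj[of xs k] by (auto simp: SO_def)
next
  case (12 f g)
  then show ?case by (auto simp: fun_ext[OF HC_functor])
qed (auto simp: HC_edg is_functor.fob_ext[OF H0_functor, simplified] is_functor.fob_ext[OF H1_functor, simplified] is_functor.fob_ext[OF HI_functor, simplified])

lemma arrow_spined: "spined (arrow_row DC) A va pa"
proof (rule spined.intro, goal_cases)
  case (1 x)
  then obtain m i y m' i' y' where x: "x = k0a ((m, i, y), (m', i', y'))" "((m, i, y), (m', i', y')) \<in> VA" by auto
  let ?s = "(m, vertex_inclusion i, y)" and ?t = "(m', vertex_inclusion i', y')"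
  have s: "?s \<in> T 0" "?t \<in> T 0" "vx ?s 0 = (m, i, y)" "vx ?t 0 = (m', i', y')"
    using x by (simp_all add: T_def vx_def VA_def V_def vertex_at)
  \<comment> \<open>A vertical arrow is an equality of values, so the identity of the common value
    represents it on level 0.\<close>
  have "ev 0 ?s = ev 0 ?t"
    using x by (simp add: ev_def VA_def vt_def)
  then have "(?s, ident (L 0) (ev 0 ?s), ?t) \<in> A 0"
    using s by (simp add: A_def)
  then show ?case
    using x s by (intro bexI) (auto simp: va_def)
next
  case (2 xs k)
  then show ?case using SA_surj[of xs k] by (auto simp: SA_def)
next
  case (12 f g)
  then show ?case by (auto simp: fun_arr_ext[OF HC_functor])
qed (auto simp: HC_pa pa_rules va_rules pa_rules(1)[simplified] va_rules(1)[simplified] is_functor.far_ext[OF H0_functor, simplified] is_functor.far_ext[OF H1_functor, simplified] is_functor.far_ext[OF HI_functor, simplified])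

lemma double_category_DC: "double_category DC"
  using H0_functor H1_functor HI_functor HC_functor spined.category_spined[OF object_spined] spined.category_spined[OF arrow_spined]
  by (intro double_category.intro) (simp_all only: DC_simps)

end

section \<open>Weak globularity\<close>

lemma path_component_invariant:
  assumes h: "\<And>f. f \<in> arr C \<Longrightarrow> h (src C f) = h (tgt C f)" and y: "y \<in> path_component C x"
  shows "h y = h x"
proof -
  have "(x, y) \<in> ({(src C f, tgt C f) |f. f \<in> arr C} \<union> {(tgt C f, src C f) |f. f \<in> arr C})\<^sup>*"
    using y by (simp add: path_component_def)
  then show ?thesis
    by (induction rule: rtrancl_induct) (auto simp: h)
qed

lemma iso_fibre_powerD:
  assumes p: "is_functor C B p" and q: "is_functor C B q" and j: "j < k"
    and i: "iso_arr (fibre_power C p q k) fs"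
  shows "iso_arr C (fs ! j)"
proof -
  let ?P = "fibre_power C p q k"
  obtain gs where gs: "gs \<in> hom ?P (tgt ?P fs) (src ?P fs)"
    "cmp ?P gs fs = ident ?P (src ?P fs)" "cmp ?P fs gs = ident ?P (tgt ?P fs)"
    using i unfolding iso_arr_def by blast
  have f: "fs \<in> chains (arr C) (far p) (far q) k"
    using iso_arr_arr[OF i] by simp
  have g: "gs \<in> chains (arr C) (far p) (far q) k"
    using gs(1) by (simp add: in_hom)
  have e: "map (src C) gs = map (tgt C) fs" "map (tgt C) gs = map (src C) fs"
    using gs(1) fibre_power_simps(3,4)[OF f] fibre_power_simps(3,4)[OF g] by (simp_all only: in_hom)
  have m: "map2 (cmp C) gs fs = map (ident C) (map (src C) fs)" "map2 (cmp C) fs gs = map (ident C) (map (tgt C) fs)"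
    using gs(2,3) f g e fibre_power_closed(1,2)[OF p q f] by (simp_all del: map_map)
  show ?thesis
    by (rule iso_arrI[of _ _ "gs ! j"])
      (use arg_cong[OF m(1), of "\<lambda>xs. xs ! j"] arg_cong[OF m(2), of "\<lambda>xs. xs ! j"] chainsD(1,2)[OF f] chainsD(1,2)[OF g] j
        map_eq_nthD[OF e(1), of j] map_eq_nthD[OF e(2), of j] in auto)
qed

context tam_code
begin

text \<open>The value is constant along vertical arrows, hence on components; conversely two
  vertices with the same value are joined by a single arrow.\<close>

lemma path_component_C0:
  assumes "a \<in> V" "b \<in> V"
  shows "path_component C0 (k0 a) = path_component C0 (k0 b) \<longleftrightarrow> vt a = vt b"
proof
  assume e: "path_component C0 (k0 a) = path_component C0 (k0 b)"
  have "k0 a \<in> path_component C0 (k0 b)"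
    using path_component_self[of "k0 a" C0] assms e by simp
  then have "vt (inv k0 (k0 a)) = vt (inv k0 (k0 b))"
    by (rule path_component_invariant[rotated]) (auto simp: VA_def)
  then show "vt a = vt b"
    by simp
next
  assume "vt a = vt b"
  then have v: "(a, b) \<in> VA"
    using assms by (simp add: VA_def)
  then show "path_component C0 (k0 a) = path_component C0 (k0 b)"
    using path_component_arr[OF cat_C0, of "k0a (a, b)"] by simp
qed

text \<open>Two vertices in one component are joined by exactly one arrow, so nothing is lost by
  passing to components.\<close>

lemma quotient_C0: "ff_es C0 (components_cat C0) (quotient_functor C0)"
proof (rule ff_esI)
  show "is_functor C0 (components_cat C0) (quotient_functor C0)"
    by (rule is_functor_quotient) simp
next
  fix x y g
  assume "x \<in> obj C0" "y \<in> obj C0" and g: "g \<in> arr (components_cat C0)"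
    "src (components_cat C0) g = fob (quotient_functor C0) x" "tgt (components_cat C0) g = fob (quotient_functor C0) y"
  then obtain a b where ab: "a \<in> V" "b \<in> V" "x = k0 a" "y = k0 b" by auto
  have e: "g = path_component C0 x" "g = path_component C0 y"
    using g ab by simp_all
  then have "(a, b) \<in> VA"
    using ab path_component_C0[of a b] by (simp add: VA_def)
  then show "\<exists>f\<in>arr C0. src C0 f = x \<and> tgt C0 f = y \<and> far (quotient_functor C0) f = g"
    using ab e by (intro bexI[of _ "k0a (a, b)"]) auto
next
  fix f g
  assume "f \<in> arr C0" "g \<in> arr C0" "src C0 f = src C0 g" "tgt C0 f = tgt C0 g"
  then show "f = g"
    by auto
next
  fix z
  assume "z \<in> obj (components_cat C0)"
  then obtain x where x: "x \<in> obj C0" "z = path_component C0 x" by auto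
  have "iso_arr (components_cat C0) (ident (components_cat C0) z)"
    by (rule iso_ident) (use x in auto)
  then show "\<exists>x\<in>obj C0. \<exists>c. iso_arr (components_cat C0) c \<and> src (components_cat C0) c = z \<and> tgt (components_cat C0) c = fob (quotient_functor C0) x"
    using x by (intro bexI[of _ x] exI[of _ z]) auto
qed

lemma iso_C1:
  assumes "(p, f, q) \<in> EA" and f: "iso_arr (L (Suc 0)) f"
  shows "iso_arr C1 (k1a (p, f, q))"
proof -
  have "(q, iinv (L (Suc 0)) f, p) \<in> EA"
    using assms by (simp add: EA_def)
  then show ?thesis
    using assms by (intro iso_arrI[of _ _ "k1a (q, iinv (L (Suc 0)) f, p)"]) (auto simp: EA_def)
qed

definition "G0 = comp_functor C1 (quotient_functor C0) H0"
definition "G1 = comp_functor C1 (quotient_functor C0) H1"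

lemma G_functor: "is_functor C1 (components_cat C0) G0" "is_functor C1 (components_cat C0) G1"
  unfolding G0_def G1_def by (rule is_functor_comp[OF H0_functor is_functor_quotient] is_functor_comp[OF H1_functor is_functor_quotient]; simp)+

lemma G_simps:
  "p \<in> E \<Longrightarrow> fob G0 (k1 p) = path_component C0 (k0 (d0 p))" "p \<in> E \<Longrightarrow> fob G1 (k1 p) = path_component C0 (k0 (d1 p))"
  "f \<in> arr C1 \<Longrightarrow> far G0 f = fob G0 (src C1 f)" "f \<in> arr C1 \<Longrightarrow> far G1 f = fob G1 (src C1 f)"
  by (auto simp: G0_def G1_def EA_E)

lemma chains_mono:
  assumes "xs \<in> chains S p q k" "\<And>x y. x \<in> S \<Longrightarrow> y \<in> S \<Longrightarrow> q x = p y \<Longrightarrow> q' x = p' y"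
  shows "xs \<in> chains S p' q' k"
  by (rule chainsI) (use assms chainsD[OF assms(1)] in auto)

lemma H_G_chains:
  "xs \<in> chains (obj C1) (fob H0) (fob H1) k \<Longrightarrow> xs \<in> chains (obj C1) (fob G0) (fob G1) k"
  "fs \<in> chains (arr C1) (far H0) (far H1) k \<Longrightarrow> fs \<in> chains (arr C1) (far G0) (far G1) k"
  by (erule chains_mono, simp add: G0_def G1_def)+

text \<open>A vertical arrow is determined by its ends. If the sources and the targets of the cells
  match strictly, then so do the cells; this is fullness of the inclusion of strict chains.\<close>

lemma G_H_arr_chains:
  assumes fs: "fs \<in> chains (arr C1) (far G0) (far G1) k" and s: "map (src C1) fs \<in> chains (obj C1) (fob H0) (fob H1) k"
    and t: "map (tgt C1) fs \<in> chains (obj C1) (fob H0) (fob H1) k"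
  shows "fs \<in> chains (arr C1) (far H0) (far H1) k"
proof (rule chainsI)
  fix i assume i: "Suc i < k"
  note l = chainsD(1,2)[OF fs]
  obtain p f q p' f' q' where f: "fs ! i = k1a (p, f, q)" "(p, f, q) \<in> EA" "fs ! Suc i = k1a (p', f', q')" "(p', f', q') \<in> EA"
    using l(2)[of i] l(2)[of "Suc i"] i by auto
  show "far H1 (fs ! i) = far H0 (fs ! Suc i)"
    using chainsD(3)[OF s i] chainsD(3)[OF t i] i f EA_E[OF f(2)] EA_E[OF f(4)] by (simp add: l(1))
qed (use chainsD[OF fs] in auto)

text \<open>The substance is essential surjectivity. Edges that match only up to components lie on
  unrelated objects of \<open>Y\<close>; essential surjectivity of the Segal map supplies one object
  whose own edges are isomorphic to them.\<close>

lemma weakly_globular_DC: "weakly_globular DC"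
proof -
  have "ff_es (fibre_power C1 H0 H1 n) (fibre_power C1 G0 G1 n) (id_functor (fibre_power C1 H0 H1 n))" if n: "n \<ge> 2" for n
  proof (rule ff_esI)
    note cl = fibre_power_closed[OF H0_functor H1_functor]
    show "is_functor (fibre_power C1 H0 H1 n) (fibre_power C1 G0 G1 n) (id_functor (fibre_power C1 H0 H1 n))"
      unfolding id_functor_def
      by (rule functor_functor_on) (use H_G_chains in \<open>simp_all add: category_fibre_power[OF H0_functor H1_functor]
        category_fibre_power[OF G_functor] cl del: C1_simps\<close>)
  next
    fix xs ys gs
    assume a: "xs \<in> obj (fibre_power C1 H0 H1 n)" "ys \<in> obj (fibre_power C1 H0 H1 n)" "gs \<in> arr (fibre_power C1 G0 G1 n)"
      "src (fibre_power C1 G0 G1 n) gs = fob (id_functor (fibre_power C1 H0 H1 n)) xs"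
      "tgt (fibre_power C1 G0 G1 n) gs = fob (id_functor (fibre_power C1 H0 H1 n)) ys"
    have m: "map (src C1) gs = xs" "map (tgt C1) gs = ys"
      using a by (simp_all del: C1_simps)
    have "gs \<in> chains (arr C1) (far H0) (far H1) n"
      by (rule G_H_arr_chains) (use a m in \<open>simp_all del: C1_simps\<close>)
    then show "\<exists>f\<in>arr (fibre_power C1 H0 H1 n). src (fibre_power C1 H0 H1 n) f = xs \<and> tgt (fibre_power C1 H0 H1 n) f = ys \<and>
        far (id_functor (fibre_power C1 H0 H1 n)) f = gs"
      using m by (intro bexI[of _ gs]) (simp_all del: C1_simps)
  next
    fix f g
    assume "f \<in> arr (fibre_power C1 H0 H1 n)" "g \<in> arr (fibre_power C1 H0 H1 n)"
      "far (id_functor (fibre_power C1 H0 H1 n)) f = far (id_functor (fibre_power C1 H0 H1 n)) g"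
    then show "f = g"
      by simp
  next
    fix zs
    assume "zs \<in> obj (fibre_power C1 G0 G1 n)"
    then have z: "zs \<in> chains (k1 ` E) (fob G0) (fob G1) n"
      by simp
    have "\<forall>j. \<exists>p. j < n \<longrightarrow> p \<in> E \<and> zs ! j = k1 p"
      using chainsD(2)[OF z] by blast
    then obtain p where p: "\<And>j. j < n \<Longrightarrow> p j \<in> E \<and> zs ! j = k1 (p j)"
      by metis
    have v: "vt (d1 (p j)) = vt (d0 (p (Suc j)))" if "Suc j < n" for j
      using chainsD(3)[OF z that] p[of j] p[of "Suc j"] that path_component_C0[of "d1 (p j)" "d0 (p (Suc j))"] by (simp add: G_simps)
    \<comment> \<open>The edges need not match, but their values do, so the values form an object of
      the Segal target.\<close>
    let ?es = "map (\<lambda>j. ed (p j)) [0..<n]"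
    have "?es \<in> obj (segal_target Y n)"
      unfolding segal_target_eq fibre_power_simps by (rule chainsI) (use p v in \<open>auto simp: vt_d\<close>)
    then obtain y c where y: "y \<in> obj (L n)" and c: "iso_arr (segal_target Y n) c" "src (segal_target Y n) c = ?es" "tgt (segal_target Y n) c = fob (segal_map Y n) y"
      using ff_es_es[OF segal_ff_es[OF n]] by blast
    let ?v0 = "act Y 0 (Suc 0) (vertex_inclusion 0)" and ?v1 = "act Y 0 (Suc 0) (vertex_inclusion (Suc 0))"
    have vf: "is_functor (L (Suc 0)) (L 0) ?v0" "is_functor (L (Suc 0)) (L 0) ?v1"
      by (simp_all add: is_functor_vertex)
    have cc: "c \<in> chains (arr (L (Suc 0))) (far ?v0) (far ?v1) n"
      using iso_arr_arr[OF c(1)] by (simp add: segal_target_eq)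
    note lc = chainsD[OF cc]
    have sc: "map (src (L (Suc 0))) c = ?es" "map (tgt (L (Suc 0))) c = fob (segal_map Y n) y"
      using c(2,3) cc by (simp_all add: segal_target_eq)
    have sc': "src (L (Suc 0)) (c ! j) = ed (p j)" "tgt (L (Suc 0)) (c ! j) = fo (Suc 0) n (seg j (Suc j)) y" if "j < n" for j
      using arg_cong[OF sc(1), of "\<lambda>xs. xs ! j"] arg_cong[OF sc(2), of "\<lambda>xs. xs ! j"] that lc(1) y by (simp_all add: segal_map_simps)
    have ic: "iso_arr (L (Suc 0)) (c ! j)" if "j < n" for j
      by (rule iso_fibre_powerD[OF vf that]) (use c(1) in \<open>simp add: segal_target_eq\<close>)
    \<comment> \<open>The tautological presentation of \<open>y\<close>: its edges form a strict
      chain, and their values are the spine of \<open>y\<close>.\<close>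
    define s where "s = (n, (\<lambda>i\<in>{..n}. i), y)"
    have s: "s \<in> T n" "ev n s = y"
      using y by (simp_all add: T_def s_def ev_def)
    let ?gs = "map (\<lambda>j. k1a (p j, c ! j, edg s j (Suc j))) [0..<n]"
    have ea: "(p j, c ! j, edg s j (Suc j)) \<in> EA" if "j < n" for j
      using p[OF that] sc'[OF that] lc(2)[OF that] that edg_rules(1,2)[OF s(1), of j "Suc j"] by (simp add: EA_def s(2))
    have sob: "SO n s \<in> obj (fibre_power C1 H0 H1 n)"
      using SO_chains[OF s(1)] n by simp
    have gs: "?gs \<in> chains (arr C1) (far G0) (far G1) n"
    proof (rule chainsI)
      fix j assume j: "Suc j < n"
      have "far G1 (k1a (p j, c ! j, edg s j (Suc j))) = fob G1 (zs ! j)" "far G0 (k1a (p (Suc j), c ! Suc j, edg s (Suc j) (Suc (Suc j)))) = fob G0 (zs ! Suc j)"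
        using ea[of j] ea[of "Suc j"] p[of j] p[of "Suc j"] j by (simp_all add: G_simps(3,4))
      then show "far G1 (?gs ! j) = far G0 (?gs ! Suc j)"
        using chainsD(3)[OF z j] j by simp
    qed (use ea in auto)
    have "iso_arr (fibre_power C1 G0 G1 n) ?gs"
      by (rule iso_fibre_power[OF G_functor gs]) (simp add: iso_C1 ea ic)
    moreover have "src (fibre_power C1 G0 G1 n) ?gs = zs"
      using gs ea p chainsD(1)[OF z] by (auto intro!: nth_equalityI simp del: C1_simps(2))
    moreover have "tgt (fibre_power C1 G0 G1 n) ?gs = SO n s"
      using gs ea n by (auto simp: SO_def simp del: C1_simps(2))
    ultimately show "\<exists>x\<in>obj (fibre_power C1 H0 H1 n). \<exists>c. iso_arr (fibre_power C1 G0 G1 n) c \<and>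
        src (fibre_power C1 G0 G1 n) c = zs \<and> tgt (fibre_power C1 G0 G1 n) c = fob (id_functor (fibre_power C1 H0 H1 n)) x"
      using sob by (intro bexI[of _ "SO n s"] exI[of _ ?gs]) (simp_all only: id_functor_simps simp_thms)
  qed
  then show ?thesis
    unfolding weakly_globular_def equivalence_functor_iff_ff_es
    using double_category_DC quotient_C0 by (simp add: G0_def G1_def)
qed

section \<open>Evaluation from the nerve to \<open>Y\<close>\<close>

lemma obj_nerve: "xs \<in> obj (nerve_lev DC k) \<longleftrightarrow> (\<exists>s \<in> T k. xs = SO k s)"
proof
  assume "xs \<in> obj (nerve_lev DC k)"
  then show "\<exists>s \<in> T k. xs = SO k s"
    using spined.valid_spine[OF object_spined, of k xs]
    by (simp add: double_category.nerve_lev_obj[OF double_category_DC] spined.spine_def[OF object_spined] SO_def)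
next
  assume "\<exists>s \<in> T k. xs = SO k s"
  then obtain s where s: "s \<in> T k" "xs = SO k s" by blast
  show "xs \<in> obj (nerve_lev DC k)"
    using spined.spine_valid[OF object_spined s(1)] s(2)
    by (simp add: double_category.nerve_lev_obj[OF double_category_DC] spined.spine_def[OF object_spined] SO_def)
qed

lemma arr_nerve: "xs \<in> arr (nerve_lev DC k) \<longleftrightarrow> (\<exists>\<sigma> \<in> A k. xs = SA k \<sigma>)"
proof
  assume "xs \<in> arr (nerve_lev DC k)"
  then show "\<exists>\<sigma> \<in> A k. xs = SA k \<sigma>"
    using spined.valid_spine[OF arrow_spined, of k xs]
    by (simp add: double_category.nerve_lev_arr[OF double_category_DC] spined.spine_def[OF arrow_spined] SA_def)
next
  assume "\<exists>\<sigma> \<in> A k. xs = SA k \<sigma>"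
  then obtain \<sigma> where s: "\<sigma> \<in> A k" "xs = SA k \<sigma>" by blast
  show "xs \<in> arr (nerve_lev DC k)"
    using spined.spine_valid[OF arrow_spined s(1)] s(2)
    by (simp add: double_category.nerve_lev_arr[OF double_category_DC] spined.spine_def[OF arrow_spined] SA_def)
qed

lemma nmap_SO:
  assumes "s \<in> T k" "\<theta> \<in> Delta m k"
  shows "nmap (object_row DC) m k \<theta> (SO k s) = SO m (res m \<theta> s)"
  using spined.spine_nmap[OF object_spined assms] by (simp add: spined.spine_def[OF object_spined] SO_def)

lemma nmap_SA:
  assumes "\<sigma> \<in> A k" "\<theta> \<in> Delta m k"
  shows "nmap (arrow_row DC) m k \<theta> (SA k \<sigma>) = SA m (rA m k \<theta> \<sigma>)"
  using spined.spine_nmap[OF arrow_spined assms] by (simp add: spined.spine_def[OF arrow_spined] SA_def rA_pa[OF assms] rA_va)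

definition evo where "evo k xs = ev k (inv_into (T k) (SO k) xs)"
definition eva where "eva k xs = fst (snd (inv_into (A k) (SA k) xs))"

lemma evo_SO [simp]: "s \<in> T k \<Longrightarrow> evo k (SO k s) = ev k s"
  by (simp add: evo_def)

lemma eva_SA: "(s, F, t) \<in> A k \<Longrightarrow> eva k (SA k (s, F, t)) = F"
  by (simp add: eva_def)

lemma nerve_SA:
  assumes a: "(s, F, t) \<in> A k"
  shows "SA k (s, F, t) \<in> arr (nerve_lev DC k)" "src (nerve_lev DC k) (SA k (s, F, t)) = SO k s" "tgt (nerve_lev DC k) (SA k (s, F, t)) = SO k t"
proof -
  show *: "SA k (s, F, t) \<in> arr (nerve_lev DC k)"
    using a arr_nerve by blast
  note v = *[unfolded double_category.nerve_lev_arr[OF double_category_DC]]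
  show "src (nerve_lev DC k) (SA k (s, F, t)) = SO k s" "tgt (nerve_lev DC k) (SA k (s, F, t)) = SO k t"
    unfolding double_category.nerve_lev_simps(1,2)[OF double_category_DC v] DC_simps by (rule SA_src[OF a])+
qed

lemma arr_nerveE:
  assumes "f \<in> arr (nerve_lev DC k)"
  obtains s F t where "(s, F, t) \<in> A k" "f = SA k (s, F, t)"
  using assms arr_nerve prod_cases3 by metis

lemma nerve_SO_ident: "s \<in> T k \<Longrightarrow> ident (nerve_lev DC k) (SO k s) = SA k (s, ident (L k) (ev k s), s)"
proof -
  assume s: "s \<in> T k"
  then have "SO k s \<in> obj (nerve_lev DC k)"
    using obj_nerve by blast
  from double_category.nerve_lev_simps(3)[OF double_category_DC this[unfolded double_category.nerve_lev_obj[OF double_category_DC]]]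
  show ?thesis
    by (simp only: SA_ident(2)[OF s] DC_simps)
qed

lemma nerve_SA_cmp:
  assumes a: "(s, F, t) \<in> A k" and b: "(t, G, r) \<in> A k"
  shows "cmp (nerve_lev DC k) (SA k (t, G, r)) (SA k (s, F, t)) = SA k (s, cmp (L k) G F, r)"
proof -
  note v = nerve_SA(1)[OF a, unfolded double_category.nerve_lev_arr[OF double_category_DC]]
    nerve_SA(1)[OF b, unfolded double_category.nerve_lev_arr[OF double_category_DC]]
  have "map (if k = 0 then src (cat0 DC) else src (cat1 DC)) (SA k (t, G, r)) = map (if k = 0 then tgt (cat0 DC) else tgt (cat1 DC)) (SA k (s, F, t))"
    unfolding DC_simps SA_src(1)[OF b] SA_src(2)[OF a] ..
  from double_category.nerve_lev_simps(4)[OF double_category_DC v this]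
  show ?thesis
    unfolding SA_cmp(2)[OF a b] DC_simps by (cases "k = 0") simp_all
qed

text \<open>Evaluation of formal restrictions commutes strictly with the action, so the cells are
  identities.\<close>

definition EV :: "('u list, 'u list, 'o, 'a) pnat" where
  "EV = \<lparr>pfun = (\<lambda>k. functor_on (nerve_lev DC k) (evo k) (eva k)),
     pcell = (\<lambda>m n \<phi>. if \<phi> \<in> Delta m n then \<lambda>xs\<in>obj (nerve_lev DC n). ident (L m) (fo m n \<phi> (evo n xs)) else undefined)\<rparr>"

lemma nerve_cat: "category (nerve_lev DC k)"
  by (rule double_category.nerve_lev_category[OF double_category_DC])

lemma EV_functor: "is_functor (nerve_lev DC k) (L k) (functor_on (nerve_lev DC k) (evo k) (eva k))"
proof (rule functor_functor_on, goal_cases)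
  case 1 show ?case by (rule nerve_cat)
next
  case 2 show ?case by simp
next
  case (3 x)
  then obtain s where "s \<in> T k" "x = SO k s" using obj_nerve by blast
  then show ?case by simp
next
  case (4 f)
  then obtain s F t where f: "(s, F, t) \<in> A k" "f = SA k (s, F, t)" by (rule arr_nerveE)
  show ?case
    unfolding f(2) nerve_SA(2,3)[OF f(1)] eva_SA[OF f(1)] using AD[OF f(1)] by simp
next
  case (5 x)
  then obtain s where s: "s \<in> T k" "x = SO k s" using obj_nerve by blast
  show ?case
    unfolding s(2) nerve_SO_ident[OF s(1)] eva_SA[OF SA_ident(1)[OF s(1)]] using s(1) by simp
next
  case (6 f g)
  obtain s F t where f: "(s, F, t) \<in> A k" "f = SA k (s, F, t)" using 6(1) by (rule arr_nerveE)
  obtain t' G r where g: "(t', G, r) \<in> A k" "g = SA k (t', G, r)" using 6(2) by (rule arr_nerveE)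
  have "SO k t' = SO k t"
    using 6(3) unfolding f(2) g(2) nerve_SA(2)[OF g(1)] nerve_SA(3)[OF f(1)] .
  then have t': "t' = t"
    by (rule SO_inj[OF AD(1)[OF g(1)] AD(2)[OF f(1)]])
  note g1 = g(1)[unfolded t']
  show ?case
    unfolding f(2) g(2) t' nerve_SA_cmp[OF f(1) g1] eva_SA[OF f(1)] eva_SA[OF g1] eva_SA[OF SA_cmp(1)[OF f(1) g1]] ..
qed

lemma EV_simps [simp]:
  "xs \<in> obj (nerve_lev DC k) \<Longrightarrow> fob (pfun EV k) xs = evo k xs"
  "f \<in> arr (nerve_lev DC k) \<Longrightarrow> far (pfun EV k) f = eva k f"
  "\<phi> \<in> Delta m n \<Longrightarrow> xs \<in> obj (nerve_lev DC n) \<Longrightarrow> pcell EV m n \<phi> xs = ident (L m) (fo m n \<phi> (evo n xs))"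
  by (simp_all add: EV_def)

lemma nerve_act_simps:
  assumes "\<phi> \<in> Delta m n"
  shows "s \<in> T n \<Longrightarrow> fob (act (nerve DC) m n \<phi>) (SO n s) = SO m (res m \<phi> s)"
    "\<sigma> \<in> A n \<Longrightarrow> far (act (nerve DC) m n \<phi>) (SA n \<sigma>) = SA m (rA m n \<phi> \<sigma>)"
proof -
  show "fob (act (nerve DC) m n \<phi>) (SO n s) = SO m (res m \<phi> s)" if s: "s \<in> T n"
  proof -
    have "SO n s \<in> obj (nerve_lev DC n)"
      using s obj_nerve by blast
    then show ?thesis
      using assms s by (simp add: nerve_simps nmap_SO)
  qed
  show "far (act (nerve DC) m n \<phi>) (SA n \<sigma>) = SA m (rA m n \<phi> \<sigma>)" if s: "\<sigma> \<in> A n"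
  proof -
    have "SA n \<sigma> \<in> arr (nerve_lev DC n)"
      using s arr_nerve by blast
    then show ?thesis
      using assms s by (simp add: nerve_simps nmap_SA)
  qed
qed

lemma nerve_simplicial: "simplicial_cat (nerve DC)"
  by (rule double_category.simplicial_nerve[OF double_category_DC])

lemma evo_obj: "xs \<in> obj (nerve_lev DC k) \<Longrightarrow> evo k xs \<in> obj (L k)"
  using fun_obj[OF EV_functor] by simp

lemma evo_act:
  assumes "\<phi> \<in> Delta m n" "xs \<in> obj (nerve_lev DC n)"
  shows "fob (act (nerve DC) m n \<phi>) xs \<in> obj (nerve_lev DC m)" "evo m (fob (act (nerve DC) m n \<phi>) xs) = fo m n \<phi> (evo n xs)"
proof -
  obtain s where s: "s \<in> T n" "xs = SO n s" using assms obj_nerve by blast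
  have r: "res m \<phi> s \<in> T m"
    using s assms by simp
  show "fob (act (nerve DC) m n \<phi>) xs \<in> obj (nerve_lev DC m)"
    unfolding s(2) nerve_act_simps(1)[OF assms(1) s(1)] using r obj_nerve by blast
  show "evo m (fob (act (nerve DC) m n \<phi>) xs) = fo m n \<phi> (evo n xs)"
    unfolding s(2) nerve_act_simps(1)[OF assms(1) s(1)] using s r assms by simp
qed

lemma eva_act:
  assumes "\<phi> \<in> Delta m n" "f \<in> arr (nerve_lev DC n)"
  shows "eva m (far (act (nerve DC) m n \<phi>) f) = fa m n \<phi> (eva n f)"
proof -
  obtain s F t where f: "(s, F, t) \<in> A n" "f = SA n (s, F, t)" using assms(2) by (rule arr_nerveE)
  have "rA m n \<phi> (s, F, t) = (res m \<phi> s, fa m n \<phi> F, res m \<phi> t)"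
    by (simp add: rA_def)
  then show ?thesis
    unfolding f(2) nerve_act_simps(2)[OF assms(1) f(1)] eva_SA[OF f(1)]
    using eva_SA[of "res m \<phi> s" "fa m n \<phi> F" "res m \<phi> t" m] rA_A[OF f(1) assms(1)] by (simp only:)
qed

lemma EV_pn: "pseudonatural (nerve DC) Y EV"
proof (rule pnI, goal_cases)
  case 1 show ?case by (rule nerve_simplicial)
next
  case 2 show ?case by simp
next
  case (3 n)
  show ?case by (simp add: EV_def nerve_simps(1) EV_functor)
next
  case (4 m n \<phi> x)
  then show ?case using evo_act[OF 4(1), of x] by (simp add: nerve_simps(1) evo_obj)
next
  case (5 m n \<phi> a)
  then have a: "a \<in> arr (nerve_lev DC n)" by (simp add: nerve_simps(1))
  have "far (act (nerve DC) m n \<phi>) a \<in> arr (nerve_lev DC m)"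
    using act_rules(2)[OF nerve_simplicial 5] by (simp add: nerve_simps(1))
  moreover have "eva n a \<in> arr (L n)" "src (L n) (eva n a) = evo n (src (nerve_lev DC n) a)" "tgt (L n) (eva n a) = evo n (tgt (nerve_lev DC n) a)"
    using fun_arr[OF EV_functor a] a nerve_cat by simp_all
  ultimately show ?case
    using a 5(1) nerve_cat by (simp add: nerve_simps(1) eva_act)
next
  case (6 n x)
  then show ?case by (simp add: nerve_simps(1) evo_obj)
next
  case (7 l m n \<phi> \<psi> x)
  then show ?case
    using evo_act[OF 7(2), of x] by (simp add: nerve_simps(1) Delta_compose[of _ _ m] evo_obj act_compose[of Y _ _ m])
next
  case (8 m n \<phi>)
  then show ?case by (simp add: EV_def)
next
  case (9 m n \<phi> x)
  then show ?case by (simp add: EV_def nerve_simps(1))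
qed

text \<open>Arrows between two presentations were defined as the arrows between their values, which
  gives full faithfulness. Every object of \<open>Y\<close> on level \<open>k\<close> is the value
  of its tautological presentation by the identity of \<open>[k]\<close>.\<close>

lemma EV_ff_es: "ff_es (lev (nerve DC) k) (L k) (pfun EV k)"
  unfolding nerve_simps(1)
proof (rule ff_esI)
  show "is_functor (nerve_lev DC k) (L k) (pfun EV k)"
    by (simp add: EV_def EV_functor)
next
  fix x y g
  assume a: "x \<in> obj (nerve_lev DC k)" "y \<in> obj (nerve_lev DC k)" "g \<in> arr (L k)" "src (L k) g = fob (pfun EV k) x" "tgt (L k) g = fob (pfun EV k) y"
  obtain s where s: "s \<in> T k" "x = SO k s" using a(1) obj_nerve by blast
  obtain t where t: "t \<in> T k" "y = SO k t" using a(2) obj_nerve by blast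
  have st: "(s, g, t) \<in> A k"
    using a s t by (simp add: A_def)
  show "\<exists>f\<in>arr (nerve_lev DC k). src (nerve_lev DC k) f = x \<and> tgt (nerve_lev DC k) f = y \<and> far (pfun EV k) f = g"
    using nerve_SA[OF st] eva_SA[OF st] s(2) t(2) by (intro bexI[of _ "SA k (s, g, t)"]) simp_all
next
  fix f g
  assume a: "f \<in> arr (nerve_lev DC k)" "g \<in> arr (nerve_lev DC k)" "src (nerve_lev DC k) f = src (nerve_lev DC k) g"
    "tgt (nerve_lev DC k) f = tgt (nerve_lev DC k) g" "far (pfun EV k) f = far (pfun EV k) g"
  obtain s F t where f: "(s, F, t) \<in> A k" "f = SA k (s, F, t)" using a(1) by (rule arr_nerveE)
  obtain s' F' t' where g: "(s', F', t') \<in> A k" "g = SA k (s', F', t')" using a(2) by (rule arr_nerveE)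
  have "s = s'"
    by (rule SO_inj[OF AD(1)[OF f(1)] AD(1)[OF g(1)]]) (use a(3) in \<open>simp only: f(2) g(2) nerve_SA(2)[OF f(1)] nerve_SA(2)[OF g(1)]\<close>)
  moreover have "t = t'"
    by (rule SO_inj[OF AD(2)[OF f(1)] AD(2)[OF g(1)]]) (use a(4) in \<open>simp only: f(2) g(2) nerve_SA(3)[OF f(1)] nerve_SA(3)[OF g(1)]\<close>)
  moreover have "F = F'"
    using a(5) a(1,2) by (simp add: f(2) g(2) eva_SA[OF f(1)] eva_SA[OF g(1)])
  ultimately show "f = g"
    using f(2) g(2) by simp
next
  fix y assume y: "y \<in> obj (L k)"
  define s where "s = (k, (\<lambda>i\<in>{..k}. i), y)"
  have s: "s \<in> T k" "ev k s = y"
    using y by (simp_all add: T_def s_def ev_def)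
  moreover have "SO k s \<in> obj (nerve_lev DC k)"
    using s obj_nerve by blast
  ultimately show "\<exists>x\<in>obj (nerve_lev DC k). \<exists>c. iso_arr (L k) c \<and> src (L k) c = y \<and> tgt (L k) c = fob (pfun EV k) x"
    using y by (intro bexI[of _ "SO k s"] exI[of _ "ident (L k) y"]) simp_all
qed

end

section \<open>From weakly globular double categories to Tamsamani weak 2-categories\<close>

text \<open>Conjugation in two stages, by \<open>a\<close> and \<open>b\<close> before applying
  \<open>F\<close> and by \<open>a'\<close> and \<open>b'\<close> after it, is conjugation by the
  composites. The action of the discretisation on arrows is of this form.\<close>

lemma functor_conj_cmp:
  assumes F: "is_functor C D F" and g: "g \<in> arr C"
    and a: "iso_arr C a" "src C a = src C g" and b: "iso_arr C b" "src C b = tgt C g"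
    and a': "iso_arr D a'" "src D a' = fob F (tgt C a)" and b': "iso_arr D b'" "src D b' = fob F (tgt C b)"
  shows "cmp D (cmp D b' (far F b)) (cmp D (far F g) (iinv D (cmp D a' (far F a)))) =
    cmp D b' (cmp D (far F (cmp C b (cmp C g (iinv C a)))) (iinv D a'))"
proof -
  have [simp]: "category C" "category D"
    using F by (simp_all add: is_functor_def)
  note [simp] = functor_rules[OF F] g a b a' b' iso_arr_arr[OF a(1)] iso_arr_arr[OF b(1)] iso_arr_arr[OF a'(1)] iso_arr_arr[OF b'(1)]
  show ?thesis
    by simp
qed

text \<open>The discretisation adds to the objects \<open>x\<close> of level \<open>n\<close> a record of the way \<open>x = X(\<phi>)(x')\<close> arises as a
  degeneracy: replacing level \<open>0\<close> by representatives forces a different value on the totally degenerate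
  objects, and only this bookkeeping makes the result strictly functorial.\<close>

locale discretization = simplicial_cat X for X :: "('o, 'a) scat" +
  fixes rep :: "'o \<Rightarrow> 'o" and \<kappa> :: "'o \<Rightarrow> 'a"
    and ko :: "nat \<Rightarrow> nat \<times> (nat \<Rightarrow> nat) \<times> 'o \<Rightarrow> 'u" and ka :: "'u \<times> 'a \<times> 'u \<Rightarrow> 'u"
  assumes thin: "f \<in> arr (lev X 0) \<Longrightarrow> g \<in> arr (lev X 0) \<Longrightarrow> src (lev X 0) f = src (lev X 0) g \<Longrightarrow> tgt (lev X 0) f = tgt (lev X 0) g \<Longrightarrow> f = g"
    and \<kappa> [simp]: "x \<in> obj (lev X 0) \<Longrightarrow> iso_arr (lev X 0) (\<kappa> x)" "x \<in> obj (lev X 0) \<Longrightarrow> src (lev X 0) (\<kappa> x) = x"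
      "x \<in> obj (lev X 0) \<Longrightarrow> tgt (lev X 0) (\<kappa> x) = rep x"
    and rep_eq: "f \<in> arr (lev X 0) \<Longrightarrow> rep (src (lev X 0) f) = rep (tgt (lev X 0) f)"
    and ko: "inj_on (ko n) {s. fst (snd s) \<in> Delta n (fst s) \<and> snd (snd s) \<in> obj (lev X (fst s))}"
    and ka: "inj ka"
begin

abbreviation "zero n \<equiv> (\<lambda>i\<in>{..n}. 0 :: nat)"

lemma \<kappa>_arr [simp]: "x \<in> obj (L 0) \<Longrightarrow> \<kappa> x \<in> arr (L 0)"
  by (rule iso_arr_arr) simp

lemma rep_obj [simp]: "x \<in> obj (L 0) \<Longrightarrow> rep x \<in> obj (L 0)"
  using cat_tgt_obj[of "L 0" "\<kappa> x"] by simp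

lemma rep_rep [simp]: "x \<in> obj (L 0) \<Longrightarrow> rep (rep x) = rep x"
  using rep_eq[of "\<kappa> x"] by simp

lemma \<kappa>_rep: "x \<in> obj (L 0) \<Longrightarrow> rep x = x \<Longrightarrow> \<kappa> x = ident (L 0) x"
  by (rule thin) simp_all

text \<open>The map of a triple is monotone, so equality of its two extreme values means that it is
  constant and the simplex totally degenerate.\<close>

definition con :: "nat \<Rightarrow> nat \<times> (nat \<Rightarrow> nat) \<times> 'o \<Rightarrow> bool" where
  "con n s \<longleftrightarrow> fst (snd s) 0 = fst (snd s) n"
definition v0 where "v0 s = fo 0 (fst s) (vertex_inclusion (fst (snd s) 0)) (snd (snd s))"
text \<open>A totally degenerate simplex is presented anew, from level 0, as the degeneracy of the
  representative of its vertex. All other triples are kept.\<close>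

definition norm where "norm n s = (if con n s then (0, zero n, rep (v0 s)) else s)"
text \<open>The isomorphism from the value of a triple to the value of its normal form: the
  corresponding degeneracy of \<open>\<kappa>\<close>, or an identity if nothing changes.\<close>

definition J where "J n s = (if con n s then fa n 0 (zero n) (\<kappa> (v0 s)) else ident (L n) (ev n s))"
definition P where "P n = {s \<in> T n. norm n s = s}"

lemma v0_obj [simp]: "s \<in> T n \<Longrightarrow> v0 s \<in> obj (L 0)"
  by (auto simp: T_def v0_def Delta_le)

lemma zero_eq: "compose {..l} (zero n) \<theta> = zero l" if "\<theta> \<in> Delta l n"
  using Delta_le[OF that] by (auto simp: compose_def fun_eq_iff)

lemma zero_id: "zero 0 = (\<lambda>i\<in>{..0}. i)"
  by (auto simp: fun_eq_iff)

lemma fo_zero: "x \<in> obj (L 0) \<Longrightarrow> fo 0 0 (zero 0) x = x"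
  unfolding zero_id by (rule act_id_simps(1)[OF self_simplicial])

lemma con_const: "s \<in> T n \<Longrightarrow> con n s \<Longrightarrow> i \<le> n \<Longrightarrow> fst (snd s) i = fst (snd s) 0"
  using Delta_mono[of "fst (snd s)" n "fst s" 0 i] Delta_mono[of "fst (snd s)" n "fst s" i n] by (simp add: T_def con_def)

lemma con_vertex:
  assumes "s \<in> T n" "con n s"
  shows "fst (snd s) = compose {..n} (vertex_inclusion (fst (snd s) 0)) (zero n)"
proof (rule Delta_eqI[of _ n "fst s" _ "fst s"])
  show "compose {..n} (vertex_inclusion (fst (snd s) 0)) (zero n) \<in> Delta n (fst s)"
    by (rule Delta_compose[of _ _ 0]) (use assms Delta_le[of "fst (snd s)" n "fst s" 0] in \<open>auto simp: T_def\<close>)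
  show "fst (snd s) i = compose {..n} (vertex_inclusion (fst (snd s) 0)) (zero n) i" if "i \<le> n" for i
    using con_const[OF assms that] that by (simp add: compose_def vertex_inclusion_def)
qed (use assms in \<open>simp add: T_def\<close>)

lemma con_ev:
  assumes "s \<in> T n" "con n s"
  shows "ev n s = fo n 0 (zero n) (v0 s)"
proof -
  have "fo n 0 (zero n) (v0 s) = fo n (fst s) (compose {..n} (vertex_inclusion (fst (snd s) 0)) (zero n)) (snd (snd s))"
    unfolding v0_def by (rule compose_fo) (use assms Delta_le[of "fst (snd s)" n "fst s" 0] in \<open>auto simp: T_def\<close>)
  then show ?thesis
    by (simp only: ev_def con_vertex[OF assms, symmetric])
qed

lemma res_compose:
  assumes "\<psi> \<in> Delta k l"
  shows "res k \<psi> (res l \<theta> s) = res k (compose {..k} \<theta> \<psi>) s"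
  using Delta_le[OF assms] by (auto simp: res_def compose_def fun_eq_iff)

lemma res_id: "s \<in> T n \<Longrightarrow> res n (\<lambda>i\<in>{..n}. i) s = s"
  using Delta_arb[of "fst (snd s)" n "fst s"] by (auto simp: res_def compose_def prod_eq_iff fun_eq_iff T_def)

lemma res_con: "s \<in> T n \<Longrightarrow> \<theta> \<in> Delta l n \<Longrightarrow> con n s \<Longrightarrow> con l (res l \<theta> s) \<and> v0 (res l \<theta> s) = v0 s"
  using con_const[of s n "\<theta> 0"] con_const[of s n "\<theta> l"] Delta_le[of \<theta> l n 0] Delta_le[of \<theta> l n l]
  by (auto simp: con_def res_def v0_def compose_def)

lemma norm_con: "con n s \<Longrightarrow> s \<in> T n \<Longrightarrow> con n (norm n s) \<and> v0 (norm n s) = rep (v0 s)"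
proof -
  assume a: "con n s" "s \<in> T n"
  have v: "vertex_inclusion 0 = (\<lambda>i\<in>{..0}. i)"
    by (auto simp: vertex_inclusion_def fun_eq_iff)
  have r: "rep (v0 s) \<in> obj (L 0)"
    using a by simp
  have "v0 (0, zero n, rep (v0 s)) = rep (v0 s)"
    using act_id_simps(1)[OF self_simplicial r] by (simp add: v0_def[of "(0, zero n, rep (v0 s))"] v)
  then show ?thesis
    using a by (simp add: norm_def con_def)
qed

lemma norm_T [simp]:
  assumes "s \<in> T n"
  shows "norm n s \<in> T n"
proof (cases "con n s")
  case True
  have "rep (v0 s) \<in> obj (L 0)"
    using assms by simp
  then show ?thesis
    using True by (simp only: norm_def T_def if_True mem_Collect_eq fst_conv snd_conv const_Delta simp_thms)
qed (simp add: norm_def assms)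

lemma norm_norm [simp]: "s \<in> T n \<Longrightarrow> norm n (norm n s) = norm n s"
  using norm_con[of n s] by (cases "con n s") (simp_all add: norm_def[of n])

lemma norm_P [simp]: "s \<in> T n \<Longrightarrow> norm n s \<in> P n"
  by (simp add: P_def)

lemma P_T: "s \<in> P n \<Longrightarrow> s \<in> T n" "s \<in> P n \<Longrightarrow> norm n s = s"
  by (simp_all add: P_def)

text \<open>A restriction of a totally degenerate simplex is totally degenerate on the same vertex,
  and taking representatives is idempotent. One normalisation at the end therefore suffices.\<close>

lemma norm_res:
  assumes "s \<in> T n" "\<theta> \<in> Delta l n"
  shows "norm l (res l \<theta> (norm n s)) = norm l (res l \<theta> s)"
proof (cases "con n s")
  case True
  then show ?thesis
    using res_con[OF assms True] res_con[OF norm_T[OF assms(1)] assms(2)] norm_con[OF True assms(1)] assms(1)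
    by (simp add: norm_def[of l])
qed (simp add: norm_def[of n])

lemma norm_ev:
  assumes "s \<in> T n" "con n s"
  shows "ev n (norm n s) = fo n 0 (zero n) (rep (v0 s))"
  using assms by (simp add: norm_def ev_def)

lemma J_rules [simp]:
  assumes "s \<in> T n"
  shows "iso_arr (L n) (J n s)" "J n s \<in> arr (L n)" "src (L n) (J n s) = ev n s" "tgt (L n) (J n s) = ev n (norm n s)"
  using assms con_ev[OF assms] norm_ev[OF assms] by (simp_all add: J_def norm_def)

lemma J_P:
  assumes "s \<in> P n"
  shows "J n s = ident (L n) (ev n s)"
proof (cases "con n s")
  case True
  have s: "s \<in> T n" "norm n s = s"
    using P_T[OF assms] by auto
  then have "rep (v0 s) = v0 s"
    using norm_con[OF True s(1)] by simp
  then show ?thesis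
    using True con_ev[OF s(1) True] s by (simp add: J_def \<kappa>_rep)
qed (simp add: J_def)

text \<open>Exactly one factor matters. If \<open>s\<close> is totally degenerate, the first
  normalisation makes the whole change, and the second factor is an identity because
  \<open>\<kappa>\<close> is trivial at representatives. Otherwise \<open>J n s\<close> is an
  identity.\<close>

lemma J_cocycle:
  assumes "s \<in> T n" "\<theta> \<in> Delta l n"
  shows "J l (res l \<theta> s) = cmp (L l) (J l (res l \<theta> (norm n s))) (fa l n \<theta> (J n s))"
proof (cases "con n s")
  case True
  note r = res_con[OF assms True] res_con[OF norm_T[OF assms(1)] assms(2)] norm_con[OF True assms(1)]
  have "fa l n \<theta> (J n s) = fa l 0 (zero l) (\<kappa> (v0 s))"
    using assms True by (simp add: J_def compose_fo zero_eq)
  moreover have "J l (res l \<theta> (norm n s)) = fa l 0 (zero l) (ident (L 0) (rep (v0 s)))"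
    using r assms by (simp add: J_def \<kappa>_rep)
  ultimately show ?thesis
    using r assms by (simp add: J_def[of l "res l \<theta> s"])
next
  case False
  then have "norm n s = s" "J n s = ident (L n) (ev n s)"
    by (simp_all add: norm_def J_def)
  then show ?thesis
    using assms by simp
qed

section \<open>The discretised simplicial category\<close>

definition dec where "dec n = inv_into (T n) (ko n)"

lemma dec [simp]: "s \<in> T n \<Longrightarrow> dec n (ko n s) = s"
  unfolding dec_def using ko[of n] by (intro inv_into_f_f) (simp_all add: T_def)

lemma ka_inv [simp]: "inv ka (ka f) = f" "ka f = ka g \<longleftrightarrow> f = g"
  using ka by (simp_all add: inj_eq)

definition ZA where "ZA n = {(p, f, q). p \<in> ko n ` P n \<and> q \<in> ko n ` P n \<and> f \<in> arr (L n) \<and> src (L n) f = ev n (dec n p) \<and> tgt (L n) f = ev n (dec n q)}"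

definition Zlev :: "nat \<Rightarrow> ('u, 'u) cat" where
  "Zlev n = mk_cat (ko n ` P n) (ka ` ZA n) (\<lambda>f. fst (inv ka f)) (\<lambda>f. snd (snd (inv ka f)))
     (\<lambda>x. ka (x, ident (L n) (ev n (dec n x)), x))
     (\<lambda>g f. ka (fst (inv ka f), cmp (L n) (fst (snd (inv ka g))) (fst (snd (inv ka f))), snd (snd (inv ka g))))"

definition zact where "zact l n \<theta> p = ko l (norm l (res l \<theta> (dec n p)))"
definition jj where "jj l n \<theta> p = J l (res l \<theta> (dec n p))"
text \<open>Normalisation after restriction may move the ends of an arrow; the restricted arrow is
  moved along with them by conjugation.\<close>

definition zarr where "zarr l n \<theta> f = (case inv ka f of (p, g, q) \<Rightarrow>
   ka (zact l n \<theta> p, cmp (L l) (jj l n \<theta> q) (cmp (L l) (fa l n \<theta> g) (iinv (L l) (jj l n \<theta> p))), zact l n \<theta> q))"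

definition Z :: "('u, 'u) scat" where
  "Z = \<lparr>lev = Zlev, act = (\<lambda>l n \<theta>. if \<theta> \<in> Delta l n then functor_on (Zlev n) (zact l n \<theta>) (zarr l n \<theta>) else undefined)\<rparr>"

lemma P_dec: "p \<in> ko n ` P n \<Longrightarrow> dec n p \<in> T n" "p \<in> ko n ` P n \<Longrightarrow> dec n p \<in> P n"
  "p \<in> ko n ` P n \<Longrightarrow> ko n (dec n p) = p"
  by (auto simp: P_T)

lemma Zlev_cat [simp]: "category (Zlev n)"
  unfolding Zlev_def by (rule category_mk_cat) (auto simp: ZA_def P_T)

lemma Zlev_simps [simp]:
  "obj (Zlev n) = ko n ` P n" "arr (Zlev n) = ka ` ZA n"
  "(p, f, q) \<in> ZA n \<Longrightarrow> src (Zlev n) (ka (p, f, q)) = p" "(p, f, q) \<in> ZA n \<Longrightarrow> tgt (Zlev n) (ka (p, f, q)) = q"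
  "x \<in> ko n ` P n \<Longrightarrow> ident (Zlev n) x = ka (x, ident (L n) (ev n (dec n x)), x)"
  "(p, f, q) \<in> ZA n \<Longrightarrow> (q, g, r) \<in> ZA n \<Longrightarrow> cmp (Zlev n) (ka (q, g, r)) (ka (p, f, q)) = ka (p, cmp (L n) g f, r)"
  by (simp_all add: Zlev_def)

lemma ZA_D:
  assumes "(p, f, q) \<in> ZA n"
  shows "p \<in> ko n ` P n" "q \<in> ko n ` P n" "f \<in> arr (L n)" "src (L n) f = ev n (dec n p)" "tgt (L n) f = ev n (dec n q)"
  using assms by (simp_all add: ZA_def)

lemma zact_rules [simp]:
  assumes "p \<in> ko n ` P n" "\<theta> \<in> Delta l n"
  shows "zact l n \<theta> p \<in> ko l ` P l" "dec l (zact l n \<theta> p) = norm l (res l \<theta> (dec n p))"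
  using P_dec(1)[OF assms(1)] assms(2) by (simp_all add: zact_def)

lemma jj_rules [simp]:
  assumes "p \<in> ko n ` P n" "\<theta> \<in> Delta l n"
  shows "iso_arr (L l) (jj l n \<theta> p)" "jj l n \<theta> p \<in> arr (L l)" "src (L l) (jj l n \<theta> p) = fo l n \<theta> (ev n (dec n p))"
    "tgt (L l) (jj l n \<theta> p) = ev l (dec l (zact l n \<theta> p))"
  using P_dec(1)[OF assms(1)] assms by (simp_all add: jj_def)

text \<open>By \<open>norm_res\<close> the intermediate normalisation leaves no trace in the result,
  and by \<open>J_cocycle\<close> the isomorphism it contributed is absorbed by that of the
  composite map. The first part is strictness on objects.\<close>

lemma zact_compose:
  assumes "p \<in> ko n ` P n" "\<theta> \<in> Delta l n" "\<psi> \<in> Delta k l"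
  shows "zact k l \<psi> (zact l n \<theta> p) = zact k n (compose {..k} \<theta> \<psi>) p"
    "jj k n (compose {..k} \<theta> \<psi>) p = cmp (L k) (jj k l \<psi> (zact l n \<theta> p)) (fa k l \<psi> (jj l n \<theta> p))"
proof -
  note p = P_dec(1)[OF assms(1)]
  have r: "res k \<psi> (res l \<theta> (dec n p)) = res k (compose {..k} \<theta> \<psi>) (dec n p)"
    by (rule res_compose[OF assms(3)])
  show "zact k l \<psi> (zact l n \<theta> p) = zact k n (compose {..k} \<theta> \<psi>) p"
    using norm_res[OF res_T[OF p assms(2)] assms(3)] by (simp add: zact_def[of k] zact_rules[OF assms(1,2)] r)
  show "jj k n (compose {..k} \<theta> \<psi>) p = cmp (L k) (jj k l \<psi> (zact l n \<theta> p)) (fa k l \<psi> (jj l n \<theta> p))"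
    using J_cocycle[OF res_T[OF p assms(2)] assms(3)] by (simp add: jj_def zact_rules[OF assms(1,2)] r)
qed

lemma zact_id:
  assumes "p \<in> ko n ` P n"
  shows "zact n n (\<lambda>i\<in>{..n}. i) p = p" "jj n n (\<lambda>i\<in>{..n}. i) p = ident (L n) (ev n (dec n p))"
  using P_dec[OF assms] by (simp_all add: zact_def jj_def res_id P_T(2) J_P)

lemma zarr_ka: "zarr l n \<theta> (ka (p, g, q)) = ka (zact l n \<theta> p, cmp (L l) (jj l n \<theta> q) (cmp (L l) (fa l n \<theta> g) (iinv (L l) (jj l n \<theta> p))), zact l n \<theta> q)"
  by (simp add: zarr_def)

lemma zarr_ZA:
  assumes "(p, f, q) \<in> ZA n" "\<theta> \<in> Delta l n"
  shows "(zact l n \<theta> p, cmp (L l) (jj l n \<theta> q) (cmp (L l) (fa l n \<theta> f) (iinv (L l) (jj l n \<theta> p))), zact l n \<theta> q) \<in> ZA l"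
  unfolding ZA_def using ZA_D[OF assms(1)] assms(2) jj_rules[of p n \<theta> l] jj_rules[of q n \<theta> l] by (simp del: zact_rules(2))

lemma zact_functor:
  assumes \<theta> [simp]: "\<theta> \<in> Delta l n"
  shows "is_functor (Zlev n) (Zlev l) (functor_on (Zlev n) (zact l n \<theta>) (zarr l n \<theta>))"
proof (rule functor_functor_on, goal_cases)
  case (3 x)
  then show ?case by simp
next
  case (4 f)
  then obtain p g q where f: "f = ka (p, g, q)" "(p, g, q) \<in> ZA n" by auto
  show ?case
    using zarr_ZA[OF f(2) \<theta>] f by (simp add: zarr_ka)
next
  case (5 x)
  then have x: "x \<in> ko n ` P n" by simp
  show ?case
    using x P_dec(1)[OF x] jj_rules[OF x \<theta>] zact_rules(1)[OF x \<theta>] by (simp add: zarr_ka del: zact_rules)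
next
  case (6 f g)
  then obtain p h q where f: "f = ka (p, h, q)" "(p, h, q) \<in> ZA n" by auto
  obtain q' k r where g: "g = ka (q', k, r)" "(q', k, r) \<in> ZA n" using 6(2) by auto
  have q: "q' = q" using 6(3) f g by simp
  note g2 = g(2)[unfolded q]
  note fd = ZA_D[OF f(2)] and gd = ZA_D[OF g2]
  show ?case
    unfolding f(1) g(1) q Zlev_simps(6)[OF f(2) g2] zarr_ka Zlev_simps(6)[OF zarr_ZA[OF f(2) \<theta>] zarr_ZA[OF g2 \<theta>]]
    using fd gd jj_rules[OF fd(1) \<theta>] jj_rules[OF fd(2) \<theta>] jj_rules[OF gd(2) \<theta>] P_dec(1)[OF fd(1)] P_dec(1)[OF fd(2)] P_dec(1)[OF gd(2)]
    by (simp del: zact_rules)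
qed simp_all

lemma Z_simplicial: "simplicial_cat Z"
proof (rule simplicial_cat.intro, goal_cases)
  case (1 n)
  show ?case by (simp add: Z_def)
next
  case (2 \<phi> m n)
  then show ?case by (simp add: Z_def zact_functor)
next
  case (3 n)
  have "zarr n n (\<lambda>i\<in>{..n}. i) f = f" if fa: "f \<in> arr (Zlev n)" for f
  proof -
    obtain p g q where f: "f = ka (p, g, q)" "(p, g, q) \<in> ZA n" using fa by auto
    note d = ZA_D[OF f(2)]
    show ?thesis
      using d P_dec(1)[OF d(1)] P_dec(1)[OF d(2)] by (simp add: f(1) zarr_ka zact_id[OF d(1)] zact_id[OF d(2)])
  qed
  then show ?case
    by (auto simp: Z_def id_functor_def zact_id intro!: functor_on_cong)
next
  case (4 \<psi> k l \<theta> n)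
  have "zarr k n (compose {..k} \<theta> \<psi>) f = zarr k l \<psi> (zarr l n \<theta> f)" if fa: "f \<in> arr (Zlev n)" for f
  proof -
    obtain p g q where f: "f = ka (p, g, q)" "(p, g, q) \<in> ZA n" using fa by auto
    note d = ZA_D[OF f(2)]
    note jr = jj_rules[OF d(1) 4(2)] jj_rules[OF d(2) 4(2)]
      jj_rules[OF zact_rules(1)[OF d(1) 4(2)] 4(1)] jj_rules[OF zact_rules(1)[OF d(2) 4(2)] 4(1)]
    have e: "fa k n (compose {..k} \<theta> \<psi>) g = fa k l \<psi> (fa l n \<theta> g)"
      by (rule act_compose(2)[OF self_simplicial 4 d(3)])
    have "cmp (L k) (cmp (L k) (jj k l \<psi> (zact l n \<theta> q)) (fa k l \<psi> (jj l n \<theta> q)))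
        (cmp (L k) (fa k l \<psi> (fa l n \<theta> g)) (iinv (L k) (cmp (L k) (jj k l \<psi> (zact l n \<theta> p)) (fa k l \<psi> (jj l n \<theta> p))))) =
      cmp (L k) (jj k l \<psi> (zact l n \<theta> q))
        (cmp (L k) (fa k l \<psi> (cmp (L l) (jj l n \<theta> q) (cmp (L l) (fa l n \<theta> g) (iinv (L l) (jj l n \<theta> p))))) (iinv (L k) (jj k l \<psi> (zact l n \<theta> p))))"
      by (rule functor_conj_cmp[OF act_fun[OF self_simplicial 4(1)]])
        (use d act_rules(2-4)[OF self_simplicial 4(2) d(3)] jr in \<open>simp_all only:\<close>)
    then show ?thesis
      unfolding f(1) zarr_ka zact_compose[OF d(1) 4(2,1)] zact_compose[OF d(2) 4(2,1)] e by (simp only:)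
  qed
  then show ?case
    using 4 functor_rules(2)[OF zact_functor[OF 4(2)]]
    by (auto simp: Z_def comp_functor_def zact_compose Delta_compose[of _ _ l] simp del: Zlev_simps(2) intro!: functor_on_cong)
next
  case (5 \<phi> m n)
  then show ?case by (simp add: Z_def)
qed

text \<open>Evaluation is now only pseudo-natural: its cells \<open>jj\<close> record the change of
  value made by normalisation.\<close>

definition EVZ :: "('u, 'u, 'o, 'a) pnat" where
  "EVZ = \<lparr>pfun = (\<lambda>n. functor_on (Zlev n) (\<lambda>p. ev n (dec n p)) (\<lambda>f. fst (snd (inv ka f)))),
     pcell = (\<lambda>l n \<theta>. if \<theta> \<in> Delta l n then (\<lambda>p\<in>ko n ` P n. jj l n \<theta> p) else undefined)\<rparr>"

lemma Z_simps: "lev Z n = Zlev n" "\<theta> \<in> Delta l n \<Longrightarrow> p \<in> ko n ` P n \<Longrightarrow> fob (act Z l n \<theta>) p = zact l n \<theta> p"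
  "\<theta> \<in> Delta l n \<Longrightarrow> f \<in> ka ` ZA n \<Longrightarrow> far (act Z l n \<theta>) f = zarr l n \<theta> f"
  by (simp_all add: Z_def)

lemma EVZ_simps: "p \<in> ko n ` P n \<Longrightarrow> fob (pfun EVZ n) p = ev n (dec n p)"
  "(p, f, q) \<in> ZA n \<Longrightarrow> far (pfun EVZ n) (ka (p, f, q)) = f"
  "\<theta> \<in> Delta l n \<Longrightarrow> p \<in> ko n ` P n \<Longrightarrow> pcell EVZ l n \<theta> p = jj l n \<theta> p"
  by (simp_all add: EVZ_def)

lemma EVZ_functor: "is_functor (Zlev n) (L n) (pfun EVZ n)"
proof -
  have "(p, ident (L n) (ev n (dec n p)), p) \<in> ZA n" if "p \<in> ko n ` P n" for p
    using that P_dec[OF that] by (simp add: ZA_def)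
  moreover have "(p, cmp (L n) g f, r) \<in> ZA n" if "(p, f, q) \<in> ZA n" "(q, g, r) \<in> ZA n" for p f q g r
    using ZA_D[OF that(1)] ZA_D[OF that(2)] by (simp add: ZA_def)
  ultimately show ?thesis
    by (intro functorI) (auto simp: EVZ_simps ZA_D P_T, auto simp: EVZ_def functor_on_def)
qed

lemma EVZ_pn: "pseudonatural Z X EVZ"
proof (rule pnI, goal_cases)
  case 1 show ?case by (rule Z_simplicial)
next
  case 2 show ?case by simp
next
  case (3 n)
  show ?case by (simp add: Z_simps EVZ_functor)
next
  case (4 l n \<theta> p)
  then show ?case
    using zact_rules(1)[of p n \<theta> l] jj_rules[of p n \<theta> l] by (simp add: Z_simps EVZ_simps del: zact_rules)
next
  case (5 l n \<theta> f)
  then obtain p g q where f: "f = ka (p, g, q)" "(p, g, q) \<in> ZA n" by (auto simp: Z_simps)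
  note d = ZA_D[OF f(2)]
  show ?case
    using d 5(1) jj_rules[OF d(1) 5(1)] jj_rules[OF d(2) 5(1)] zarr_ZA[OF f(2) 5(1)] f(2) P_dec(1)[OF d(1)] P_dec(1)[OF d(2)]
    by (simp add: f(1) Z_simps EVZ_simps zarr_ka del: zact_rules)
next
  case (6 n p)
  then show ?case by (simp add: Z_simps EVZ_simps zact_id)
next
  case (7 k l n \<theta> \<psi> p)
  then show ?case
    using zact_compose(2)[OF _ 7(2,1), of p] zact_rules(1)[OF _ 7(2), of p] by (simp add: Z_simps EVZ_simps Delta_compose[of _ _ l] del: zact_rules)
next
  case (8 m n \<phi>)
  then show ?case by (simp add: EVZ_def)
next
  case (9 m n \<phi> x)
  then show ?case by (simp add: EVZ_def Z_simps)
qed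

lemma EVZ_ff_es: "ff_es (lev Z n) (L n) (pfun EVZ n)"
  unfolding Z_simps
proof (rule ff_esI[OF EVZ_functor])
  fix x y g
  assume a: "x \<in> obj (Zlev n)" "y \<in> obj (Zlev n)" "g \<in> arr (L n)" "src (L n) g = fob (pfun EVZ n) x" "tgt (L n) g = fob (pfun EVZ n) y"
  then have "(x, g, y) \<in> ZA n"
    by (simp add: ZA_def EVZ_simps)
  then show "\<exists>f\<in>arr (Zlev n). src (Zlev n) f = x \<and> tgt (Zlev n) f = y \<and> far (pfun EVZ n) f = g"
    by (intro bexI[of _ "ka (x, g, y)"]) (simp_all add: EVZ_simps)
next
  fix f g
  assume "f \<in> arr (Zlev n)" "g \<in> arr (Zlev n)" "src (Zlev n) f = src (Zlev n) g" "tgt (Zlev n) f = tgt (Zlev n) g" "far (pfun EVZ n) f = far (pfun EVZ n) g"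
  then show "f = g"
    by (auto simp: EVZ_simps)
next
  fix x assume x: "x \<in> obj (L n)"
  let ?s = "(n, (\<lambda>i\<in>{..n}. i), x)"
  have s: "?s \<in> T n" "ev n ?s = x"
    using x by (simp_all add: T_def ev_def)
  then show "\<exists>p\<in>obj (Zlev n). \<exists>c. iso_arr (L n) c \<and> src (L n) c = x \<and> tgt (L n) c = fob (pfun EVZ n) p"
    using J_rules[OF s(1)] norm_P[OF s(1)] by (intro bexI[of _ "ko n (norm n ?s)"] exI[of _ "J n ?s"]) (simp_all add: EVZ_simps)
qed

text \<open>On level 0 every map is constant, so every object stands for a representative. An arrow
  joins objects with the same representative, hence equal objects, and by thinness it is an
  identity.\<close>

lemma Z0_discrete: "is_discrete (lev Z 0)"
proof -
  have "f \<in> ident (Zlev 0) ` (ko 0 ` P 0)" if f: "f \<in> arr (Zlev 0)" for f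
  proof -
    obtain p g q where f: "f = ka (p, g, q)" "(p, g, q) \<in> ZA 0" using f by auto
    note d = ZA_D[OF f(2)]
    obtain s t where st: "p = ko 0 s" "s \<in> P 0" "q = ko 0 t" "t \<in> P 0"
      using d(1,2) by auto
    have *: "s = (0, zero 0, rep (v0 s))" "ev 0 s = rep (v0 s)" if "s \<in> P 0" for s
    proof -
      have c: "con 0 s" by (simp add: con_def)
      then have n: "norm 0 s = (0, zero 0, rep (v0 s))" by (simp add: norm_def)
      show "s = (0, zero 0, rep (v0 s))"
        by (rule trans[OF P_T(2)[OF that, symmetric] n])
      show "ev 0 s = rep (v0 s)"
        using norm_ev[OF P_T(1)[OF that] c] P_T[OF that] fo_zero[of "rep (v0 s)"] rep_obj[OF v0_obj[OF P_T(1)[OF that]]] by (simp only:)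
    qed
    have v: "src (L 0) g = rep (v0 s)" "tgt (L 0) g = rep (v0 t)"
      using d(4,5) *(2)[OF st(2)] *(2)[OF st(4)] P_T(1)[OF st(2)] P_T(1)[OF st(4)] by (simp_all add: st(1,3))
    then have "rep (v0 s) = rep (v0 t)"
      using rep_eq[OF d(3)] rep_rep[OF v0_obj[OF P_T(1)[OF st(2)]]] rep_rep[OF v0_obj[OF P_T(1)[OF st(4)]]] by (simp add: v)
    then have "(0, zero 0, rep (v0 s)) = (0 :: nat, zero 0, rep (v0 t))"
      by (simp only:)
    then have "s = t"
      by (rule trans[OF trans[OF *(1)[OF st(2)]] *(1)[OF st(4), symmetric]])
    moreover have "g = ident (L 0) (ev 0 (dec 0 p))"
      by (rule thin) (use d(3-5) \<open>s = t\<close> P_T(1)[OF st(2)] in \<open>simp_all add: st(1,3)\<close>)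
    ultimately have "f = ident (Zlev 0) p"
      using f(1) st(1,3) d(1) by simp
    then show ?thesis
      using d(1) by blast
  qed
  moreover have "ident (Zlev 0) p \<in> arr (Zlev 0)" if "p \<in> ko 0 ` P 0" for p
    by (rule cat_ident(1)[OF Zlev_cat]) (use that in \<open>simp only: Zlev_simps(1)\<close>)
  ultimately have "arr (Zlev 0) = ident (Zlev 0) ` obj (Zlev 0)"
    unfolding Zlev_simps(1) by (intro equalityI subsetI) (blast elim: imageE)+
  then show ?thesis
    unfolding is_discrete_def Z_simps by (intro conjI Zlev_cat)
qed

end

section \<open>Discretisation of a weakly globular double category\<close>

locale wg_double_category = double_category X for X :: "'u dblcat" +
  assumes wg: "weakly_globular X"
begin

lemma quotient_ff_es: "ff_es (cat0 X) (components_cat (cat0 X)) (quotient_functor (cat0 X))"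
  using wg by (simp add: weakly_globular_def equivalence_functor_iff_ff_es)

lemma cat0_thin: "f \<in> arr (cat0 X) \<Longrightarrow> g \<in> arr (cat0 X) \<Longrightarrow> src (cat0 X) f = src (cat0 X) g \<Longrightarrow> tgt (cat0 X) f = tgt (cat0 X) g \<Longrightarrow> f = g"
  by (rule ff_es_faithful[OF quotient_ff_es]) simp_all

lemma cat0_connected:
  assumes "x \<in> obj (cat0 X)" "y \<in> obj (cat0 X)" "path_component (cat0 X) x = path_component (cat0 X) y"
  shows "\<exists>f \<in> arr (cat0 X). src (cat0 X) f = x \<and> tgt (cat0 X) f = y"
  using ff_es_full[OF quotient_ff_es, of x y "path_component (cat0 X) x"] assms by auto

text \<open>The quotient is full onto a discrete category, so every arrow has one in the opposite
  direction; by thinness the two are inverse.\<close>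

lemma cat0_iso:
  assumes "f \<in> arr (cat0 X)"
  shows "iso_arr (cat0 X) f"
proof -
  obtain g where g: "g \<in> arr (cat0 X)" "src (cat0 X) g = tgt (cat0 X) f" "tgt (cat0 X) g = src (cat0 X) f"
    using cat0_connected[of "tgt (cat0 X) f" "src (cat0 X) f"] path_component_arr[OF cats(1) assms] assms by auto
  have "cmp (cat0 X) g f = ident (cat0 X) (src (cat0 X) f)" "cmp (cat0 X) f g = ident (cat0 X) (tgt (cat0 X) f)"
    by (rule cat0_thin; simp add: g assms)+
  then show ?thesis
    by (intro iso_arrI[OF assms g])
qed

text \<open>The choice is made from the component as a set, so objects of one component get the same
  representative.\<close>

definition rp where "rp x = (SOME y. y \<in> path_component (cat0 X) x)"

lemma rp:
  assumes "x \<in> obj (cat0 X)"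
  shows "rp x \<in> obj (cat0 X)" "path_component (cat0 X) (rp x) = path_component (cat0 X) x"
proof -
  have r: "rp x \<in> path_component (cat0 X) x"
    unfolding rp_def using path_component_self[OF assms] by (rule someI)
  then show "rp x \<in> obj (cat0 X)"
    by (simp add: path_component_def)
  show "path_component (cat0 X) (rp x) = path_component (cat0 X) x"
    by (rule path_component_invariant[where h = "path_component (cat0 X)", OF _ r]) (rule path_component_arr[OF cats(1)])
qed

definition kp where "kp x = (SOME f. f \<in> arr (cat0 X) \<and> src (cat0 X) f = x \<and> tgt (cat0 X) f = rp x)"

lemma kp:
  assumes "x \<in> obj (cat0 X)"
  shows "kp x \<in> arr (cat0 X)" "src (cat0 X) (kp x) = x" "tgt (cat0 X) (kp x) = rp x"
proof -
  have "\<exists>f. f \<in> arr (cat0 X) \<and> src (cat0 X) f = x \<and> tgt (cat0 X) f = rp x"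
    using cat0_connected[of x "rp x"] rp[OF assms] assms by auto
  from someI_ex[OF this] show "kp x \<in> arr (cat0 X)" "src (cat0 X) (kp x) = x" "tgt (cat0 X) (kp x) = rp x"
    unfolding kp_def by auto
qed

lemma lev0:
  "lev (nerve X) 0 = fibre_power (cat0 X) (id_functor (cat0 X)) (id_functor (cat0 X)) 1"
  "xs \<in> obj (lev (nerve X) 0) \<longleftrightarrow> (\<exists>x \<in> obj (cat0 X). xs = [x])"
  "fs \<in> arr (lev (nerve X) 0) \<longleftrightarrow> (\<exists>f \<in> arr (cat0 X). fs = [f])"
  "f \<in> arr (cat0 X) \<Longrightarrow> src (lev (nerve X) 0) [f] = [src (cat0 X) f]"
  "f \<in> arr (cat0 X) \<Longrightarrow> tgt (lev (nerve X) 0) [f] = [tgt (cat0 X) f]"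
  by (simp_all add: nerve_simps(1) nerve_lev_def chains_1)

lemma lev0_iso:
  assumes "f \<in> arr (cat0 X)"
  shows "iso_arr (lev (nerve X) 0) [f]"
  unfolding lev0(1)
  by (rule iso_fibre_power[OF is_functor_id is_functor_id]) (simp_all add: chains_1 cat0_iso assms)

lemma discretization_nerve:
  fixes ko :: "nat \<Rightarrow> nat \<times> (nat \<Rightarrow> nat) \<times> 'u list \<Rightarrow> 'v" and ka :: "'v \<times> 'u list \<times> 'v \<Rightarrow> 'v"
  assumes ko: "\<And>n. inj_on (ko n) {s. fst (snd s) \<in> Delta n (fst s)}" and ka: "inj ka"
  shows "discretization (nerve X) (\<lambda>xs. [rp (hd xs)]) (\<lambda>xs. [kp (hd xs)]) ko ka"
proof (intro discretization.intro discretization_axioms.intro, goal_cases)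
  case 1 show ?case by (rule simplicial_nerve)
next
  case (2 f g)
  then show ?case using cat0_thin by (auto simp: lev0(2-5))
next
  case (3 x)
  then show ?case by (auto simp: lev0(2) kp intro: lev0_iso)
next
  case (4 x)
  then show ?case by (auto simp: lev0(2-5) kp)
next
  case (5 x)
  then show ?case by (auto simp: lev0(2-5) kp)
next
  case (6 f)
  then obtain g where g: "g \<in> arr (cat0 X)" "f = [g]" by (auto simp: lev0(2-5))
  have "rp (src (cat0 X) g) = rp (tgt (cat0 X) g)"
    unfolding rp_def path_component_arr[OF cats(1) g(1)] ..
  then show ?case using g by (simp add: lev0(2-5))
next
  case (7 n)
  show ?case by (rule inj_on_subset[OF ko]) auto
next
  case 8 show ?case by (rule ka)
qed

lemma lev_Suc:
  "k > 0 \<Longrightarrow> lev (nerve X) k = fibre_power (cat1 X) (hdom X) (hcod X) k"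
  by (simp add: nerve_simps(1) nerve_lev_def)

lemma nerve_seg:
  assumes "j < k"
  shows "xs \<in> obj (lev (nerve X) k) \<Longrightarrow> fob (act (nerve X) (Suc 0) k (seg j (Suc j))) xs = [xs ! j]"
    "fs \<in> arr (lev (nerve X) k) \<Longrightarrow> far (act (nerve X) (Suc 0) k (seg j (Suc j))) fs = [fs ! j]"
  using assms npath_single[of "object_row X" k xs j] npath_single[of "arrow_row X" k fs j]
  by (simp_all add: nerve_simps nmap_def nerve_lev_obj nerve_lev_arr)

lemma nerve_vertex_act:
  assumes "x \<in> obj (cat1 X)"
  shows "fob (act (nerve X) 0 (Suc 0) (vertex_inclusion 0)) [x] = [fob (hdom X) x]"
    "fob (act (nerve X) 0 (Suc 0) (vertex_inclusion (Suc 0))) [x] = [fob (hcod X) x]"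
proof -
  have "[x] \<in> obj (nerve_lev X (Suc 0))"
    using assms by (simp add: nerve_lev_def chains_1)
  moreover have "vertex_inclusion i 0 = i" for i
    by (simp add: vertex_inclusion_def)
  ultimately show "fob (act (nerve X) 0 (Suc 0) (vertex_inclusion 0)) [x] = [fob (hdom X) x]"
    "fob (act (nerve X) 0 (Suc 0) (vertex_inclusion (Suc 0))) [x] = [fob (hcod X) x]"
    by (simp_all add: nerve_simps nmap_def nerve_vertex_def)
qed

text \<open>Vertical arrows are determined by their ends, so cells whose sources and targets match
  also match themselves.\<close>

lemma arrow_chain:
  assumes "length fs = k" "\<And>j. j < k \<Longrightarrow> fs ! j \<in> arr (cat1 X)"
    and s: "map (src (cat1 X)) fs \<in> chains (obj (cat1 X)) (fob (hdom X)) (fob (hcod X)) k"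
    and t: "map (tgt (cat1 X)) fs \<in> chains (obj (cat1 X)) (fob (hdom X)) (fob (hcod X)) k"
  shows "fs \<in> chains (arr (cat1 X)) (far (hdom X)) (far (hcod X)) k"
proof (rule chainsI)
  fix j assume j: "Suc j < k"
  show "far (hcod X) (fs ! j) = far (hdom X) (fs ! Suc j)"
    by (rule cat0_thin) (use assms(1,2) j chainsD(3)[OF s j] chainsD(3)[OF t j] in simp_all)
qed (use assms in auto)

end

section \<open>Transfer of the Segal condition\<close>

context discrete_objects
begin

lemma segal_map_functor: "is_functor (L k) (segal_target Y k) (segal_map Y k)"
proof (rule functorI, goal_cases)
  case 1 show ?case by simp
next
  case 2
  show ?case unfolding segal_target_eq by (rule category_fibre_power[OF is_functor_vertex is_functor_vertex]) simp_all
next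
  case (3 x)
  then show ?case by (auto simp: segal_map_simps segal_target_eq fo_seg_vertex intro!: chainsI)
next
  case (4 f)
  then have "map (\<lambda>j. fa (Suc 0) k (seg j (Suc j)) f) [0..<k] \<in> chains (arr (L (Suc 0))) (fa 0 (Suc 0) (vertex_inclusion 0)) (fa 0 (Suc 0) (vertex_inclusion (Suc 0))) k"
    by (intro segal_chain) (auto simp: fo_seg_vertex)
  then show ?case
    using 4 by (simp add: segal_map_simps segal_target_eq)
next
  case (5 x)
  then have "map (\<lambda>j. fo (Suc 0) k (seg j (Suc j)) x) [0..<k] \<in> chains (obj (L (Suc 0))) (fo 0 (Suc 0) (vertex_inclusion 0)) (fo 0 (Suc 0) (vertex_inclusion (Suc 0))) k"
    by (auto simp: fo_seg_vertex intro!: chainsI)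
  then show ?case
    using 5 by (simp add: segal_map_simps segal_target_eq)
next
  case (6 f g)
  then have c: "map (\<lambda>j. fa (Suc 0) k (seg j (Suc j)) f) [0..<k] \<in> chains (arr (L (Suc 0))) (fa 0 (Suc 0) (vertex_inclusion 0)) (fa 0 (Suc 0) (vertex_inclusion (Suc 0))) k"
    "map (\<lambda>j. fa (Suc 0) k (seg j (Suc j)) g) [0..<k] \<in> chains (arr (L (Suc 0))) (fa 0 (Suc 0) (vertex_inclusion 0)) (fa 0 (Suc 0) (vertex_inclusion (Suc 0))) k"
    by (auto intro!: segal_chain simp: fo_seg_vertex)
  have "cmp (segal_target Y k) (map (\<lambda>j. fa (Suc 0) k (seg j (Suc j)) g) [0..<k]) (map (\<lambda>j. fa (Suc 0) k (seg j (Suc j)) f) [0..<k]) =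
    map2 (cmp (L (Suc 0))) (map (\<lambda>j. fa (Suc 0) k (seg j (Suc j)) g) [0..<k]) (map (\<lambda>j. fa (Suc 0) k (seg j (Suc j)) f) [0..<k])"
    unfolding segal_target_eq by (rule fibre_power_simps(6)[OF c]) (use 6 in auto)
  then show ?case
    using 6 by (auto simp: segal_map_simps intro!: nth_equalityI)
qed (auto simp: segal_map_def functor_on_def)

text \<open>Each clause of the Segal condition is carried along \<open>F\<close> to the nerve, where
  it becomes a property of strict chains. Fully faithful: cells of \<open>X\<close> are composable
  once their ends are. Essentially surjective: a spine over the discrete level 0 becomes a list
  matching up to path components, and weak globularity rectifies it.\<close>

lemma tamsamani_of_ff_es:
  assumes wg: "weakly_globular X" and F: "pseudonatural Y (nerve X) F"
    and ff: "\<And>n. ff_es (L n) (lev (nerve X) n) (pfun F n)"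
  shows "tamsamani Y"
proof -
  interpret X: wg_double_category X
    by (intro wg_double_category.intro wg_double_category_axioms.intro) (use wg in \<open>simp_all add: weakly_globular_def\<close>)
  let ?N = "nerve X" and ?c1 = "cat1 X" and ?e = "\<lambda>j. seg j (Suc j)"
  note [simp] = pn_rules[OF F]
  have obj1: "\<exists>a \<in> obj ?c1. xs = [a]" if "xs \<in> obj (lev ?N (Suc 0))" for xs
    using that by (auto simp: X.lev_Suc chains_1)
  have arr1: "\<exists>a \<in> arr ?c1. xs = [a] \<and> src (lev ?N (Suc 0)) xs = [src ?c1 a] \<and> tgt (lev ?N (Suc 0)) xs = [tgt ?c1 a]" if "xs \<in> arr (lev ?N (Suc 0))" for xs
    using that by (auto simp: X.lev_Suc chains_1)
  have levk: "length xs = k" if "xs \<in> obj (lev ?N k)" "k > 0" for xs k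
    using that chainsD(1) by (auto simp: X.lev_Suc)
  note F1faith = ff_es_faithful[OF ff[of "Suc 0"]]
  have "ff_es (L k) (segal_target Y k) (segal_map Y k)" if k: "2 \<le> k" for k
  proof (rule ff_esI[OF segal_map_functor])
    note Fk = ff[of k]
    fix x y gs
    assume x [simp]: "x \<in> obj (L k)" and y [simp]: "y \<in> obj (L k)" and gs: "gs \<in> arr (segal_target Y k)"
      "src (segal_target Y k) gs = fob (segal_map Y k) x" "tgt (segal_target Y k) gs = fob (segal_map Y k) y"
    let ?xs = "fob (pfun F k) x" and ?ys = "fob (pfun F k) y"
    have gc: "gs \<in> chains (arr (L (Suc 0))) (fa 0 (Suc 0) (vertex_inclusion 0)) (fa 0 (Suc 0) (vertex_inclusion (Suc 0))) k"
      using gs(1) by (simp add: segal_target_eq)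
    note g = chainsD(1,2)[OF gc]
    have gst: "src (L (Suc 0)) (gs ! j) = fo (Suc 0) k (?e j) x" "tgt (L (Suc 0)) (gs ! j) = fo (Suc 0) k (?e j) y" if "j < k" for j
      using arg_cong[OF gs(2), of "\<lambda>zs. zs ! j"] arg_cong[OF gs(3), of "\<lambda>zs. zs ! j"] gc g(1) that
      by (simp_all add: segal_target_eq segal_map_simps)
    \<comment> \<open>The image of the given arrow under \<open>F\<close>, moved by the cells of
      \<open>F\<close> so that its ends become the \<open>j\<close>-th entries of \<open>?xs\<close>
      and \<open>?ys\<close> and match strictly.\<close>
    define h where "h = (\<lambda>j. cmp (lev ?N (Suc 0)) (iinv (lev ?N (Suc 0)) (pcell F (Suc 0) k (?e j) y))
      (cmp (lev ?N (Suc 0)) (far (pfun F (Suc 0)) (gs ! j)) (pcell F (Suc 0) k (?e j) x)))"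
    have h: "h j \<in> arr (lev ?N (Suc 0))" "src (lev ?N (Suc 0)) (h j) = [?xs ! j]" "tgt (lev ?N (Suc 0)) (h j) = [?ys ! j]"
      "cmp (lev ?N (Suc 0)) (pcell F (Suc 0) k (?e j) y) (h j) = cmp (lev ?N (Suc 0)) (far (pfun F (Suc 0)) (gs ! j)) (pcell F (Suc 0) k (?e j) x)"
      if "j < k" for j
      using that g gst[OF that] by (simp_all add: h_def X.nerve_seg)
    define as where "as = map (\<lambda>j. hd (h j)) [0..<k]"
    have a: "hd (h j) \<in> arr ?c1" "h j = [hd (h j)]" "src ?c1 (hd (h j)) = ?xs ! j" "tgt ?c1 (hd (h j)) = ?ys ! j" if "j < k" for j
      using arr1[OF h(1)[OF that]] h(2,3)[OF that] by auto
    have xy: "?xs \<in> obj (lev ?N k)" "?ys \<in> obj (lev ?N k)" by simp_all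
    have st: "map (src ?c1) as = ?xs" "map (tgt ?c1) as = ?ys"
      using levk[OF xy(1)] levk[OF xy(2)] k a by (auto simp: as_def intro!: nth_equalityI)
    have "as \<in> chains (arr ?c1) (far (hdom X)) (far (hcod X)) k"
      by (rule X.arrow_chain) (use xy k st a in \<open>simp_all add: X.lev_Suc as_def\<close>)
    then have as: "as \<in> arr (lev ?N k)" "src (lev ?N k) as = ?xs" "tgt (lev ?N k) as = ?ys"
      using k st by (simp_all add: X.lev_Suc)
    then obtain f where f: "f \<in> arr (L k)" "src (L k) f = x" "tgt (L k) f = y" "far (pfun F k) f = as"
      using ff_es_full[OF Fk x y] by blast
    have "fa (Suc 0) k (?e j) f = gs ! j" if j: "j < k" for j
    proof (rule F1faith)
      show "far (pfun F (Suc 0)) (fa (Suc 0) k (?e j) f) = far (pfun F (Suc 0)) (gs ! j)"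
      proof (rule iso_right_cancel[of "lev ?N (Suc 0)" "pcell F (Suc 0) k (?e j) x"])
        have "far (act ?N (Suc 0) k (?e j)) as = h j"
          using X.nerve_seg(2)[OF j as(1)] a[OF j] j by (simp add: as_def)
        then show "cmp (lev ?N (Suc 0)) (far (pfun F (Suc 0)) (fa (Suc 0) k (?e j) f)) (pcell F (Suc 0) k (?e j) x) =
          cmp (lev ?N (Suc 0)) (far (pfun F (Suc 0)) (gs ! j)) (pcell F (Suc 0) k (?e j) x)"
          using h(4)[OF j] f j by (subst pn_nat[OF F]) simp_all
      qed (use j f g gst in simp_all)
    qed (use j f g gst in simp_all)
    then have "far (segal_map Y k) f = gs"
      using f(1) g(1) by (auto simp: segal_map_simps intro!: nth_equalityI)
    then show "\<exists>f\<in>arr (L k). src (L k) f = x \<and> tgt (L k) f = y \<and> far (segal_map Y k) f = gs"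
      using f by blast
  next
    fix f g
    assume a [simp]: "f \<in> arr (L k)" "g \<in> arr (L k)" and s: "src (L k) f = src (L k) g" and t: "tgt (L k) f = tgt (L k) g"
      and e: "far (segal_map Y k) f = far (segal_map Y k) g"
    have fg: "far (pfun F k) f \<in> arr (lev ?N k)" "far (pfun F k) g \<in> arr (lev ?N k)" by simp_all
    have "[far (pfun F k) f ! j] = [far (pfun F k) g ! j]" if j: "j < k" for j
    proof -
      have ej: "fa (Suc 0) k (?e j) f = fa (Suc 0) k (?e j) g"
        using arg_cong[OF e, of "\<lambda>zs. zs ! j"] j by (simp add: segal_map_simps)
      have "far (act ?N (Suc 0) k (?e j)) (far (pfun F k) f) = far (act ?N (Suc 0) k (?e j)) (far (pfun F k) g)"
        by (rule iso_left_cancel[of "lev ?N (Suc 0)" "pcell F (Suc 0) k (?e j) (tgt (L k) f)"])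
          (use j s t ej pn_nat[OF F, of "?e j" "Suc 0" k f "src (L k) f"] pn_nat[OF F, of "?e j" "Suc 0" k g "src (L k) g"] in simp_all)
      then show ?thesis
        using X.nerve_seg(2)[OF j fg(1)] X.nerve_seg(2)[OF j fg(2)] by simp
    qed
    moreover have "length (far (pfun F k) f) = k" "length (far (pfun F k) g) = k"
      using fg k by (simp_all add: X.lev_Suc chainsD(1))
    ultimately have "far (pfun F k) f = far (pfun F k) g"
      by (auto intro: nth_equalityI)
    then show "f = g"
      by (intro ff_es_faithful[OF ff[of k]]) (simp_all add: s t)
  next
    fix zs
    assume "zs \<in> obj (segal_target Y k)"
    then have zc: "zs \<in> chains (obj (L (Suc 0))) (fo 0 (Suc 0) (vertex_inclusion 0)) (fo 0 (Suc 0) (vertex_inclusion (Suc 0))) k"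
      by (simp add: segal_target_eq)
    note z = chainsD[OF zc]
    define w where "w = (\<lambda>j. hd (fob (pfun F (Suc 0)) (zs ! j)))"
    have w: "w j \<in> obj ?c1" "fob (pfun F (Suc 0)) (zs ! j) = [w j]" if "j < k" for j
      using obj1[of "fob (pfun F (Suc 0)) (zs ! j)"] z(2)[OF that] by (auto simp: w_def)
    let ?Q = "quotient_functor (cat0 X)"
    let ?G0 = "comp_functor ?c1 ?Q (hdom X)" and ?G1 = "comp_functor ?c1 ?Q (hcod X)"
    have Gf: "is_functor ?c1 (components_cat (cat0 X)) ?G0" "is_functor ?c1 (components_cat (cat0 X)) ?G1"
      by (rule is_functor_comp[OF X.hdom_functor is_functor_quotient] is_functor_comp[OF X.hcod_functor is_functor_quotient]; simp)+
    \<comment> \<open>Consecutive entries share a vertex in \<open>Y_0\<close>. The cells of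
      \<open>F\<close> connect the two corresponding vertices in \<open>X\<close> to the image of
      that vertex, hence to each other.\<close>
    have comp: "path_component (cat0 X) (fob (hcod X) (w j)) = path_component (cat0 X) (fob (hdom X) (w (Suc j)))" if j: "Suc j < k" for j
    proof -
      let ?v = "fo 0 (Suc 0) (vertex_inclusion (Suc 0)) (zs ! j)"
      have *: "path_component (cat0 X) v = path_component (cat0 X) v'" if f: "f \<in> arr (lev ?N 0)" "src (lev ?N 0) f = [v]" "tgt (lev ?N 0) f = [v']" for f v v'
        using f path_component_arr[OF X.cats(1)] by (auto simp: X.lev0(2-5))
      have "fob (pfun F 0) ?v \<in> obj (lev ?N 0)"
        using z(2)[of j] j by simp
      then obtain v where v: "fob (pfun F 0) ?v = [v]"
        by (auto simp: X.lev0(2-5))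
      have "path_component (cat0 X) (fob (hcod X) (w j)) = path_component (cat0 X) v"
        by (rule *[of "pcell F 0 (Suc 0) (vertex_inclusion (Suc 0)) (zs ! j)"]) (use z(2)[of j] w[of j] j v in \<open>simp_all add: X.nerve_vertex_act\<close>)
      moreover have "path_component (cat0 X) (fob (hdom X) (w (Suc j))) = path_component (cat0 X) v"
        by (rule *[of "pcell F 0 (Suc 0) (vertex_inclusion 0) (zs ! Suc j)"])
          (use z(2)[of "Suc j"] z(3)[OF j] w[of "Suc j"] j v in \<open>simp_all add: X.nerve_vertex_act\<close>)
      ultimately show ?thesis by simp
    qed
    have "map w [0..<k] \<in> obj (fibre_power ?c1 ?G0 ?G1 k)"
      using w comp by (auto intro!: chainsI)
    \<comment> \<open>This is weak globularity: a list that matches only up to path components is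
      isomorphic to a strict chain.\<close>
    moreover have "ff_es (fibre_power ?c1 (hdom X) (hcod X) k) (fibre_power ?c1 ?G0 ?G1 k) (id_functor (fibre_power ?c1 (hdom X) (hcod X) k))"
      using wg k by (simp add: weakly_globular_def equivalence_functor_iff_ff_es)
    ultimately obtain xs c where xs: "xs \<in> obj (fibre_power ?c1 (hdom X) (hcod X) k)" and c: "iso_arr (fibre_power ?c1 ?G0 ?G1 k) c"
      "src (fibre_power ?c1 ?G0 ?G1 k) c = map w [0..<k]" "tgt (fibre_power ?c1 ?G0 ?G1 k) c = xs"
      using ff_es_es by fastforce
    have cc: "c \<in> chains (arr ?c1) (far ?G0) (far ?G1) k"
      using iso_arr_arr[OF c(1)] by simp
    have cj: "iso_arr ?c1 (c ! j)" "src ?c1 (c ! j) = w j" "tgt ?c1 (c ! j) = xs ! j" if j: "j < k" for j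
      using iso_fibre_powerD[OF Gf j c(1)] arg_cong[OF c(2), of "\<lambda>zs. zs ! j"] arg_cong[OF c(3), of "\<lambda>zs. zs ! j"] cc j chainsD(1)[OF cc]
      by simp_all
    have c1: "iso_arr (lev ?N (Suc 0)) [c ! j]" "src (lev ?N (Suc 0)) [c ! j] = [w j]" "tgt (lev ?N (Suc 0)) [c ! j] = [xs ! j]" if j: "j < k" for j
    proof -
      have m: "[c ! j] \<in> chains (arr ?c1) (far (hdom X)) (far (hcod X)) (Suc 0)"
        using iso_arr_arr[OF cj(1)[OF j]] by (simp add: chains_1)
      show "iso_arr (lev ?N (Suc 0)) [c ! j]"
        unfolding X.lev_Suc[OF zero_less_Suc] by (rule iso_fibre_power[OF X.hdom_functor X.hcod_functor m]) (use cj(1)[OF j] in simp)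
      show "src (lev ?N (Suc 0)) [c ! j] = [w j]" "tgt (lev ?N (Suc 0)) [c ! j] = [xs ! j]"
        using m cj(2,3)[OF j] by (simp_all add: X.lev_Suc)
    qed
    have xs': "xs \<in> obj (lev ?N k)"
      using xs k by (simp add: X.lev_Suc)
    obtain p d where p [simp]: "p \<in> obj (L k)" and d [simp]: "iso_arr (lev ?N k) d" "src (lev ?N k) d = xs" "tgt (lev ?N k) d = fob (pfun F k) p"
      using ff_es_es[OF ff xs'] by blast
    have "\<exists>g \<in> arr (L (Suc 0)). src (L (Suc 0)) g = zs ! j \<and> tgt (L (Suc 0)) g = fo (Suc 0) k (?e j) p \<and> iso_arr (L (Suc 0)) g" if j: "j < k" for j
    proof -
      \<comment> \<open>From the image of \<open>zs ! j\<close> to the strict chain by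
        \<open>c\<close>, to the \<open>j\<close>-th edge of the image of \<open>p\<close> by
        \<open>d\<close>, and to the image of the \<open>j\<close>-th edge of \<open>p\<close> by
        the cell of \<open>F\<close>. On level 1 such an isomorphism lifts along
        \<open>F\<close>.\<close>
      define q where "q = cmp (lev ?N (Suc 0)) (pcell F (Suc 0) k (?e j) p) (cmp (lev ?N (Suc 0)) (far (act ?N (Suc 0) k (?e j)) d) [c ! j])"
      have q: "iso_arr (lev ?N (Suc 0)) q" "src (lev ?N (Suc 0)) q = fob (pfun F (Suc 0)) (zs ! j)"
        "tgt (lev ?N (Suc 0)) q = fob (pfun F (Suc 0)) (fo (Suc 0) k (?e j) p)"
        using j c1[OF j] w[OF j] X.nerve_seg(1)[OF j xs'] iso_arr_arr[OF d(1)] iso_arr_arr[OF c1(1)[OF j]] by (simp_all add: q_def)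
      obtain g where "g \<in> arr (L (Suc 0))" "src (L (Suc 0)) g = zs ! j" "tgt (L (Suc 0)) g = fo (Suc 0) k (?e j) p" "far (pfun F (Suc 0)) g = q"
        using ff_es_full[OF ff[of "Suc 0"], of "zs ! j" "fo (Suc 0) k (?e j) p" q] q iso_arr_arr[OF q(1)] z(2)[OF j] j by auto
      then show ?thesis
        using ff_es_iso[OF ff, of g] q(1) by blast
    qed
    then obtain g where g: "\<And>j. j < k \<Longrightarrow> g j \<in> arr (L (Suc 0)) \<and> src (L (Suc 0)) (g j) = zs ! j \<and> tgt (L (Suc 0)) (g j) = fo (Suc 0) k (?e j) p \<and> iso_arr (L (Suc 0)) (g j)"
      by metis
    have gc: "map g [0..<k] \<in> chains (arr (L (Suc 0))) (fa 0 (Suc 0) (vertex_inclusion 0)) (fa 0 (Suc 0) (vertex_inclusion (Suc 0))) k"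
      by (rule segal_chain) (use g z(3) in auto)
    have "iso_arr (segal_target Y k) (map g [0..<k])"
      unfolding segal_target_eq by (rule iso_fibre_power[OF is_functor_vertex is_functor_vertex gc]) (use g in auto)
    moreover have "src (segal_target Y k) (map g [0..<k]) = zs" "tgt (segal_target Y k) (map g [0..<k]) = fob (segal_map Y k) p"
      using gc g z(1) by (auto simp: segal_target_eq segal_map_simps intro!: nth_equalityI)
    ultimately show "\<exists>x\<in>obj (L k). \<exists>c. iso_arr (segal_target Y k) c \<and> src (segal_target Y k) c = zs \<and> tgt (segal_target Y k) c = fob (segal_map Y k) x"
      using p by blast
  qed
  then show ?thesis
    unfolding tamsamani_def equivalence_functor_iff_ff_es using discrete by simp
qed

end

section \<open>Codes in the universe and conclusion\<close>

lemma infinite_encodings: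
  assumes "infinite (UNIV :: 'u set)"
  obtains nt :: "nat \<Rightarrow> 'u" and pr :: "'u \<times> 'u \<Rightarrow> 'u" and lc :: "'u list \<Rightarrow> 'u" where "inj nt" "inj pr" "inj lc"
proof -
  obtain nt :: "nat \<Rightarrow> 'u" where nt: "inj nt"
    using infinite_countable_subset[OF assms] by blast
  obtain pr :: "'u \<times> 'u \<Rightarrow> 'u" where pr: "inj pr"
    using card_of_Times_same_infinite[OF assms, folded card_of_ordIso] by (auto simp: bij_betw_def)
  define l where "l = (\<lambda>xs. foldr (\<lambda>x a. pr (x, a)) xs (nt 0))"
  have l: "l xs = l ys \<Longrightarrow> xs = ys" if "length xs = length ys" for xs ys
    using that by (induction xs ys rule: list_induct2) (auto simp: l_def inj_eq[OF pr])
  \<comment> \<open>Folding with \<open>pr\<close> may confuse lists of different lengths, so the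
    length is stored beside the fold.\<close>
  have "inj (\<lambda>xs. pr (nt (length xs), l xs))"
    by (rule injI) (auto simp: inj_eq[OF pr] inj_eq[OF nt] intro: l)
  then show thesis
    using nt pr that by blast
qed

text \<open>Evaluation runs from the discretisation to the nerve; the adjoint equivalence it
  generates is turned round at the end.\<close>

lemma adj_equiv_of_wgdbl:
  fixes X :: "'u dblcat"
  assumes inf: "infinite (UNIV :: 'u set)" and wg: "weakly_globular X"
  shows "\<exists>Z :: ('u, 'u) scat. tamsamani Z \<and> (\<exists>e e' u c. adj_equiv (nerve X) Z e e' u c)"
proof -
  obtain nt :: "nat \<Rightarrow> 'u" and pr :: "'u \<times> 'u \<Rightarrow> 'u" and lc :: "'u list \<Rightarrow> 'u" where enc: "inj nt" "inj pr" "inj lc"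
    using infinite_encodings[OF inf] .
  note [simp] = enc[THEN inj_eq]
  interpret X: wg_double_category X
    by (intro wg_double_category.intro wg_double_category_axioms.intro) (use wg in \<open>simp_all add: weakly_globular_def\<close>)
  \<comment> \<open>A map in \<open>Delta n m\<close> is determined by its values at
    \<open>0, ..., n\<close>, so it is coded by the list of these \<open>n + 1\<close> values. Other
    functions are not separated by this code, whence injectivity only on a set.\<close>
  let ?ko = "\<lambda>n (s :: nat \<times> (nat \<Rightarrow> nat) \<times> 'u list). pr (nt (fst s), pr (lc (map (\<lambda>i. nt (fst (snd s) i)) [0..<Suc n]), lc (snd (snd s))))"
  let ?ka = "\<lambda>(p, f, q). pr (p, pr (lc f, q))"
  have ko: "inj_on (?ko n) {s. fst (snd s) \<in> Delta n (fst s)}" for n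
  proof (rule inj_onI)
    fix s t :: "nat \<times> (nat \<Rightarrow> nat) \<times> 'u list"
    assume st: "s \<in> {s. fst (snd s) \<in> Delta n (fst s)}" "t \<in> {s. fst (snd s) \<in> Delta n (fst s)}" and e: "?ko n s = ?ko n t"
    have "fst (snd s) = fst (snd t)"
      by (rule Delta_eqI[of _ n "fst s" _ "fst t"]) (use st e in \<open>auto simp del: upt_Suc\<close>)
    then show "s = t"
      using e by (simp add: prod_eq_iff del: upt_Suc)
  qed
  interpret D: discretization "nerve X" "\<lambda>xs. [X.rp (hd xs)]" "\<lambda>xs. [X.kp (hd xs)]" ?ko ?ka
    by (rule X.discretization_nerve[OF ko]) (auto intro!: injI)
  interpret Z: discrete_objects D.Z
    by (intro discrete_objects.intro discrete_objects_axioms.intro D.Z_simplicial D.Z0_discrete)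
  have "tamsamani D.Z"
    by (rule Z.tamsamani_of_ff_es[OF wg D.EVZ_pn D.EVZ_ff_es])
  moreover obtain e' u c where "adj_equiv D.Z (nerve X) D.EVZ e' u c"
    using ex_adj_equiv_of_ff_es[OF D.EVZ_pn D.EVZ_ff_es] by blast
  ultimately show ?thesis
    using adj_equiv_sym by blast
qed

lemma adj_equiv_of_tamsamani:
  fixes Y :: "('u, 'u) scat"
  assumes inf: "infinite (UNIV :: 'u set)" and Y: "tamsamani Y"
  shows "\<exists>X :: 'u dblcat. weakly_globular X \<and> (\<exists>e e' u c. adj_equiv Y (nerve X) e e' u c)"
proof -
  obtain nt :: "nat \<Rightarrow> 'u" and pr :: "'u \<times> 'u \<Rightarrow> 'u" and lc :: "'u list \<Rightarrow> 'u" where enc: "inj nt" "inj pr" "inj lc"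
    using infinite_encodings[OF inf] .
  note [simp] = enc(1,2)[THEN inj_eq]
  define k0 where "k0 = (\<lambda>(m, i, y :: 'u). pr (nt m, pr (nt i, y)))"
  define k0a where "k0a = (\<lambda>(a, b). pr (k0 a, k0 b))"
  define k1 where "k1 = (\<lambda>(m, a). pr (nt m, k0 a))"
  define k1a where "k1a = (\<lambda>(p, f :: 'u, q). pr (k1 p, pr (f, k1 q)))"
  have k0: "inj k0"
    by (rule injI) (auto simp: k0_def)
  have k1: "inj k1"
    by (rule injI) (auto simp: k1_def inj_eq[OF k0])
  have "inj k0a" "inj k1a"
    by (rule injI; auto simp: k0a_def k1a_def inj_eq[OF k0] inj_eq[OF k1])+
  then interpret tam_code Y k0 k0a k1 k1a
    using Y k0 k1 by (intro tam_code.intro discrete_objects.intro discrete_objects_axioms.intro tam_code_axioms.intro)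
      (simp_all add: tamsamani_def)
  obtain e' u c where "adj_equiv (nerve DC) Y EV e' u c"
    using ex_adj_equiv_of_ff_es[OF EV_pn EV_ff_es] by blast
  then show ?thesis
    using weakly_globular_DC adj_equiv_sym by blast
qed

theorem theoremA:
  assumes "infinite (UNIV :: 'u set)"
  shows "\<exists>F. biequivalence (WGDbl_ps :: 'u wgdbl_twocat) (Ta2_ps :: 'u ta2_twocat) F"
  unfolding WGDbl_ps_def Ta2_ps_def
proof (rule biequivalence_of_equivalent_objects)
  show "simplicial_cat (nerve X)" if "X \<in> {X. weakly_globular X}" for X :: "'u dblcat"
    using that by (auto simp: weakly_globular_def intro: double_category.simplicial_nerve)
  show "simplicial_cat Y" if "Y \<in> {Y. tamsamani Y}" for Y :: "('u, 'u) scat"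
    using that by (simp add: tamsamani_def)
  show "\<exists>Y\<in>{Y. tamsamani Y}. \<exists>e e' u c. adj_equiv (nerve X) (Y :: ('u, 'u) scat) e e' u c"
    if "X \<in> {X. weakly_globular X}" for X :: "'u dblcat"
    using adj_equiv_of_wgdbl[OF assms, of X] that by blast
  show "\<exists>X\<in>{X. weakly_globular X}. \<exists>d d' v k. adj_equiv Y (nerve (X :: 'u dblcat)) d d' v k"
    if "Y \<in> {Y. tamsamani Y}" for Y :: "('u, 'u) scat"
    using adj_equiv_of_tamsamani[OF assms, of Y] that by blast
qed

end
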